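(* Let $\Omega=[0,1]^d$. Consider the target distribution class $\mathcal{G}=\{\nu : p_\nu(x)\in W^{\alpha}(r)\}$ in a Sobolev class with smoothness $\alpha\in\mathbb{N}_{\ge 0}$, for some constant $r>0$. Consider the evaluation metric induced by $\mathcal{F}=W^{\beta}(1)$, a Sobolev class with smoothness $\beta\in\mathbb{N}_{\ge 0}$. The minimax optimal rate is $$\inf_{\widetilde{\nu}_n}\ \sup_{\nu\in\mathcal{G}}\ \mathbb{E}\, d_{\mathcal{F}}(\nu,\widetilde{\nu}_n)\ \asymp\ n^{-\frac{\alpha+\beta}{2\alpha+d}}\vee n^{-\frac12},$$ where $\widetilde{\nu}_n$ is any estimator for $\nu$ based on $n$ i.i.d. samples $X_1,X_2,\dots,X_n\sim\nu$.
   Context: Here $d$ is the dimension, $\nu$ denotes a probability distribution on $\Omega$, and $p_\nu$ is its density with respect to Lebesgue measure on $\Omega$. For a smoothness parameter $\alpha\in\mathbb{N}_{\ge0}$ and a radius $r\in\mathbb{R}_{\ge 0}$, the Sobolev class is $$W^{\alpha}(r)=W^{\alpha,2}(r)=\Big\{f:\Omega\to\mathbb{R}\ :\ \big(\sum_{|\gamma|\le\alpha}\|D^{(\gamma)}f\|_2^2\big)^{1/2}\le r\Big\},$$ where $\gamma\in\mathbb{N}_{\ge0}^d$ is a multi-index, $|\gamma|=\sum_i\gamma_i$, $D^{(\gamma)}$ denotes the $\gamma$-weak derivative, and $\|f\|_2=(\int_\Omega |f(x)|^2dx)^{1/2}$. For a symmetric function class $\mathcal{F}$, the integral probability metric is $d_{\mathcal{F}}(\mu,\nu)=\sup_{f\in\mathcal{F}}\int_\Omega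 f\,(d\mu-d\nu)$. The expectation is over the samples. Notation: $a\vee b=\max(a,b)$. Holding other parameters fixed, $A(n)\precsim n^{s}$ means $\limsup_{n\to\infty}\log A(n)/\log n\le s$; $A(n)\succsim n^{s}$ means $\liminf_{n\to\infty}\log A(n)/\log n\ge s$; $A(n)\asymp n^{s}$ means both.
   Formalization: The radius satisfies r > 1 instead of r > 0: every density on the cube has L2 norm at least 1, so for r < 1 the class is empty and for r = 1 it contains only the uniform distribution; the minimax risk is then 0 and the claimed lower bound fails. *)

theory Defs
  imports "HOL-Probability.Probability"
begin

section \<open>Weak derivatives\<close>

definition partial_deriv :: "'d::finite \<Rightarrow> (real ^ 'd \<Rightarrow> real) \<Rightarrow> real ^ 'd \<Rightarrow> real" where
  "partial_deriv i f x = deriv (\<lambda>t. f (x + t *\<^sub>R axis i 1)) 0"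

fun iter_partial :: "'d::finite list \<Rightarrow> (real ^ 'd \<Rightarrow> real) \<Rightarrow> real ^ 'd \<Rightarrow> real" where
  "iter_partial [] f = f"
| "iter_partial (i # is) f = partial_deriv i (iter_partial is f)"

definition smooth :: "(real ^ 'd::finite \<Rightarrow> real) \<Rightarrow> bool" where
  "smooth f \<longleftrightarrow> (\<forall>is x. iter_partial is f differentiable at x)"

definition multi_order :: "('d::finite \<Rightarrow> nat) \<Rightarrow> nat" where
  "multi_order \<gamma> = (\<Sum>i\<in>UNIV. \<gamma> i)"

text \<open>
  The classical derivative of multi-index \<open>\<gamma>\<close>: coordinate \<open>i\<close> is differentiated \<open>\<gamma> i\<close> times.
  It is applied to smooth functions only, for which the order chosen is immaterial.
\<close>
definition multi_deriv :: "('d::finite \<Rightarrow> nat) \<Rightarrow> (real ^ 'd \<Rightarrow> real) \<Rightarrow> real ^ 'd \<Rightarrow> real" where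
  "multi_deriv \<gamma> f = iter_partial (SOME is. \<forall>i. count_list is i = \<gamma> i) f"

definition test_function :: "(real ^ 'd::finite) set \<Rightarrow> (real ^ 'd \<Rightarrow> real) \<Rightarrow> bool" where
  "test_function U \<phi> \<longleftrightarrow>
     smooth \<phi> \<and> compact (closure {x. \<phi> x \<noteq> 0}) \<and> closure {x. \<phi> x \<noteq> 0} \<subseteq> U"

definition locally_integrable :: "(real ^ 'd::finite) set \<Rightarrow> (real ^ 'd \<Rightarrow> real) \<Rightarrow> bool" where
  "locally_integrable U f \<longleftrightarrow> (\<forall>K. compact K \<and> K \<subseteq> U \<longrightarrow> set_integrable lborel K f)"

definition weak_deriv ::
  "(real ^ 'd::finite) set \<Rightarrow> ('d \<Rightarrow> nat) \<Rightarrow> (real ^ 'd \<Rightarrow> real) \<Rightarrow> (real ^ 'd \<Rightarrow> real) \<Rightarrow> bool" where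
  "weak_deriv U \<gamma> f g \<longleftrightarrow>
     locally_integrable U f \<and> locally_integrable U g \<and>
     (\<forall>\<phi>. test_function U \<phi> \<longrightarrow>
        (LINT x:U|lborel. f x * multi_deriv \<gamma> \<phi> x) =
        (- 1) ^ multi_order \<gamma> * (LINT x:U|lborel. g x * \<phi> x))"

section \<open>Sobolev classes on the unit cube\<close>

definition unit_cube :: "(real ^ 'd::finite) set" where
  "unit_cube = {x. \<forall>i. 0 \<le> x $ i \<and> x $ i \<le> 1}"

definition cube_lborel :: "(real ^ 'd::finite) measure" where
  "cube_lborel = restrict_space lborel unit_cube"

definition square_integrable :: "(real ^ 'd::finite \<Rightarrow> real) \<Rightarrow> bool" where
  "square_integrable f \<longleftrightarrow>
     f \<in> borel_measurable cube_lborel \<and> integrable cube_lborel (\<lambda>x. \<bar>f x\<bar>\<^sup>2)"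

definition L2_norm :: "(real ^ 'd::finite \<Rightarrow> real) \<Rightarrow> real" where
  "L2_norm f = sqrt (LINT x|cube_lborel. \<bar>f x\<bar>\<^sup>2)"

definition multi_indices :: "nat \<Rightarrow> ('d::finite \<Rightarrow> nat) set" where
  "multi_indices \<alpha> = {\<gamma>. multi_order \<gamma> \<le> \<alpha>}"

text \<open>
  Functions on the cube are total functions whose values off the cube play no role. They are not
  identified when they agree almost everywhere, so Borel measurability of \<open>f\<close> itself is required.
  The family \<open>D\<close> collects the weak derivatives, which are determined up to null sets.
\<close>
definition sobolev_class :: "nat \<Rightarrow> real \<Rightarrow> (real ^ 'd::finite \<Rightarrow> real) set" where
  "sobolev_class \<alpha> r =
     {f. f \<in> borel_measurable cube_lborel \<and>
         (\<exists>D. (\<forall>\<gamma>\<in>multi_indices \<alpha>.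
                 weak_deriv (interior unit_cube) \<gamma> f (D \<gamma>) \<and> square_integrable (D \<gamma>)) \<and>
              sqrt (\<Sum>\<gamma>\<in>multi_indices \<alpha>. (L2_norm (D \<gamma>))\<^sup>2) \<le> r)}"

lemma finite_multi_indices [simp]: "finite (multi_indices \<alpha> :: ('d::finite \<Rightarrow> nat) set)"
proof (rule finite_subset)
  show "multi_indices \<alpha> \<subseteq> (\<Pi>\<^sub>E i\<in>(UNIV :: 'd set). {..\<alpha>})"
  proof
    fix \<gamma> :: "'d \<Rightarrow> nat" assume "\<gamma> \<in> multi_indices \<alpha>"
    then have le: "(\<Sum>i\<in>UNIV. \<gamma> i) \<le> \<alpha>"
      by (simp add: multi_indices_def multi_order_def)
    have "\<gamma> i \<le> \<alpha>" for i
      using member_le_sum[of i UNIV \<gamma>] le by simp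
    then show "\<gamma> \<in> (\<Pi>\<^sub>E i\<in>UNIV. {..\<alpha>})" by auto
  qed
qed (simp add: finite_PiE)

lemma unit_cube_eq_cbox: "unit_cube = (cbox 0 1 :: (real ^ 'd::finite) set)"
  by (auto simp: unit_cube_def mem_box_cart)

lemma ex_list_multi_index: "\<exists>is. \<forall>i. count_list is i = \<gamma> i" for \<gamma> :: "'d::finite \<Rightarrow> nat"
proof -
  define M where "M = Abs_multiset \<gamma>"
  have "count M = \<gamma>" by (simp add: M_def)
  moreover obtain xs where "mset xs = M" by (rule ex_mset[THEN exE])
  ultimately have "\<forall>i. count_list xs i = \<gamma> i" by (metis count_mset)
  then show ?thesis ..
qed

section \<open>Target distributions and evaluation metric\<close>

definition sobolev_distributions :: "nat \<Rightarrow> real \<Rightarrow> (real ^ 'd::finite) measure set" where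
  "sobolev_distributions \<alpha> r =
     {\<nu> \<in> space (prob_algebra cube_lborel).
        \<exists>p\<in>sobolev_class \<alpha> r. (\<forall>x\<in>unit_cube. 0 \<le> p x) \<and>
          \<nu> = density cube_lborel (\<lambda>x. ennreal (p x))}"

text \<open>
  The supremum runs over the functions in \<open>F\<close> for which both integrals exist. The function
  \<open>ennreal\<close> maps negative differences to \<open>0\<close>, which does not change the supremum for a nonempty
  symmetric \<open>F\<close>.
\<close>
definition ipm :: "('a \<Rightarrow> real) set \<Rightarrow> 'a measure \<Rightarrow> 'a measure \<Rightarrow> ennreal" where
  "ipm F \<mu> \<nu> =
     (SUP f\<in>{f \<in> F. integrable \<mu> f \<and> integrable \<nu> f}. ennreal ((LINT x|\<mu>. f x) - (LINT x|\<nu>. f x)))"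

section \<open>Minimax risk\<close>

text \<open>
  An estimator maps a sample \<open>(X 0, \<dots>, X (n - 1))\<close> measurably to a probability measure on
  the cube.
\<close>
definition estimators ::
  "nat \<Rightarrow> ((nat \<Rightarrow> real ^ 'd::finite) \<Rightarrow> (real ^ 'd) measure) set" where
  "estimators n = measurable (PiM {..<n} (\<lambda>_. cube_lborel)) (prob_algebra cube_lborel)"

definition minimax_risk ::
  "(real ^ 'd::finite) measure set \<Rightarrow> (real ^ 'd \<Rightarrow> real) set \<Rightarrow> nat \<Rightarrow> ennreal" where
  "minimax_risk G F n =
     (INF T\<in>estimators n. SUP \<nu>\<in>G. \<integral>\<^sup>+ X. ipm F \<nu> (T X) \<partial>(PiM {..<n} (\<lambda>_. \<nu>)))"

section \<open>Polynomial rates\<close>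

definition log_ennreal :: "ennreal \<Rightarrow> ereal" where
  "log_ennreal a =
     (if a = 0 then - \<infinity> else if a = \<infinity> then \<infinity> else ereal (ln (enn2real a)))"

definition rate_le :: "(nat \<Rightarrow> ennreal) \<Rightarrow> real \<Rightarrow> bool" where
  "rate_le A s \<longleftrightarrow> limsup (\<lambda>n. log_ennreal (A n) / ereal (ln (real n))) \<le> ereal s"

definition rate_ge :: "(nat \<Rightarrow> ennreal) \<Rightarrow> real \<Rightarrow> bool" where
  "rate_ge A s \<longleftrightarrow> liminf (\<lambda>n. log_ennreal (A n) / ereal (ln (real n))) \<ge> ereal s"

text \<open>\<open>rate_eq A s\<close> says that \<open>A n\<close> is of order \<open>n powr s\<close> up to subpolynomial factors.\<close>
definition rate_eq :: "(nat \<Rightarrow> ennreal) \<Rightarrow> real \<Rightarrow> bool" where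
  "rate_eq A s \<longleftrightarrow> rate_le A s \<and> rate_ge A s"

end

theory Submission
  imports Defs "HOL-Computational_Algebra.Polynomial"
begin

text \<open>
  Why the rate holds. Both halves come from matching a resolution \<open>K\<close> to the sample size \<open>n\<close>.

  Upper bound. Tensor products of normalised Legendre polynomials form an orthonormal basis
  \<open>e\<^sub>k\<close> of \<open>L\<^sup>2\<close> of the cube (\<open>Parseval_cube\<close>). The coefficients of a function in \<open>W\<^sup>m(R)\<close>
  satisfy \<open>\<Sum>\<^sub>k (1 + max k) ^ (2 m) f\<^sub>k\<^sup>2 \<le> C R\<^sup>2\<close> (\<open>sobolev_coeff_decay\<close>). The reason is that the Legendre
  equation is a Sturm-Liouville equation whose weight \<open>t (1 - t)\<close> vanishes at the ends of the
  interval: repeated integration by parts against the weak derivatives leaves no boundary terms,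
  although the functions satisfy no boundary conditions, and it turns derivatives of order \<open>m\<close>
  into a factor of size \<open>k\<^sup>m\<close>.

  With \<open>f \<in> W\<^sup>\<beta>(1)\<close> and densities \<open>p, p' \<in> W\<^sup>\<alpha>(r)\<close>, split
  \<open>\<integral> f (p - p') = \<Sum>\<^sub>k f\<^sub>k (p\<^sub>k - p'\<^sub>k)\<close> at \<open>max k = K\<close>. The tail is \<open>O(K powr - (\<alpha> + \<beta>))\<close>, and the head is
  bounded by a weighted distance of the coefficients that no longer depends on \<open>f\<close>
  (\<open>integral_difference_bound\<close>). Empirical coefficients have variance at most \<open>(1/n) \<integral> p e\<^sub>k\<^sup>2\<close>.
  The densities of the class are uniformly bounded in \<open>L\<^sup>2\<close>, but for small \<open>\<alpha>\<close> they need not be bounded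
  functions, so this integral is estimated by fourth moments of the basis functions; they grow more slowly than every power of the degree
  (\<open>phi_fourth_moment\<close>). Summing over \<open>k\<close> gives a weighted error of
  \<open>sqrt (K powr (max (d - 2 \<beta>) 0 + \<delta>) / n)\<close> for every \<open>\<delta> > 0\<close>. The estimator picks, from a finite net of the
  class, the distribution whose coefficients are closest to the empirical ones
  (\<open>minimax_upper_bound\<close>). The choice \<open>K = n powr (1 / (2 \<alpha> + d))\<close> balances the terms, and \<open>\<delta>\<close>
  disappears because rates are compared on the logarithmic scale.

  Lower bound. Cut the cube into \<open>M\<^sup>d\<close> cells and perturb the uniform density by \<open>\<plusminus> a\<close> times a
  mean-zero bump in each cell. As \<open>r > 1\<close>, these densities lie in \<open>W\<^sup>\<alpha>(r)\<close> when \<open>a \<lesssim> M powr - \<alpha>\<close>,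
  and the samples do not determine the individual signs when \<open>n a\<^sup>2 \<lesssim> M\<^sup>d\<close>, by a chi-square
  computation (\<open>two_point_bound\<close>). Signed sums of bumps of height \<open>M powr - \<beta>\<close> are available
  as test functions, and averaging over all signs gives a risk of order \<open>a M powr - \<beta>\<close>
  (\<open>Assouad_lower_bound\<close>). One cell with \<open>a = c n powr (- 1/2)\<close> gives the parametric rate, and
  \<open>M = n powr (1 / (2 \<alpha> + d))\<close> with \<open>a = c M powr - \<alpha>\<close> gives the nonparametric one.
\<close>

section \<open>Square-integrable functions and orthonormal families\<close>

text \<open>
  Square integrability for an arbitrary measure, not just on the cube: the same Hilbert space
  arguments are applied to the cube and to the law of the sample.
\<close>

definition sqint :: "'a measure \<Rightarrow> ('a \<Rightarrow> real) \<Rightarrow> bool" where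
  "sqint M f \<longleftrightarrow> f \<in> borel_measurable M \<and> integrable M (\<lambda>x. (f x)\<^sup>2)"

lemma sqint_mult_integrable:
  assumes "sqint M f" "sqint M g"
  shows "integrable M (\<lambda>x. f x * g x)"
proof (rule Bochner_Integration.integrable_bound)
  show "integrable M (\<lambda>x. (f x)\<^sup>2 + (g x)\<^sup>2)" using assms by (auto simp: sqint_def)
  show "(\<lambda>x. f x * g x) \<in> borel_measurable M" using assms by (auto simp: sqint_def)
  have "\<bar>a * b\<bar> \<le> \<bar>a\<^sup>2 + b\<^sup>2\<bar>" for a b :: real
  proof -
    have "2 * (\<bar>a\<bar> * \<bar>b\<bar>) \<le> a\<^sup>2 + b\<^sup>2"
      using sum_squares_bound[of "\<bar>a\<bar>" "\<bar>b\<bar>"] by simp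
    moreover have "0 \<le> \<bar>a\<bar> * \<bar>b\<bar>" by simp
    ultimately show ?thesis unfolding abs_mult by linarith
  qed
  then show "AE x in M. norm (f x * g x) \<le> norm ((f x)\<^sup>2 + (g x)\<^sup>2)" by simp
qed

lemma sqint_cmult: "sqint M f \<Longrightarrow> sqint M (\<lambda>x. c * f x)"
  by (auto simp: sqint_def power_mult_distrib)

lemma sqint_zero: "sqint M (\<lambda>x. 0)"
  by (simp add: sqint_def)

lemma sqint_add:
  assumes "sqint M f" "sqint M g" shows "sqint M (\<lambda>x. f x + g x)"
proof -
  have "(\<lambda>x. (f x + g x)\<^sup>2) = (\<lambda>x. (f x)\<^sup>2 + 2 * (f x * g x) + (g x)\<^sup>2)"
    by (auto simp: power2_eq_square algebra_simps)
  then show ?thesis using assms sqint_mult_integrable[OF assms] by (auto simp: sqint_def)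
qed

lemma sqint_diff:
  assumes "sqint M f" "sqint M g" shows "sqint M (\<lambda>x. f x - g x)"
  using sqint_add[OF assms(1) sqint_cmult[OF assms(2), of "-1"]] by simp

lemma sqint_sum:
  assumes "\<And>k. k \<in> S \<Longrightarrow> sqint M (g k)" shows "sqint M (\<lambda>x. \<Sum>k\<in>S. a k * g k x)"
  using assms
  by (induction S rule: infinite_finite_induct) (auto simp: sqint_zero intro!: sqint_add sqint_cmult)

lemma sqint_bounded:
  assumes "finite_measure M" "f \<in> borel_measurable M" "\<And>x. x \<in> space M \<Longrightarrow> \<bar>f x\<bar> \<le> B"
  shows "sqint M f"
proof -
  interpret finite_measure M by fact
  have "(f x)\<^sup>2 \<le> B\<^sup>2" if "x \<in> space M" for x
    using assms(3)[OF that] by (simp add: abs_le_square_iff[symmetric])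
  then have "integrable M (\<lambda>x. (f x)\<^sup>2)"
    using assms(2) by (intro integrable_const_bound[where B="B\<^sup>2"]) auto
  then show ?thesis using assms(2) by (simp add: sqint_def)
qed

lemma integral_square_add:
  assumes "sqint M f" "sqint M g"
  shows "(LINT x|M. (f x + t * g x)\<^sup>2) =
    (LINT x|M. (f x)\<^sup>2) + 2 * t * (LINT x|M. f x * g x) + t\<^sup>2 * (LINT x|M. (g x)\<^sup>2)"
proof -
  have "(LINT x|M. (f x + t * g x)\<^sup>2) = (LINT x|M. (f x)\<^sup>2 + (2 * t) * (f x * g x) + t\<^sup>2 * (g x)\<^sup>2)"
    by (rule Bochner_Integration.integral_cong) (auto simp: power2_eq_square algebra_simps)
  also have "\<dots> = (LINT x|M. (f x)\<^sup>2) + 2 * t * (LINT x|M. f x * g x) + t\<^sup>2 * (LINT x|M. (g x)\<^sup>2)"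
    using assms sqint_mult_integrable[OF assms] by (simp add: sqint_def)
  finally show ?thesis .
qed

text \<open>
  The quadratic polynomial \<open>t \<mapsto> \<integral> (f + t g)\<^sup>2\<close> is nonnegative, so its discriminant is not positive.
\<close>

lemma Cauchy_Schwarz_integral:
  assumes "sqint M f" "sqint M g"
  shows "(LINT x|M. f x * g x)\<^sup>2 \<le> (LINT x|M. (f x)\<^sup>2) * (LINT x|M. (g x)\<^sup>2)"
proof -
  define A B C where "A = (LINT x|M. (f x)\<^sup>2)" and "B = (LINT x|M. (g x)\<^sup>2)"
    and "C = (LINT x|M. f x * g x)"
  have *: "0 \<le> A + 2 * t * C + t\<^sup>2 * B" for t
  proof -
    have "0 \<le> (LINT x|M. (f x + t * g x)\<^sup>2)" by simp
    then show ?thesis unfolding integral_square_add[OF assms] A_def B_def C_def .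
  qed
  have B: "B \<ge> 0" unfolding B_def by simp
  show "C\<^sup>2 \<le> A * B"
  proof (cases "B = 0")
    case True
    have "C = 0"
    proof (rule ccontr)
      assume "C \<noteq> 0"
      with *[of "- (A + 1) / (2 * C)"] True show False by (simp add: field_simps)
    qed
    with True show ?thesis by simp
  next
    case False
    then have "B > 0" using B by simp
    with *[of "- C / B"] have "0 \<le> A - C\<^sup>2 / B"
      by (simp add: power2_eq_square field_simps)
    with \<open>B > 0\<close> show ?thesis by (simp add: field_simps)
  qed
qed

lemma Cauchy_Schwarz_integral_sqrt:
  assumes "sqint M f" "sqint M g"
  shows "\<bar>LINT x|M. f x * g x\<bar> \<le> sqrt (LINT x|M. (f x)\<^sup>2) * sqrt (LINT x|M. (g x)\<^sup>2)"
  using Cauchy_Schwarz_integral[OF assms]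
  by (metis real_sqrt_abs real_sqrt_le_mono real_sqrt_mult)

definition orthonormal :: "'a measure \<Rightarrow> ('k \<Rightarrow> 'a \<Rightarrow> real) \<Rightarrow> 'k set \<Rightarrow> bool" where
  "orthonormal M e S \<longleftrightarrow> (\<forall>k\<in>S. sqint M (e k)) \<and>
     (\<forall>k\<in>S. \<forall>l\<in>S. (LINT x|M. e k x * e l x) = of_bool (k = l))"

lemma orthonormal_distance:
  assumes "finite S" "orthonormal M e S" "sqint M f"
  shows "(LINT x|M. (f x - (\<Sum>k\<in>S. a k * e k x))\<^sup>2) =
    (LINT x|M. (f x)\<^sup>2) - 2 * (\<Sum>k\<in>S. a k * (LINT x|M. f x * e k x)) + (\<Sum>k\<in>S. (a k)\<^sup>2)"
proof -
  define g where "g = (\<lambda>x. \<Sum>k\<in>S. a k * e k x)"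
  have e: "sqint M (e k)" if "k \<in> S" for k using assms(2) that by (auto simp: orthonormal_def)
  have g: "sqint M g" unfolding g_def by (intro sqint_sum e)
  have 1: "(LINT x|M. f x * g x) = (\<Sum>k\<in>S. a k * (LINT x|M. f x * e k x))"
  proof -
    have "(LINT x|M. f x * g x) = (LINT x|M. (\<Sum>k\<in>S. a k * (f x * e k x)))"
      by (simp add: g_def sum_distrib_left mult_ac)
    also have "\<dots> = (\<Sum>k\<in>S. (LINT x|M. a k * (f x * e k x)))"
      using sqint_mult_integrable[OF assms(3) e] by (intro Bochner_Integration.integral_sum) simp
    finally show ?thesis by simp
  qed
  have 2: "(LINT x|M. (g x)\<^sup>2) = (\<Sum>k\<in>S. (a k)\<^sup>2)"
  proof -
    have "(LINT x|M. (g x)\<^sup>2) = (LINT x|M. (\<Sum>k\<in>S. \<Sum>l\<in>S. a k * a l * (e k x * e l x)))"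
      by (simp add: g_def power2_eq_square sum_product mult_ac)
    also have "\<dots> = (\<Sum>k\<in>S. \<Sum>l\<in>S. a k * a l * (LINT x|M. e k x * e l x))"
      using sqint_mult_integrable[OF e e]
      by (subst Bochner_Integration.integral_sum; simp)+
    also have "\<dots> = (\<Sum>k\<in>S. \<Sum>l\<in>S. if k = l then (a k)\<^sup>2 else 0)"
      using assms(2) by (intro sum.cong refl) (auto simp: orthonormal_def power2_eq_square)
    finally show ?thesis using assms(1) by simp
  qed
  show ?thesis using integral_square_add[OF assms(3) g, of "-1"] 1 2 unfolding g_def by simp
qed

lemma Bessel_inequality:
  assumes "finite S" "orthonormal M e S" "sqint M f"
  shows "(\<Sum>k\<in>S. (LINT x|M. f x * e k x)\<^sup>2) \<le> (LINT x|M. (f x)\<^sup>2)"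
proof -
  define c where "c = (\<lambda>k. LINT x|M. f x * e k x)"
  have "0 \<le> (LINT x|M. (f x - (\<Sum>k\<in>S. c k * e k x))\<^sup>2)" by simp
  also have "\<dots> = (LINT x|M. (f x)\<^sup>2) - 2 * (\<Sum>k\<in>S. c k * c k) + (\<Sum>k\<in>S. (c k)\<^sup>2)"
    unfolding orthonormal_distance[OF assms] by (simp add: c_def)
  also have "\<dots> = (LINT x|M. (f x)\<^sup>2) - (\<Sum>k\<in>S. (c k)\<^sup>2)"
    by (simp add: power2_eq_square)
  finally show ?thesis by (simp add: c_def)
qed

lemma orthonormal_best_approximation:
  assumes "finite S" "orthonormal M e S" "sqint M f"
  shows "(LINT x|M. (f x - (\<Sum>k\<in>S. (LINT x|M. f x * e k x) * e k x))\<^sup>2) \<le>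
     (LINT x|M. (f x - (\<Sum>k\<in>S. a k * e k x))\<^sup>2)"
proof -
  define c where "c = (\<lambda>k. LINT x|M. f x * e k x)"
  have "0 \<le> (\<Sum>k\<in>S. (a k - c k)\<^sup>2)" by (intro sum_nonneg) simp
  also have "\<dots> = (\<Sum>k\<in>S. (a k)\<^sup>2) - 2 * (\<Sum>k\<in>S. a k * c k) + (\<Sum>k\<in>S. (c k)\<^sup>2)"
    by (simp add: power2_eq_square algebra_simps sum.distrib sum_subtractf sum_distrib_left)
  finally have *: "2 * (\<Sum>k\<in>S. a k * c k) \<le> (\<Sum>k\<in>S. (a k)\<^sup>2) + (\<Sum>k\<in>S. (c k)\<^sup>2)" by simp
  have "(LINT x|M. (f x - (\<Sum>k\<in>S. c k * e k x))\<^sup>2) =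
      (LINT x|M. (f x)\<^sup>2) - 2 * (\<Sum>k\<in>S. c k * c k) + (\<Sum>k\<in>S. (c k)\<^sup>2)"
    unfolding orthonormal_distance[OF assms] by (simp add: c_def)
  then show ?thesis unfolding orthonormal_distance[OF assms, of a] using *
    by (simp add: c_def power2_eq_square)
qed

text \<open>
  Truncating the expansion of \<open>f\<close> costs no more than its best approximation in the span. The
  coefficients \<open>a\<close> are arbitrary, so any approximation of \<open>f\<close> yields a bound.
\<close>

lemma Parseval_approx:
  assumes "finite S" "orthonormal M e S" "sqint M f" "sqint M u"
  shows "\<bar>(LINT x|M. f x * u x) - (\<Sum>k\<in>S. (LINT x|M. f x * e k x) * (LINT x|M. u x * e k x))\<bar>
    \<le> sqrt (LINT x|M. (f x - (\<Sum>k\<in>S. a k * e k x))\<^sup>2) * sqrt (LINT x|M. (u x)\<^sup>2)"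
proof -
  define c where "c = (\<lambda>k. LINT x|M. f x * e k x)"
  define g where "g = (\<lambda>x. f x - (\<Sum>k\<in>S. c k * e k x))"
  have e: "sqint M (e k)" if "k \<in> S" for k using assms(2) that by (auto simp: orthonormal_def)
  have g: "sqint M g" unfolding g_def by (intro sqint_sum sqint_diff e assms)
  have "(LINT x|M. g x * u x) = (LINT x|M. f x * u x - (\<Sum>k\<in>S. c k * (u x * e k x)))"
    by (rule Bochner_Integration.integral_cong) (auto simp: g_def algebra_simps sum_distrib_left)
  also have "\<dots> = (LINT x|M. f x * u x) - (LINT x|M. (\<Sum>k\<in>S. c k * (u x * e k x)))"
    by (intro Bochner_Integration.integral_diff Bochner_Integration.integrable_sum
        integrable_mult_right sqint_mult_integrable assms e)
  also have "(LINT x|M. (\<Sum>k\<in>S. c k * (u x * e k x))) = (\<Sum>k\<in>S. c k * (LINT x|M. u x * e k x))"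
    using sqint_mult_integrable[OF assms(4) e] by (subst Bochner_Integration.integral_sum) auto
  finally have "\<bar>(LINT x|M. f x * u x) - (\<Sum>k\<in>S. c k * (LINT x|M. u x * e k x))\<bar>
      \<le> sqrt (LINT x|M. (g x)\<^sup>2) * sqrt (LINT x|M. (u x)\<^sup>2)"
    using Cauchy_Schwarz_integral_sqrt[OF g assms(4)] by simp
  also have "\<dots> \<le> sqrt (LINT x|M. (f x - (\<Sum>k\<in>S. a k * e k x))\<^sup>2) * sqrt (LINT x|M. (u x)\<^sup>2)"
    using orthonormal_best_approximation[OF assms(1-3), of a]
    by (intro mult_right_mono real_sqrt_le_mono) (auto simp: g_def c_def)
  finally show ?thesis by (simp add: c_def)
qed

section \<open>Shifted Legendre polynomials\<close>

text \<open>
  The affine map of \<open>[0, 1]\<close> onto \<open>[- 1, 1]\<close>, where Legendre polynomials usually live.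
\<close>

definition ypoly :: "real poly" where "ypoly = [:-1, 2:]"

text \<open>
  The Sturm-Liouville weight. That it vanishes at both ends of the interval removes all boundary terms.
\<close>

definition wpoly :: "real poly" where "wpoly = [:0, 1, -1:]"

lemma poly_ypoly [simp]: "poly ypoly x = 2 * x - 1"
  by (simp add: ypoly_def)

lemma poly_wpoly [simp]: "poly wpoly x = x * (1 - x)"
  by (simp add: wpoly_def algebra_simps)

lemma pderiv_ypoly [simp]: "pderiv ypoly = [:2:]"
  by (simp add: ypoly_def pderiv_pCons)

lemma pderiv_wpoly [simp]: "pderiv wpoly = - ypoly"
  by (simp add: ypoly_def wpoly_def pderiv_pCons)

text \<open>Bonnet's recursion for the Legendre polynomials in the variable \<open>2 t - 1\<close>.\<close>

fun legendre :: "nat \<Rightarrow> real poly" where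
  "legendre 0 = 1"
| "legendre (Suc 0) = ypoly"
| "legendre (Suc (Suc n)) =
     smult ((2 * real n + 3) / (real n + 2)) (ypoly * legendre (Suc n)) -
     smult ((real n + 1) / (real n + 2)) (legendre n)"

declare legendre.simps(3) [simp del]

lemma scaled_difference: "m \<noteq> 0 \<Longrightarrow> m * (a / m * u - b / m * v) = a * u - b * v" for m :: real
  by (simp add: field_simps)

lemma legendre_rec:
  "(real n + 2) * poly (legendre (Suc (Suc n))) x =
     (2 * real n + 3) * ((2 * x - 1) * poly (legendre (Suc n)) x) - (real n + 1) * poly (legendre n) x"
  unfolding legendre.simps(3) poly_diff poly_smult
  by (subst scaled_difference) (auto simp: algebra_simps)

lemma pderiv_legendre_rec:
  "(real n + 2) * poly (pderiv (legendre (Suc (Suc n)))) x =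
     (2 * real n + 3) * (2 * poly (legendre (Suc n)) x + (2 * x - 1) * poly (pderiv (legendre (Suc n))) x)
     - (real n + 1) * poly (pderiv (legendre n)) x"
  unfolding legendre.simps(3) pderiv_diff pderiv_smult poly_diff poly_smult
  by (subst scaled_difference) (auto simp: pderiv_mult pderiv_pCons algebra_simps)

text \<open>
  The classical relations between consecutive Legendre polynomials and their derivatives; the factor 2
  comes from the substitution \<open>2 t - 1\<close>. Each induction step uses both, hence the conjunction.
\<close>

lemma legendre_deriv_relations:
  "poly (pderiv (legendre (Suc n))) x =
     (2 * x - 1) * poly (pderiv (legendre n)) x + 2 * (real n + 1) * poly (legendre n) x \<and>
   (2 * x - 1) * poly (pderiv (legendre (Suc n))) x - poly (pderiv (legendre n)) x =
     2 * (real n + 1) * poly (legendre (Suc n)) x"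
proof (induction n)
  case 0
  then show ?case by (simp add: pderiv_pCons algebra_simps)
next
  case (Suc n)
  define y P0 P1 P2 D0 D1 D2 N where "y = 2 * x - 1" and "P0 = poly (legendre n) x"
    and "P1 = poly (legendre (Suc n)) x" and "P2 = poly (legendre (Suc (Suc n))) x"
    and "D0 = poly (pderiv (legendre n)) x" and "D1 = poly (pderiv (legendre (Suc n))) x"
    and "D2 = poly (pderiv (legendre (Suc (Suc n)))) x" and "N = real n"
  have N: "N + 2 \<noteq> 0" unfolding N_def by linarith
  have A: "D1 = y * D0 + 2 * (N + 1) * P0"
    using Suc[THEN conjunct1] unfolding y_def P0_def P1_def D0_def D1_def N_def .
  have B: "y * D1 - D0 = 2 * (N + 1) * P1"
    using Suc[THEN conjunct2] unfolding y_def P0_def P1_def D0_def D1_def N_def .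
  have r: "(N + 2) * P2 = (2 * N + 3) * (y * P1) - (N + 1) * P0"
    using legendre_rec[of n x] by (simp add: y_def P0_def P1_def P2_def N_def)
  have dr: "(N + 2) * D2 = (2 * N + 3) * (2 * P1 + y * D1) - (N + 1) * D0"
    using pderiv_legendre_rec[of n x] by (simp add: y_def D0_def D1_def D2_def P1_def N_def)
  have "(N + 2) * D2 = (N + 2) * (y * D1 + 2 * (N + 2) * P1)"
    using dr B by algebra
  then have A': "D2 = y * D1 + 2 * (N + 2) * P1" using N by simp
  have "y * D2 - D1 = 2 * (N + 2) * P2"
    using A' A B r by algebra
  then show ?case using A'
    by (simp add: y_def P1_def P2_def D1_def D2_def N_def algebra_simps)
qed

text \<open>
  The relations between derivatives give \<open>w P'\<close> as a combination of two Legendre polynomials, and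
  differentiating this once more closes up to the Legendre equation.
\<close>

lemma legendre_ode:
  "pderiv (wpoly * pderiv (legendre n)) = smult (- (real n * (real n + 1))) (legendre n)"
proof (cases n)
  case 0
  then show ?thesis by simp
next
  case (Suc m)
  define N where "N = real m + 1"
  have "wpoly * pderiv (legendre (Suc m)) =
     smult (N / 2) (legendre m - ypoly * legendre (Suc m))"
  proof (rule poly_eq_poly_eq_iff[THEN iffD1], rule ext)
    fix x
    define y P0 P1 D0 D1 where "y = 2 * x - 1" and "P0 = poly (legendre m) x"
      and "P1 = poly (legendre (Suc m)) x"
      and "D0 = poly (pderiv (legendre m)) x" and "D1 = poly (pderiv (legendre (Suc m))) x"
    have A: "D1 = y * D0 + 2 * N * P0"
      using legendre_deriv_relations[of m x, THEN conjunct1]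
      unfolding y_def P0_def P1_def D0_def D1_def N_def .
    have B: "y * D1 - D0 = 2 * N * P1"
      using legendre_deriv_relations[of m x, THEN conjunct2]
      unfolding y_def P0_def P1_def D0_def D1_def N_def .
    have "4 * (x * (1 - x)) = 1 - y\<^sup>2" by (simp add: y_def power2_eq_square algebra_simps)
    then have "4 * ((x * (1 - x)) * D1) = 2 * N * (P0 - y * P1)"
      using A B by algebra
    then show "poly (wpoly * pderiv (legendre (Suc m))) x =
        poly (smult (N / 2) (legendre m - ypoly * legendre (Suc m))) x"
      by (simp add: y_def P0_def P1_def D1_def algebra_simps)
  qed
  then have *: "pderiv (wpoly * pderiv (legendre (Suc m))) =
     pderiv (smult (N / 2) (legendre m - ypoly * legendre (Suc m)))" by simp
  show ?thesis
  proof (rule poly_eq_poly_eq_iff[THEN iffD1], rule ext)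
    fix x
    define y P1 D0 D1 where "y = 2 * x - 1" 
      and "P1 = poly (legendre (Suc m)) x"
      and "D0 = poly (pderiv (legendre m)) x" and "D1 = poly (pderiv (legendre (Suc m))) x"
    have B: "y * D1 - D0 = 2 * N * P1"
      using legendre_deriv_relations[of m x, THEN conjunct2]
      unfolding y_def P1_def D0_def D1_def N_def .
    have "poly (pderiv (wpoly * pderiv (legendre (Suc m)))) x = N / 2 * (D0 - 2 * P1 - y * D1)"
      unfolding * by (simp add: pderiv_smult pderiv_diff pderiv_mult pderiv_pCons
          y_def P1_def D0_def D1_def algebra_simps)
    also have "\<dots> = - (N * (N + 1)) * P1" using B by algebra
    finally show "poly (pderiv (wpoly * pderiv (legendre n))) x =
        poly (smult (- (real n * (real n + 1))) (legendre n)) x"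
      using Suc by (simp add: P1_def N_def)
  qed
qed

lemma legendre_degree_le: "degree (legendre n) \<le> n"
proof (induction n rule: legendre.induct)
  case (3 n)
  have "degree (ypoly * legendre (Suc n)) \<le> 1 + Suc n"
    using degree_mult_le[of ypoly "legendre (Suc n)"] 3(1) by (simp add: ypoly_def)
  then show ?case using 3(2) unfolding legendre.simps(3)
    by (intro degree_diff_le order_trans[OF degree_smult_le]) auto
qed (auto simp: ypoly_def)

lemma legendre_coeff_pos: "coeff (legendre n) n > 0"
proof (induction n rule: legendre.induct)
  case (3 n)
  have "coeff (legendre (Suc n)) (Suc (Suc n)) = 0" "coeff (legendre n) (Suc (Suc n)) = 0"
    using legendre_degree_le[of "Suc n"] legendre_degree_le[of n]
    by (auto intro!: coeff_eq_0)
  then show ?case using 3 unfolding legendre.simps(3) by (simp add: ypoly_def)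
qed (auto simp: ypoly_def)

text \<open>
  The leading coefficient of \<open>legendre n\<close> is not zero, so leading terms can be removed one by one.
\<close>

lemma legendre_span:
  assumes "degree p \<le> N"
  shows "\<exists>a. p = (\<Sum>k\<le>N. smult (a k) (legendre k))"
  using assms
proof (induction N arbitrary: p)
  case 0
  then show ?case by (auto intro!: exI[of _ "\<lambda>_. coeff p 0"] simp: degree_eq_zeroE elim!: degree_eq_zeroE)
next
  case (Suc N)
  define c where "c = coeff p (Suc N) / coeff (legendre (Suc N)) (Suc N)"
  have "degree (p - smult c (legendre (Suc N))) \<le> N"
  proof (rule degree_le, intro allI impI)
    fix i assume i: "N < i"
    show "coeff (p - smult c (legendre (Suc N))) i = 0"
    proof (cases "i = Suc N")
      case True
      then show ?thesis using legendre_coeff_pos[of "Suc N"] by (simp add: c_def)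
    next
      case False
      then have "Suc N < i" using i by simp
      then show ?thesis using Suc.prems legendre_degree_le[of "Suc N"] by (simp add: coeff_eq_0)
    qed
  qed
  from Suc.IH[OF this] obtain a where a: "p - smult c (legendre (Suc N)) =
     (\<Sum>k\<le>N. smult (a k) (legendre k))" by blast
  have "p = (\<Sum>k\<le>Suc N. smult ((a(Suc N := c)) k) (legendre k))"
    using a by (simp add: algebra_simps)
  then show ?case by blast
qed

subsection \<open>Higher derivatives\<close>

text \<open>
  The eigenvalue of the Sturm-Liouville operator of weight \<open>(t (1 - t)) ^ j\<close> at the \<open>j\<close>-th derivative
  of the \<open>n\<close>-th Legendre polynomial. It vanishes at \<open>j = n\<close>, where that derivative is constant.
\<close>

definition legendre_eig :: "nat \<Rightarrow> nat \<Rightarrow> real" where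
  "legendre_eig n j = real n * (real n + 1) - real j * (real j + 1)"

lemma legendre_ode_deriv:
  "wpoly * (pderiv ^^ (j + 2)) (legendre n) + smult (- (real j + 1)) (ypoly * (pderiv ^^ (j + 1)) (legendre n))
     + smult (legendre_eig n j) ((pderiv ^^ j) (legendre n)) = 0"
proof (induction j)
  case 0
  show ?case using legendre_ode[of n]
    by (simp add: pderiv_mult legendre_eig_def numeral_2_eq_2 algebra_simps flip: smult_add_left)
next
  case (Suc j)
  define L0 L1 L2 L3 where "L0 = (pderiv ^^ j) (legendre n)" and "L1 = pderiv L0"
    and "L2 = pderiv L1" and "L3 = pderiv L2"
  have "wpoly * L2 + smult (- (real j + 1)) (ypoly * L1) + smult (legendre_eig n j) L0 = 0"
    using Suc by (simp add: L0_def L1_def L2_def numeral_2_eq_2)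
  then have "pderiv (wpoly * L2 + smult (- (real j + 1)) (ypoly * L1) + smult (legendre_eig n j) L0) = 0"
    by simp
  then have *: "poly (pderiv (wpoly * L2 + smult (- (real j + 1)) (ypoly * L1) + smult (legendre_eig n j) L0)) x = 0" for x
    by simp
  have "wpoly * L3 + smult (- (real (Suc j) + 1)) (ypoly * L2) + smult (legendre_eig n (Suc j)) L1 = 0"
  proof (rule poly_eq_poly_eq_iff[THEN iffD1], rule ext)
    fix x
    show "poly (wpoly * L3 + smult (- (real (Suc j) + 1)) (ypoly * L2) + smult (legendre_eig n (Suc j)) L1) x = poly 0 x"
      using *[of x]
      by (simp add: pderiv_mult pderiv_add pderiv_smult pderiv_minus pderiv_pCons legendre_eig_def
          L1_def[symmetric] L2_def[symmetric] L3_def[symmetric] algebra_simps)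
  qed
  then show ?case by (simp add: L0_def L1_def L2_def L3_def numeral_2_eq_2)
qed

text \<open>
  Multiplying the \<open>j\<close> times differentiated Legendre equation by \<open>w ^ j\<close> puts it in divergence form.
  This is the form in which it can be integrated by parts against weak derivatives.
\<close>

lemma legendre_sturm_liouville:
  "pderiv (wpoly ^ Suc j * (pderiv ^^ Suc j) (legendre n)) =
     smult (- legendre_eig n j) (wpoly ^ j * (pderiv ^^ j) (legendre n))"
proof -
  define L0 L1 L2 where "L0 = (pderiv ^^ j) (legendre n)" and "L1 = pderiv L0"
    and "L2 = pderiv L1"
  have "wpoly * L2 + smult (- (real j + 1)) (ypoly * L1) + smult (legendre_eig n j) L0 = 0"
    using legendre_ode_deriv[of j n] by (simp add: L0_def L1_def L2_def numeral_2_eq_2)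
  then have *: "wpoly * L2 + smult (- (real j + 1)) (ypoly * L1) = - smult (legendre_eig n j) L0"
    by (simp add: add_eq_0_iff)
  have "pderiv (wpoly ^ Suc j * L1) =
     wpoly ^ j * (wpoly * L2 + smult (- (real j + 1)) (ypoly * L1))"
    unfolding pderiv_mult pderiv_power_Suc L2_def[symmetric]
    by (rule poly_eq_poly_eq_iff[THEN iffD1], rule ext) (simp add: algebra_simps)
  then show ?thesis unfolding * by (simp add: L0_def L1_def)
qed

subsection \<open>Integrals of polynomials over the unit interval\<close>

definition unit_interval :: "real measure" where
  "unit_interval = restrict_space lborel {0..1}"

lemma unit_interval_space [simp]: "space unit_interval = {0..1}"
  by (simp add: unit_interval_def space_restrict_space)

lemma integrable_unit_interval_cont:
  fixes f :: "real \<Rightarrow> real"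
  assumes "continuous_on {0..1} f" shows "integrable unit_interval f"
  unfolding unit_interval_def
  using borel_integrable_atLeastAtMost'[OF assms]
  by (simp add: integrable_restrict_space set_integrable_def)

lemma continuous_on_poly_real [continuous_intros]: "continuous_on A (poly (p :: real poly))"
  by (intro continuous_at_imp_continuous_on) auto

lemma integrable_poly [simp]: "integrable unit_interval (poly p)"
  by (intro integrable_unit_interval_cont continuous_intros)

text \<open>
  Integration as a linear functional on polynomials, so that polynomial identities can be integrated
  by rewriting, without integrability side conditions.
\<close>

definition pint :: "real poly \<Rightarrow> real" where
  "pint p = (LINT t|unit_interval. poly p t)"

lemma pint_add: "pint (p + q) = pint p + pint q"
  and pint_diff: "pint (p - q) = pint p - pint q"
  and pint_smult: "pint (smult c p) = c * pint p"
  by (simp_all add: pint_def)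

lemma pint_pderiv: "pint (pderiv p) = poly p 1 - poly p 0"
proof -
  have "pint (pderiv p) = (LINT t|lborel. indicator {0..1} t *\<^sub>R poly (pderiv p) t)"
    unfolding unit_interval_def pint_def by (simp add: integral_restrict_space set_lebesgue_integral_def)
  also have "\<dots> = poly p 1 - poly p 0"
    by (rule integral_FTC_Icc)
       (auto intro!: continuous_intros DERIV_subset[OF poly_DERIV] simp: has_real_derivative_iff_has_vector_derivative[symmetric])
  finally show ?thesis .
qed

lemma pint_by_parts:
  assumes "poly p 0 = 0" "poly p 1 = 0"
  shows "pint (p * pderiv q) = - pint (pderiv p * q)"
proof -
  have "pint (p * pderiv q + q * pderiv p) = 0"
    using pint_pderiv[of "p * q"] assms by (simp add: pderiv_mult)
  then show ?thesis by (simp add: pint_add mult_ac)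
qed

text \<open>Each integration by parts moves one derivative and produces one eigenvalue.\<close>

lemma legendre_weighted_pint:
  "pint (wpoly ^ j * (pderiv ^^ j) (legendre n) * (pderiv ^^ j) (legendre m)) =
     (\<Prod>i<j. legendre_eig n i) * pint (legendre n * legendre m)"
proof (induction j)
  case (Suc j)
  have "pint (wpoly ^ Suc j * (pderiv ^^ Suc j) (legendre n) * pderiv ((pderiv ^^ j) (legendre m)))
     = - pint (pderiv (wpoly ^ Suc j * (pderiv ^^ Suc j) (legendre n)) * (pderiv ^^ j) (legendre m))"
    by (rule pint_by_parts) auto
  also have "\<dots> = legendre_eig n j * pint (wpoly ^ j * (pderiv ^^ j) (legendre n) * (pderiv ^^ j) (legendre m))"
    unfolding legendre_sturm_liouville mult_smult_left pint_smult by simp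
  finally show ?case unfolding Suc.IH by simp
qed simp

text \<open>The Sturm-Liouville operator is symmetric, and its eigenvalues are distinct.\<close>

lemma legendre_orthogonal:
  assumes "n \<noteq> m" shows "pint (legendre n * legendre m) = 0"
proof -
  define X where "X = pint (legendre n * legendre m)"
  have "pint (wpoly * pderiv (legendre n) * pderiv (legendre m)) = legendre_eig n 0 * X"
    using legendre_weighted_pint[of 1 n m] by (simp add: X_def)
  moreover have "pint (wpoly * pderiv (legendre n) * pderiv (legendre m)) = legendre_eig m 0 * X"
    using legendre_weighted_pint[of 1 m n] by (simp add: X_def mult_ac)
  moreover have "legendre_eig n 0 \<noteq> legendre_eig m 0"
  proof -
    have "legendre_eig n 0 - legendre_eig m 0 = (real n - real m) * (real n + real m + 1)"
      by (simp add: legendre_eig_def algebra_simps)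
    moreover have "real n + real m + 1 \<noteq> 0" by linarith
    ultimately show ?thesis using assms by auto
  qed
  ultimately show ?thesis by (simp add: X_def)
qed

lemma legendre_rec_poly:
  "smult (real n + 2) (legendre (Suc (Suc n))) =
     smult (2 * real n + 3) (ypoly * legendre (Suc n)) - smult (real n + 1) (legendre n)"
  by (rule poly_eq_poly_eq_iff[THEN iffD1], rule ext) (use legendre_rec in simp)

text \<open>
  Integrating the recursion for \<open>P\<^sub>n\<^sub>+\<^sub>2\<close> against \<open>P\<^sub>n\<^sub>+\<^sub>2\<close> and that for \<open>P\<^sub>n\<^sub>+\<^sub>3\<close> against \<open>P\<^sub>n\<^sub>+\<^sub>1\<close> relates the
  same mixed integral to the norms of two consecutive polynomials.
\<close>

lemma legendre_norm: "(2 * real n + 1) * pint (legendre n * legendre n) = 1"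
proof -
  define H where "H = (\<lambda>n. pint (legendre n * legendre n))"
  have H0: "H 0 = 1"
    using pint_pderiv[of "[:0,1:]"] by (simp add: H_def pderiv_pCons one_pCons)
  have H1: "H (Suc 0) = 1 / 3"
  proof -
    have "pderiv [:0,1,-2,4/3:] = ypoly * ypoly" by (simp add: ypoly_def pderiv_pCons)
    then show ?thesis using pint_pderiv[of "[:0,1,-2,4/3:]"] by (simp add: H_def)
  qed
  have step: "(2 * real n + 5) * H (Suc (Suc n)) = (2 * real n + 3) * H (Suc n)" for n
  proof -
    \<comment> \<open>The recursion yields \<open>y P\<^sub>n\<^sub>+\<^sub>1\<close> from its step at \<open>n\<close> and \<open>y P\<^sub>n\<^sub>+\<^sub>2\<close> from its step at \<open>n + 1\<close>;
      orthogonality kills the remaining terms.\<close>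
    define X where "X = pint (ypoly * legendre (Suc n) * legendre (Suc (Suc n)))"
    have "(real n + 2) * H (Suc (Suc n)) = pint (smult (real n + 2) (legendre (Suc (Suc n))) * legendre (Suc (Suc n)))"
      by (simp add: H_def pint_smult)
    also have "\<dots> = (2 * real n + 3) * X"
      unfolding legendre_rec_poly using legendre_orthogonal[of n "Suc (Suc n)"]
      by (simp add: left_diff_distrib pint_diff pint_smult X_def)
    finally have 1: "(real n + 2) * H (Suc (Suc n)) = (2 * real n + 3) * X" .
    have "0 = pint (smult (real (Suc n) + 2) (legendre (Suc (Suc (Suc n)))) * legendre (Suc n))"
      using legendre_orthogonal[of "Suc (Suc (Suc n))" "Suc n"] by (simp add: pint_smult)
    also have "\<dots> = (2 * real n + 5) * X - (real n + 2) * H (Suc n)"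
      unfolding legendre_rec_poly[of "Suc n"]
      unfolding left_diff_distrib mult_smult_left pint_diff pint_smult
      by (simp add: X_def H_def mult_ac add.commute)
    finally have 2: "(2 * real n + 5) * X = (real n + 2) * H (Suc n)" by simp
    have "(real n + 2) * ((2 * real n + 5) * H (Suc (Suc n))) = (real n + 2) * ((2 * real n + 3) * H (Suc n))"
      using 1 2 by algebra
    moreover have "real n + 2 \<noteq> 0" by linarith
    ultimately show ?thesis by simp
  qed
  have "(2 * real n + 1) * H n = 1"
  proof (induction n rule: legendre.induct)
    case (3 n) then show ?case using step[of n] by (simp add: algebra_simps)
  qed (auto simp: H0 H1)
  then show ?thesis by (simp add: H_def)
qed

subsection \<open>Pointwise bounds\<close>

lemma legendre_at_1: "poly (legendre n) 1 = 1"
proof (induction n rule: legendre.induct)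
  case (3 n)
  have "(real n + 2) * poly (legendre (Suc (Suc n))) 1 = (real n + 2) * 1"
    using legendre_rec[of n 1] 3 by simp
  moreover have "real n + 2 \<noteq> 0" by linarith
  ultimately show ?case unfolding mult_cancel_left by simp
qed auto

lemma legendre_at_0: "(poly (legendre n) 0)\<^sup>2 = 1 "
proof -
  have "poly (legendre n) 0 = (-1) ^ n"
  proof (induction n rule: legendre.induct)
    case (3 n)
    have "(real n + 2) * poly (legendre (Suc (Suc n))) 0 = (real n + 2) * (-1) ^ n"
      using legendre_rec[of n 0] 3 by (simp add: algebra_simps)
    moreover have "real n + 2 \<noteq> 0" by linarith
    ultimately show ?case by simp
  qed auto
  then show ?thesis by (simp flip: power_mult)
qed

lemma unimodal_le_ends:
  fixes F :: "real \<Rightarrow> real"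
  assumes "\<And>t. 0 \<le> t \<Longrightarrow> t \<le> 1 \<Longrightarrow> (F has_real_derivative (2 * t - 1) * G t) (at t)"
    and "\<And>t. G t \<ge> 0" and "0 \<le> x" "x \<le> 1"
  shows "F x \<le> max (F 0) (F 1)"
proof (cases "x \<ge> 1/2")
  case True
  have "F x \<le> F 1"
  proof (rule DERIV_nonneg_imp_nondecreasing[OF assms(4)])
    fix t assume "x \<le> t" "t \<le> 1"
    then show "\<exists>d. (F has_real_derivative d) (at t) \<and> 0 \<le> d"
      using assms(1)[of t] assms(2)[of t] assms(3) True by (intro exI[of _ "(2 * t - 1) * G t"]) auto
  qed
  then show ?thesis by simp
next
  case False
  have "F x \<le> F 0"
  proof (rule DERIV_nonpos_imp_nonincreasing[OF assms(3)])
    fix t assume "0 \<le> t" "t \<le> x"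
    then show "\<exists>d. (F has_real_derivative d) (at t) \<and> d \<le> 0"
      using assms(1)[of t] assms(2)[of t] assms(4) False
      by (intro exI[of _ "(2 * t - 1) * G t"]) (auto intro!: mult_nonpos_nonneg)
  qed
  then show ?thesis by simp
qed

text \<open>
  The energy \<open>P\<^sup>2 + w P'\<^sup>2 / N\<close>, with \<open>N = n (n + 1)\<close>, has derivative \<open>(2 t - 1) P'\<^sup>2 / N\<close> by the Legendre
  equation. It dominates \<open>P\<^sup>2\<close> and is largest at the ends, where the weight vanishes and \<open>P\<^sup>2 = 1\<close>.
\<close>

lemma legendre_abs_le_1:
  assumes "0 \<le> x" "x \<le> 1" shows "(poly (legendre n) x)\<^sup>2 \<le> 1"
proof (cases "n = 0")
  case False
  define N where "N = real n * (real n + 1)"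
  have N: "N > 0" using False by (simp add: N_def)
  define P P' P'' where "P = poly (legendre n)" and "P' = poly (pderiv (legendre n))"
    and "P'' = poly (pderiv (pderiv (legendre n)))"
  have d[derivative_intros]: "(P has_real_derivative P' t) (at t)" "(P' has_real_derivative P'' t) (at t)" for t
    by (auto simp: P_def P'_def P''_def intro: poly_DERIV)
  define F where "F = (\<lambda>t. (P t)\<^sup>2 + t * (1 - t) * (P' t)\<^sup>2 / N)"
  have ode: "t * (1 - t) * P'' t = (2 * t - 1) * P' t - N * P t" for t
  proof -
    have "poly (pderiv (wpoly * pderiv (legendre n))) t = - N * P t"
      unfolding legendre_ode by (simp add: N_def P_def)
    then show ?thesis by (simp add: pderiv_mult pderiv_pCons P'_def P''_def algebra_simps)
  qed
  have "F x \<le> max (F 0) (F 1)"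
  proof (rule unimodal_le_ends[where G="\<lambda>t. (P' t)\<^sup>2 / N"])
    fix t :: real
    have "(F has_real_derivative
       2 * P t * P' t + ((1 - 2 * t) * (P' t)\<^sup>2 + t * (1 - t) * (2 * P' t * P'' t)) / N) (at t)"
    proof -
      have 1: "((\<lambda>t. t * (1 - t) * (P' t)\<^sup>2) has_real_derivative
          (1 - 2 * t) * (P' t)\<^sup>2 + t * (1 - t) * (2 * P' t * P'' t)) (at t)"
        by (auto intro!: derivative_eq_intros simp: algebra_simps power2_eq_square)
      have 2: "((\<lambda>t. (P t)\<^sup>2) has_real_derivative 2 * P t * P' t) (at t)"
        by (auto intro!: derivative_eq_intros)
      show ?thesis unfolding F_def by (rule DERIV_add[OF 2 DERIV_cdivide[OF 1]])
    qed
    moreover have "2 * P t * P' t + ((1 - 2 * t) * (P' t)\<^sup>2 + t * (1 - t) * (2 * P' t * P'' t)) / N =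
       (2 * t - 1) * ((P' t)\<^sup>2 / N)"
    proof -
      have "t * (1 - t) * (2 * P' t * P'' t) = 2 * P' t * ((2 * t - 1) * P' t - N * P t)"
        using ode[of t] by algebra
      then show ?thesis using N by (simp add: field_simps power2_eq_square)
    qed
    ultimately show "(F has_real_derivative (2 * t - 1) * ((P' t)\<^sup>2 / N)) (at t)" by simp
  qed (use assms N in auto)
  moreover have "F 0 = 1" "F 1 = 1" using legendre_at_0[of n] legendre_at_1[of n] by (auto simp: F_def P_def)
  moreover have "(P x)\<^sup>2 \<le> F x" using assms N by (simp add: F_def)
  ultimately show ?thesis by (simp add: P_def)
qed simp

text \<open>At the centre the middle term of the recursion disappears.\<close>

lemma legendre_mid: "(poly (legendre n) (1/2))\<^sup>2 \<le> 1 / (real n + 1)"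
proof (induction n rule: legendre.induct)
  case (3 n)
  have pos: "real n + 2 > 0" by linarith
  have "poly (legendre (Suc (Suc n))) (1/2) = - ((real n + 1) / (real n + 2)) * poly (legendre n) (1/2)"
    using legendre_rec[of n "1/2"] pos by (simp add: field_simps)
  then have "(poly (legendre (Suc (Suc n))) (1/2))\<^sup>2 = ((real n + 1) / (real n + 2))\<^sup>2 * (poly (legendre n) (1/2))\<^sup>2"
    by (simp only: power_mult_distrib power2_minus)
  also have "\<dots> \<le> ((real n + 1) / (real n + 2))\<^sup>2 * (1 / (real n + 1))"
    using 3 by (intro mult_left_mono) auto
  also have "\<dots> = (real n + 1) / (real n + 2)\<^sup>2" by (simp add: power2_eq_square)
  also have "\<dots> \<le> 1 / (real (Suc (Suc n)) + 1)"
    by (simp add: divide_simps power2_eq_square) (simp add: algebra_simps)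
  finally show ?case .
qed auto

lemma legendre_mid_deriv:
  "(poly (pderiv (legendre n)) (1/2))\<^sup>2 / ((2 * real n + 1)\<^sup>2 + 1) \<le> 1 / (real n + 1)"
proof (cases n)
  case 0 then show ?thesis by simp
next
  case (Suc m)
  have "poly (pderiv (legendre n)) (1/2) = 2 * (real m + 1) * poly (legendre m) (1/2)"
    using legendre_deriv_relations[of m "1/2"] Suc by simp
  then have "(poly (pderiv (legendre n)) (1/2))\<^sup>2 = 4 * (real m + 1)\<^sup>2 * (poly (legendre m) (1/2))\<^sup>2"
    by (simp only: power_mult_distrib) simp
  also have "\<dots> \<le> 4 * (real m + 1)\<^sup>2 * (1 / (real m + 1))"
    using legendre_mid[of m] by (intro mult_left_mono) auto
  also have "\<dots> = 4 * (real m + 1)" by (simp add: power2_eq_square)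
  also have "\<dots> \<le> ((2 * real n + 1)\<^sup>2 + 1) * (1 / (real n + 1))"
    using Suc by (simp add: divide_simps power2_eq_square) (simp add: algebra_simps)
  finally show ?thesis
    by (subst pos_divide_le_eq) (auto intro: add_nonneg_pos simp: mult_ac)
qed

text \<open>
  The Sonin function \<open>V = s (P\<^sup>2 + u\<^sup>2 / Z)\<close>, with \<open>s = 2 sqrt (t (1 - t))\<close>, \<open>y = 2 t - 1\<close>,
  \<open>u = y P - s\<^sup>2 P'\<close> and \<open>Z = (2 n + 1)\<^sup>2 s\<^sup>2 + 1\<close>, satisfies \<open>V' = - 4 y u\<^sup>2 / (Z\<^sup>2 s)\<close>, so it is
  maximal at the centre of the interval, where the recurrence gives its size.
\<close>

lemma legendre_sonin:
  assumes x: "0 < x" "x < 1"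
  shows "2 * sqrt (x * (1 - x)) * (poly (legendre n) x)\<^sup>2 \<le> 2 / (real n + 1)"
proof -
  define q where "q = (2 * real n + 1)\<^sup>2"
  have q: "q \<ge> 0" by (simp add: q_def)
  define P P' P'' where "P = poly (legendre n)" and "P' = poly (pderiv (legendre n))"
    and "P'' = poly (pderiv (pderiv (legendre n)))"
  have d[derivative_intros]: "(P has_real_derivative P' t) (at t)" "(P' has_real_derivative P'' t) (at t)" for t
    by (auto simp: P_def P'_def P''_def intro: poly_DERIV)
  define S where "S = (\<lambda>t::real. 4 * (t * (1 - t)))"
  define u where "u = (\<lambda>t. (2 * t - 1) * P t - S t * P' t)"
  define Z where "Z = (\<lambda>t. q * S t + 1)"
  define V where "V = (\<lambda>t. sqrt (S t) * ((P t)\<^sup>2 + (u t)\<^sup>2 / Z t))"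
  define W where "W = (\<lambda>t. 4 * (u t)\<^sup>2 / ((Z t)\<^sup>2 * sqrt (S t)))"
  \<comment> \<open>\<open>1 - q = - 4 n (n + 1)\<close>, so this is four times the Legendre equation.\<close>
  have ode: "4 * (t * (1 - t)) * P'' t + 4 * (1 - 2 * t) * P' t = (1 - q) * P t" for t
  proof -
    have "poly (pderiv (wpoly * pderiv (legendre n))) t = - (real n * (real n + 1)) * P t"
      unfolding legendre_ode by (simp add: P_def)
    then show ?thesis
      by (simp add: pderiv_mult pderiv_pCons P'_def P''_def algebra_simps q_def power2_eq_square)
  qed
  have S: "S t > 0" if "0 < t" "t < 1" for t using that by (simp add: S_def)
  have Z: "Z t > 0" if "0 < t" "t < 1" for t
    unfolding Z_def using S[OF that] q by (intro add_nonneg_pos mult_nonneg_nonneg) auto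
  have V': "(V has_real_derivative (1 - 2 * t) * W t) (at t)" if t: "0 < t" "t < 1" for t
  proof -
    define s where "s = sqrt (S t)"
    have s: "s > 0" "s\<^sup>2 = S t" using S[OF t] by (auto simp: s_def)
    have dS: "(S has_real_derivative 4 * (1 - 2 * t)) (at t)"
      unfolding S_def by (auto intro!: derivative_eq_intros)
    have du: "(u has_real_derivative (q + 1) * P t + (2 * t - 1) * P' t) (at t)"
    proof -
      have "(u has_real_derivative 2 * P t + (2 * t - 1) * P' t - (4 * (1 - 2 * t) * P' t + S t * P'' t)) (at t)"
        unfolding u_def by (auto intro!: derivative_eq_intros dS)
      moreover have "2 * P t + (2 * t - 1) * P' t - (4 * (1 - 2 * t) * P' t + S t * P'' t) =
          (q + 1) * P t + (2 * t - 1) * P' t"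
        using ode[of t] by (simp add: S_def algebra_simps)
      ultimately show ?thesis by metis
    qed
    have dZ: "(Z has_real_derivative q * (4 * (1 - 2 * t))) (at t)"
      unfolding Z_def by (auto intro!: derivative_eq_intros dS)
    define R' where "R' = 2 * P t * P' t + (2 * u t * ((q + 1) * P t + (2 * t - 1) * P' t) * Z t
       - (u t)\<^sup>2 * (q * (4 * (1 - 2 * t)))) / (Z t)\<^sup>2"
    have "(V has_real_derivative (4 * (1 - 2 * t)) / (2 * s) * ((P t)\<^sup>2 + (u t)\<^sup>2 / Z t) + s * R') (at t)"
    proof -
      have 1: "((\<lambda>t. (P t)\<^sup>2) has_real_derivative 2 * P t * P' t) (at t)"
        by (auto intro!: derivative_eq_intros)
      have 2: "((\<lambda>t. (u t)\<^sup>2) has_real_derivative 2 * u t * ((q + 1) * P t + (2 * t - 1) * P' t)) (at t)"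
        by (auto intro!: derivative_eq_intros du)
      have 3: "((\<lambda>t. sqrt (S t)) has_real_derivative (4 * (1 - 2 * t)) / (2 * s)) (at t)"
        using S[OF t] unfolding s_def by (auto intro!: derivative_eq_intros dS simp: field_simps)
      have 4: "((\<lambda>t. (P t)\<^sup>2 + (u t)\<^sup>2 / Z t) has_real_derivative R') (at t)"
        using DERIV_add[OF 1 DERIV_divide[OF 2 dZ]] Z[OF t] by (simp add: R'_def power2_eq_square)
      show ?thesis using DERIV_mult[OF 3 4] unfolding V_def s_def by (simp add: mult_ac add.commute)
    qed
    moreover have "(4 * (1 - 2 * t)) / (2 * s) * ((P t)\<^sup>2 + (u t)\<^sup>2 / Z t) + s * R' = (1 - 2 * t) * W t"
    proof -
      define y where "y = 2 * t - 1"
      define p p' U z where "p = P t" and "p' = P' t" and "U = u t" and "z = Z t"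
      have z: "z > 0" using Z[OF t] by (simp add: z_def)
      have y2: "s\<^sup>2 + y\<^sup>2 = 1" using s by (simp add: S_def y_def power2_eq_square algebra_simps)
      have zz: "z = q * s\<^sup>2 + 1" by (simp add: z_def Z_def s)
      have UU: "s\<^sup>2 * p' = y * p - U" by (simp add: U_def u_def s y_def p_def p'_def)
      \<comment> \<open>Clearing denominators turns the derivative of \<open>V\<close> into a polynomial identity modulo
        \<open>y2\<close>, \<open>zz\<close> and \<open>UU\<close>.\<close>
      have "s\<^sup>2 * z\<^sup>2 * R' = s\<^sup>2 * (2 * p * p' * z\<^sup>2 + (2 * U * ((q + 1) * p + y * p') * z + U\<^sup>2 * (4 * q * y)))"
        using z by (simp add: R'_def flip: p_def p'_def U_def z_def)
          (simp add: y_def field_simps)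
      also have "\<dots> = 2 * p * (y * p - U) * z\<^sup>2 + 2 * U * (z * p - y * U) * z + 4 * y * (z - 1) * U\<^sup>2"
        using UU zz y2 by algebra
      also have "\<dots> = 2 * y * z\<^sup>2 * p\<^sup>2 + 2 * y * z * U\<^sup>2 - 4 * y * U\<^sup>2"
        by (simp add: algebra_simps power2_eq_square)
      finally have R: "s\<^sup>2 * z\<^sup>2 * R' = 2 * y * z\<^sup>2 * p\<^sup>2 + 2 * y * z * U\<^sup>2 - 4 * y * U\<^sup>2" .
      have "s * z\<^sup>2 * ((4 * (1 - 2 * t)) / (2 * s) * (p\<^sup>2 + U\<^sup>2 / z) + s * R') =
          - 2 * y * (z\<^sup>2 * p\<^sup>2 + z * U\<^sup>2) + s\<^sup>2 * z\<^sup>2 * R'"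
        using z s(1) by (simp add: y_def field_simps power2_eq_square)
      also have "\<dots> = - 4 * y * U\<^sup>2" unfolding R by (simp add: algebra_simps)
      also have "\<dots> = s * z\<^sup>2 * ((1 - 2 * t) * W t)"
        using z s(1) by (simp add: W_def y_def flip: s_def U_def z_def)
      finally show ?thesis using z s(1) by (simp add: p_def U_def z_def)
    qed
    ultimately show ?thesis by simp
  qed
  have W: "W t \<ge> 0" if "0 < t" "t < 1" for t
    using S[OF that] by (simp add: W_def)
  have "V x \<le> V (1/2)"
  proof (cases "x \<ge> 1/2")
    case True
    show ?thesis
    proof (rule DERIV_nonpos_imp_nonincreasing[OF True])
      fix t assume "1 / 2 \<le> t" "t \<le> x"
      then show "\<exists>d. (V has_real_derivative d) (at t) \<and> d \<le> 0"
        using V'[of t] W[of t] x by (intro exI[of _ "(1 - 2 * t) * W t"]) (auto intro!: mult_nonpos_nonneg)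
    qed
  next
    case False
    show ?thesis
    proof (rule DERIV_nonneg_imp_nondecreasing[of x "1/2"])
      fix t assume "x \<le> t" "t \<le> 1 / 2"
      then show "\<exists>d. (V has_real_derivative d) (at t) \<and> 0 \<le> d"
        using V'[of t] W[of t] x by (intro exI[of _ "(1 - 2 * t) * W t"]) auto
    qed (use False in simp)
  qed
  also have "V (1/2) \<le> 2 / (real n + 1)"
  proof -
    have "V (1/2) = (P (1/2))\<^sup>2 + (P' (1/2))\<^sup>2 / (q + 1)"
      by (simp add: V_def S_def u_def Z_def)
    also have "\<dots> \<le> 1 / (real n + 1) + 1 / (real n + 1)"
      unfolding P_def P'_def q_def by (intro add_mono legendre_mid legendre_mid_deriv)
    finally show ?thesis by simp
  qed
  finally have "V x \<le> 2 / (real n + 1)" .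
  moreover have "sqrt (S x) * (P x)\<^sup>2 \<le> V x"
    unfolding V_def using S[OF x] Z[OF x] by (intro mult_left_mono) auto
  moreover have "sqrt (S x) = 2 * sqrt (x * (1 - x))"
    unfolding S_def by (simp add: real_sqrt_mult)
  ultimately show ?thesis by (simp add: P_def)
qed

subsection \<open>Normalised Legendre polynomials\<close>

definition phi :: "nat \<Rightarrow> real poly" where
  "phi n = smult (sqrt (2 * real n + 1)) (legendre n)"

lemma phi_orthonormal: "pint (phi n * phi m) = of_bool (n = m)"
proof (cases "n = m")
  case True
  have "pint (phi n * phi n) = (2 * real n + 1) * pint (legendre n * legendre n)"
    by (simp add: phi_def pint_smult)
  then show ?thesis using legendre_norm[of n] True by simp
next
  case False
  then show ?thesis using legendre_orthogonal[OF False] by (simp add: phi_def pint_smult)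
qed

lemma pderiv_iter_smult: "(pderiv ^^ j) (smult c p) = smult c ((pderiv ^^ j) p)"
  by (induction j) (auto simp: pderiv_smult)

text \<open>
  The \<open>j\<close>-th derivatives are again orthogonal, for the weight \<open>w ^ j\<close>; this makes Bessel's inequality
  applicable to the weak derivatives of order \<open>j\<close>.
\<close>

lemma phi_weighted_orthonormal:
  "pint (wpoly ^ j * (pderiv ^^ j) (phi n) * (pderiv ^^ j) (phi m)) =
     (\<Prod>i<j. legendre_eig n i) * of_bool (n = m)"
  using legendre_weighted_pint[of j n m] phi_orthonormal[of n m]
  by (simp add: phi_def pderiv_iter_smult pint_smult)

lemma phi_sturm_liouville:
  "pderiv (wpoly ^ Suc j * (pderiv ^^ Suc j) (phi n)) =
     smult (- legendre_eig n j) (wpoly ^ j * (pderiv ^^ j) (phi n))"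
  using arg_cong[OF legendre_sturm_liouville[of j n], of "smult (sqrt (2 * real n + 1))"]
  unfolding phi_def pderiv_iter_smult
  by (simp only: mult_smult_right pderiv_smult smult_smult mult.commute)

lemma phi_span:
  assumes "degree p \<le> N"
  shows "\<exists>a. p = (\<Sum>k\<le>N. smult (a k) (phi k))"
proof -
  obtain a where "p = (\<Sum>k\<le>N. smult (a k) (legendre k))" using legendre_span[OF assms] by blast
  also have "\<dots> = (\<Sum>k\<le>N. smult (a k / sqrt (2 * real k + 1)) (phi k))"
  proof (intro sum.cong refl)
    fix k
    have "sqrt (2 * real k + 1) \<noteq> 0" by simp
    then show "smult (a k) (legendre k) = smult (a k / sqrt (2 * real k + 1)) (phi k)"
      by (simp add: phi_def)
  qed
  finally show ?thesis by (intro exI[of _ "\<lambda>k. a k / sqrt (2 * real k + 1)"])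
qed

lemma phi_square: "(poly (phi n) x)\<^sup>2 = (2 * real n + 1) * (poly (legendre n) x)\<^sup>2"
  by (simp add: phi_def power_mult_distrib)

lemma phi_bound:
  assumes "0 \<le> x" "x \<le> 1" shows "(poly (phi n) x)\<^sup>2 \<le> 2 * real n + 1"
  using legendre_abs_le_1[OF assms, of n] unfolding phi_square
  by (metis add_nonneg_nonneg mult.right_neutral mult_left_mono mult_nonneg_nonneg of_nat_0_le_iff zero_le_numeral zero_le_one)

lemma phi_bound_interior:
  assumes "0 < x" "x < 1" shows "(poly (phi n) x)\<^sup>2 \<le> 2 / sqrt (x * (1 - x))"
proof -
  define w where "w = sqrt (x * (1 - x))"
  have w: "w > 0" using assms by (simp add: w_def)
  have n: "real n + 1 > 0" by linarith
  have *: "w * (poly (legendre n) x)\<^sup>2 \<le> 1 / (real n + 1)"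
    using legendre_sonin[OF assms, of n] by (simp add: w_def)
  have "w * (poly (phi n) x)\<^sup>2 = (2 * real n + 1) * (w * (poly (legendre n) x)\<^sup>2)"
    by (simp add: phi_square)
  also have "\<dots> \<le> (2 * real n + 1) * (1 / (real n + 1))"
    using * by (intro mult_left_mono) auto
  also have "\<dots> \<le> 2" using n by (simp add: field_simps)
  finally have "(poly (phi n) x)\<^sup>2 \<le> 2 / w" using w by (simp add: pos_le_divide_eq mult.commute)
  then show ?thesis by (simp add: w_def)
qed

text \<open>
  The two pointwise bounds \<open>\<phi>\<^sup>2 \<le> 2 n + 1\<close> and \<open>\<phi>\<^sup>2 \<le> 2 / sqrt (t (1 - t))\<close> are interpolated with
  exponents \<open>\<delta>\<close> and \<open>2 - \<delta>\<close>. The second alone would give the non-integrable function \<open>1 / (t (1 - t))\<close>; the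
  small exponent \<open>\<delta>\<close> on the first makes a convergent Beta integral of it.
\<close>

lemma phi_fourth_moment:
  fixes \<delta> :: real
  assumes "0 < \<delta>" "\<delta> < 1"
  shows "\<exists>C>0. \<forall>n. pint (phi n ^ 4) \<le> C * (2 * real n + 1) powr \<delta>"
proof -
  \<comment> \<open>The summand 1 only ensures that \<open>C\<close> is positive.\<close>
  define C where "C = 2 powr (2 - \<delta>) * \<bar>Beta (\<delta>/2) (\<delta>/2)\<bar> + 1"
  have "pint (phi n ^ 4) \<le> C * (2 * real n + 1) powr \<delta>" for n
  proof -
    define A where "A = 2 * real n + 1"
    have A: "A \<ge> 1" by (simp add: A_def)
    have "set_integrable lborel {0..1} (poly (phi n ^ 4))"
      by (intro borel_integrable_atLeastAtMost' continuous_intros)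
    note * = set_borel_integral_eq_integral[OF this]
    have "pint (phi n ^ 4) = integral {0..1} (poly (phi n ^ 4))"
      using *(2) by (simp add: pint_def unit_interval_def integral_restrict_space set_lebesgue_integral_def del: poly_power)
    with *(1) have 1: "(poly (phi n ^ 4) has_integral pint (phi n ^ 4)) {0<..<1}"
      unfolding has_integral_Icc_iff_Ioo[symmetric] by (simp add: has_integral_iff)
    have "((\<lambda>t. t powr (\<delta>/2 - 1) * (1 - t) powr (\<delta>/2 - 1)) has_integral Beta (\<delta>/2) (\<delta>/2)) {0<..<1}"
      unfolding has_integral_Icc_iff_Ioo[symmetric] using assms by (intro has_integral_Beta_real) auto
    then have 2: "((\<lambda>t. (2 powr (2 - \<delta>) * A powr \<delta>) * (t powr (\<delta>/2 - 1) * (1 - t) powr (\<delta>/2 - 1)))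
         has_integral (2 powr (2 - \<delta>) * A powr \<delta>) * Beta (\<delta>/2) (\<delta>/2)) {0<..<1}"
      by (rule has_integral_mult_right)
    have "pint (phi n ^ 4) \<le> (2 powr (2 - \<delta>) * A powr \<delta>) * Beta (\<delta>/2) (\<delta>/2)"
    proof (rule has_integral_le[OF 1 2])
      fix t :: real assume t: "t \<in> {0<..<1}"
      define y where "y = (poly (phi n) t)\<^sup>2"
      define w where "w = t * (1 - t)"
      have w: "w > 0" using t by (simp add: w_def)
      have y: "0 \<le> y" "y \<le> A" "y \<le> 2 / sqrt w"
        using phi_bound[of t n] phi_bound_interior[of t n] t by (auto simp: y_def A_def w_def)
      have "poly (phi n ^ 4) t = y\<^sup>2" by (simp add: y_def)
      also have "y\<^sup>2 \<le> 2 powr (2 - \<delta>) * A powr \<delta> * w powr (\<delta>/2 - 1)"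
      proof (cases "y = 0")
        case False
        then have y0: "y > 0" using y by simp
        have "y\<^sup>2 = y powr (2 - \<delta>) * y powr \<delta>"
          using y0 powr_add[of y "2 - \<delta>" \<delta>] by (simp add: powr_numeral)
        also have "\<dots> \<le> (2 / sqrt w) powr (2 - \<delta>) * A powr \<delta>"
          using y assms by (intro mult_mono powr_mono2) auto
        also have "(2 / sqrt w) powr (2 - \<delta>) = 2 powr (2 - \<delta>) * w powr (\<delta>/2 - 1)"
        proof -
          have e: "1 / 2 * (2 - \<delta>) = - (\<delta>/2 - 1)" by (simp add: field_simps)
          have "(sqrt w) powr (2 - \<delta>) = w powr (1 / 2 * (2 - \<delta>))"
            unfolding powr_half_sqrt[OF less_imp_le[OF w], symmetric] powr_powr ..
          also have "\<dots> = inverse (w powr (\<delta>/2 - 1))"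
            unfolding e by (rule powr_minus)
          finally have "(sqrt w) powr (2 - \<delta>) = inverse (w powr (\<delta>/2 - 1))" .
          moreover have "(2 / sqrt w) powr (2 - \<delta>) = 2 powr (2 - \<delta>) / (sqrt w) powr (2 - \<delta>)"
            by (rule powr_divide)
          ultimately show ?thesis by (simp only: divide_inverse inverse_inverse_eq)
        qed
        finally show ?thesis by (simp add: mult_ac)
      qed simp
      also have "w powr (\<delta>/2 - 1) = t powr (\<delta>/2 - 1) * (1 - t) powr (\<delta>/2 - 1)"
        using t by (simp add: w_def powr_mult)
      finally show "poly (phi n ^ 4) t \<le> (2 powr (2 - \<delta>) * A powr \<delta>) * (t powr (\<delta>/2 - 1) * (1 - t) powr (\<delta>/2 - 1))" .
    qed
    also have "\<dots> = 2 powr (2 - \<delta>) * Beta (\<delta>/2) (\<delta>/2) * A powr \<delta>" by simp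
    also have "\<dots> \<le> C * A powr \<delta>"
    proof (rule mult_right_mono)
      show "2 powr (2 - \<delta>) * Beta (\<delta>/2) (\<delta>/2) \<le> C"
        using mult_left_mono[OF abs_ge_self[of "Beta (\<delta>/2) (\<delta>/2)"], of "2 powr (2 - \<delta>)", OF powr_ge_zero]
        unfolding C_def by linarith
    qed simp
    finally show ?thesis by (simp add: A_def)
  qed
  moreover have "C > 0" unfolding C_def by (intro add_nonneg_pos) auto
  ultimately show ?thesis by blast
qed

section \<open>Tensor products on the cube\<close>

definition tensor :: "('d::finite \<Rightarrow> real \<Rightarrow> real) \<Rightarrow> real ^ 'd \<Rightarrow> real" where
  "tensor g x = (\<Prod>i\<in>UNIV. g i (x $ i))"

lemma lborel_tensor:
  fixes g :: "'d::finite \<Rightarrow> real \<Rightarrow> real"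
  assumes "\<And>i. integrable lborel (g i)"
  shows "integrable lborel (tensor g)"
    and "(LINT x|lborel. tensor g x) = (\<Prod>i\<in>UNIV. LINT t|lborel. g i t)"
proof -
  interpret product_sigma_finite "\<lambda>_::real ^ 'd. lborel :: real measure"
    by standard
  define H where "H = (\<lambda>b :: real ^ 'd. g (SOME i. axis i 1 = b))"
  have inj: "inj (\<lambda>i::'d. axis i (1::real))" by (auto simp: inj_def axis_eq_axis)
  have B: "(Basis :: (real ^ 'd) set) = range (\<lambda>i. axis i 1)"
    by (auto simp: Basis_vec_def)
  have H: "H (axis i 1) = g i" for i
  proof -
    have "(SOME j. axis j (1::real) = axis i 1) = i"
      by (rule some_equality) (auto simp: axis_eq_axis)
    then show ?thesis by (simp add: H_def)
  qed
  have [measurable]: "g i \<in> borel_measurable borel" for i using borel_measurable_integrable[OF assms[of i]] by simp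
  have comp: "(\<Sum>b\<in>Basis. f b *\<^sub>R b) $ i = f (axis i 1)" for f :: "real ^ 'd \<Rightarrow> real" and i
  proof -
    have "(\<Sum>b\<in>Basis. f b *\<^sub>R b) $ i = (\<Sum>b\<in>Basis. f b *\<^sub>R b) \<bullet> axis i 1"
      by (simp add: cart_eq_inner_axis)
    also have "\<dots> = f (axis i 1)"
      by (rule inner_sum_left_Basis) (simp add: B)
    finally show ?thesis .
  qed
  have eq: "tensor g (\<Sum>b\<in>Basis. f b *\<^sub>R b) = (\<Prod>b\<in>Basis. H b (f b))" for f
    unfolding tensor_def comp unfolding B using inj by (subst prod.reindex) (auto simp: H)
  have m: "tensor g \<in> borel_measurable borel" unfolding tensor_def by measurable
  have int: "integrable lborel (H b)" if "b \<in> Basis" for b using that by (auto simp: B H assms)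
  have m2: "(\<lambda>f. \<Sum>b\<in>Basis. f b *\<^sub>R b) \<in> measurable (\<Pi>\<^sub>M b\<in>(Basis :: (real ^ 'd) set). lborel) borel"
    by measurable
  have "integrable (\<Pi>\<^sub>M b\<in>Basis. lborel) (\<lambda>f. \<Prod>b\<in>Basis. H b (f b))"
    by (rule product_integrable_prod) (auto intro: int)
  then have "integrable (\<Pi>\<^sub>M b\<in>Basis. lborel) (\<lambda>f. tensor g (\<Sum>b\<in>Basis. f b *\<^sub>R b))"
    unfolding eq .
  then show "integrable lborel (tensor g)"
    by (subst lborel_eq) (subst integrable_distr_eq, auto simp: m m2)
  have "(LINT x|lborel. tensor g x) = (LINT f|(\<Pi>\<^sub>M b\<in>Basis. lborel). tensor g (\<Sum>b\<in>Basis. f b *\<^sub>R b))"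
    by (subst lborel_eq) (subst integral_distr, auto simp: m m2)
  also have "\<dots> = (\<Prod>b\<in>Basis. LINT t|lborel. H b t)"
    unfolding eq by (rule product_integral_prod) (auto intro: int)
  also have "\<dots> = (\<Prod>i\<in>UNIV. LINT t|lborel. g i t)"
    unfolding B using inj by (subst prod.reindex) (auto simp: H)
  finally show "(LINT x|lborel. tensor g x) = (\<Prod>i\<in>UNIV. LINT t|lborel. g i t)" .
qed

lemma unit_cube_borel [measurable, simp]: "unit_cube \<in> sets borel"
  by (simp add: unit_cube_eq_cbox)

lemma space_cube [simp]: "space cube_lborel = unit_cube"
  by (simp add: cube_lborel_def space_restrict_space)

lemma integral_cube:
  "(LINT x|cube_lborel. f x) = (LINT x|lborel. indicator unit_cube x * f x)" for f :: "_ \<Rightarrow> real"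
  unfolding cube_lborel_def by (subst integral_restrict_space) (auto simp: mult.commute)

lemma integrable_cube:
  "integrable cube_lborel f \<longleftrightarrow> integrable lborel (\<lambda>x. indicator unit_cube x * f x)" for f :: "_ \<Rightarrow> real"
  unfolding cube_lborel_def by (subst integrable_restrict_space) (auto simp: mult.commute)

lemma prob_space_cube: "prob_space (cube_lborel :: (real ^ 'd::finite) measure)"
proof
  have "emeasure (cube_lborel :: (real ^ 'd) measure) unit_cube = emeasure lborel (cbox 0 (1 :: real ^ 'd))"
    unfolding cube_lborel_def unit_cube_eq_cbox by (subst emeasure_restrict_space) auto
  also have "\<dots> = 1"
  proof -
    have "(1 :: real ^ 'd) \<bullet> b = 1" if "b \<in> Basis" for b
      using that by (auto simp: Basis_vec_def inner_axis)
    then show ?thesis by (simp add: emeasure_lborel_cbox_eq)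
  qed
  finally show "emeasure (cube_lborel :: (real ^ 'd) measure) (space cube_lborel) = 1" by simp
qed

lemma borel_measurable_cube: "f \<in> borel_measurable borel \<Longrightarrow> f \<in> borel_measurable cube_lborel"
  unfolding cube_lborel_def by (intro measurable_restrict_space1) simp

lemma cube_tensor:
  fixes g :: "'d::finite \<Rightarrow> real \<Rightarrow> real"
  assumes "\<And>i. integrable unit_interval (g i)"
  shows "integrable cube_lborel (tensor g)"
    and "(LINT x|cube_lborel. tensor g x) = (\<Prod>i\<in>UNIV. LINT t|unit_interval. g i t)"
proof -
  define h where "h = (\<lambda>i t. indicator {0..1} t * g i t)"
  have *: "integrable lborel (h i)" for i
    using assms[of i] by (simp add: h_def unit_interval_def integrable_restrict_space)
  have ind: "indicator unit_cube x = (\<Prod>i\<in>(UNIV::'d set). indicator {0..1} (x $ i) :: real)" for x :: "real ^ 'd"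
  proof (cases "x \<in> unit_cube")
    case True
    then show ?thesis by (auto simp: unit_cube_def)
  next
    case False
    then obtain i where "x $ i \<notin> {0..1}" by (auto simp: unit_cube_def)
    then have "(\<Prod>i\<in>(UNIV::'d set). indicator {0..1} (x $ i) :: real) = 0"
      by (intro prod_zero bexI[of _ i]) auto
    with False show ?thesis by simp
  qed
  have eq: "(\<lambda>x. indicator unit_cube x * tensor g x) = tensor h"
    by (rule ext) (simp add: ind tensor_def h_def prod.distrib)
  show "integrable cube_lborel (tensor g)"
    unfolding integrable_cube eq by (rule lborel_tensor[OF *])
  show "(LINT x|cube_lborel. tensor g x) = (\<Prod>i\<in>UNIV. LINT t|unit_interval. g i t)"
    unfolding integral_cube eq lborel_tensor(2)[OF *]
    by (simp add: h_def unit_interval_def integral_restrict_space)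
qed

text \<open>The multi-index \<open>k\<close> lists the degrees in the coordinates.\<close>

definition legendre_basis :: "('d::finite \<Rightarrow> nat) \<Rightarrow> real ^ 'd \<Rightarrow> real" where
  "legendre_basis k = tensor (\<lambda>i. poly (phi (k i)))"

lemma tensor_mult: "tensor g x * tensor h x = tensor (\<lambda>i t. g i t * h i t) x"
  by (simp add: tensor_def prod.distrib)

lemma tensor_measurable:
  assumes "\<And>i. g i \<in> borel_measurable borel" shows "tensor g \<in> borel_measurable borel"
  unfolding tensor_def
  by (intro borel_measurable_prod measurable_compose[OF _ assms]) measurable

lemma legendre_basis_measurable [measurable]: "legendre_basis k \<in> borel_measurable cube_lborel"
  unfolding legendre_basis_def
  by (intro borel_measurable_cube tensor_measurable borel_measurable_continuous_onI continuous_intros)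

lemma cube_tensor_poly:
  "integrable cube_lborel (tensor (\<lambda>i. poly (p i)))"
  "(LINT x|cube_lborel. tensor (\<lambda>i. poly (p i)) x) = (\<Prod>i\<in>UNIV. pint (p i))"
  using cube_tensor[of "\<lambda>i. poly (p i)"] by (auto simp: pint_def)

lemma tensor_poly_mult: "tensor (\<lambda>i. poly (p i)) x * tensor (\<lambda>i. poly (q i)) x = tensor (\<lambda>i. poly (p i * q i)) x"
  by (simp add: tensor_def prod.distrib)

lemma sqint_tensor_poly: "sqint cube_lborel (tensor (\<lambda>i. poly (p i)))"
proof -
  have "(\<lambda>x. (tensor (\<lambda>i. poly (p i)) x)\<^sup>2) = tensor (\<lambda>i. poly (p i * p i))"
    by (rule ext) (simp add: power2_eq_square tensor_poly_mult)
  moreover have "tensor (\<lambda>i. poly (p i)) \<in> borel_measurable cube_lborel"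
    by (intro borel_measurable_cube tensor_measurable borel_measurable_continuous_onI continuous_intros)
  ultimately show ?thesis using cube_tensor_poly(1)[of "\<lambda>i. p i * p i"] unfolding sqint_def by simp
qed

lemma orthonormal_legendre_basis: "orthonormal cube_lborel legendre_basis S"
  unfolding orthonormal_def legendre_basis_def tensor_poly_mult cube_tensor_poly phi_orthonormal
  by (auto simp: sqint_tensor_poly fun_eq_iff)

section \<open>Smooth functions of one variable\<close>

text \<open>
  The derivative is existentially quantified at each step, so that closure under arithmetic follows by
  induction on the order, without formulas for the iterated derivatives.
\<close>

fun diff_times :: "nat \<Rightarrow> (real \<Rightarrow> real) \<Rightarrow> bool" where
  "diff_times 0 f \<longleftrightarrow> True"
| "diff_times (Suc n) f \<longleftrightarrow> (\<exists>f'. (\<forall>x. (f has_real_derivative f' x) (at x)) \<and> diff_times n f')"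

definition smooth1 :: "(real \<Rightarrow> real) \<Rightarrow> bool" where
  "smooth1 f \<longleftrightarrow> (\<forall>n. diff_times n f)"

lemma diff_times_Suc_D: "diff_times (Suc n) f \<Longrightarrow> diff_times n f"
proof (induction n arbitrary: f)
  case (Suc n)
  then obtain f' where "\<forall>x. (f has_real_derivative f' x) (at x)" "diff_times (Suc n) f'" by auto
  with Suc.IH[of f'] show ?case by auto
qed simp

lemma smooth1_deriv:
  assumes "smooth1 f"
  shows "(f has_real_derivative deriv f x) (at x)" "smooth1 (deriv f)"
proof -
  have *: "\<exists>f'. (\<forall>x. (f has_real_derivative f' x) (at x)) \<and> diff_times n f'" for n
    using assms[unfolded smooth1_def, rule_format, of "Suc n"] by simp
  then obtain f' where f': "\<forall>x. (f has_real_derivative f' x) (at x)" by blast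
  then have d: "deriv f = f'" by (auto simp: DERIV_imp_deriv)
  then show "(f has_real_derivative deriv f x) (at x)" using f' by simp
  show "smooth1 (deriv f)" unfolding smooth1_def
  proof
    fix n
    obtain g where g: "\<forall>x. (f has_real_derivative g x) (at x)" "diff_times n g" using * by blast
    then have "deriv f = g" by (auto simp: DERIV_imp_deriv)
    then show "diff_times n (deriv f)" using g by simp
  qed
qed

lemma smooth1_iter_deriv: "smooth1 f \<Longrightarrow> smooth1 ((deriv ^^ n) f)"
  by (induction n) (auto intro: smooth1_deriv)

lemma smooth1_continuous: "smooth1 f \<Longrightarrow> continuous_on A f"
  by (meson DERIV_isCont continuous_at_imp_continuous_on smooth1_deriv(1))

lemma diff_times_add: "diff_times n f \<Longrightarrow> diff_times n g \<Longrightarrow> diff_times n (\<lambda>x. f x + g x)"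
proof (induction n arbitrary: f g)
  case (Suc n)
  then obtain f' g' where *: "\<forall>x. (f has_real_derivative f' x) (at x)" "diff_times n f'"
     "\<forall>x. (g has_real_derivative g' x) (at x)" "diff_times n g'" by auto
  then have "\<forall>x. ((\<lambda>x. f x + g x) has_real_derivative f' x + g' x) (at x)"
    by (auto intro: DERIV_add)
  with Suc.IH[OF *(2,4)] show ?case unfolding diff_times.simps by (intro exI[of _ "\<lambda>x. f' x + g' x"] conjI)
qed simp

lemma diff_times_mult: "diff_times n f \<Longrightarrow> diff_times n g \<Longrightarrow> diff_times n (\<lambda>x. f x * g x)"
proof (induction n arbitrary: f g)
  case (Suc n)
  then obtain f' g' where *: "\<forall>x. (f has_real_derivative f' x) (at x)" "diff_times n f'"
     "\<forall>x. (g has_real_derivative g' x) (at x)" "diff_times n g'" by auto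
  then have "\<forall>x. ((\<lambda>x. f x * g x) has_real_derivative f' x * g x + g' x * f x) (at x)"
    by (auto intro: DERIV_mult)
  moreover have "diff_times n (\<lambda>x. f' x * g x + g' x * f x)"
    using Suc.prems *(2,4) by (intro diff_times_add Suc.IH diff_times_Suc_D[of n f] diff_times_Suc_D[of n g])
  ultimately show ?case unfolding diff_times.simps by (intro exI[of _ "\<lambda>x. f' x * g x + g' x * f x"] conjI)
qed simp

lemma diff_times_const: "diff_times n (\<lambda>x. c)"
proof (induction n arbitrary: c)
  case (Suc n)
  have "\<forall>x. ((\<lambda>x. c) has_real_derivative 0) (at x)" by auto
  with Suc[of 0] show ?case unfolding diff_times.simps by (intro exI[of _ "\<lambda>x. 0"]) blast
qed simp

lemma diff_times_affine: "diff_times n f \<Longrightarrow> diff_times n (\<lambda>x. f (a * x + b))"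
proof (induction n arbitrary: f)
  case (Suc n)
  then obtain f' where *: "\<forall>x. (f has_real_derivative f' x) (at x)" "diff_times n f'" by auto
  have "((\<lambda>x. f (a * x + b)) has_real_derivative a * f' (a * x + b)) (at x)" for x
  proof -
    have 1: "((\<lambda>x. a * x + b) has_real_derivative a) (at x)"
      by (auto intro!: derivative_eq_intros)
    show ?thesis using DERIV_chain2[OF *(1)[rule_format] 1] by (simp only: mult.commute)
  qed
  moreover have "diff_times n (\<lambda>x. a * f' (a * x + b))"
    using Suc.IH[OF *(2)] by (intro diff_times_mult diff_times_const)
  ultimately show ?case unfolding diff_times.simps by (intro exI[of _ "\<lambda>x. a * f' (a * x + b)"]) blast
qed simp

lemma diff_times_divide:
  "diff_times n f \<Longrightarrow> diff_times n g \<Longrightarrow> (\<And>x. g x > 0) \<Longrightarrow> diff_times n (\<lambda>x. f x / g x)"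
proof (induction n arbitrary: f g)
  case (Suc n)
  then obtain f' g' where *: "\<forall>x. (f has_real_derivative f' x) (at x)" "diff_times n f'"
     "\<forall>x. (g has_real_derivative g' x) (at x)" "diff_times n g'" by auto
  have "g x \<noteq> 0" for x using Suc.prems(3)[of x] by simp
  then have "\<forall>x. ((\<lambda>x. f x / g x) has_real_derivative (f' x * g x + (-1) * (f x * g' x)) / (g x * g x)) (at x)"
    using * DERIV_divide[of f _ _ UNIV g] by simp
  moreover have "diff_times n (\<lambda>x. (f' x * g x + (-1) * (f x * g' x)) / (g x * g x))"
  proof (rule Suc.IH)
    note d = diff_times_Suc_D[OF Suc.prems(1)] diff_times_Suc_D[OF Suc.prems(2)]
    show "diff_times n (\<lambda>x. f' x * g x + (-1) * (f x * g' x))"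
      by (intro diff_times_add diff_times_mult diff_times_const d *(2,4))
    show "diff_times n (\<lambda>x. g x * g x)" by (intro diff_times_mult d)
    show "g x * g x > 0" for x using Suc.prems(3)[of x] by simp
  qed
  ultimately show ?case unfolding diff_times.simps
    by (intro exI[of _ "\<lambda>x. (f' x * g x + (-1) * (f x * g' x)) / (g x * g x)"] conjI)
qed simp

lemma smooth1_add: "smooth1 f \<Longrightarrow> smooth1 g \<Longrightarrow> smooth1 (\<lambda>x. f x + g x)"
  and smooth1_mult: "smooth1 f \<Longrightarrow> smooth1 g \<Longrightarrow> smooth1 (\<lambda>x. f x * g x)"
  and smooth1_const: "smooth1 (\<lambda>x. c)"
  and smooth1_affine: "smooth1 f \<Longrightarrow> smooth1 (\<lambda>x. f (a * x + b))"
  and smooth1_divide: "smooth1 f \<Longrightarrow> smooth1 g \<Longrightarrow> (\<And>x. g x > 0) \<Longrightarrow> smooth1 (\<lambda>x. f x / g x)"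
  by (simp_all add: smooth1_def diff_times_add diff_times_mult diff_times_const diff_times_affine diff_times_divide)

lemma smooth1_poly: "smooth1 (poly p)"
proof -
  have "diff_times n (poly p)" for n
  proof (induction n arbitrary: p)
    case (Suc n)
    then show ?case unfolding diff_times.simps
      by (intro exI[of _ "poly (pderiv p)"] conjI allI poly_DERIV)
  qed simp
  then show ?thesis by (simp add: smooth1_def)
qed

lemma poly_times_exp_tendsto_0: "((\<lambda>y. y ^ k * poly p y / exp y) \<longlongrightarrow> 0) at_top" for p :: "real poly"
proof (induction p arbitrary: k rule: pCons_induct)
  case (pCons a p)
  have "((\<lambda>y. a * (y ^ k / exp y) + y ^ Suc k * poly p y / exp y) \<longlongrightarrow> a * 0 + 0) at_top"
    by (intro tendsto_intros tendsto_power_div_exp_0 pCons.IH)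
  also have "(\<lambda>y. a * (y ^ k / exp y) + y ^ Suc k * poly p y / exp y) = (\<lambda>y. y ^ k * poly (pCons a p) y / exp y)"
    by (rule ext) (simp add: add_divide_distrib algebra_simps)
  finally show ?case by simp
qed simp

text \<open>
  The functions \<open>p (1 / x) exp (- 1 / x)\<close> on the positive half-line, extended by zero. With arbitrary
  polynomials \<open>p\<close> they are closed under differentiation, which makes all of them smooth.
\<close>

definition flat_exp :: "real poly \<Rightarrow> real \<Rightarrow> real" where
  "flat_exp p x = (if x > 0 then poly p (1 / x) * exp (- (1 / x)) else 0)"

lemma flat_exp_deriv:
  "(flat_exp p has_real_derivative flat_exp ([:0,0,1:] * (p - pderiv p)) x) (at x)"
proof -
  consider "x < 0" | "x > 0" | "x = 0" by linarith
  then show ?thesis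
  proof cases
    case 1
    have "((\<lambda>x. 0) has_real_derivative 0) (at x)" by simp
    then have "(flat_exp p has_real_derivative 0) (at x)"
      by (rule has_field_derivative_transform_within_open[where S="{..<0}"]) (use 1 in \<open>auto simp: flat_exp_def\<close>)
    with 1 show ?thesis by (simp add: flat_exp_def)
  next
    case 2
    have d: "((\<lambda>x. poly p (1 / x)) has_real_derivative poly (pderiv p) (1 / x) * (- (1 / x\<^sup>2))) (at x)"
      by (rule DERIV_chain2[OF poly_DERIV]) (use 2 in \<open>auto intro!: derivative_eq_intros simp: power2_eq_square divide_simps\<close>)
    have e: "((\<lambda>x. exp (- (1 / x))) has_real_derivative exp (- (1 / x)) * (1 / x\<^sup>2)) (at x)"
    proof (rule DERIV_chain2[OF DERIV_exp])
      show "((\<lambda>x. - (1 / x)) has_real_derivative 1 / x\<^sup>2) (at x)"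
        by (rule derivative_eq_intros refl | use 2 in \<open>simp add: power2_eq_square\<close>)+
    qed
    have "((\<lambda>x. poly p (1 / x) * exp (- (1 / x))) has_real_derivative
        flat_exp ([:0,0,1:] * (p - pderiv p)) x) (at x)"
      using DERIV_mult[OF d e] 2
      by (simp add: flat_exp_def algebra_simps power2_eq_square)
    then show ?thesis
      by (rule has_field_derivative_transform_within_open[where S="{0<..}"]) (use 2 in \<open>auto simp: flat_exp_def\<close>)
  next
    case 3
    have "((\<lambda>h. (inverse h) ^ 1 * poly p (inverse h) / exp (inverse h)) \<longlongrightarrow> 0) (at_right 0)"
      by (rule filterlim_compose[OF poly_times_exp_tendsto_0 filterlim_inverse_at_top_right])
    then have "((\<lambda>h. (flat_exp p (0 + h) - flat_exp p 0) / h) \<longlongrightarrow> 0) (at_right 0)"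
      by (rule Lim_transform_eventually)
         (auto simp: eventually_at_right_less flat_exp_def exp_minus field_simps intro!: eventually_at_rightI[of 0 1])
    moreover have "((\<lambda>h. (flat_exp p (0 + h) - flat_exp p 0) / h) \<longlongrightarrow> 0) (at_left 0)"
      by (rule Lim_transform_eventually[OF tendsto_const])
         (auto simp: flat_exp_def intro!: eventually_at_leftI[of "-1" 0])
    ultimately have "((\<lambda>h. (flat_exp p (0 + h) - flat_exp p 0) / h) \<longlongrightarrow> 0) (at 0)"
      using filterlim_split_at_real by blast
    then show ?thesis using 3 by (simp add: DERIV_def flat_exp_def)
  qed
qed

lemma smooth1_flat_exp: "smooth1 (flat_exp p)"
proof -
  have "diff_times n (flat_exp p)" for n
  proof (induction n arbitrary: p)
    case (Suc n)
    then show ?case unfolding diff_times.simps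
      by (intro exI[of _ "flat_exp ([:0,0,1:] * (p - pderiv p))"] conjI allI flat_exp_deriv)
  qed simp
  then show ?thesis by (simp add: smooth1_def)
qed

definition smooth_step :: "real \<Rightarrow> real" where
  "smooth_step x = flat_exp 1 x / (flat_exp 1 x + flat_exp 1 (1 - x))"

lemma smooth1_smooth_step: "smooth1 smooth_step"
proof -
  have "flat_exp 1 x + flat_exp 1 ((-1) * x + 1) > 0" for x
    by (cases "x > 0") (auto simp: flat_exp_def intro: add_pos_nonneg)
  then have "smooth1 (\<lambda>x. flat_exp 1 x / (flat_exp 1 x + flat_exp 1 ((-1) * x + 1)))"
    by (intro smooth1_divide smooth1_add smooth1_affine smooth1_flat_exp) auto
  then show ?thesis by (simp add: smooth_step_def[abs_def])
qed

lemma smooth_step_simps: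
  "x \<le> 0 \<Longrightarrow> smooth_step x = 0" "x \<ge> 1 \<Longrightarrow> smooth_step x = 1"
  "0 \<le> smooth_step x" "smooth_step x \<le> 1"
proof -
  have "flat_exp 1 y \<ge> 0" for y by (simp add: flat_exp_def)
  note 1 = this[of x] and 2 = this[of "1 - x"]
  show "0 \<le> smooth_step x" unfolding smooth_step_def using 1 2 by simp
  show "smooth_step x \<le> 1" unfolding smooth_step_def divide_le_eq_1 using 1 2 by linarith
qed (auto simp: smooth_step_def flat_exp_def)

text \<open>
  Vanishes outside \<open>(a, b)\<close> and equals 1 at distance at least \<open>1 / N\<close> from the complement of \<open>(a, b)\<close>.
\<close>

definition cutoff :: "real \<Rightarrow> real \<Rightarrow> real \<Rightarrow> real \<Rightarrow> real" where
  "cutoff N a b x = smooth_step (N * (x - a)) * smooth_step (N * (b - x))"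

lemma smooth1_cutoff: "smooth1 (cutoff N a b)"
proof -
  have "smooth1 (\<lambda>x. smooth_step (N * x + (- N * a)) * smooth_step ((- N) * x + N * b))"
    by (intro smooth1_mult smooth1_affine smooth1_smooth_step)
  then show ?thesis by (simp add: cutoff_def[abs_def] algebra_simps)
qed

lemma cutoff_bounds: "0 \<le> cutoff N a b x" "cutoff N a b x \<le> 1"
  by (auto simp: cutoff_def smooth_step_simps mult_le_one)

lemma cutoff_zero: "N \<ge> 0 \<Longrightarrow> x \<le> a \<or> b \<le> x \<Longrightarrow> cutoff N a b x = 0"
  by (auto simp: cutoff_def smooth_step_simps mult_nonneg_nonpos)

lemma cutoff_one: "N * (x - a) \<ge> 1 \<Longrightarrow> N * (b - x) \<ge> 1 \<Longrightarrow> cutoff N a b x = 1"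
  by (auto simp: cutoff_def smooth_step_simps)

lemma smooth_step_deriv_zero: "x < 0 \<or> x > 1 \<Longrightarrow> deriv smooth_step x = 0"
proof (rule DERIV_imp_deriv)
  have c: "((\<lambda>_. c :: real) has_real_derivative 0) (at x)" for c by simp
  assume "x < 0 \<or> x > 1"
  then show "(smooth_step has_real_derivative 0) (at x)"
  proof
    assume "x < 0"
    then show ?thesis
      by (intro has_field_derivative_transform_within_open[OF c[of 0], of "{..<0}"])
         (auto simp: smooth_step_simps)
  next
    assume "x > 1"
    then show ?thesis
      by (intro has_field_derivative_transform_within_open[OF c[of 1], of "{1<..}"])
         (auto simp: smooth_step_simps)
  qed
qed

text \<open>The derivative is continuous and vanishes outside a compact interval.\<close>

lemma smooth_step_deriv_bounded: "\<exists>B\<ge>0. \<forall>x. \<bar>deriv smooth_step x\<bar> \<le> B"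
proof -
  have "continuous_on {0..1} (deriv smooth_step)"
    by (intro smooth1_continuous smooth1_deriv smooth1_smooth_step)
  then have "bounded (deriv smooth_step ` {0..1})"
    by (intro compact_imp_bounded compact_continuous_image) auto
  then have "\<exists>B. \<forall>x\<in>{0..1}. \<bar>deriv smooth_step x\<bar> \<le> B"
    by (simp add: bounded_iff)
  then obtain B where B: "\<And>x. x \<in> {0..1} \<Longrightarrow> \<bar>deriv smooth_step x\<bar> \<le> B"
    by blast
  then have B0: "B \<ge> 0" using B[of 0] by force
  have "\<bar>deriv smooth_step x\<bar> \<le> B" for x
    using B[of x] B0 smooth_step_deriv_zero[of x] by (cases "x \<in> {0..1}") auto
  then show ?thesis using B0 by blast
qed

section \<open>Smooth tensor products\<close>

lemma iter_partial_tensor_aux: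
  assumes "\<And>i. smooth1 (G i)"
  shows "partial_deriv i (tensor G) = tensor (G(i := deriv (G i)))"
proof
  fix x
  define c where "c = (\<Prod>j\<in>UNIV - {i}. G j (x $ j))"
  have split: "tensor H y = H i (y $ i) * (\<Prod>j\<in>UNIV - {i}. H j (y $ j))" for H and y :: "real ^ 'a"
    unfolding tensor_def by (rule prod.remove) auto
  have eq: "tensor G (x + t *\<^sub>R axis i 1) = G i (x $ i + t) * c" for t
    unfolding split[of G] c_def by (auto intro!: arg_cong2[where f="(*)"] prod.cong simp: axis_def)
  have "((\<lambda>t. G i (x $ i + t)) has_real_derivative deriv (G i) (x $ i + 0) * 1) (at 0)"
    by (rule DERIV_chain2[OF smooth1_deriv(1)[OF assms]]) (auto intro!: derivative_eq_intros)
  then have "((\<lambda>t. G i (x $ i + t) * c) has_real_derivative deriv (G i) (x $ i) * c) (at 0)"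
    by (auto intro!: derivative_eq_intros)
  then have "partial_deriv i (tensor G) x = deriv (G i) (x $ i) * c"
    unfolding partial_deriv_def eq by (rule DERIV_imp_deriv)
  also have "\<dots> = tensor (G(i := deriv (G i))) x"
    unfolding split[of "G(i := _)"] c_def by auto
  finally show "partial_deriv i (tensor G) x = tensor (G(i := deriv (G i))) x" .
qed

lemma iter_partial_tensor:
  assumes "\<And>i. smooth1 (G i)"
  shows "iter_partial is (tensor G) = tensor (\<lambda>i. (deriv ^^ count_list is i) (G i))"
proof (induction "is")
  case (Cons a xs)
  have "iter_partial (a # xs) (tensor G) = partial_deriv a (tensor (\<lambda>i. (deriv ^^ count_list xs i) (G i)))"
    using Cons by simp
  also have "\<dots> = tensor ((\<lambda>i. (deriv ^^ count_list xs i) (G i))(a := deriv ((deriv ^^ count_list xs a) (G a))))"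
    by (rule iter_partial_tensor_aux) (intro smooth1_iter_deriv assms)
  also have "(\<lambda>i. (deriv ^^ count_list xs i) (G i))(a := deriv ((deriv ^^ count_list xs a) (G a))) =
      (\<lambda>i. (deriv ^^ count_list (a # xs) i) (G i))"
    by (auto simp: fun_eq_iff)
  finally show ?case .
qed (simp add: tensor_def)

text \<open>
  On tensor products derivatives in distinct coordinates act on distinct factors, so that the order of
  differentiation chosen in the definition of \<open>multi_deriv\<close> does not matter.
\<close>

lemma multi_deriv_tensor:
  assumes "\<And>i. smooth1 (G i)"
  shows "multi_deriv \<gamma> (tensor G) = tensor (\<lambda>i. (deriv ^^ \<gamma> i) (G i))"
proof -
  have "\<forall>i. count_list (SOME is. \<forall>i. count_list is i = \<gamma> i) i = \<gamma> i"
    by (rule someI_ex[OF ex_list_multi_index])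
  then show ?thesis unfolding multi_deriv_def iter_partial_tensor[OF assms] by simp
qed

lemma tensor_differentiable:
  assumes "\<And>i. smooth1 (G i)" shows "tensor G differentiable (at x)"
proof -
  have d: "(\<lambda>x. G i (x $ i)) differentiable (at x)" for i
  proof -
    have "(G i has_derivative (*) (deriv (G i) (x $ i))) (at (x $ i))"
      using smooth1_deriv(1)[OF assms] by (simp add: has_field_derivative_def)
    then have "((\<lambda>x. G i (x $ i)) has_derivative (\<lambda>h. deriv (G i) (x $ i) * (h $ i))) (at x)"
      by (rule has_derivative_compose[rotated]) (intro bounded_linear_imp_has_derivative bounded_linear_vec_nth)
    then show ?thesis by (auto simp: differentiable_def)
  qed
  have "(\<lambda>x. \<Prod>i\<in>S. G i (x $ i)) differentiable (at x)" if "finite S" for S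
    using that by (induction S rule: finite_induct) (auto intro!: differentiable_mult d)
  then show ?thesis unfolding tensor_def[abs_def] by simp
qed

lemma smooth_tensor: "(\<And>i. smooth1 (G i)) \<Longrightarrow> smooth (tensor G)"
  unfolding smooth_def by (auto simp: iter_partial_tensor intro!: tensor_differentiable smooth1_iter_deriv)

lemma interior_unit_cube: "interior unit_cube = {x :: real ^ 'd::finite. \<forall>i. 0 < x $ i \<and> x $ i < 1}"
  unfolding unit_cube_eq_cbox interior_cbox by (auto simp: mem_box_cart)

lemma test_function_tensor:
  fixes G :: "'d::finite \<Rightarrow> real \<Rightarrow> real"
  assumes "\<And>i. smooth1 (G i)"
    and "\<And>i. 0 < a i" "\<And>i. b i < 1" "\<And>i t. t \<le> a i \<or> b i \<le> t \<Longrightarrow> G i t = 0"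
  shows "test_function (interior unit_cube) (tensor G)"
proof -
  define A B :: "real ^ 'd" where "A = (\<chi> i. a i)" and "B = (\<chi> i. b i)"
  have "{x. tensor G x \<noteq> 0} \<subseteq> cbox A B"
  proof
    fix x assume "x \<in> {x. tensor G x \<noteq> 0}"
    then have "G i (x $ i) \<noteq> 0" for i by (auto simp: tensor_def)
    then have "a i < x $ i \<and> x $ i < b i" for i using assms(4) by (meson not_le)
    then show "x \<in> cbox A B" by (auto simp: mem_box_cart A_def B_def less_imp_le)
  qed
  then have 1: "closure {x. tensor G x \<noteq> 0} \<subseteq> cbox A B"
    by (intro closure_minimal) auto
  moreover have "cbox A B \<subseteq> interior unit_cube"
    unfolding interior_unit_cube using assms(2,3) le_less_trans less_le_trans
    by (fastforce simp: mem_box_cart A_def B_def)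
  moreover have "compact (closure {x. tensor G x \<noteq> 0})"
    using 1 by (meson bounded_cbox bounded_subset closed_closure compact_eq_bounded_closed)
  ultimately show ?thesis unfolding test_function_def using smooth_tensor[OF assms(1)] by auto
qed

section \<open>Weak derivatives tested against tensor products\<close>

lemma deriv_iter_zero_outside:
  assumes "\<And>t. t \<le> a \<or> b \<le> t \<Longrightarrow> G t = 0" "t < a \<or> b < t"
  shows "(deriv ^^ n) G t = (0::real)"
  using assms(2)
proof (induction n arbitrary: t)
  case 0
  then show ?case using assms(1)[of t] by auto
next
  case (Suc n)
  have c: "((\<lambda>_. 0 :: real) has_real_derivative 0) (at t)" by simp
  have "open ({..<a} \<union> {b<..})" "t \<in> {..<a} \<union> {b<..}" using Suc.prems by auto
  then have "((deriv ^^ n) G has_real_derivative 0) (at t)"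
    by (rule has_field_derivative_transform_within_open[OF c]) (use Suc.IH in auto)
  then show ?case by (simp add: DERIV_imp_deriv)
qed

lemma set_integral_interior_cube:
  fixes f \<phi> :: "real ^ 'd::finite \<Rightarrow> real"
  assumes "\<And>x. x \<notin> interior unit_cube \<Longrightarrow> \<phi> x = 0"
  shows "(LINT x:interior unit_cube|lborel. f x * \<phi> x) = (LINT x|cube_lborel. f x * \<phi> x)"
proof -
  have "indicator (interior unit_cube) x *\<^sub>R (f x * \<phi> x) = indicator unit_cube x * (f x * \<phi> x)" for x
    using assms[of x] interior_subset[of "unit_cube :: (real ^ 'd) set"] by (auto simp: indicator_def)
  then show ?thesis unfolding set_lebesgue_integral_def integral_cube
    by (intro Bochner_Integration.integral_cong) auto
qed

text \<open>
  Tensor products with factors supported inside the open unit interval are test functions. All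
  consequences of weak differentiability below are drawn from test functions of this kind.
\<close>

lemma weak_deriv_tensor:
  fixes G :: "'d::finite \<Rightarrow> real \<Rightarrow> real"
  assumes "weak_deriv (interior unit_cube) \<gamma> f g"
    and "\<And>i. smooth1 (G i)"
    and "\<And>i. 0 < a i" "\<And>i. b i < 1" "\<And>i t. t \<le> a i \<or> b i \<le> t \<Longrightarrow> G i t = 0"
  shows "(LINT x|cube_lborel. f x * tensor (\<lambda>i. (deriv ^^ \<gamma> i) (G i)) x) =
    (- 1) ^ multi_order \<gamma> * (LINT x|cube_lborel. g x * tensor G x)"
proof -
  have out: "tensor (\<lambda>i. (deriv ^^ \<gamma> i) (G i)) x = 0" if x: "x \<notin> interior unit_cube" for x and \<gamma> :: "'d \<Rightarrow> nat"
  proof -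
    obtain i where "x $ i \<le> 0 \<or> 1 \<le> x $ i" using x by (auto simp: interior_unit_cube not_less)
    then have "x $ i < a i \<or> b i < x $ i" using assms(3,4)[of i] by auto
    then have "(deriv ^^ \<gamma> i) (G i) (x $ i) = 0"
      by (intro deriv_iter_zero_outside[OF assms(5)])
    then show ?thesis unfolding tensor_def by (intro prod_zero) auto
  qed
  have "test_function (interior unit_cube) (tensor G)"
    by (rule test_function_tensor[OF assms(2-5)])
  then have "(LINT x:interior unit_cube|lborel. f x * multi_deriv \<gamma> (tensor G) x) =
      (- 1) ^ multi_order \<gamma> * (LINT x:interior unit_cube|lborel. g x * tensor G x)"
    using assms(1) unfolding weak_deriv_def by blast
  then show ?thesis
    unfolding multi_deriv_tensor[OF assms(2)]
    using out[of _ "\<lambda>_. 0"] out[of _ \<gamma>] by (simp add: set_integral_interior_cube)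
qed

subsection \<open>A locally integrable function is determined by its integrals against test functions\<close>

text \<open>
  Boxes form an intersection-stable generator of the Borel sets, so the integral vanishes over every
  Borel set, in particular over the sets where \<open>k\<close> is positive and where it is negative.
\<close>

lemma integrable_zero_on_boxes:
  fixes k :: "'a::euclidean_space \<Rightarrow> real"
  assumes int: "integrable lborel k" and supp: "\<And>x. x \<notin> box u v \<Longrightarrow> k x = 0"
    and zero: "\<And>a b. (LINT x|lborel. indicator (box a b) x * k x) = 0"
  shows "AE x in lborel. k x = 0"
proof -
  have m[measurable]: "k \<in> borel_measurable borel" using int by auto
  have UN: "(LINT x|lborel. k x) = 0"
  proof -
    have "(\<lambda>x. indicator (box u v) x * k x) = k" using supp by (auto simp: indicator_def fun_eq_iff)
    then show ?thesis using zero[of u v] by simp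
  qed
  have intA: "integrable lborel (\<lambda>x. indicator A x * k x)" if "A \<in> sets borel" for A
    using integrable_real_mult_indicator[of A lborel k] that int by (simp add: mult.commute)
  have "(LINT x|lborel. indicator A x * k x) = 0" if "A \<in> sets borel" for A
  proof -
    have gen: "A \<in> sets borel" if "A \<in> sigma_sets UNIV (range (\<lambda>(a,b). box a b :: 'a set))" for A
      using that unfolding borel_eq_box by (subst sets_measure_of) auto
    have "Int_stable (range (\<lambda>(a,b). box a b :: 'a set))"
      by (auto simp: Int_stable_def box_Int_box)
    moreover have "range (\<lambda>(a,b). box a b :: 'a set) \<subseteq> Pow UNIV" by auto
    moreover have "A \<in> sigma_sets UNIV (range (\<lambda>(a,b). box a b :: 'a set))"
      using that unfolding borel_eq_box by (subst (asm) sets_measure_of) auto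
    ultimately show ?thesis
    proof (induction A rule: sigma_sets_induct_disjoint)
      case (basic A)
      then show ?case using zero by auto
    next
      case empty
      then show ?case by simp
    next
      case (compl A)
      have "(LINT x|lborel. indicator (UNIV - A) x * k x) = (LINT x|lborel. k x - indicator A x * k x)"
        by (intro Bochner_Integration.integral_cong) (auto simp: indicator_def)
      also have "\<dots> = (LINT x|lborel. k x) - (LINT x|lborel. indicator A x * k x)"
        using compl gen by (intro Bochner_Integration.integral_diff int intA) auto
      finally show ?case using compl UN by simp
    next
      case (union A)
      have A: "A i \<in> sets lborel" for i using union gen by auto
      have "(LINT x:(\<Union>i. A i)|lborel. k x) = (\<Sum>i. LINT x:A i|lborel. k x)"
        using union A intA[of "\<Union>i. A i"]
        by (intro lebesgue_integral_countable_add) (auto simp: disjoint_family_on_def set_integrable_def)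
      also have "\<dots> = 0" using union by (simp add: set_lebesgue_integral_def)
      finally show ?case by (simp add: set_lebesgue_integral_def)
    qed
  qed
  note * = this
  have pos: "(LINT x|lborel. indicator {x. 0 < k x} x * k x) = 0" "(LINT x|lborel. indicator {x. k x < 0} x * k x) = 0"
    by (intro *; measurable)+
  have "(LINT x|lborel. \<bar>k x\<bar>) = (LINT x|lborel. indicator {x. 0 < k x} x * k x - indicator {x. k x < 0} x * k x)"
    by (intro Bochner_Integration.integral_cong) (auto simp: indicator_def)
  also have "\<dots> = 0" using pos by (subst Bochner_Integration.integral_diff) (auto intro!: intA)
  finally have "AE x in lborel. \<bar>k x\<bar> = 0"
    using int by (subst (asm) integral_nonneg_eq_0_iff_AE) auto
  then show ?thesis by simp
qed

lemma tensor_cutoff_tendsto: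
  fixes a b :: "'d::finite \<Rightarrow> real" and x :: "real ^ 'd"
  shows "(\<lambda>n. tensor (\<lambda>i. cutoff (real n) (a i) (b i)) x) \<longlonglongrightarrow> indicator {x. \<forall>i. a i < x $ i \<and> x $ i < b i} x"
proof (cases "\<forall>i. a i < x $ i \<and> x $ i < b i")
  case True
  have "eventually (\<lambda>n. cutoff (real n) (a i) (b i) (x $ i) = 1) sequentially" for i
  proof -
    define e where "e = min (x $ i - a i) (b i - x $ i)"
    have e: "e > 0" using True by (simp add: e_def)
    have "eventually (\<lambda>n. real n \<ge> 1 / e) sequentially"
      using filterlim_real_sequentially by (simp add: filterlim_at_top)
    then show ?thesis
    proof eventually_elim
      case (elim n)
      then have "1 \<le> real n * e" using e by (simp add: field_simps)
      moreover have "real n * e \<le> real n * (x $ i - a i)" "real n * e \<le> real n * (b i - x $ i)"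
        by (auto simp: e_def intro!: mult_left_mono)
      ultimately show ?case by (intro cutoff_one) auto
    qed
  qed
  then have "eventually (\<lambda>n. \<forall>i. cutoff (real n) (a i) (b i) (x $ i) = 1) sequentially"
    by (simp add: eventually_all_finite)
  then have "eventually (\<lambda>n. tensor (\<lambda>i. cutoff (real n) (a i) (b i)) x = 1) sequentially"
    by eventually_elim (simp add: tensor_def)
  then show ?thesis using True by (simp add: tendsto_eventually)
next
  case False
  then obtain i where "x $ i \<le> a i \<or> b i \<le> x $ i" by (auto simp: not_less)
  then have "tensor (\<lambda>i. cutoff (real n) (a i) (b i)) x = 0" for n
    unfolding tensor_def by (intro prod_zero) (auto intro!: bexI[of _ i] cutoff_zero)
  then show ?thesis using False by simp
qed

lemma tensor_bound:
  assumes "\<And>i. \<bar>G i (x $ i)\<bar> \<le> B i" shows "\<bar>tensor G x\<bar> \<le> (\<Prod>i\<in>UNIV. B i)"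
  unfolding tensor_def abs_prod using assms by (intro prod_mono) auto

lemma box_vec: "box (\<chi> i. a i) (\<chi> i. b i) = {x :: real ^ 'd::finite. \<forall>i. a i < x $ i \<and> x $ i < b i}"
  by (auto simp: mem_box_cart)

lemma cbox_vec_subset_interior:
  assumes "\<And>i. 0 < a i" "\<And>i. b i < 1"
  shows "cbox (\<chi> i. a i) (\<chi> i. b i) \<subseteq> interior (unit_cube :: (real ^ 'd::finite) set)"
proof
  fix x :: "real ^ 'd" assume x: "x \<in> cbox (\<chi> i. a i) (\<chi> i. b i)"
  have "0 < x $ i \<and> x $ i < 1" for i
  proof -
    have "a i \<le> x $ i" "x $ i \<le> b i" using x by (auto simp: mem_box_cart)
    then show ?thesis using assms[of i] by linarith
  qed
  then show "x \<in> interior unit_cube" by (simp add: interior_unit_cube)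
qed

lemma AE_not_frontier_cube: "AE x in lborel. x \<notin> frontier (unit_cube :: (real ^ 'd::finite) set)"
  unfolding unit_cube_eq_cbox frontier_cbox
proof (rule AE_not_in)
  have "emeasure lborel (cbox 0 (1 :: real ^ 'd) - box 0 1) = emeasure lborel (cbox 0 (1 :: real ^ 'd)) - emeasure lborel (box 0 (1 :: real ^ 'd))"
    using emeasure_lborel_box_finite[of 0 "1 :: real ^ 'd"] by (intro emeasure_Diff box_subset_cbox) auto
  also have "\<dots> = 0" by (simp add: emeasure_lborel_cbox_eq emeasure_lborel_box_eq)
  finally show "cbox 0 (1 :: real ^ 'd) - box 0 1 \<in> null_sets lborel" by (simp add: null_sets_def)
qed

lemma AE_interior_cube: "AE x in cube_lborel. x \<in> interior (unit_cube :: (real ^ 'd::finite) set)"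
proof -
  have "AE x in lborel. x \<in> unit_cube \<longrightarrow> x \<in> interior (unit_cube :: (real ^ 'd) set)"
    using AE_not_frontier_cube by eventually_elim (auto simp: frontier_def closure_subset[THEN subsetD])
  then show ?thesis unfolding cube_lborel_def
    by (subst AE_restrict_space_iff) auto
qed

text \<open>
  A function agrees almost everywhere with its weak derivative of order zero. Tensor products of
  cutoffs converge to the indicator of any box whose closure lies in the open cube; hence \<open>f - g\<close> has
  integral zero over all these boxes, and the cube is exhausted by countably many of them.
\<close>

lemma fundamental_lemma:
  fixes f g :: "real ^ 'd::finite \<Rightarrow> real"
  assumes w: "weak_deriv (interior unit_cube) (\<lambda>_. 0) f g"
  shows "AE x in cube_lborel. f x = g x"
proof -
  have loc: "locally_integrable (interior unit_cube) f" "locally_integrable (interior unit_cube) g"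
    using w by (auto simp: weak_deriv_def)
  have box0: "(LINT x|lborel. indicator {x. \<forall>i. a i < x $ i \<and> x $ i < b i} x * (f x - g x)) = 0"
    if ab: "\<And>i. 0 < a i" "\<And>i. b i < 1" for a b :: "'d \<Rightarrow> real"
  proof -
    define K where "K = cbox (\<chi> i. a i) (\<chi> i. b i)"
    have K: "compact K" "K \<subseteq> interior unit_cube"
      unfolding K_def using cbox_vec_subset_interior[of a b] ab by auto
    then have K3: "K \<subseteq> unit_cube" using interior_subset by blast
    have int: "integrable lborel (\<lambda>x. indicator K x * f x)" "integrable lborel (\<lambda>x. indicator K x * g x)"
      using loc K unfolding locally_integrable_def set_integrable_def by auto
    then have intd: "integrable lborel (\<lambda>x. indicator K x * (f x - g x))"
      by (simp add: right_diff_distrib)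
    define T where "T = (\<lambda>n. tensor (\<lambda>i. cutoff (real n) (a i) (b i)))"
    have T0: "T n x = 0" if "x \<notin> K" for n x
    proof -
      have "\<exists>i. x $ i < a i \<or> b i < x $ i"
        using that unfolding K_def mem_box_cart by (auto simp: not_le)
      then obtain i where "x $ i < a i \<or> b i < x $ i" ..
      then have "x $ i \<le> a i \<or> b i \<le> x $ i" by auto
      then show ?thesis unfolding T_def tensor_def
        by (intro prod_zero) (auto intro!: bexI[of _ i] cutoff_zero)
    qed
    have T1: "\<bar>T n x\<bar> \<le> 1" for n x
      unfolding T_def using tensor_bound[of "\<lambda>i. cutoff (real n) (a i) (b i)" x "\<lambda>_. 1"] cutoff_bounds
      by auto
    have Tm[measurable]: "T n \<in> borel_measurable borel" for n
      unfolding T_def by (intro tensor_measurable borel_measurable_continuous_onI smooth1_continuous smooth1_cutoff)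
    have eq: "(LINT x|lborel. T n x * (indicator K x * (f x - g x))) = 0" for n
    proof -
      have "(LINT x|cube_lborel. f x * T n x) = (LINT x|cube_lborel. g x * T n x)"
        using weak_deriv_tensor[OF w, of "\<lambda>i. cutoff (real n) (a i) (b i)" a b] ab
        by (auto simp: T_def smooth1_cutoff cutoff_zero multi_order_def)
      moreover have "(LINT x|cube_lborel. h x * T n x) = (LINT x|lborel. T n x * (indicator K x * h x))" for h
        unfolding integral_cube using T0[of _ n] K3
        by (intro Bochner_Integration.integral_cong) (auto simp: indicator_def)
      moreover have "integrable lborel (\<lambda>x. T n x * (indicator K x * h x))"
        if "integrable lborel (\<lambda>x. indicator K x * h x)" for h
      proof (rule Bochner_Integration.integrable_bound[OF that])
        show "(\<lambda>x. T n x * (indicator K x * h x)) \<in> borel_measurable lborel"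
          using borel_measurable_integrable[OF that] by measurable
        show "AE x in lborel. norm (T n x * (indicator K x * h x)) \<le> norm (indicator K x * h x)"
          using T1[of n] by (auto simp: abs_mult intro!: mult_left_le_one_le)
      qed
      ultimately show ?thesis using int by (simp add: right_diff_distrib)
    qed
    have "(\<lambda>n. LINT x|lborel. T n x * (indicator K x * (f x - g x))) \<longlonglongrightarrow>
        (LINT x|lborel. indicator {x. \<forall>i. a i < x $ i \<and> x $ i < b i} x * (indicator K x * (f x - g x)))"
    proof (rule integral_dominated_convergence[where w="\<lambda>x. norm (indicator K x * (f x - g x))"])
      show "AE x in lborel. (\<lambda>n. T n x * (indicator K x * (f x - g x))) \<longlonglongrightarrow>
          indicator {x. \<forall>i. a i < x $ i \<and> x $ i < b i} x * (indicator K x * (f x - g x))"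
        unfolding T_def by (intro AE_I2 tendsto_mult tensor_cutoff_tendsto tendsto_const)
      show "AE x in lborel. norm (T n x * (indicator K x * (f x - g x))) \<le> norm (indicator K x * (f x - g x))" for n
        using T1[of n] by (auto simp: abs_mult intro!: mult_left_le_one_le)
      show "integrable lborel (\<lambda>x. norm (indicator K x * (f x - g x)))"
        using intd by (rule integrable_norm)
      have "{x. \<forall>i. a i < x $ i \<and> x $ i < b i} \<in> sets borel" unfolding box_vec[symmetric] by simp
      then show "(\<lambda>x. indicator {x. \<forall>i. a i < x $ i \<and> x $ i < b i} x * (indicator K x * (f x - g x))) \<in> borel_measurable lborel"
        using borel_measurable_integrable[OF intd] by measurable
      show "(\<lambda>x. T n x * (indicator K x * (f x - g x))) \<in> borel_measurable lborel" for n
        using borel_measurable_integrable[OF intd] by measurable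
    qed
    then have "(LINT x|lborel. indicator {x. \<forall>i. a i < x $ i \<and> x $ i < b i} x * (indicator K x * (f x - g x))) = 0"
      unfolding eq using LIMSEQ_unique tendsto_const by blast
    moreover have "indicator {x. \<forall>i. a i < x $ i \<and> x $ i < b i} x * (indicator K x * (f x - g x)) =
        indicator {x. \<forall>i. a i < x $ i \<and> x $ i < b i} x * (f x - g x)" for x
      by (auto simp: indicator_def K_def mem_box_cart less_imp_le)
    ultimately show ?thesis by simp
  qed
  \<comment> \<open>Open boxes exhausting the open cube whose closures stay inside it.\<close>
  define Q where "Q = (\<lambda>n. (box (\<chi> i. 1 / (real n + 3)) (\<chi> i. 1 - 1 / (real n + 3)) :: (real ^ 'd) set))"
  have "AE x in lborel. indicator (Q n) x * (f x - g x) = 0" for n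
  proof (rule integrable_zero_on_boxes)
    define K where "K = (cbox (\<chi> i. 1 / (real n + 3)) (\<chi> i. 1 - 1 / (real n + 3)) :: (real ^ 'd) set)"
    have "K \<subseteq> interior unit_cube" "compact K"
      unfolding K_def using cbox_vec_subset_interior[of "\<lambda>_. 1 / (real n + 3)" "\<lambda>_. 1 - 1 / (real n + 3)"] by auto
    then have "integrable lborel (\<lambda>x. indicator K x * f x)" "integrable lborel (\<lambda>x. indicator K x * g x)"
      using loc unfolding locally_integrable_def set_integrable_def by auto
    then have "integrable lborel (\<lambda>x. indicator K x * (f x - g x))"
      by (simp add: right_diff_distrib)
    from integrable_real_mult_indicator[OF _ this, of "Q n"]
    have "integrable lborel (\<lambda>x. indicator K x * (f x - g x) * indicator (Q n) x)" by (simp add: Q_def)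
    also have "(\<lambda>x. indicator K x * (f x - g x) * indicator (Q n) x) = (\<lambda>x. indicator (Q n) x * (f x - g x))"
      using box_subset_cbox by (auto simp: fun_eq_iff indicator_def Q_def K_def subset_eq)
    finally show "integrable lborel (\<lambda>x. indicator (Q n) x * (f x - g x))" .
    show "\<And>x. x \<notin> box (\<chi> i. 1 / (real n + 3)) (\<chi> i. 1 - 1 / (real n + 3)) \<Longrightarrow> indicator (Q n) x * (f x - g x) = 0"
      by (simp add: Q_def)
    fix a b :: "real ^ 'd"
    have eq: "indicator (box a b) x * (indicator (Q n) x * (f x - g x)) =
      indicator {x. \<forall>i. max (a $ i) (1 / (real n + 3)) < x $ i \<and> x $ i < min (b $ i) (1 - 1 / (real n + 3))} x * (f x - g x)" for x
      by (auto simp: indicator_def Q_def mem_box_cart)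
    show "(LINT x|lborel. indicator (box a b) x * (indicator (Q n) x * (f x - g x))) = 0"
      unfolding eq by (rule box0) (auto simp: less_max_iff_disj min_less_iff_disj)
  qed
  then have "AE x in lborel. \<forall>n. indicator (Q n) x * (f x - g x) = 0"
    by (subst AE_all_countable) blast
  moreover note AE_not_frontier_cube
  ultimately have "AE x in lborel. x \<in> unit_cube \<longrightarrow> f x = g x"
  proof eventually_elim
    case (elim x)
    show ?case
    proof
      assume "x \<in> unit_cube"
      then have x: "x \<in> interior unit_cube" using elim(2) by (auto simp: frontier_def closure_subset[THEN subsetD])
      define e where "e = Min (range (\<lambda>i. min (x $ i) (1 - x $ i)))"
      have "e > 0" unfolding e_def using x by (subst Min_gr_iff) (auto simp: interior_unit_cube)
      then obtain n where n: "inverse (real (Suc n)) < e" using reals_Archimedean by blast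
      have "1 / (real n + 3) < inverse (real (Suc n))" by (simp add: field_simps)
      then have n': "1 / (real n + 3) < e" using n by simp
      have "1 / (real n + 3) < x $ i \<and> x $ i < 1 - 1 / (real n + 3)" for i
      proof -
        have "e \<le> min (x $ i) (1 - x $ i)" unfolding e_def by (intro Min_le) auto
        with n' show ?thesis by linarith
      qed
      then have "x \<in> Q n" unfolding Q_def box_vec by blast
      then show "f x = g x" using elim(1)[rule_format, of n] by simp
    qed
  qed
  then show ?thesis unfolding cube_lborel_def
    by (subst AE_restrict_space_iff) auto
qed

section \<open>Decay of the Legendre coefficients\<close>

text \<open>
  Vanishes within \<open>1 / (n + 3)\<close> of the ends of the unit interval and is 1 beyond twice that distance. The
  shift by 3 keeps the interval between the two ends nondegenerate for \<open>n = 0\<close>.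
\<close>

definition edge_cutoff :: "nat \<Rightarrow> real \<Rightarrow> real" where
  "edge_cutoff n = cutoff (real n + 3) (1 / (real n + 3)) (1 - 1 / (real n + 3))"

lemma edge_cutoff_eq:
  "edge_cutoff n t = smooth_step ((real n + 3) * t - 1) * smooth_step ((real n + 3) * (1 - t) - 1)"
proof -
  have "real n + 3 \<noteq> 0" by linarith
  then have "(real n + 3) * (t - 1 / (real n + 3)) = (real n + 3) * t - 1"
    "(real n + 3) * (1 - 1 / (real n + 3) - t) = (real n + 3) * (1 - t) - 1"
    by (simp_all add: field_simps)
  then show ?thesis unfolding edge_cutoff_def cutoff_def by simp
qed

lemma smooth1_edge_cutoff: "smooth1 (edge_cutoff n)"
  unfolding edge_cutoff_def by (rule smooth1_cutoff)

lemma edge_cutoff_deriv: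
  "deriv (edge_cutoff n) t = (real n + 3) *
     (deriv smooth_step ((real n + 3) * t - 1) * smooth_step ((real n + 3) * (1 - t) - 1) -
      smooth_step ((real n + 3) * t - 1) * deriv smooth_step ((real n + 3) * (1 - t) - 1))"
proof -
  have 1: "((\<lambda>t. smooth_step ((real n + 3) * t - 1)) has_real_derivative
      deriv smooth_step ((real n + 3) * t - 1) * (real n + 3)) (at t)"
    by (rule DERIV_chain2[OF smooth1_deriv(1)[OF smooth1_smooth_step]]) (auto intro!: derivative_eq_intros)
  have 2: "((\<lambda>t. smooth_step ((real n + 3) * (1 - t) - 1)) has_real_derivative
      deriv smooth_step ((real n + 3) * (1 - t) - 1) * (- (real n + 3))) (at t)"
    by (rule DERIV_chain2[OF smooth1_deriv(1)[OF smooth1_smooth_step]]) (auto intro!: derivative_eq_intros)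
  show ?thesis unfolding edge_cutoff_eq[abs_def]
    by (rule DERIV_imp_deriv[OF DERIV_cong[OF DERIV_mult[OF 1 2]]]) (simp add: algebra_simps)
qed

text \<open>
  The derivative is of order \<open>n\<close>, but only at distance of order \<open>1 / n\<close> from an end, where the weight
  compensates for it. For this reason the cutoffs leave no trace in the limit.
\<close>

lemma edge_cutoff_deriv_weighted:
  "\<exists>B\<ge>0. \<forall>n. \<forall>t\<in>{0..1}. \<bar>t * (1 - t) * deriv (edge_cutoff n) t\<bar> \<le> B"
proof -
  obtain B where B: "B \<ge> 0" "\<And>x. \<bar>deriv smooth_step x\<bar> \<le> B"
    using smooth_step_deriv_bounded by blast
  have key: "s * \<bar>N * deriv smooth_step (N * s - 1)\<bar> \<le> 2 * B" if "0 \<le> s" "0 < N" for N s :: real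
  proof (cases "N * s \<le> 2")
    case True
    have "s * \<bar>N * deriv smooth_step (N * s - 1)\<bar> = (N * s) * \<bar>deriv smooth_step (N * s - 1)\<bar>"
      using that by (simp add: abs_mult)
    also have "\<dots> \<le> 2 * B" using True B that by (intro mult_mono) auto
    finally show ?thesis .
  next
    case False
    then have "deriv smooth_step (N * s - 1) = 0" by (intro smooth_step_deriv_zero) auto
    then show ?thesis using B by simp
  qed
  have "\<bar>t * (1 - t) * deriv (edge_cutoff n) t\<bar> \<le> 4 * B" if t: "t \<in> {0..1}" for n t
  proof -
    define N where "N = real n + 3"
    have N: "N > 0" by (simp add: N_def)
    define p q P Q where "p = \<bar>N * deriv smooth_step (N * t - 1)\<bar>" and "q = \<bar>N * deriv smooth_step (N * (1 - t) - 1)\<bar>"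
      and "P = smooth_step (N * (1 - t) - 1)" and "Q = smooth_step (N * t - 1)"
    have PQ: "0 \<le> P" "P \<le> 1" "0 \<le> Q" "Q \<le> 1" unfolding P_def Q_def by (rule smooth_step_simps)+
    have pq: "0 \<le> p" "0 \<le> q" by (auto simp: p_def q_def)
    have pk: "t * p \<le> 2 * B" "(1 - t) * q \<le> 2 * B" unfolding p_def q_def using key[of t N] key[of "1 - t" N] t N by auto
    have "\<bar>deriv (edge_cutoff n) t\<bar> \<le> p * P + q * Q"
    proof -
      have "\<bar>deriv (edge_cutoff n) t\<bar> = \<bar>N * deriv smooth_step (N * t - 1) * P - N * deriv smooth_step (N * (1 - t) - 1) * Q\<bar>"
        unfolding edge_cutoff_deriv P_def Q_def N_def by (simp add: algebra_simps)
      also have "\<dots> \<le> \<bar>N * deriv smooth_step (N * t - 1) * P\<bar> + \<bar>N * deriv smooth_step (N * (1 - t) - 1) * Q\<bar>"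
        by (rule abs_triangle_ineq4)
      finally show ?thesis using PQ by (simp add: abs_mult p_def q_def)
    qed
    also have "\<dots> \<le> p + q" using PQ pq by (intro add_mono mult_right_le_one_le) auto
    finally have "\<bar>t * (1 - t) * deriv (edge_cutoff n) t\<bar> \<le> t * (1 - t) * (p + q)"
      using t by (simp add: abs_mult mult_left_mono)
    also have "\<dots> = (1 - t) * (t * p) + t * ((1 - t) * q)" by (simp add: algebra_simps)
    also have "\<dots> \<le> 1 * (2 * B) + 1 * (2 * B)"
    proof (rule add_mono)
      show "(1 - t) * (t * p) \<le> 1 * (2 * B)" by (rule mult_mono) (use t pk(1) pq in auto)
      show "t * ((1 - t) * q) \<le> 1 * (2 * B)" by (rule mult_mono) (use t pk(2) pq in auto)
    qed
    finally show ?thesis by simp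
  qed
  then show ?thesis using B(1) by (intro exI[of _ "4 * B"]) auto
qed

lemma edge_cutoff_eventually:
  assumes "0 < t" "t < 1"
  shows "eventually (\<lambda>n. edge_cutoff n t = 1 \<and> deriv (edge_cutoff n) t = 0) sequentially"
proof -
  define e where "e = min t (1 - t)"
  have e: "e > 0" using assms by (simp add: e_def)
  have "eventually (\<lambda>n. real n \<ge> 3 / e) sequentially"
    using filterlim_real_sequentially by (simp add: filterlim_at_top)
  then show ?thesis
  proof eventually_elim
    case (elim n)
    then have "3 \<le> real n * e" using e by (simp add: field_simps)
    moreover have "real n * e \<le> (real n + 3) * t" "real n * e \<le> (real n + 3) * (1 - t)"
      using assms by (auto simp: e_def intro!: mult_mono)
    ultimately have "(real n + 3) * t - 1 > 1" "(real n + 3) * (1 - t) - 1 > 1" by linarith+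
    then show ?case
      by (simp add: edge_cutoff_eq edge_cutoff_deriv smooth_step_simps smooth_step_deriv_zero)
  qed
qed

lemma poly_bounded_unit_interval: "\<exists>B\<ge>0. \<forall>t\<in>{0..1}. \<bar>poly p t\<bar> \<le> B" for p :: "real poly"
proof -
  have "bounded (poly p ` {0..1})"
    by (intro compact_imp_bounded compact_continuous_image continuous_intros) auto
  then obtain B where "\<forall>t\<in>{0..1}. \<bar>poly p t\<bar> \<le> B" by (auto simp: bounded_iff)
  then show ?thesis by (intro exI[of _ "\<bar>B\<bar>"]) (auto intro: order_trans)
qed

text \<open>Convergence in the open cube suffices, since the boundary is a null set.\<close>

lemma cube_dominated_convergence:
  fixes F :: "real ^ 'd::finite \<Rightarrow> real"
  assumes F: "integrable cube_lborel F"
    and T: "\<And>n. T n \<in> borel_measurable borel" "T' \<in> borel_measurable borel"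
    and bound: "\<And>n x. x \<in> unit_cube \<Longrightarrow> \<bar>T n x\<bar> \<le> B"
    and lim: "\<And>x. x \<in> interior unit_cube \<Longrightarrow> (\<lambda>n. T n x) \<longlonglongrightarrow> T' x"
  shows "(\<lambda>n. LINT x|cube_lborel. F x * T n x) \<longlonglongrightarrow> (LINT x|cube_lborel. F x * T' x)"
proof (rule integral_dominated_convergence[where w="\<lambda>x. B * norm (F x)"])
  have [measurable]: "F \<in> borel_measurable cube_lborel" "T n \<in> borel_measurable cube_lborel" "T' \<in> borel_measurable cube_lborel" for n
    using F T by (auto intro: borel_measurable_cube)
  show "(\<lambda>x. F x * T' x) \<in> borel_measurable cube_lborel" "\<And>n. (\<lambda>x. F x * T n x) \<in> borel_measurable cube_lborel"
    by measurable
  show "integrable cube_lborel (\<lambda>x. B * norm (F x))" using F by auto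
  show "AE x in cube_lborel. (\<lambda>n. F x * T n x) \<longlonglongrightarrow> F x * T' x"
    using AE_interior_cube by eventually_elim (intro tendsto_mult tendsto_const lim)
  show "AE x in cube_lborel. norm (F x * T n x) \<le> B * norm (F x)" for n
    using bound[of _ n] by (intro AE_I2) (auto simp: abs_mult mult.commute[of B] intro!: mult_left_mono)
qed

text \<open>
  Multiply all factors of the polynomial by edge cutoffs to obtain test functions, and let the cutoffs
  tend to 1. The factor \<open>w\<close> in the \<open>i\<close>-th coordinate keeps the derivative of the cutoff bounded, so that
  dominated convergence applies and no boundary term survives.
\<close>

lemma weak_deriv_by_parts:
  fixes r :: "'d::finite \<Rightarrow> real poly" and i :: 'd
  assumes w0: "weak_deriv (interior unit_cube) ((\<lambda>_. 0)(i := j)) f F"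
    and w1: "weak_deriv (interior unit_cube) ((\<lambda>_. 0)(i := Suc j)) f F'"
    and int: "integrable cube_lborel F" "integrable cube_lborel F'"
  shows "(LINT x|cube_lborel. F x * tensor (\<lambda>l. poly ((r(i := pderiv (wpoly * q))) l)) x) =
     - (LINT x|cube_lborel. F' x * tensor (\<lambda>l. poly ((r(i := wpoly * q)) l)) x)"
proof -
  define s where "s = r(i := wpoly * q)"
  define s' where "s' = r(i := pderiv (wpoly * q))"
  \<comment> \<open>\<open>G n\<close> is the test function for the derivative of order \<open>Suc j\<close>; its derivative \<open>H n\<close> in the
    \<open>i\<close>-th coordinate is the one for order \<open>j\<close>.\<close>
  define G where "G = (\<lambda>n l t. edge_cutoff n t * poly (s l) t)"
  define H where "H = (\<lambda>n. (G n)(i := deriv (G n i)))"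
  have sG: "smooth1 (G n l)" for n l unfolding G_def by (intro smooth1_mult smooth1_edge_cutoff smooth1_poly)
  have sH: "smooth1 (H n l)" for n l unfolding H_def by (auto intro: sG smooth1_deriv)
  \<comment> \<open>The derivative of \<open>G n\<close> vanishes only strictly outside \<open>[a n, b n]\<close>, so the support of
    \<open>H n\<close> is enclosed in a slightly larger interval below.\<close>
  define a b where "a = (\<lambda>n. 1 / (real n + 3))" and "b = (\<lambda>n. 1 - 1 / (real n + 3))"
  have ab: "0 < a n" "b n < 1" "a n / 2 < a n" "b n < (1 + b n) / 2" for n
  proof -
    have "a n > 0" "b n = 1 - a n" by (auto simp: a_def b_def)
    then show "0 < a n" "b n < 1" "a n / 2 < a n" "b n < (1 + b n) / 2" by (simp_all add: field_simps)
  qed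
  have zG: "G n l t = 0" if "t \<le> a n \<or> b n \<le> t" for n l t
    using that unfolding G_def edge_cutoff_def a_def b_def by (simp add: cutoff_zero)
  have zH: "H n l t = 0" if t: "t \<le> a n / 2 \<or> (1 + b n) / 2 \<le> t" for n l t
  proof -
    have "t < a n \<or> b n < t" using t ab[of n] by linarith
    then show ?thesis unfolding H_def
      using deriv_iter_zero_outside[of "a n" "b n" "G n l" t 1] deriv_iter_zero_outside[of "a n" "b n" "G n l" t 0] zG
      by auto
  qed
  have dG: "deriv (G n i) t = deriv (edge_cutoff n) t * (t * (1 - t) * poly q t) + edge_cutoff n t * poly (s' i) t" for n t
  proof (rule DERIV_imp_deriv)
    have "(G n i has_real_derivative deriv (edge_cutoff n) t * poly (s i) t + poly (pderiv (s i)) t * edge_cutoff n t) (at t)"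
      unfolding G_def by (intro DERIV_mult poly_DERIV smooth1_deriv(1) smooth1_edge_cutoff)
    then show "(G n i has_real_derivative deriv (edge_cutoff n) t * (t * (1 - t) * poly q t) + edge_cutoff n t * poly (s' i) t) (at t)"
      by (simp add: s_def s'_def mult.commute)
  qed
  have eq: "(LINT x|cube_lborel. F x * tensor (H n) x) = - (LINT x|cube_lborel. F' x * tensor (G n) x)" for n
  proof -
    have "(LINT x|cube_lborel. f x * tensor (\<lambda>l. (deriv ^^ ((\<lambda>_. 0)(i := Suc j)) l) (G n l)) x) =
       (- 1) ^ Suc j * (LINT x|cube_lborel. F' x * tensor (G n) x)"
      using weak_deriv_tensor[OF w1, of "G n" "\<lambda>_. a n" "\<lambda>_. b n"] ab zG sG
      by (simp add: multi_order_def)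
    moreover have "(LINT x|cube_lborel. f x * tensor (\<lambda>l. (deriv ^^ ((\<lambda>_. 0)(i := j)) l) (H n l)) x) =
       (- 1) ^ j * (LINT x|cube_lborel. F x * tensor (H n) x)"
      using weak_deriv_tensor[OF w0, of "H n" "\<lambda>_. a n / 2" "\<lambda>_. (1 + b n) / 2"] ab zH sH
      by (simp add: multi_order_def)
    moreover have "(\<lambda>l. (deriv ^^ ((\<lambda>_. 0)(i := j)) l) (H n l)) = (\<lambda>l. (deriv ^^ ((\<lambda>_. 0)(i := Suc j)) l) (G n l))"
      by (auto simp: H_def fun_eq_iff funpow_swap1)
    ultimately have "(- 1) ^ j * (LINT x|cube_lborel. F x * tensor (H n) x) = (- 1) ^ j * (- (LINT x|cube_lborel. F' x * tensor (G n) x))"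
      by simp
    then show ?thesis by (simp only: mult_cancel_left) auto
  qed
  have "\<forall>p :: real poly. \<exists>B. \<forall>t\<in>{0..1}. \<bar>poly p t\<bar> \<le> B"
    using poly_bounded_unit_interval by blast
  then obtain bd :: "real poly \<Rightarrow> real" where bd: "\<forall>p. \<forall>t\<in>{0..1}. \<bar>poly p t\<bar> \<le> bd p"
    by (rule choice[THEN exE])
  define B B' Bq where "B = (\<lambda>l. bd (s l))" and "B' = (\<lambda>l. bd (s' l))" and "Bq = bd q"
  have B: "\<bar>poly (s l) t\<bar> \<le> B l" and B': "\<bar>poly (s' l) t\<bar> \<le> B' l" and Bq: "\<bar>poly q t\<bar> \<le> Bq"
    if "t \<in> {0..1}" for l t
    using bd that by (auto simp: B_def B'_def Bq_def)
  obtain C where C: "C \<ge> 0" "\<And>n t. t \<in> {0..1} \<Longrightarrow> \<bar>t * (1 - t) * deriv (edge_cutoff n) t\<bar> \<le> C"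
    using edge_cutoff_deriv_weighted by blast
  have ec: "0 \<le> edge_cutoff n t" "edge_cutoff n t \<le> 1" for n t
    unfolding edge_cutoff_def by (rule cutoff_bounds)+
  have cutb: "\<bar>edge_cutoff n t * z\<bar> \<le> \<bar>z\<bar>" for n t z
    using ec[of n t] by (simp add: abs_mult mult_left_le_one_le)
  have GB: "\<bar>G n l t\<bar> \<le> B l" if "t \<in> {0..1}" for n l t
    unfolding G_def using cutb B[OF that] order_trans by blast
  \<comment> \<open>The first summand of \<open>dG\<close> contains \<open>t (1 - t)\<close>, which bounds it uniformly in \<open>n\<close>.\<close>
  have HB: "\<bar>H n l t\<bar> \<le> \<bar>B l\<bar> + C * \<bar>Bq\<bar> + \<bar>B' l\<bar>" if t: "t \<in> {0..1}" for n l t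
  proof (cases "l = i")
    case True
    have "\<bar>H n l t\<bar> \<le> \<bar>(t * (1 - t) * deriv (edge_cutoff n) t) * poly q t\<bar> + \<bar>edge_cutoff n t * poly (s' i) t\<bar>"
      unfolding H_def using True dG[of n t] by (auto simp: mult_ac intro: order_trans[OF abs_triangle_ineq])
    also have "\<dots> \<le> C * \<bar>Bq\<bar> + \<bar>B' i\<bar>"
    proof (rule add_mono)
      show "\<bar>(t * (1 - t) * deriv (edge_cutoff n) t) * poly q t\<bar> \<le> C * \<bar>Bq\<bar>"
        unfolding abs_mult[of _ "poly q t"] using C t Bq[OF t] by (intro mult_mono) auto
      show "\<bar>edge_cutoff n t * poly (s' i) t\<bar> \<le> \<bar>B' i\<bar>"
        using cutb[of n t "poly (s' i) t"] B'[OF t, of i] by linarith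
    qed
    finally show ?thesis using True by simp
  next
    case False
    then have "\<bar>H n l t\<bar> \<le> B l" using GB[OF t] by (simp add: H_def)
    moreover have "0 \<le> C * \<bar>Bq\<bar>" using C by simp
    ultimately show ?thesis by linarith
  qed
  have Gl: "(\<lambda>n. G n l t) \<longlonglongrightarrow> poly (s l) t" if t: "0 < t" "t < 1" for l t
    by (rule tendsto_eventually, rule eventually_mono[OF edge_cutoff_eventually[OF t]]) (simp add: G_def)
  have Hl: "(\<lambda>n. H n l t) \<longlonglongrightarrow> poly (s' l) t" if t: "0 < t" "t < 1" for l t
  proof (cases "l = i")
    case True
    show ?thesis
      by (rule tendsto_eventually, rule eventually_mono[OF edge_cutoff_eventually[OF t]])
         (simp add: H_def True dG)
  next
    case False
    then have "s' l = s l" by (simp add: s_def s'_def)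
    then show ?thesis using Gl[OF t, of l] False by (simp add: H_def)
  qed
  have cube_coord: "x $ l \<in> {0..1}" if "x \<in> unit_cube" for x :: "real ^ 'd" and l using that by (auto simp: unit_cube_def)
  have L1: "(\<lambda>n. LINT x|cube_lborel. F x * tensor (H n) x) \<longlonglongrightarrow> (LINT x|cube_lborel. F x * tensor (\<lambda>l. poly (s' l)) x)"
  proof (rule cube_dominated_convergence[OF int(1)])
    show "tensor (H n) \<in> borel_measurable borel" for n
      by (intro tensor_measurable borel_measurable_continuous_onI smooth1_continuous sH)
    show "tensor (\<lambda>l. poly (s' l)) \<in> borel_measurable borel"
      by (intro tensor_measurable borel_measurable_continuous_onI continuous_intros)
    show "\<bar>tensor (H n) x\<bar> \<le> (\<Prod>l\<in>UNIV. \<bar>B l\<bar> + C * \<bar>Bq\<bar> + \<bar>B' l\<bar>)" if "x \<in> unit_cube" for n x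
      by (intro tensor_bound HB cube_coord that)
    show "(\<lambda>n. tensor (H n) x) \<longlonglongrightarrow> tensor (\<lambda>l. poly (s' l)) x" if "x \<in> interior unit_cube" for x
      using that unfolding tensor_def interior_unit_cube by (intro tendsto_prod Hl) auto
  qed
  have L2: "(\<lambda>n. LINT x|cube_lborel. F' x * tensor (G n) x) \<longlonglongrightarrow> (LINT x|cube_lborel. F' x * tensor (\<lambda>l. poly (s l)) x)"
  proof (rule cube_dominated_convergence[OF int(2)])
    show "tensor (G n) \<in> borel_measurable borel" for n
      by (intro tensor_measurable borel_measurable_continuous_onI smooth1_continuous sG)
    show "tensor (\<lambda>l. poly (s l)) \<in> borel_measurable borel"
      by (intro tensor_measurable borel_measurable_continuous_onI continuous_intros)
    show "\<bar>tensor (G n) x\<bar> \<le> (\<Prod>l\<in>UNIV. B l)" if "x \<in> unit_cube" for n x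
      by (intro tensor_bound GB cube_coord that)
    show "(\<lambda>n. tensor (G n) x) \<longlonglongrightarrow> tensor (\<lambda>l. poly (s l)) x" if "x \<in> interior unit_cube" for x
      using that unfolding tensor_def interior_unit_cube by (intro tendsto_prod Gl) auto
  qed
  from L1 have "(\<lambda>n. - (LINT x|cube_lborel. F' x * tensor (G n) x)) \<longlonglongrightarrow> (LINT x|cube_lborel. F x * tensor (\<lambda>l. poly (s' l)) x)"
    unfolding eq .
  from LIMSEQ_unique[OF this tendsto_minus[OF L2]] show ?thesis unfolding s_def s'_def .
qed

text \<open>The \<open>k\<close>-th coefficient of \<open>f\<close> in the Legendre basis.\<close>

abbreviation (input) coeff_fun :: "(real ^ 'd::finite \<Rightarrow> real) \<Rightarrow> ('d \<Rightarrow> nat) \<Rightarrow> real" where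
  "coeff_fun f k \<equiv> (LINT x|cube_lborel. f x * legendre_basis k x)"

lemma sqint_iff_square_integrable: "square_integrable f \<longleftrightarrow> sqint cube_lborel f"
  by (simp add: square_integrable_def sqint_def)

lemma finite_measure_cube: "finite_measure (cube_lborel :: (real ^ 'd::finite) measure)"
  using prob_space_cube by (rule prob_space.finite_measure)

lemma sqint_cube_integrable: "sqint (cube_lborel :: (real ^ 'd::finite) measure) f \<Longrightarrow> integrable cube_lborel f"
proof -
  interpret finite_measure "cube_lborel :: (real ^ 'd) measure" by (rule finite_measure_cube)
  assume "sqint (cube_lborel :: (real ^ 'd) measure) f"
  moreover have "sqint (cube_lborel :: (real ^ 'd) measure) (\<lambda>_. 1)" by (simp add: sqint_def)
  ultimately show ?thesis using sqint_mult_integrable by fastforce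
qed

lemma tensor_upd:
  "tensor (\<lambda>l. poly ((r(i := p)) l)) x = poly p (x $ i) * (\<Prod>j\<in>UNIV - {i}. poly (r j) (x $ j))"
proof -
  have "tensor (\<lambda>l. poly ((r(i := p)) l)) x =
      poly ((r(i := p)) i) (x $ i) * (\<Prod>j\<in>UNIV - {i}. poly ((r(i := p)) j) (x $ j))"
    unfolding tensor_def by (rule prod.remove) auto
  also have "(\<Prod>j\<in>UNIV - {i}. poly ((r(i := p)) j) (x $ j)) = (\<Prod>j\<in>UNIV - {i}. poly (r j) (x $ j))"
    by (intro prod.cong) auto
  finally show ?thesis by simp
qed

lemma tensor_smult:
  "tensor (\<lambda>l. poly ((r(i := smult c p)) l)) x = c * tensor (\<lambda>l. poly ((r(i := p)) l)) x"
  unfolding tensor_upd by simp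

text \<open>
  The Sturm-Liouville form writes \<open>\<lambda>\<^sub>j w ^ j \<phi>\<^sup>(\<^sup>j\<^sup>)\<close> as a divergence of a function containing the factor
  \<open>w\<close>, so that each eigenvalue pays for one integration by parts in the \<open>i\<close>-th coordinate.
\<close>

lemma coeff_iterated_by_parts:
  fixes k :: "'d::finite \<Rightarrow> nat" and i :: 'd
  assumes w: "\<And>j. j \<le> m \<Longrightarrow> weak_deriv (interior unit_cube) ((\<lambda>_. 0)(i := j)) f (F j)"
    and F: "\<And>j. j \<le> m \<Longrightarrow> sqint cube_lborel (F j)"
    and "j \<le> m"
  shows "(\<Prod>l<j. legendre_eig (k i) l) * (LINT x|cube_lborel. F 0 x * legendre_basis k x) =
    (LINT x|cube_lborel. F j x *
       tensor (\<lambda>l. poly (((\<lambda>l. phi (k l))(i := wpoly ^ j * (pderiv ^^ j) (phi (k i)))) l)) x)"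
  using assms(3)
proof (induction j)
  case 0
  have "(\<lambda>l. phi (k l))(i := wpoly ^ 0 * (pderiv ^^ 0) (phi (k i))) = (\<lambda>l. phi (k l))" by auto
  then show ?case by (simp add: legendre_basis_def)
next
  case (Suc j)
  define r where "r = (\<lambda>l. phi (k l))"
  define Q where "Q = (\<lambda>j. wpoly ^ j * (pderiv ^^ j) (phi (k i)))"
  have dQ: "pderiv (wpoly * (wpoly ^ j * (pderiv ^^ Suc j) (phi (k i)))) = smult (- legendre_eig (k i) j) (Q j)"
    using phi_sturm_liouville[of j "k i"] unfolding Q_def by (simp only: power_Suc mult.assoc)
  have "(LINT x|cube_lborel. F j x * tensor (\<lambda>l. poly ((r(i := smult (- legendre_eig (k i) j) (Q j))) l)) x) =
     - (LINT x|cube_lborel. F (Suc j) x * tensor (\<lambda>l. poly ((r(i := Q (Suc j))) l)) x)"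
    using weak_deriv_by_parts[OF w[of j] w[of "Suc j"], of r "wpoly ^ j * (pderiv ^^ Suc j) (phi (k i))"]
      Suc.prems sqint_cube_integrable[OF F]
    unfolding dQ by (simp only: Q_def power_Suc mult.assoc)
  then have "legendre_eig (k i) j * (LINT x|cube_lborel. F j x * tensor (\<lambda>l. poly ((r(i := Q j)) l)) x) =
      (LINT x|cube_lborel. F (Suc j) x * tensor (\<lambda>l. poly ((r(i := Q (Suc j))) l)) x)"
    unfolding tensor_smult by (simp add: mult.left_commute[of _ "legendre_eig (k i) j"])
  then show ?case using Suc unfolding Q_def r_def by (simp add: mult_ac)
qed

lemma legendre_eig_pos: "j < n \<Longrightarrow> legendre_eig n j > 0"
proof -
  assume "j < n"
  have "legendre_eig n j = (real n - real j) * (real n + real j + 1)"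
    by (simp add: legendre_eig_def algebra_simps)
  then show ?thesis using \<open>j < n\<close> by simp
qed

text \<open>
  The functions \<open>w ^ (m / 2) \<partial>\<^sub>i ^ m e\<^sub>k / sqrt \<lambda>\<^sub>k\<close>, where \<open>\<lambda>\<^sub>k\<close> is the product of the eigenvalues, are
  orthonormal, and the coefficients of \<open>w ^ (m / 2) F m\<close> with respect to them are \<open>sqrt \<lambda>\<^sub>k\<close> times those
  of \<open>F 0\<close>. Bessel's inequality and \<open>w \<le> 1\<close> give the claim.
\<close>

lemma weighted_Bessel:
  fixes i :: "'d::finite"
  assumes w: "\<And>j. j \<le> m \<Longrightarrow> weak_deriv (interior unit_cube) ((\<lambda>_. 0)(i := j)) f (F j)"
    and F: "\<And>j. j \<le> m \<Longrightarrow> sqint cube_lborel (F j)"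
    and S: "finite S" "\<And>k. k \<in> S \<Longrightarrow> m \<le> k i"
  shows "(\<Sum>k\<in>S. (\<Prod>l<m. legendre_eig (k i) l) * (coeff_fun (F 0) k)\<^sup>2) \<le> (LINT x|cube_lborel. (F m x)\<^sup>2)"
proof -
  define lam where "lam = (\<lambda>k. \<Prod>l<m. legendre_eig (k i) l)"
  have lam: "lam k > 0" if "k \<in> S" for k
    unfolding lam_def using S(2)[OF that] by (intro prod_pos legendre_eig_pos) auto
  define w' where "w' = (\<lambda>x :: real ^ 'd. sqrt (x $ i * (1 - x $ i)) ^ m)"
  have w2: "(w' x)\<^sup>2 = (x $ i * (1 - x $ i)) ^ m" if "x \<in> unit_cube" for x
  proof -
    have "0 \<le> x $ i * (1 - x $ i)" using that by (auto simp: unit_cube_def)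
    then show ?thesis unfolding w'_def by (metis power_mult mult.commute real_sqrt_pow2)
  qed
  have w1: "0 \<le> w' x" "w' x \<le> 1" if "x \<in> unit_cube" for x
  proof -
    have "0 \<le> x $ i" "x $ i \<le> 1" using that by (auto simp: unit_cube_def)
    then have "0 \<le> x $ i * (1 - x $ i)" "x $ i * (1 - x $ i) \<le> 1" by (auto intro: mult_le_one)
    then show "0 \<le> w' x" "w' x \<le> 1" unfolding w'_def by (auto intro!: power_le_one)
  qed
  have w'm: "w' \<in> borel_measurable cube_lborel"
    unfolding w'_def by (intro borel_measurable_cube borel_measurable_continuous_onI continuous_intros)
  define T where "T = (\<lambda>k. tensor (\<lambda>l. poly (((\<lambda>l. phi (k l))(i := (pderiv ^^ m) (phi (k i)))) l)))"
  define e where "e = (\<lambda>k x. w' x * T k x / sqrt (lam k))"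
  have wT: "tensor (\<lambda>l. poly (((\<lambda>l. phi (k l))(i := wpoly ^ m * (pderiv ^^ m) (phi (k i)))) l)) x = (w' x)\<^sup>2 * T k x"
    if "x \<in> unit_cube" for k x
    unfolding T_def tensor_upd w2[OF that] by simp
  have Tm: "T k \<in> borel_measurable cube_lborel" for k
    unfolding T_def by (intro borel_measurable_cube tensor_measurable borel_measurable_continuous_onI continuous_intros)
  have Tsq: "sqint cube_lborel (T k)" for k unfolding T_def by (rule sqint_tensor_poly)
  have wsq: "sqint cube_lborel (\<lambda>x. w' x * h x)" if "sqint cube_lborel h" for h
  proof -
    have [measurable]: "h \<in> borel_measurable cube_lborel" using that by (simp add: sqint_def)
    note [measurable] = w'm
    have "integrable cube_lborel (\<lambda>x. (w' x * h x)\<^sup>2)"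
    proof (rule Bochner_Integration.integrable_bound)
      show "integrable cube_lborel (\<lambda>x. (h x)\<^sup>2)" using that by (simp add: sqint_def)
      show "(\<lambda>x. (w' x * h x)\<^sup>2) \<in> borel_measurable cube_lborel" by measurable
      show "AE x in cube_lborel. norm ((w' x * h x)\<^sup>2) \<le> norm ((h x)\<^sup>2)"
        using w1 by (intro AE_I2) (auto simp: power_mult_distrib intro!: mult_left_le_one_le power_le_one)
    qed
    then show ?thesis unfolding sqint_def by auto
  qed
  have esq: "sqint cube_lborel (e k)" for k
    using sqint_cmult[OF wsq[OF Tsq[of k]], of "1 / sqrt (lam k)"] by (simp add: e_def)
  have on: "orthonormal cube_lborel e S"
    unfolding orthonormal_def
  proof (intro conjI ballI esq)
    fix k l assume kl: "k \<in> S" "l \<in> S"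
    have prod: "(w' x)\<^sup>2 * (T k x * T l x) =
       tensor (\<lambda>j. poly (((\<lambda>j. phi (k j) * phi (l j))(i := wpoly ^ m * (pderiv ^^ m) (phi (k i)) * (pderiv ^^ m) (phi (l i)))) j)) x"
      if "x \<in> unit_cube" for x
      unfolding w2[OF that] T_def tensor_upd by (simp add: prod.distrib mult_ac)
    have "(LINT x|cube_lborel. e k x * e l x) =
        (LINT x|cube_lborel. (1 / (sqrt (lam k) * sqrt (lam l))) * ((w' x)\<^sup>2 * (T k x * T l x)))"
      by (intro Bochner_Integration.integral_cong) (auto simp: e_def power2_eq_square)
    also have "\<dots> = (1 / (sqrt (lam k) * sqrt (lam l))) * (LINT x|cube_lborel. (w' x)\<^sup>2 * (T k x * T l x))"
      by simp
    also have "(LINT x|cube_lborel. (w' x)\<^sup>2 * (T k x * T l x)) =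
        (LINT x|cube_lborel. tensor (\<lambda>j. poly (((\<lambda>j. phi (k j) * phi (l j))(i := wpoly ^ m * (pderiv ^^ m) (phi (k i)) * (pderiv ^^ m) (phi (l i)))) j)) x)"
      by (intro Bochner_Integration.integral_cong refl prod) simp
    also have "\<dots> = lam k * of_bool (k = l)"
    proof -
      have "(\<Prod>j\<in>UNIV. pint (((\<lambda>j. phi (k j) * phi (l j))(i := wpoly ^ m * (pderiv ^^ m) (phi (k i)) * (pderiv ^^ m) (phi (l i)))) j)) =
          (lam k * of_bool (k i = l i)) * (\<Prod>j\<in>UNIV - {i}. of_bool (k j = l j))"
        by (subst prod.remove[of _ i]) (auto simp: phi_weighted_orthonormal phi_orthonormal lam_def)
      also have "\<dots> = lam k * (\<Prod>j\<in>UNIV. of_bool (k j = l j))"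
        by (subst (2) prod.remove[of _ i]) auto
      also have "(\<Prod>j\<in>UNIV. of_bool (k j = l j) :: real) = of_bool (k = l)"
        by (auto simp: fun_eq_iff)
      finally show ?thesis unfolding cube_tensor_poly .
    qed
    finally show "(LINT x|cube_lborel. e k x * e l x) = of_bool (k = l)"
      using lam[OF kl(1)] lam[OF kl(2)] by (auto simp: real_sqrt_mult_self)
  qed
  have coeff: "(LINT x|cube_lborel. (w' x * F m x) * e k x)\<^sup>2 = lam k * (coeff_fun (F 0) k)\<^sup>2" if k: "k \<in> S" for k
  proof -
    have "lam k * coeff_fun (F 0) k = (LINT x|cube_lborel. F m x *
       tensor (\<lambda>l. poly (((\<lambda>l. phi (k l))(i := wpoly ^ m * (pderiv ^^ m) (phi (k i)))) l)) x)"
      unfolding lam_def by (rule coeff_iterated_by_parts[OF w F]) auto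
    also have "\<dots> = (LINT x|cube_lborel. sqrt (lam k) * ((w' x * F m x) * e k x))"
    proof (rule Bochner_Integration.integral_cong[OF refl])
      fix x :: "real ^ 'd" assume "x \<in> space cube_lborel"
      then have x: "x \<in> unit_cube" by simp
      show "F m x * tensor (\<lambda>l. poly (((\<lambda>l. phi (k l))(i := wpoly ^ m * (pderiv ^^ m) (phi (k i)))) l)) x =
          sqrt (lam k) * ((w' x * F m x) * e k x)"
        unfolding wT[OF x] using lam[OF k] by (simp add: e_def power2_eq_square)
    qed
    finally have "lam k * coeff_fun (F 0) k = sqrt (lam k) * (LINT x|cube_lborel. (w' x * F m x) * e k x)" by simp
    then have "(lam k * coeff_fun (F 0) k)\<^sup>2 = (sqrt (lam k) * (LINT x|cube_lborel. (w' x * F m x) * e k x))\<^sup>2"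
      by (rule arg_cong)
    then have "(lam k)\<^sup>2 * (coeff_fun (F 0) k)\<^sup>2 = lam k * (LINT x|cube_lborel. (w' x * F m x) * e k x)\<^sup>2"
      unfolding power_mult_distrib real_sqrt_pow2[OF less_imp_le[OF lam[OF k]]] .
    then show ?thesis using lam[OF k] by (simp add: power2_eq_square)
  qed
  have "(\<Sum>k\<in>S. lam k * (coeff_fun (F 0) k)\<^sup>2) = (\<Sum>k\<in>S. (LINT x|cube_lborel. (w' x * F m x) * e k x)\<^sup>2)"
    by (intro sum.cong refl coeff[symmetric])
  also have "\<dots> \<le> (LINT x|cube_lborel. (w' x * F m x)\<^sup>2)"
    by (rule Bessel_inequality[OF S(1) on wsq[OF F]]) simp
  also have "\<dots> \<le> (LINT x|cube_lborel. (F m x)\<^sup>2)"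
  proof (rule integral_mono)
    show "integrable cube_lborel (\<lambda>x. (w' x * F m x)\<^sup>2)" using wsq[OF F[of m]] by (simp add: sqint_def)
    show "integrable cube_lborel (\<lambda>x. (F m x)\<^sup>2)" using F[of m] by (simp add: sqint_def)
    show "(w' x * F m x)\<^sup>2 \<le> (F m x)\<^sup>2" if "x \<in> space cube_lborel" for x
      using w1[of x] that by (auto simp: power_mult_distrib intro!: mult_left_le_one_le power_le_one)
  qed
  finally show ?thesis unfolding lam_def .
qed

definition max_index :: "('d::finite \<Rightarrow> nat) \<Rightarrow> nat" where
  "max_index k = Max (range k)"

lemma max_index_ge: "k i \<le> max_index k"
  unfolding max_index_def by (intro Max_ge) auto

lemma max_index_attained: "\<exists>i. k i = max_index k"
proof -
  have "max_index k \<in> range k" unfolding max_index_def by (intro Max_in) auto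
  then show ?thesis by auto
qed

text \<open>
  Each factor \<open>(n - l) (n + l + 1)\<close> with \<open>l < m \<le> n\<close> is of order \<open>n\<^sup>2\<close>, because \<open>n \<le> m (n - l)\<close>.
\<close>

lemma legendre_eig_prod_lower:
  assumes "m \<le> n" "1 \<le> m"
  shows "(1 + real n) ^ (2 * m) \<le> (4 * real m) ^ m * (\<Prod>l<m. legendre_eig n l)"
proof -
  have "(1 + real n)\<^sup>2 \<le> (4 * real m) * legendre_eig n l" if "l < m" for l
  proof -
    have l: "real l \<le> real m - 1" using that by linarith
    have nm: "real n \<ge> real m" "real m \<ge> 1" using assms by auto
    have "real n \<le> real m * (real n - real l)"
    proof -
      have "real m * (real n - real l) \<ge> real m * (real n - (real m - 1))" using l nm by (intro mult_left_mono) auto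
      moreover have "real m * (real n - (real m - 1)) - real n = (real m - 1) * (real n - real m)" by (simp add: algebra_simps)
      moreover have "(real m - 1) * (real n - real m) \<ge> 0" using nm by simp
      ultimately show ?thesis by linarith
    qed
    then have "real n * (real n + real l + 1) \<le> (real m * (real n - real l)) * (real n + real l + 1)"
      by (intro mult_right_mono) auto
    also have "\<dots> = real m * legendre_eig n l" by (simp add: legendre_eig_def algebra_simps)
    finally have *: "real n * (real n + real l + 1) \<le> real m * legendre_eig n l" .
    have "(1 + real n)\<^sup>2 \<le> (2 * real n) * (2 * (real n + real l + 1))"
      unfolding power2_eq_square using nm by (intro mult_mono) auto
    with * show ?thesis by linarith
  qed
  then have "(\<Prod>l<m. (1 + real n)\<^sup>2) \<le> (\<Prod>l<m. (4 * real m) * legendre_eig n l)"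
    by (intro prod_mono) auto
  then show ?thesis by (simp add: prod.distrib power_mult)
qed

text \<open>
  The function agrees almost everywhere with its weak derivative of order zero, hence it inherits the
  square integrability that the class requires of the derivatives.
\<close>

lemma sobolev_classE:
  assumes "f \<in> sobolev_class m R"
  obtains D where "\<forall>\<gamma>. multi_order \<gamma> \<le> m \<longrightarrow> weak_deriv (interior unit_cube) \<gamma> f (D \<gamma>) \<and>
      sqint cube_lborel (D \<gamma>) \<and> (LINT x|cube_lborel. (D \<gamma> x)\<^sup>2) \<le> R\<^sup>2"
    "R \<ge> 0" "AE x in cube_lborel. f x = D (\<lambda>_. 0) x" "sqint cube_lborel f"
proof -
  from assms obtain D where D: "\<And>\<gamma>. \<gamma> \<in> multi_indices m \<Longrightarrow> weak_deriv (interior unit_cube) \<gamma> f (D \<gamma>)"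
    "\<And>\<gamma>. \<gamma> \<in> multi_indices m \<Longrightarrow> square_integrable (D \<gamma>)"
    "sqrt (\<Sum>\<gamma>\<in>multi_indices m. (L2_norm (D \<gamma>))\<^sup>2) \<le> R"
    and f: "f \<in> borel_measurable cube_lborel"
    unfolding sobolev_class_def by blast
  have R: "R \<ge> 0" using D(3) by (meson order_trans real_sqrt_ge_zero sum_nonneg zero_le_power2)
  have *: "(LINT x|cube_lborel. (D \<gamma> x)\<^sup>2) \<le> R\<^sup>2" if "multi_order \<gamma> \<le> m" for \<gamma>
  proof -
    have "(LINT x|cube_lborel. (D \<gamma> x)\<^sup>2) = (L2_norm (D \<gamma>))\<^sup>2" by (simp add: L2_norm_def)
    also have "\<dots> \<le> (\<Sum>\<gamma>\<in>multi_indices m. (L2_norm (D \<gamma>))\<^sup>2)"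
    proof (rule member_le_sum[where f="\<lambda>\<gamma>. (L2_norm (D \<gamma>))\<^sup>2"])
      show "\<gamma> \<in> multi_indices m" using that by (simp add: multi_indices_def)
    qed auto
    also have "\<dots> \<le> R\<^sup>2" using D(3) R by (metis real_le_lsqrt real_sqrt_le_iff real_sqrt_abs abs_of_nonneg)
    finally show ?thesis .
  qed
  have 0: "(\<lambda>_. 0) \<in> multi_indices m" by (simp add: multi_indices_def multi_order_def)
  have ae: "AE x in cube_lborel. f x = D (\<lambda>_. 0) x" by (rule fundamental_lemma[OF D(1)[OF 0]])
  have s0: "sqint cube_lborel (D (\<lambda>_. 0))" using D(2)[OF 0] by (simp add: sqint_iff_square_integrable)
  have "integrable cube_lborel (\<lambda>x. (f x)\<^sup>2) \<longleftrightarrow> integrable cube_lborel (\<lambda>x. (D (\<lambda>_. 0) x)\<^sup>2)"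
    using f s0 ae by (intro integrable_cong_AE) (auto simp: sqint_def)
  then have "sqint cube_lborel f" using f s0 by (simp add: sqint_def)
  with that[of D] D * R ae show ?thesis by (simp add: multi_indices_def sqint_iff_square_integrable)
qed

text \<open>
  For each \<open>k\<close> some coordinate attains the maximal index. If that index is at least \<open>m\<close>, the weight is
  controlled by the eigenvalue product of that coordinate; otherwise it is bounded by a constant. So
  the sum is dominated by Bessel's inequality for \<open>f\<close> and one weighted Bessel inequality per coordinate.
\<close>

lemma sobolev_coeff_decay:
  "\<exists>C>0. \<forall>R. \<forall>f\<in>sobolev_class m R. \<forall>S :: ('d::finite \<Rightarrow> nat) set. finite S \<longrightarrow>
     (\<Sum>k\<in>S. (1 + real (max_index k)) ^ (2 * m) * (coeff_fun f k)\<^sup>2) \<le> C * R\<^sup>2"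
proof -
  \<comment> \<open>The first summand covers maximal indices below \<open>m\<close>, the second those from \<open>m\<close> on.\<close>
  define A where "A = (1 + real m) ^ (2 * m) + (4 * real m) ^ m + 1"
  have A: "A > 0" unfolding A_def by (intro add_nonneg_pos add_nonneg_nonneg) auto
  define C where "C = A * (1 + real CARD('d))"
  have "(\<Sum>k\<in>S. (1 + real (max_index k)) ^ (2 * m) * (coeff_fun f k)\<^sup>2) \<le> C * R\<^sup>2"
    if f: "f \<in> sobolev_class m R" and S: "finite S" for R f and S :: "('d \<Rightarrow> nat) set"
  proof -
    obtain D where D': "\<forall>\<gamma>. multi_order \<gamma> \<le> m \<longrightarrow> weak_deriv (interior unit_cube) \<gamma> f (D \<gamma>) \<and>
      sqint cube_lborel (D \<gamma>) \<and> (LINT x|cube_lborel. (D \<gamma> x)\<^sup>2) \<le> R\<^sup>2"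
      and ae: "AE x in cube_lborel. f x = D (\<lambda>_. 0) x" and sf: "sqint cube_lborel f"
      using sobolev_classE[OF f] by blast
    have D: "weak_deriv (interior unit_cube) \<gamma> f (D \<gamma>)" "sqint cube_lborel (D \<gamma>)"
      "(LINT x|cube_lborel. (D \<gamma> x)\<^sup>2) \<le> R\<^sup>2" if "multi_order \<gamma> \<le> m" for \<gamma>
      using D' that by auto
    have o: "multi_order ((\<lambda>_. 0)(i := j)) = j" for i :: 'd and j by (simp add: multi_order_def)
    have o0: "(\<lambda>_. 0)(i := 0) = (\<lambda>_. 0 :: nat)" for i :: 'd by auto
    have ceq: "coeff_fun f k = coeff_fun (D (\<lambda>_. 0)) k" for k
      using ae sf D(2)[of "\<lambda>_. 0"]
      by (intro integral_cong_AE) (auto simp: sqint_def multi_order_def)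
    have W: "(\<Sum>k\<in>{k\<in>S. m \<le> k i}. (\<Prod>l<m. legendre_eig (k i) l) * (coeff_fun f k)\<^sup>2) \<le> R\<^sup>2" for i
    proof -
      have "(\<Sum>k\<in>{k\<in>S. m \<le> k i}. (\<Prod>l<m. legendre_eig (k i) l) * (coeff_fun (D ((\<lambda>_. 0)(i := 0))) k)\<^sup>2) \<le>
          (LINT x|cube_lborel. (D ((\<lambda>_. 0)(i := m)) x)\<^sup>2)"
      proof (rule weighted_Bessel[where f=f and F="\<lambda>j. D ((\<lambda>_. 0)(i := j))"])
        fix j assume "j \<le> m"
        then show "weak_deriv (interior unit_cube) ((\<lambda>_. 0)(i := j)) f (D ((\<lambda>_. 0)(i := j)))"
          "sqint cube_lborel (D ((\<lambda>_. 0)(i := j)))"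
          by (intro D; simp only: o)+
      qed (use S in auto)
      also have "\<dots> \<le> R\<^sup>2" by (intro D; simp only: o)
      finally show ?thesis unfolding o0 ceq .
    qed
    have B: "(\<Sum>k\<in>S. (coeff_fun f k)\<^sup>2) \<le> R\<^sup>2"
    proof -
      have "(\<Sum>k\<in>S. (coeff_fun (D (\<lambda>_. 0)) k)\<^sup>2) \<le> (LINT x|cube_lborel. (D (\<lambda>_. 0) x)\<^sup>2)"
        by (intro Bessel_inequality S orthonormal_legendre_basis D(2)) (simp add: multi_order_def)
      also have "\<dots> \<le> R\<^sup>2" by (intro D(3)) (simp add: multi_order_def)
      finally show ?thesis unfolding ceq .
    qed
    \<comment> \<open>For indices below \<open>m\<close> the eigenvalue product contains a zero factor.\<close>
    define L where "L = (\<lambda>(k :: 'd \<Rightarrow> nat) i. if m \<le> k i then \<Prod>l<m. legendre_eig (k i) l else 0)"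
    have L0: "L k i \<ge> 0" for k i
      unfolding L_def by (auto intro!: prod_nonneg less_imp_le[OF legendre_eig_pos])
    have pt: "(1 + real (max_index k)) ^ (2 * m) \<le> A * (1 + (\<Sum>i\<in>UNIV. L k i))" for k :: "'d \<Rightarrow> nat"
    proof (cases "m \<le> max_index k \<and> 1 \<le> m")
      case True
      obtain i where i: "k i = max_index k" using max_index_attained by blast
      have "(1 + real (max_index k)) ^ (2 * m) \<le> (4 * real m) ^ m * L k i"
        using legendre_eig_prod_lower[of m "k i"] True i by (simp add: L_def)
      also have "\<dots> \<le> A * (1 + (\<Sum>i\<in>UNIV. L k i))"
      proof (rule mult_mono)
        have "L k i \<le> (\<Sum>i\<in>UNIV. L k i)" by (intro member_le_sum) (auto simp: L0)
        then show "L k i \<le> 1 + (\<Sum>i\<in>UNIV. L k i)" by simp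
        show "(4 * real m) ^ m \<le> A" by (simp add: A_def)
      qed (use A L0 in auto)
      finally show ?thesis .
    next
      case False
      then have "(1 + real (max_index k)) ^ (2 * m) \<le> (1 + real m) ^ (2 * m)"
        by (cases "m = 0") (auto intro!: power_mono)
      also have "\<dots> \<le> A" by (simp add: A_def)
      also have "\<dots> \<le> A * (1 + (\<Sum>i\<in>UNIV. L k i))" using A L0 by (simp add: sum_nonneg)
      finally show ?thesis .
    qed
    have "(\<Sum>k\<in>S. (1 + real (max_index k)) ^ (2 * m) * (coeff_fun f k)\<^sup>2) \<le>
        (\<Sum>k\<in>S. (A * (1 + (\<Sum>i\<in>UNIV. L k i))) * (coeff_fun f k)\<^sup>2)"
      by (intro sum_mono mult_right_mono pt) auto
    also have "\<dots> = A * ((\<Sum>k\<in>S. (coeff_fun f k)\<^sup>2) + (\<Sum>i\<in>UNIV. \<Sum>k\<in>S. L k i * (coeff_fun f k)\<^sup>2))"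
      by (subst sum.swap) (simp add: sum_distrib_left sum_distrib_right sum.distrib algebra_simps)
    also have "\<dots> \<le> A * (R\<^sup>2 + (\<Sum>i\<in>(UNIV :: 'd set). R\<^sup>2))"
    proof (intro mult_left_mono add_mono B sum_mono)
      fix i
      have "(\<Sum>k\<in>S. L k i * (coeff_fun f k)\<^sup>2) = (\<Sum>k\<in>{k\<in>S. m \<le> k i}. (\<Prod>l<m. legendre_eig (k i) l) * (coeff_fun f k)\<^sup>2)"
        using S by (subst sum.inter_filter) (auto simp: L_def intro!: sum.cong)
      then show "(\<Sum>k\<in>S. L k i * (coeff_fun f k)\<^sup>2) \<le> R\<^sup>2" using W[of i] by simp
    qed (use A in auto)
    also have "\<dots> = C * R\<^sup>2" by (simp add: C_def algebra_simps)
    finally show ?thesis .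
  qed
  moreover have "C > 0" unfolding C_def using A by (intro mult_pos_pos add_pos_nonneg) auto
  ultimately show ?thesis by blast
qed

section \<open>Density of polynomials and Parseval's identity\<close>

text \<open>
  The grid \<open>{0..<N}\<close> in each coordinate. It indexes the low frequencies in the upper bound and the
  cells of the partition of the cube in the lower bound.
\<close>

definition index_box :: "nat \<Rightarrow> ('d::finite \<Rightarrow> nat) set" where
  "index_box N = {k. max_index k < N}"

lemma index_box_PiE: "index_box N = (\<Pi>\<^sub>E i\<in>(UNIV :: 'd::finite set). {..<N})"
proof -
  have "k \<in> index_box N \<longleftrightarrow> (\<forall>i. k i < N)" for k :: "'d \<Rightarrow> nat"
    using max_index_ge[of k] max_index_attained[of k] unfolding index_box_def
    by (metis le_less_trans mem_Collect_eq)
  then show ?thesis by auto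
qed

lemma finite_index_box [simp]: "finite (index_box N)"
  unfolding index_box_PiE by (intro finite_PiE) auto

lemma index_box_mono: "N \<le> N' \<Longrightarrow> index_box N \<subseteq> index_box N'"
  by (auto simp: index_box_def)

text \<open>
  The polynomial functions on the cube, in the form in which Parseval's identity uses them.
\<close>

definition poly_span :: "(real ^ 'd::finite \<Rightarrow> real) set" where
  "poly_span = {g. \<exists>N a. g = (\<lambda>x. \<Sum>k\<in>index_box N. a k * legendre_basis k x)}"

lemma poly_span_sum_extend:
  assumes "N \<le> N'"
  shows "(\<Sum>k\<in>index_box N. a k * legendre_basis k x) =
    (\<Sum>k\<in>index_box N'. (if k \<in> index_box N then a k else 0) * legendre_basis k x)"
  using index_box_mono[OF assms] by (intro sum.mono_neutral_cong_left) auto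

lemma poly_span_cmult: "g \<in> poly_span \<Longrightarrow> (\<lambda>x. c * g x) \<in> poly_span"
proof -
  assume "g \<in> poly_span"
  then obtain N a where "g = (\<lambda>x. \<Sum>k\<in>index_box N. a k * legendre_basis k x)" by (auto simp: poly_span_def)
  then have "(\<lambda>x. c * g x) = (\<lambda>x. \<Sum>k\<in>index_box N. (c * a k) * legendre_basis k x)"
    by (simp add: sum_distrib_left mult_ac)
  then show ?thesis unfolding poly_span_def mem_Collect_eq by (intro exI)
qed

lemma poly_span_add:
  assumes "g \<in> poly_span" "h \<in> poly_span" shows "(\<lambda>x. g x + h x) \<in> poly_span"
proof -
  obtain N a where g: "g = (\<lambda>x. \<Sum>k\<in>index_box N. a k * legendre_basis k x)" using assms by (auto simp: poly_span_def)
  obtain N' b where h: "h = (\<lambda>x. \<Sum>k\<in>index_box N'. b k * legendre_basis k x)" using assms by (auto simp: poly_span_def)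
  define M where "M = max N N'"
  have "(\<lambda>x. g x + h x) = (\<lambda>x. \<Sum>k\<in>index_box M. ((if k \<in> index_box N then a k else 0) +
      (if k \<in> index_box N' then b k else 0)) * legendre_basis k x)"
    unfolding g h using poly_span_sum_extend[of N M a] poly_span_sum_extend[of N' M b]
    by (auto simp: M_def sum.distrib distrib_right)
  then show ?thesis unfolding poly_span_def mem_Collect_eq by (intro exI)
qed

lemma poly_span_zero: "(\<lambda>x. 0) \<in> poly_span"
  unfolding poly_span_def by (auto intro!: exI[of _ 0] exI[of _ "\<lambda>_. 0"])

lemma poly_span_sum: "(\<And>k. k \<in> S \<Longrightarrow> g k \<in> poly_span) \<Longrightarrow> (\<lambda>x. \<Sum>k\<in>S. a k * g k x) \<in> poly_span"
proof (induction S rule: infinite_finite_induct)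
  case (insert j F)
  have "(\<lambda>x. a j * g j x + (\<Sum>k\<in>F. a k * g k x)) \<in> poly_span"
    by (rule poly_span_add[OF poly_span_cmult insert.IH]) (use insert.prems in auto)
  then show ?case using insert.hyps by simp
qed (auto simp: poly_span_zero)

lemma poly_span_tensor: "tensor (\<lambda>i. poly (p i)) \<in> poly_span" for p :: "'d::finite \<Rightarrow> real poly"
proof -
  define N where "N = Max (range (\<lambda>i. degree (p i)))"
  have "degree (p i) \<le> N" for i unfolding N_def by (intro Max_ge) auto
  then have "\<exists>a. p i = (\<Sum>k\<le>N. smult (a k) (phi k))" for i by (rule phi_span)
  then have "\<forall>i. \<exists>a. p i = (\<Sum>k\<le>N. smult (a k) (phi k))" by blast
  then obtain a where a: "\<forall>i. p i = (\<Sum>k\<le>N. smult (a i k) (phi k))" by (rule choice[THEN exE])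
  have "tensor (\<lambda>i. poly (p i)) = (\<lambda>x. \<Sum>k\<in>index_box (Suc N). (\<Prod>i\<in>UNIV. a i (k i)) * legendre_basis k x)"
  proof
    fix x :: "real ^ 'd"
    have "tensor (\<lambda>i. poly (p i)) x = (\<Prod>i\<in>UNIV. \<Sum>j<Suc N. a i j * poly (phi j) (x $ i))"
      unfolding tensor_def using a by (simp add: poly_sum lessThan_Suc_atMost)
    also have "\<dots> = (\<Sum>k\<in>(\<Pi>\<^sub>E i\<in>UNIV. {..<Suc N}). \<Prod>i\<in>UNIV. a i (k i) * poly (phi (k i)) (x $ i))"
      by (subst prod_sum_PiE) auto
    finally show "tensor (\<lambda>i. poly (p i)) x = (\<Sum>k\<in>index_box (Suc N). (\<Prod>i\<in>UNIV. a i (k i)) * legendre_basis k x)"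
      unfolding index_box_PiE by (simp add: prod.distrib legendre_basis_def tensor_def)
  qed
  then show ?thesis unfolding poly_span_def mem_Collect_eq by (intro exI)
qed

text \<open>
  A product of two basis functions is a tensor product of polynomials, and each factor of it expands in
  Legendre polynomials of its own coordinate.
\<close>

lemma poly_span_mult:
  assumes "g \<in> poly_span" "h \<in> poly_span" shows "(\<lambda>x. g x * h x) \<in> poly_span"
proof -
  obtain N a where g: "g = (\<lambda>x. \<Sum>k\<in>index_box N. a k * legendre_basis k x)" using assms by (auto simp: poly_span_def)
  obtain N' b where h: "h = (\<lambda>x. \<Sum>k\<in>index_box N'. b k * legendre_basis k x)" using assms by (auto simp: poly_span_def)
  have 1: "(\<lambda>x. legendre_basis k x * legendre_basis l x) \<in> poly_span" for k l :: "'a \<Rightarrow> nat"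
    unfolding legendre_basis_def tensor_poly_mult by (rule poly_span_tensor)
  have "(\<lambda>x. g x * h x) = (\<lambda>x. \<Sum>k\<in>index_box N. a k * (\<Sum>l\<in>index_box N'. b l * (legendre_basis k x * legendre_basis l x)))"
    unfolding g h by (subst sum_product) (simp add: sum_distrib_left mult_ac)
  also have "\<dots> \<in> poly_span" by (intro poly_span_sum 1)
  finally show ?thesis .
qed

lemma poly_span_const: "(\<lambda>x :: real ^ 'd::finite. c) \<in> poly_span"
proof -
  have "tensor (\<lambda>i::'d. poly 1) = (\<lambda>x. 1 :: real)" by (auto simp: tensor_def)
  then show ?thesis using poly_span_cmult[OF poly_span_tensor[of "\<lambda>_::'d. 1"], of c] by simp
qed

lemma poly_span_coord: "(\<lambda>x. x $ i) \<in> poly_span"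
proof -
  have "tensor (\<lambda>l. poly (((\<lambda>_. 1)(i := [:0,1:])) l)) x = x $ i" for x
    unfolding tensor_upd by simp
  then have "tensor (\<lambda>l. poly (((\<lambda>_. 1)(i := [:0,1:])) l)) = (\<lambda>x. x $ i)" by blast
  then show ?thesis using poly_span_tensor[of "(\<lambda>_. 1)(i := [:0,1:])"] by simp
qed

lemma real_polynomial_function_poly_span:
  fixes g :: "real ^ 'd::finite \<Rightarrow> real"
  assumes "real_polynomial_function g" shows "g \<in> poly_span"
  using assms
proof (induction rule: real_polynomial_function.induct)
  case (linear f)
  interpret f: bounded_linear f by fact
  have "f x = (\<Sum>i\<in>UNIV. f (axis i 1) * (x $ i))" for x
  proof -
    have "f x = f (\<Sum>i\<in>UNIV. (x $ i) *\<^sub>R axis i 1)"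
      using basis_expansion[of x] by (simp add: scalar_mult_eq_scaleR)
    then show ?thesis by (simp add: f.sum f.scaleR mult.commute)
  qed
  then have "f = (\<lambda>x. \<Sum>i\<in>UNIV. f (axis i 1) * (x $ i))" by blast
  then show ?case using poly_span_sum[of UNIV "\<lambda>i x. x $ i" "\<lambda>i. f (axis i 1)"] poly_span_coord by metis
qed (auto intro: poly_span_const poly_span_add poly_span_mult)

lemma poly_span_sqint: "g \<in> poly_span \<Longrightarrow> sqint cube_lborel g"
  using orthonormal_legendre_basis by (auto simp: poly_span_def orthonormal_def intro!: sqint_sum)

text \<open>Membership in the \<open>L\<^sup>2\<close> closure of the polynomials.\<close>

definition poly_approximable :: "(real ^ 'd::finite \<Rightarrow> real) \<Rightarrow> bool" where
  "poly_approximable u \<longleftrightarrow> sqint cube_lborel u \<and>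
     (\<forall>\<epsilon>>0. \<exists>g\<in>poly_span. (LINT x|cube_lborel. (u x - g x)\<^sup>2) < \<epsilon>)"

lemma integral_square_diff_triangle:
  assumes "sqint M u" "sqint M v" "sqint M g"
  shows "(LINT x|M. (u x - g x)\<^sup>2) \<le> 2 * (LINT x|M. (u x - v x)\<^sup>2) + 2 * (LINT x|M. (v x - g x)\<^sup>2)"
proof -
  have i: "integrable M (\<lambda>x. (u x - v x)\<^sup>2)" "integrable M (\<lambda>x. (v x - g x)\<^sup>2)" "integrable M (\<lambda>x. (u x - g x)\<^sup>2)"
    using sqint_diff assms by (auto simp: sqint_def)
  have "(a - c)\<^sup>2 \<le> 2 * (a - b)\<^sup>2 + 2 * (b - c)\<^sup>2" for a b c :: real
  proof -
    have "2 * (a - b)\<^sup>2 + 2 * (b - c)\<^sup>2 - (a - c)\<^sup>2 = (a - 2 * b + c)\<^sup>2" by (simp add: power2_eq_square algebra_simps)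
    then show ?thesis by (metis diff_ge_0_iff_ge zero_le_power2)
  qed
  then have "(LINT x|M. (u x - g x)\<^sup>2) \<le> (LINT x|M. 2 * (u x - v x)\<^sup>2 + 2 * (v x - g x)\<^sup>2)"
    using i by (intro integral_mono) auto
  also have "\<dots> = 2 * (LINT x|M. (u x - v x)\<^sup>2) + 2 * (LINT x|M. (v x - g x)\<^sup>2)"
    using i by simp
  finally show ?thesis .
qed

lemma poly_approximable_closed:
  assumes "sqint cube_lborel u"
    and "\<And>\<epsilon>. \<epsilon> > 0 \<Longrightarrow> \<exists>v. poly_approximable v \<and> (LINT x|cube_lborel. (u x - v x)\<^sup>2) < \<epsilon>"
  shows "poly_approximable u"
  unfolding poly_approximable_def
proof (intro conjI allI impI assms(1))
  fix \<epsilon> :: real assume e: "\<epsilon> > 0"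
  obtain v where v: "poly_approximable v" "(LINT x|cube_lborel. (u x - v x)\<^sup>2) < \<epsilon> / 4" using assms(2)[of "\<epsilon> / 4"] e by auto
  then obtain g where g: "g \<in> poly_span" "(LINT x|cube_lborel. (v x - g x)\<^sup>2) < \<epsilon> / 4"
    using e unfolding poly_approximable_def by (meson zero_less_divide_iff zero_less_numeral)
  have "(LINT x|cube_lborel. (u x - g x)\<^sup>2) < \<epsilon>"
    using integral_square_diff_triangle[OF assms(1), of v g] v g poly_span_sqint[OF g(1)]
    unfolding poly_approximable_def by linarith
  then show "\<exists>g\<in>poly_span. (LINT x|cube_lborel. (u x - g x)\<^sup>2) < \<epsilon>" using g by blast
qed

lemma poly_approximable_cmult:
  assumes "poly_approximable u" shows "poly_approximable (\<lambda>x. c * u x)"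
  unfolding poly_approximable_def
proof (intro conjI allI impI)
  show "sqint cube_lborel (\<lambda>x. c * u x)" using assms by (auto simp: poly_approximable_def intro: sqint_cmult)
  fix \<epsilon> :: real assume e: "\<epsilon> > 0"
  have pos: "\<epsilon> / (c\<^sup>2 + 1) > 0" using e by (intro divide_pos_pos add_nonneg_pos) auto
  obtain g where g: "g \<in> poly_span" "(LINT x|cube_lborel. (u x - g x)\<^sup>2) < \<epsilon> / (c\<^sup>2 + 1)"
    using assms pos unfolding poly_approximable_def by blast
  have "(LINT x|cube_lborel. (c * u x - c * g x)\<^sup>2) = c\<^sup>2 * (LINT x|cube_lborel. (u x - g x)\<^sup>2)"
    by (simp flip: right_diff_distrib add: power_mult_distrib)
  also have "\<dots> \<le> c\<^sup>2 * (\<epsilon> / (c\<^sup>2 + 1))" using g by (intro mult_left_mono) auto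
  also have "\<dots> < \<epsilon>"
  proof -
    have "c\<^sup>2 + 1 > 0" by (intro add_nonneg_pos) auto
    then show ?thesis using e by (simp add: field_simps)
  qed
  finally show "\<exists>g\<in>poly_span. (LINT x|cube_lborel. (c * u x - g x)\<^sup>2) < \<epsilon>"
    using poly_span_cmult[OF g(1), of c] by (intro bexI[of _ "\<lambda>x. c * g x"])
qed

lemma poly_approximable_add:
  assumes u: "poly_approximable u" and v: "poly_approximable v"
  shows "poly_approximable (\<lambda>x. u x + v x)"
  unfolding poly_approximable_def
proof (intro conjI allI impI)
  have s: "sqint cube_lborel u" "sqint cube_lborel v" using u v by (auto simp: poly_approximable_def)
  then show uv: "sqint cube_lborel (\<lambda>x. u x + v x)" by (rule sqint_add)
  fix \<epsilon> :: real assume e: "\<epsilon> > 0"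
  obtain g where g: "g \<in> poly_span" "(LINT x|cube_lborel. (u x - g x)\<^sup>2) < \<epsilon> / 4"
    using u e unfolding poly_approximable_def by (meson zero_less_divide_iff zero_less_numeral)
  obtain h where h: "h \<in> poly_span" "(LINT x|cube_lborel. (v x - h x)\<^sup>2) < \<epsilon> / 4"
    using v e unfolding poly_approximable_def by (meson zero_less_divide_iff zero_less_numeral)
  have "(LINT x|cube_lborel. (u x + v x - (g x + h x))\<^sup>2) \<le>
     2 * (LINT x|cube_lborel. (u x + v x - (g x + v x))\<^sup>2) + 2 * (LINT x|cube_lborel. (g x + v x - (g x + h x))\<^sup>2)"
    by (intro integral_square_diff_triangle sqint_add s poly_span_sqint g h)
  also have "\<dots> < \<epsilon>" using g h by simp
  finally show "\<exists>g\<in>poly_span. (LINT x|cube_lborel. (u x + v x - g x)\<^sup>2) < \<epsilon>"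
    using poly_span_add[OF g(1) h(1)] by (intro bexI[of _ "\<lambda>x. g x + h x"])
qed

text \<open>
  The Stone-Weierstrass theorem: uniform approximation on the cube is \<open>L\<^sup>2\<close> approximation, since the
  cube has measure one.
\<close>

lemma poly_approximable_continuous:
  assumes c: "continuous_on UNIV u" shows "poly_approximable u"
  unfolding poly_approximable_def
proof (intro conjI allI impI)
  interpret prob_space "cube_lborel :: (real ^ 'a) measure" by (rule prob_space_cube)
  have cu: "continuous_on unit_cube u" using c continuous_on_subset by blast
  have cpt: "compact (unit_cube :: (real ^ 'a) set)" unfolding unit_cube_eq_cbox by simp
  obtain B where B: "\<And>x. x \<in> unit_cube \<Longrightarrow> \<bar>u x\<bar> \<le> B"
    using compact_imp_bounded[OF compact_continuous_image[OF cu cpt]] by (auto simp: bounded_iff)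
  show s: "sqint cube_lborel u"
    using c B by (intro sqint_bounded[where B=B] borel_measurable_cube borel_measurable_continuous_onI) (auto intro: finite_measure_cube)
  fix \<epsilon> :: real assume e: "\<epsilon> > 0"
  define \<delta> where "\<delta> = sqrt (\<epsilon> / 2)"
  have d: "\<delta> > 0" "\<delta>\<^sup>2 = \<epsilon> / 2" using e by (auto simp: \<delta>_def)
  obtain g where g: "real_polynomial_function g" "\<And>x. x \<in> unit_cube \<Longrightarrow> \<bar>u x - g x\<bar> < \<delta>"
    using Stone_Weierstrass_real_polynomial_function[OF cpt cu d(1)] by metis
  have gs: "g \<in> poly_span" by (rule real_polynomial_function_poly_span[OF g(1)])
  have "(LINT x|cube_lborel. (u x - g x)\<^sup>2) \<le> (LINT x|(cube_lborel :: (real ^ 'a) measure). \<delta>\<^sup>2)"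
  proof (rule integral_mono)
    show "integrable cube_lborel (\<lambda>x. (u x - g x)\<^sup>2)" using sqint_diff[OF s poly_span_sqint[OF gs]] by (simp add: sqint_def)
    show "(u x - g x)\<^sup>2 \<le> \<delta>\<^sup>2" if "x \<in> space cube_lborel" for x
      using g(2)[of x] that d(1) by (simp add: abs_le_square_iff[symmetric])
  qed auto
  also have "\<dots> < \<epsilon>" using d e prob_space by simp
  finally show "\<exists>g\<in>poly_span. (LINT x|cube_lborel. (u x - g x)\<^sup>2) < \<epsilon>" using gs by blast
qed

text \<open>
  Between a closed subset and an open superset of almost the same measure, Urysohn's lemma provides a
  continuous function.
\<close>

lemma poly_approximable_indicator:
  assumes A: "A \<in> sets (cube_lborel :: (real ^ 'd::finite) measure)"
  shows "poly_approximable (indicator A)"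
proof (rule poly_approximable_closed)
  interpret prob_space "cube_lborel :: (real ^ 'd) measure" by (rule prob_space_cube)
  have Ab: "A \<in> sets borel" using A unfolding cube_lborel_def by (auto simp: sets_restrict_space_iff)
  show s: "sqint cube_lborel (indicator A :: _ \<Rightarrow> real)"
    using A by (intro sqint_bounded[where B=1]) (auto intro: finite_measure_cube simp: indicator_def)
  fix \<epsilon> :: real assume e: "\<epsilon> > 0"
  have Al: "A \<in> sets lebesgue" using Ab by simp
  obtain U where U: "open U" "A \<subseteq> U" "U - A \<in> lmeasurable" "emeasure lebesgue (U - A) < ennreal (\<epsilon> / 2)"
    using sets_lebesgue_outer_open[OF Al, of "\<epsilon> / 2"] e by auto
  obtain K where K: "closed K" "K \<subseteq> A" "A - K \<in> lmeasurable" "emeasure lebesgue (A - K) < ennreal (\<epsilon> / 2)"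
    using sets_lebesgue_inner_closed[OF Al, of "\<epsilon> / 2"] e by auto
  obtain g :: "real ^ 'd \<Rightarrow> real" where g: "continuous_on UNIV g" "\<And>x. g x \<in> closed_segment 1 0"
    "\<And>x. x \<in> K \<Longrightarrow> g x = 1" "\<And>x. x \<in> - U \<Longrightarrow> g x = 0"
    using Urysohn[of K "- U" 1 "0::real"] K(1,2) U(1,2) by auto
  have g01: "0 \<le> g x" "g x \<le> 1" for x using g(2)[of x] by (auto simp: closed_segment_eq_real_ivl)
  have ga: "poly_approximable g" by (rule poly_approximable_continuous[OF g(1)])
  have UK[measurable]: "U - K \<in> sets borel" using U K by auto
  have "(LINT x|cube_lborel. (indicator A x - g x)\<^sup>2) \<le> (LINT x|cube_lborel. indicator (U - K) x)"
  proof (rule integral_mono)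
    show "integrable cube_lborel (\<lambda>x. (indicator A x - g x)\<^sup>2)"
      using sqint_diff[OF s, of g] ga by (simp add: sqint_def poly_approximable_def)
    show "integrable cube_lborel (\<lambda>x. indicator (U - K) x :: real)"
      by (rule integrable_const_bound[where B=1]) (auto intro!: borel_measurable_cube simp: UK)
    show "(indicator A x - g x)\<^sup>2 \<le> (indicator (U - K) x :: real)" for x
    proof (cases "x \<in> U - K")
      case True
      have "\<bar>indicator A x - g x\<bar> \<le> 1" using g01[of x] by (auto simp: indicator_def)
      then have "(indicator A x - g x)\<^sup>2 \<le> 1" by (simp add: abs_square_le_1)
      with True show ?thesis by simp
    next
      case False
      then show ?thesis using g(3,4)[of x] K(2) U(2) by (auto simp: indicator_def)
    qed
  qed
  also have "\<dots> = measure cube_lborel (unit_cube \<inter> (U - K))"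
    unfolding integral_cube by (simp add: indicator_inter_arith[symmetric] cube_lborel_def measure_restrict_space UK)
  also have "\<dots> = measure lborel (unit_cube \<inter> (U - K))"
    by (simp add: cube_lborel_def measure_restrict_space)
  also have "\<dots> < \<epsilon>"
  proof -
    have "emeasure lborel (unit_cube \<inter> (U - K)) \<le> emeasure lborel (U - K)"
      by (intro emeasure_mono) (auto simp: UK)
    also have "\<dots> = emeasure lborel ((U - A) \<union> (A - K))"
      using U(2) K(2) by (intro arg_cong[where f="emeasure lborel"]) auto
    also have "\<dots> \<le> emeasure lborel (U - A) + emeasure lborel (A - K)"
      using U K Ab by (intro emeasure_subadditive) auto
    also have "\<dots> < ennreal (\<epsilon> / 2) + ennreal (\<epsilon> / 2)"
      using U(4) K(4) U(1) K(1) Ab by (intro add_strict_mono) (auto simp: emeasure_completion)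
    also have "\<dots> = ennreal \<epsilon>" using e by (simp flip: ennreal_plus)
    finally have "emeasure lborel (unit_cube \<inter> (U - K)) < ennreal \<epsilon>" .
    then show ?thesis using e by (metis emeasure_eq_ennreal_measure ennreal_less_iff measure_nonneg order_less_imp_not_less top.not_eq_extremum less_top)
  qed
  finally show "\<exists>v. poly_approximable v \<and> (LINT x|cube_lborel. (indicator A x - v x)\<^sup>2) < \<epsilon>" using ga by blast
qed

lemma sqint_dominated:
  assumes "sqint M v" "u \<in> borel_measurable M" "\<And>x. x \<in> space M \<Longrightarrow> \<bar>u x\<bar> \<le> \<bar>v x\<bar>"
  shows "sqint M u"
proof -
  have "integrable M (\<lambda>x. (u x)\<^sup>2)"
    by (rule Bochner_Integration.integrable_bound[where f="\<lambda>x. (v x)\<^sup>2"])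
       (use assms in \<open>auto simp: sqint_def abs_le_square_iff[symmetric]\<close>)
  then show ?thesis using assms by (simp add: sqint_def)
qed

text \<open>
  The square integrability of the limit is part of the induction formula, since the approximating
  functions have to inherit it from the function that dominates them.
\<close>

lemma poly_approximable_nonneg:
  fixes u :: "real ^ 'd::finite \<Rightarrow> real"
  assumes "u \<in> borel_measurable cube_lborel" "\<And>x. 0 \<le> u x"
  shows "sqint cube_lborel u \<longrightarrow> poly_approximable u"
  using assms
proof (induction rule: borel_measurable_induct_real)
  case (set A)
  then show ?case by (auto intro: poly_approximable_indicator)
next
  case (mult u c)
  show ?case
  proof (cases "c = 0")
    case True
    then show ?thesis using poly_approximable_continuous[of "\<lambda>x :: real ^ 'd. 0 :: real"] by simp
  next
    case False
    show ?thesis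
    proof
      assume "sqint cube_lborel (\<lambda>x. c * u x)"
      from sqint_cmult[OF this, of "1 / c"] False have "sqint cube_lborel u" by simp
      then show "poly_approximable (\<lambda>x. c * u x)" using mult by (auto intro: poly_approximable_cmult)
    qed
  qed
next
  case (add u v)
  show ?case
  proof
    assume s: "sqint cube_lborel (\<lambda>x. v x + u x)"
    have nn: "0 \<le> u x" "0 \<le> v x" for x using add by auto
    have m: "u \<in> borel_measurable cube_lborel" "v \<in> borel_measurable cube_lborel" using add by auto
    have "sqint cube_lborel u" by (rule sqint_dominated[OF s m(1)]) (use nn in auto)
    moreover have "sqint cube_lborel v" by (rule sqint_dominated[OF s m(2)]) (use nn in auto)
    ultimately show "poly_approximable (\<lambda>x. v x + u x)" using add by (auto intro: poly_approximable_add)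
  qed
next
  case (seq U)
  show ?case
  proof
    assume s: "sqint cube_lborel u"
    have um[measurable]: "u \<in> borel_measurable cube_lborel" using s by (simp add: sqint_def)
    have [measurable]: "U i \<in> borel_measurable cube_lborel" for i by (rule seq)
    have U0: "0 \<le> U i x" for i x by (rule seq)
    have inc: "incseq U" by (rule seq)
    have Ulim: "(\<lambda>i. U i x) \<longlonglongrightarrow> u x" if "x \<in> space cube_lborel" for x by (rule seq) fact
    have UP: "sqint cube_lborel (U i) \<longrightarrow> poly_approximable (U i)" for i by (rule seq)
    have le: "U i x \<le> u x" if "x \<in> space cube_lborel" for i x
      using inc Ulim[OF that] by (intro incseq_le) (auto simp: incseq_def le_fun_def)
    have Us: "sqint cube_lborel (U i)" for i
    proof (rule sqint_dominated[OF s])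
      fix x :: "real ^ 'd" assume "x \<in> space cube_lborel"
      from le[OF this, of i] U0[of i x] show "\<bar>U i x\<bar> \<le> \<bar>u x\<bar>" by simp
    qed simp
    have lim: "(\<lambda>i. LINT x|cube_lborel. (u x - U i x)\<^sup>2) \<longlonglongrightarrow> (LINT x|(cube_lborel :: (real ^ 'd) measure). 0)"
    proof (rule integral_dominated_convergence[where w="\<lambda>x. (u x)\<^sup>2"])
      show "integrable cube_lborel (\<lambda>x. (u x)\<^sup>2)" using s by (simp add: sqint_def)
      show "AE x in cube_lborel. (\<lambda>i. (u x - U i x)\<^sup>2) \<longlonglongrightarrow> 0"
      proof (rule AE_I2)
        fix x :: "real ^ 'd" assume "x \<in> space cube_lborel"
        from Ulim[OF this] have "(\<lambda>i. (u x - U i x)\<^sup>2) \<longlonglongrightarrow> (u x - u x)\<^sup>2" by (intro tendsto_intros)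
        then show "(\<lambda>i. (u x - U i x)\<^sup>2) \<longlonglongrightarrow> 0" by simp
      qed
      show "AE x in cube_lborel. norm ((u x - U i x)\<^sup>2) \<le> (u x)\<^sup>2" for i
      proof (rule AE_I2)
        fix x :: "real ^ 'd" assume "x \<in> space cube_lborel"
        from le[OF this, of i] U0[of i x] show "norm ((u x - U i x)\<^sup>2) \<le> (u x)\<^sup>2"
          by (simp add: power_mono)
      qed
    qed measurable
    show "poly_approximable u"
    proof (rule poly_approximable_closed[OF s])
      fix \<epsilon> :: real assume "\<epsilon> > 0"
      with lim have "eventually (\<lambda>i. (LINT x|cube_lborel. (u x - U i x)\<^sup>2) < \<epsilon>) sequentially"
        by (intro order_tendstoD(2)) auto
      then obtain i where "(LINT x|cube_lborel. (u x - U i x)\<^sup>2) < \<epsilon>" by (auto simp: eventually_sequentially)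
      then show "\<exists>v. poly_approximable v \<and> (LINT x|cube_lborel. (u x - v x)\<^sup>2) < \<epsilon>"
        using UP[of i] Us[of i] by blast
    qed
  qed
qed

theorem poly_approximable_sqint:
  assumes s: "sqint cube_lborel u" shows "poly_approximable u"
proof -
  have m[measurable]: "u \<in> borel_measurable cube_lborel" using s by (simp add: sqint_def)
  have "sqint cube_lborel (\<lambda>x. max 0 (u x))" "sqint cube_lborel (\<lambda>x. max 0 (- u x))"
    by (rule sqint_dominated[OF s]; auto)+
  then have "poly_approximable (\<lambda>x. max 0 (u x))" "poly_approximable (\<lambda>x. max 0 (- u x))"
    using poly_approximable_nonneg[of "\<lambda>x. max 0 (u x)"] poly_approximable_nonneg[of "\<lambda>x. max 0 (- u x)"] by auto
  then have "poly_approximable (\<lambda>x. max 0 (u x) + (-1) * max 0 (- u x))"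
    by (intro poly_approximable_add poly_approximable_cmult)
  moreover have "(\<lambda>x. max 0 (u x) + (-1) * max 0 (- u x)) = u" by (auto simp: max_def)
  ultimately show ?thesis by simp
qed

theorem Parseval_cube:
  fixes f u :: "real ^ 'd::finite \<Rightarrow> real"
  assumes f: "sqint cube_lborel f" and u: "sqint cube_lborel u"
  shows "(\<lambda>N. \<Sum>k\<in>index_box N. coeff_fun f k * coeff_fun u k) \<longlonglongrightarrow> (LINT x|cube_lborel. f x * u x)"
proof (rule LIMSEQ_I)
  fix \<epsilon> :: real assume e: "\<epsilon> > 0"
  define B where "B = sqrt (LINT x|cube_lborel. (u x)\<^sup>2)"
  have B: "B \<ge> 0" by (simp add: B_def)
  define \<delta> where "\<delta> = \<epsilon> / (B + 1)"
  have d: "\<delta> > 0" using e B by (simp add: \<delta>_def)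
  have "\<delta>\<^sup>2 > 0" using d by simp
  then obtain g where g: "g \<in> poly_span" "(LINT x|cube_lborel. (f x - g x)\<^sup>2) < \<delta>\<^sup>2"
    using poly_approximable_sqint[OF f] unfolding poly_approximable_def by blast
  then obtain N0 a where ga: "g = (\<lambda>x. \<Sum>k\<in>index_box N0. a k * legendre_basis k x)" by (auto simp: poly_span_def)
  have "norm ((\<Sum>k\<in>index_box N. coeff_fun f k * coeff_fun u k) - (LINT x|cube_lborel. f x * u x)) < \<epsilon>" if N: "N \<ge> N0" for N
  proof -
    have geq: "g = (\<lambda>x. \<Sum>k\<in>index_box N. (if k \<in> index_box N0 then a k else 0) * legendre_basis k x)"
      unfolding ga using poly_span_sum_extend[OF N] by blast
    have "\<bar>(LINT x|cube_lborel. f x * u x) - (\<Sum>k\<in>index_box N. coeff_fun f k * coeff_fun u k)\<bar>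
        \<le> sqrt (LINT x|cube_lborel. (f x - g x)\<^sup>2) * B"
      unfolding B_def geq by (rule Parseval_approx[OF finite_index_box orthonormal_legendre_basis f u])
    also have "\<dots> \<le> \<delta> * B"
      using g(2) d B by (intro mult_right_mono real_le_lsqrt) auto
    also have "\<dots> < \<epsilon>" unfolding \<delta>_def using e B by (simp add: field_simps)
    finally show ?thesis by (simp add: abs_minus_commute)
  qed
  then show "\<exists>no. \<forall>N\<ge>no. norm ((\<Sum>k\<in>index_box N. coeff_fun f k * coeff_fun u k) - (LINT x|cube_lborel. f x * u x)) < \<epsilon>"
    by blast
qed

section \<open>The deterministic part of the upper bound\<close>

text \<open>
  A Sobolev norm of negative order \<open>- \<beta>\<close> of the low frequencies: the dual norm of the weighted
  \<open>l\<^sup>2\<close> norm in which the coefficients of \<open>W\<^sup>\<beta>(1)\<close> are bounded.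
\<close>

definition weighted_dist :: "nat \<Rightarrow> nat \<Rightarrow> (('d::finite \<Rightarrow> nat) \<Rightarrow> real) \<Rightarrow> real" where
  "weighted_dist \<beta> K v = L2_set (\<lambda>k. v k / (1 + real (max_index k)) ^ \<beta>) (index_box K)"

lemma weighted_dist_square:
  "(weighted_dist \<beta> K v)\<^sup>2 = (\<Sum>k\<in>index_box K. (v k)\<^sup>2 / (1 + real (max_index k)) ^ (2 * \<beta>))"
  unfolding weighted_dist_def L2_set_def
  by (simp add: sum_nonneg power_divide power_mult mult.commute)

lemma weighted_dist_nonneg: "0 \<le> weighted_dist \<beta> K v"
  by (simp add: weighted_dist_def)

lemma weighted_dist_triangle:
  "weighted_dist \<beta> K (\<lambda>k. u k - v k) \<le> weighted_dist \<beta> K (\<lambda>k. u k - w k) + weighted_dist \<beta> K (\<lambda>k. v k - w k)"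
proof -
  have "weighted_dist \<beta> K (\<lambda>k. u k - v k) =
     L2_set (\<lambda>k. (u k - w k) / (1 + real (max_index k)) ^ \<beta> + (w k - v k) / (1 + real (max_index k)) ^ \<beta>) (index_box K)"
    unfolding weighted_dist_def by (simp flip: add_divide_distrib)
  also have "\<dots> \<le> weighted_dist \<beta> K (\<lambda>k. u k - w k) + weighted_dist \<beta> K (\<lambda>k. w k - v k)"
    unfolding weighted_dist_def by (rule L2_set_triangle_ineq)
  also have "weighted_dist \<beta> K (\<lambda>k. w k - v k) = weighted_dist \<beta> K (\<lambda>k. v k - w k)"
    unfolding weighted_dist_def L2_set_def by (simp add: power_divide power2_commute)
  finally show ?thesis .
qed

lemma sum_abs_mult_le:
  fixes a b :: "'k \<Rightarrow> real"
  assumes "(\<Sum>k\<in>S. (a k)\<^sup>2) \<le> A" "(\<Sum>k\<in>S. (b k)\<^sup>2) \<le> B"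
  shows "(\<Sum>k\<in>S. \<bar>a k\<bar> * \<bar>b k\<bar>) \<le> sqrt A * sqrt B"
proof -
  have "(\<Sum>k\<in>S. \<bar>a k\<bar> * \<bar>b k\<bar>) \<le> L2_set a S * L2_set b S" by (rule L2_set_mult_ineq)
  also have "\<dots> \<le> sqrt A * sqrt B"
  proof -
    have "0 \<le> (\<Sum>k\<in>S. (a k)\<^sup>2)" "0 \<le> (\<Sum>k\<in>S. (b k)\<^sup>2)" by (intro sum_nonneg; simp)+
    then have "0 \<le> A" using assms(1) by linarith
    then show ?thesis
      unfolding L2_set_def using assms by (intro mult_mono real_sqrt_le_mono real_sqrt_ge_zero) (auto intro: sum_nonneg)
  qed
  finally show ?thesis .
qed

text \<open>
  By Parseval's identity the integral is \<open>\<Sum>\<^sub>k f\<^sub>k (p\<^sub>k - p'\<^sub>k)\<close>. Below \<open>K\<close> the decay of \<open>f\<^sub>k\<close> alone is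
  paired with the weighted distance. Above \<open>K\<close> the decay of \<open>f\<^sub>k\<close> and that of \<open>p\<^sub>k - p'\<^sub>k\<close> are both used,
  and their weights leave a factor \<open>K powr - (\<alpha> + \<beta>)\<close>.
\<close>

lemma integral_difference_bound:
  "\<exists>C>0. \<forall>f\<in>sobolev_class \<beta> 1. \<forall>p\<in>sobolev_class \<alpha> r. \<forall>p'\<in>sobolev_class \<alpha> r. \<forall>K\<ge>1.
     \<bar>LINT x|cube_lborel. f x * (p x - p' x)\<bar> \<le>
       C * (1 / real K ^ (\<alpha> + \<beta>) + weighted_dist \<beta> K (\<lambda>k. coeff_fun p k - coeff_fun p' k))"
proof -
  obtain A where A: "A > 0" "\<And>R f S. f \<in> sobolev_class \<alpha> R \<Longrightarrow> finite S \<Longrightarrow>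
     (\<Sum>k\<in>S. (1 + real (max_index (k :: 'a \<Rightarrow> nat))) ^ (2 * \<alpha>) * (coeff_fun f k)\<^sup>2) \<le> A * R\<^sup>2"
    using sobolev_coeff_decay[of \<alpha>] by blast
  obtain B where B: "B > 0" "\<And>R f S. f \<in> sobolev_class \<beta> R \<Longrightarrow> finite S \<Longrightarrow>
     (\<Sum>k\<in>S. (1 + real (max_index (k :: 'a \<Rightarrow> nat))) ^ (2 * \<beta>) * (coeff_fun f k)\<^sup>2) \<le> B * R\<^sup>2"
    using sobolev_coeff_decay[of \<beta>] by blast
  define C where "C = sqrt B + sqrt B * sqrt (4 * A * r\<^sup>2)"
  have C: "C > 0" unfolding C_def using A B by (intro add_pos_nonneg) auto
  have "\<bar>LINT x|cube_lborel. f x * (p x - p' x)\<bar> \<le>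
       C * (1 / real K ^ (\<alpha> + \<beta>) + weighted_dist \<beta> K (\<lambda>k. coeff_fun p k - coeff_fun p' k))"
    if f: "f \<in> sobolev_class \<beta> 1" and p: "p \<in> sobolev_class \<alpha> r" "p' \<in> sobolev_class \<alpha> r" and K: "K \<ge> 1"
    for f p p' :: "real ^ 'a \<Rightarrow> real" and K
  proof -
    have s: "sqint cube_lborel f" "sqint cube_lborel p" "sqint cube_lborel p'"
      using f p by (auto elim: sobolev_classE)
    define u where "u = (\<lambda>x. p x - p' x)"
    have su: "sqint cube_lborel u" unfolding u_def by (intro sqint_diff s)
    have basis: "sqint cube_lborel (legendre_basis k)" for k :: "'a \<Rightarrow> nat"
      unfolding legendre_basis_def by (rule sqint_tensor_poly)
    have cu: "coeff_fun u k = coeff_fun p k - coeff_fun p' k" for k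
      unfolding u_def using sqint_mult_integrable[OF s(2) basis] sqint_mult_integrable[OF s(3) basis]
      by (simp add: left_diff_distrib)
    define wt where "wt = (\<lambda>k :: 'a \<Rightarrow> nat. 1 + real (max_index k))"
    have wt: "wt k \<ge> 1" for k by (simp add: wt_def)
    have decf: "(\<Sum>k\<in>S. (wt k ^ \<beta> * coeff_fun f k)\<^sup>2) \<le> B" if "finite S" for S
      using B(2)[OF f that] by (simp add: wt_def power_mult_distrib power_mult mult.commute)
    have decu: "(\<Sum>k\<in>S. (wt k ^ \<alpha> * coeff_fun u k)\<^sup>2) \<le> 4 * A * r\<^sup>2" if S: "finite S" for S
    proof -
      have "(wt k ^ \<alpha> * coeff_fun u k)\<^sup>2 \<le> 2 * (wt k ^ (2 * \<alpha>) * (coeff_fun p k)\<^sup>2) + 2 * (wt k ^ (2 * \<alpha>) * (coeff_fun p' k)\<^sup>2)" for k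
      proof -
        have "(a - b)\<^sup>2 \<le> 2 * a\<^sup>2 + 2 * b\<^sup>2" for a b :: real
          using sum_squares_bound[of a "- b"] by (simp add: power2_diff)
        then have "wt k ^ (2 * \<alpha>) * (coeff_fun u k)\<^sup>2 \<le> wt k ^ (2 * \<alpha>) * (2 * (coeff_fun p k)\<^sup>2 + 2 * (coeff_fun p' k)\<^sup>2)"
          unfolding cu using wt[of k] by (intro mult_left_mono) auto
        then show ?thesis by (simp add: power_mult_distrib power_mult[symmetric] mult.commute algebra_simps)
      qed
      then have "(\<Sum>k\<in>S. (wt k ^ \<alpha> * coeff_fun u k)\<^sup>2) \<le>
          (\<Sum>k\<in>S. 2 * (wt k ^ (2 * \<alpha>) * (coeff_fun p k)\<^sup>2) + 2 * (wt k ^ (2 * \<alpha>) * (coeff_fun p' k)\<^sup>2))"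
        by (intro sum_mono)
      also have "\<dots> \<le> 2 * (A * r\<^sup>2) + 2 * (A * r\<^sup>2)"
        using A(2)[OF p(1) S] A(2)[OF p(2) S] by (simp add: sum.distrib sum_distrib_left[symmetric] wt_def)
      finally show ?thesis by simp
    qed
    define D where "D = weighted_dist \<beta> K (\<lambda>k. coeff_fun p k - coeff_fun p' k)"
    have low: "(\<Sum>k\<in>index_box K. \<bar>coeff_fun f k\<bar> * \<bar>coeff_fun u k\<bar>) \<le> sqrt B * D"
    proof -
      have "(\<Sum>k\<in>index_box K. \<bar>coeff_fun f k\<bar> * \<bar>coeff_fun u k\<bar>) =
         (\<Sum>k\<in>index_box K. \<bar>wt k ^ \<beta> * coeff_fun f k\<bar> * \<bar>coeff_fun u k / wt k ^ \<beta>\<bar>)"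
      proof (intro sum.cong refl)
        fix k
        have "wt k \<noteq> 0" using wt[of k] by simp
        then show "\<bar>coeff_fun f k\<bar> * \<bar>coeff_fun u k\<bar> = \<bar>wt k ^ \<beta> * coeff_fun f k\<bar> * \<bar>coeff_fun u k / wt k ^ \<beta>\<bar>"
          by (simp add: abs_mult)
      qed
      also have "\<dots> \<le> sqrt B * sqrt (D\<^sup>2)"
      proof (rule sum_abs_mult_le[OF decf])
        show "(\<Sum>k\<in>index_box K. (coeff_fun u k / wt k ^ \<beta>)\<^sup>2) \<le> D\<^sup>2"
          unfolding D_def weighted_dist_square cu by (simp add: wt_def power_divide power_mult mult.commute)
      qed simp
      also have "sqrt (D\<^sup>2) = D" unfolding D_def by (simp only: real_sqrt_abs abs_of_nonneg[OF weighted_dist_nonneg])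
      finally show ?thesis .
    qed
    have high: "(\<Sum>k\<in>index_box N - index_box K. \<bar>coeff_fun f k\<bar> * \<bar>coeff_fun u k\<bar>) \<le>
        (sqrt B * sqrt (4 * A * r\<^sup>2)) * (1 / real K ^ (\<alpha> + \<beta>))" for N
    proof -
      have "(\<Sum>k\<in>index_box N - index_box K. \<bar>coeff_fun f k\<bar> * \<bar>coeff_fun u k\<bar>) \<le>
         (\<Sum>k\<in>index_box N - index_box K. (\<bar>wt k ^ \<beta> * coeff_fun f k\<bar> * \<bar>wt k ^ \<alpha> * coeff_fun u k\<bar>) * (1 / real K ^ (\<alpha> + \<beta>)))"
      proof (rule sum_mono)
        fix k :: "'a \<Rightarrow> nat" assume "k \<in> index_box N - index_box K"
        then have "real K \<le> wt k" by (auto simp: index_box_def wt_def)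
        then have "real K ^ (\<alpha> + \<beta>) \<le> wt k ^ (\<alpha> + \<beta>)" by (intro power_mono) auto
        moreover have "real K ^ (\<alpha> + \<beta>) > 0" using K by simp
        ultimately have "1 \<le> wt k ^ (\<alpha> + \<beta>) * (1 / real K ^ (\<alpha> + \<beta>))" by (simp add: field_simps)
        then have "(\<bar>coeff_fun f k\<bar> * \<bar>coeff_fun u k\<bar>) * 1 \<le> (\<bar>coeff_fun f k\<bar> * \<bar>coeff_fun u k\<bar>) * (wt k ^ (\<alpha> + \<beta>) * (1 / real K ^ (\<alpha> + \<beta>)))"
          by (intro mult_left_mono) auto
        then show "\<bar>coeff_fun f k\<bar> * \<bar>coeff_fun u k\<bar> \<le> (\<bar>wt k ^ \<beta> * coeff_fun f k\<bar> * \<bar>wt k ^ \<alpha> * coeff_fun u k\<bar>) * (1 / real K ^ (\<alpha> + \<beta>))"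
          using wt[of k] by (simp add: abs_mult power_add mult_ac)
      qed
      also have "\<dots> \<le> (sqrt B * sqrt (4 * A * r\<^sup>2)) * (1 / real K ^ (\<alpha> + \<beta>))"
        unfolding sum_distrib_right[symmetric] by (intro mult_right_mono sum_abs_mult_le decf decu) auto
      finally show ?thesis .
    qed
    have part: "\<bar>\<Sum>k\<in>index_box N. coeff_fun f k * coeff_fun u k\<bar> \<le>
        sqrt B * D + (sqrt B * sqrt (4 * A * r\<^sup>2)) * (1 / real K ^ (\<alpha> + \<beta>))" if N: "N \<ge> K" for N
    proof -
      have "\<bar>\<Sum>k\<in>index_box N. coeff_fun f k * coeff_fun u k\<bar> \<le> (\<Sum>k\<in>index_box N. \<bar>coeff_fun f k\<bar> * \<bar>coeff_fun u k\<bar>)"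
        by (rule order_trans[OF sum_abs]) (simp add: abs_mult)
      also have "\<dots> = (\<Sum>k\<in>index_box N - index_box K. \<bar>coeff_fun f k\<bar> * \<bar>coeff_fun u k\<bar>) + (\<Sum>k\<in>index_box K. \<bar>coeff_fun f k\<bar> * \<bar>coeff_fun u k\<bar>)"
        by (rule sum.subset_diff[OF index_box_mono[OF N]]) simp
      finally show ?thesis using low high[of N] by linarith
    qed
    have "\<bar>LINT x|cube_lborel. f x * u x\<bar> \<le> sqrt B * D + (sqrt B * sqrt (4 * A * r\<^sup>2)) * (1 / real K ^ (\<alpha> + \<beta>))"
      by (rule LIMSEQ_le_const2[OF tendsto_rabs[OF Parseval_cube[OF s(1) su]]]) (use part in blast)
    also have "\<dots> \<le> C * D + C * (1 / real K ^ (\<alpha> + \<beta>))"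
      unfolding C_def using A B weighted_dist_nonneg[of \<beta> K] by (intro add_mono mult_right_mono) (auto simp: D_def)
    finally show ?thesis by (simp add: u_def D_def algebra_simps)
  qed
  then show ?thesis using C by blast
qed

section \<open>The stochastic part of the upper bound\<close>

lemma iid_variance:
  fixes Y :: "'a \<Rightarrow> real"
  assumes "prob_space \<nu>" and Y: "Y \<in> borel_measurable \<nu>" "\<And>x. x \<in> space \<nu> \<Longrightarrow> \<bar>Y x\<bar> \<le> B"
    and mean: "(LINT x|\<nu>. Y x) = 0"
  shows "integrable (PiM {..<n::nat} (\<lambda>_. \<nu>)) (\<lambda>X. (\<Sum>i<n. Y (X i))\<^sup>2)"
    and "(LINT X|PiM {..<n::nat} (\<lambda>_. \<nu>). (\<Sum>i<n. Y (X i))\<^sup>2) = real n * (LINT x|\<nu>. (Y x)\<^sup>2)"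
proof -
  interpret prob_space \<nu> by fact
  interpret P: product_sigma_finite "\<lambda>_::nat. \<nu>" by standard
  define P where "P = PiM {..<n::nat} (\<lambda>_. \<nu>)"
  have Yi: "integrable \<nu> Y" using Y by (intro integrable_const_bound[where B=B]) auto
  have Yi2: "integrable \<nu> (\<lambda>x. Y x * Y x)"
  proof (rule integrable_const_bound[where B="B * B"])
    show "AE x in \<nu>. norm (Y x * Y x) \<le> B * B"
    proof (rule AE_I2)
      fix x assume "x \<in> space \<nu>"
      from Y(2)[OF this] show "norm (Y x * Y x) \<le> B * B"
        unfolding real_norm_def abs_mult by (intro mult_mono) auto
    qed
  qed (use Y in auto)
  define F where "F = (\<lambda>(i::nat) (j::nat) (l::nat) x. (if l = i then Y x else 1) * (if l = j then Y x else 1 :: real))"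
  have FI: "integrable \<nu> (F i j l)" for i j l :: nat
    unfolding F_def by (cases "l = i"; cases "l = j") (simp_all add: Yi Yi2)
  have Fprod: "(\<Prod>l<n. F i j l (X l)) = Y (X i) * Y (X j)" if "i < n" "j < n" for i j and X :: "nat \<Rightarrow> 'a"
    unfolding F_def prod.distrib using that by (simp add: prod.delta)
  have int: "integrable P (\<lambda>X. Y (X i) * Y (X j))" if "i < n" "j < n" for i j
    using P.product_integrable_prod[of "{..<n}" "F i j"] FI that unfolding P_def by (simp add: Fprod)
  have val: "(LINT X|P. Y (X i) * Y (X j)) = (if i = j then LINT x|\<nu>. (Y x)\<^sup>2 else 0)" if ij: "i < n" "j < n" for i j
  proof -
    have "(LINT X|P. Y (X i) * Y (X j)) = (\<Prod>l<n. LINT x|\<nu>. F i j l x)"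
      using P.product_integral_prod[of "{..<n}" "F i j"] FI ij unfolding P_def by (simp add: Fprod)
    also have "\<dots> = (if i = j then LINT x|\<nu>. (Y x)\<^sup>2 else 0)"
    proof (cases "i = j")
      case True
      have "(\<Prod>l<n. LINT x|\<nu>. F i j l x) = (\<Prod>l<n. if l = i then LINT x|\<nu>. (Y x)\<^sup>2 else 1)"
        using True by (intro prod.cong) (auto simp: F_def power2_eq_square prob_space)
      then show ?thesis using True ij by (simp add: prod.delta)
    next
      case False
      have "(LINT x|\<nu>. F i j i x) = 0" using False mean by (simp add: F_def)
      then have "(\<Prod>l<n. LINT x|\<nu>. F i j l x) = 0" using ij by (intro prod_zero) auto
      then show ?thesis using False by simp
    qed
    finally show ?thesis .
  qed
  have row: "integrable P (\<lambda>X. \<Sum>j<n. Y (X i) * Y (X j))" if "i < n" for i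
    using int that by (intro Bochner_Integration.integrable_sum) auto
  have "(LINT X|P. (\<Sum>i<n. Y (X i))\<^sup>2) = (LINT X|P. (\<Sum>i<n. \<Sum>j<n. Y (X i) * Y (X j)))"
    by (simp add: power2_eq_square sum_product)
  also have "\<dots> = (\<Sum>i<n. \<Sum>j<n. LINT X|P. Y (X i) * Y (X j))"
  proof -
    have "(LINT X|P. (\<Sum>i<n. \<Sum>j<n. Y (X i) * Y (X j))) = (\<Sum>i<n. LINT X|P. (\<Sum>j<n. Y (X i) * Y (X j)))"
      by (rule Bochner_Integration.integral_sum) (use row in auto)
    also have "\<dots> = (\<Sum>i<n. \<Sum>j<n. LINT X|P. Y (X i) * Y (X j))"
      by (intro sum.cong refl Bochner_Integration.integral_sum) (use int in auto)
    finally show ?thesis .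
  qed
  also have "\<dots> = (\<Sum>i<n. \<Sum>j<n. if i = j then LINT x|\<nu>. (Y x)\<^sup>2 else 0)"
    using val by (intro sum.cong) auto
  also have "\<dots> = real n * (LINT x|\<nu>. (Y x)\<^sup>2)" by simp
  finally show "(LINT X|PiM {..<n::nat} (\<lambda>_. \<nu>). (\<Sum>i<n. Y (X i))\<^sup>2) = real n * (LINT x|\<nu>. (Y x)\<^sup>2)"
    unfolding P_def .
  show "integrable (PiM {..<n::nat} (\<lambda>_. \<nu>)) (\<lambda>X. (\<Sum>i<n. Y (X i))\<^sup>2)"
  proof -
    have "integrable P (\<lambda>X. \<Sum>i<n. \<Sum>j<n. Y (X i) * Y (X j))"
      by (rule Bochner_Integration.integrable_sum) (use row in auto)
    then show ?thesis by (simp add: P_def power2_eq_square sum_product)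
  qed
qed

lemma sum_inverse_le: "(\<Sum>j<K. 1 / (1 + real j)) \<le> 1 + ln (real K)" if "K \<ge> 1"
  using that
proof (induction K rule: dec_induct)
  case base
  then show ?case by simp
next
  case (step K)
  have K: "real K > 0" using step by simp
  have "ln (real K / (real K + 1)) \<le> real K / (real K + 1) - 1"
    using K by (intro ln_le_minus_one) simp
  also have "\<dots> = - (1 / (1 + real K))" using K by (simp add: field_simps)
  finally have "1 / (1 + real K) \<le> ln (real (Suc K)) - ln (real K)"
    using K by (simp add: ln_div add.commute)
  then show ?case using step by simp
qed

lemma log_le_power: "1 + ln x \<le> (1 + 1 / \<delta>) * x powr \<delta>" if "x \<ge> 1" "\<delta> > 0" for x :: real
proof -
  have "\<delta> * ln x = ln (x powr \<delta>)" using that by (simp add: ln_powr)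
  also have "\<dots> \<le> x powr \<delta> - 1" using that by (intro ln_le_minus_one) simp
  finally have "ln x \<le> (1 / \<delta>) * x powr \<delta>" using that by (simp add: field_simps)
  moreover have "1 \<le> x powr \<delta>" using that by (simp add: ge_one_powr_ge_zero)
  ultimately show ?thesis by (simp add: distrib_right)
qed

text \<open>
  With \<open>s = min (2 \<beta> / d) 1\<close> the weight \<open>(1 + max k) powr - 2 \<beta>\<close> is at most \<open>\<Prod>\<^sub>i (1 + k\<^sub>i) powr - s\<close>, and
  the sum of this product over the box factorises into one-dimensional sums of size \<open>K powr (1 - s)\<close>, up
  to a logarithm that is paid for by \<open>\<delta>\<close>.
\<close>

lemma weight_sum_bound:
  assumes "\<delta> > 0"
  shows "\<exists>C>0. \<forall>K\<ge>1. (\<Sum>k\<in>(index_box K :: ('d::finite \<Rightarrow> nat) set). 1 / (1 + real (max_index k)) ^ (2 * \<beta>)) \<le>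
     C * real K powr (max (real CARD('d) - 2 * real \<beta>) 0 + \<delta>)"
proof -
  define d where "d = real CARD('d)"
  have d: "d \<ge> 1" unfolding d_def using finite_UNIV_card_ge_0[where 'a='d] by simp
  \<comment> \<open>Beyond \<open>s = 1\<close> the one-dimensional sums stay bounded without decreasing further.\<close>
  define s where "s = min (2 * real \<beta> / d) 1"
  have s: "0 \<le> s" "s \<le> 1" "s * d \<le> 2 * real \<beta>" using d by (auto simp: s_def min_def field_simps)
  have sd: "d * (1 - s) = max (d - 2 * real \<beta>) 0" using d by (auto simp: s_def min_def max_def field_simps)
  define \<eta> where "\<eta> = \<delta> / d"
  have eta: "\<eta> > 0" using assms d by (simp add: \<eta>_def)
  define C where "C = (1 + 1 / \<eta>) ^ CARD('d)"
  have "(\<Sum>k\<in>(index_box K :: ('d \<Rightarrow> nat) set). 1 / (1 + real (max_index k)) ^ (2 * \<beta>)) \<le>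
     C * real K powr (max (real CARD('d) - 2 * real \<beta>) 0 + \<delta>)" if K: "K \<ge> 1" for K
  proof -
    have K1: "real K \<ge> 1" using K by simp
    have term_le: "1 / (1 + real (max_index k)) ^ (2 * \<beta>) \<le> (\<Prod>i\<in>UNIV. (1 + real (k i)) powr (- s))" for k :: "'d \<Rightarrow> nat"
    proof -
      define m where "m = 1 + real (max_index k)"
      have m: "m \<ge> 1" by (simp add: m_def)
      have "1 / m ^ (2 * \<beta>) = m powr (- real (2 * \<beta>))" using m powr_realpow[of m "2 * \<beta>"] by (simp only: powr_minus divide_inverse)
      also have "\<dots> \<le> m powr (- (s * d))" using m s by (intro powr_mono) auto
      also have "\<dots> = (m powr (- s)) ^ CARD('d)" using m by (simp add: d_def powr_power mult.commute)
      also have "\<dots> = (\<Prod>i\<in>(UNIV :: 'd set). m powr (- s))" by simp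
      also have "\<dots> \<le> (\<Prod>i\<in>UNIV. (1 + real (k i)) powr (- s))"
        using max_index_ge[of k] s by (intro prod_mono) (auto simp: m_def intro!: powr_mono2')
      finally show ?thesis by (simp add: m_def)
    qed
    \<comment> \<open>Comparison with the harmonic sum handles \<open>s < 1\<close> and \<open>s = 1\<close> alike.\<close>
    have one: "(\<Sum>j<K. (1 + real j) powr (- s)) \<le> (1 + 1 / \<eta>) * real K powr (1 - s + \<eta>)"
    proof -
      have "(\<Sum>j<K. (1 + real j) powr (- s)) \<le> (\<Sum>j<K. real K powr (1 - s) * (1 / (1 + real j)))"
      proof (rule sum_mono)
        fix j assume j: "j \<in> {..<K}"
        have "(1 + real j) powr (- s) = (1 + real j) powr (1 - s) * (1 / (1 + real j))"
          by (simp add: powr_diff powr_minus divide_inverse)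
        also have "\<dots> \<le> real K powr (1 - s) * (1 / (1 + real j))"
          using j s by (intro mult_right_mono powr_mono2) auto
        finally show "(1 + real j) powr (- s) \<le> real K powr (1 - s) * (1 / (1 + real j))" .
      qed
      also have "\<dots> \<le> real K powr (1 - s) * ((1 + 1 / \<eta>) * real K powr \<eta>)"
        unfolding sum_distrib_left[symmetric]
        using sum_inverse_le[OF K] log_le_power[OF K1 eta] by (intro mult_left_mono) auto
      finally show ?thesis by (simp add: powr_add mult_ac)
    qed
    have "(\<Sum>k\<in>(index_box K :: ('d \<Rightarrow> nat) set). 1 / (1 + real (max_index k)) ^ (2 * \<beta>)) \<le>
        (\<Sum>k\<in>(index_box K :: ('d \<Rightarrow> nat) set). \<Prod>i\<in>UNIV. (1 + real (k i)) powr (- s))"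
      by (intro sum_mono term_le)
    also have "\<dots> = (\<Prod>i\<in>(UNIV :: 'd set). \<Sum>j<K. (1 + real j) powr (- s))"
      unfolding index_box_PiE by (subst prod_sum_PiE) auto
    also have "\<dots> \<le> (\<Prod>i\<in>(UNIV :: 'd set). (1 + 1 / \<eta>) * real K powr (1 - s + \<eta>))"
      by (intro prod_mono conjI one sum_nonneg) auto
    also have "\<dots> = C * (real K powr (1 - s + \<eta>)) ^ CARD('d)"
      by (simp add: C_def power_mult_distrib)
    also have "(real K powr (1 - s + \<eta>)) ^ CARD('d) = real K powr ((1 - s + \<eta>) * d)"
      using K1 by (simp add: powr_power d_def mult.commute)
    also have "(1 - s + \<eta>) * d = max (d - 2 * real \<beta>) 0 + \<delta>"
    proof -
      have "(1 - s + \<eta>) * d = d * (1 - s) + \<eta> * d" by (simp add: algebra_simps)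
      then show ?thesis using d by (simp add: sd \<eta>_def)
    qed
    finally show ?thesis by (simp add: d_def)
  qed
  moreover have "C > 0" unfolding C_def using eta by (intro zero_less_power add_pos_pos) auto
  ultimately show ?thesis by blast
qed

text \<open>
  Only the \<open>L\<^sup>2\<close> norm of \<open>p\<close> is controlled uniformly over the class, so the Cauchy-Schwarz inequality
  leads to the fourth moment of the basis function, which is a product of one-dimensional ones.
\<close>

lemma second_moment_bound:
  assumes "\<delta> > 0"
  shows "\<exists>C>0. \<forall>p\<in>(sobolev_class \<alpha> r :: (real ^ 'd::finite \<Rightarrow> real) set). \<forall>K\<ge>1. \<forall>k\<in>index_box K.
     (LINT x|cube_lborel. p x * (legendre_basis k x)\<^sup>2) \<le> C * real K powr \<delta>"
proof -
  define d where "d = real CARD('d)"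
  have d: "d \<ge> 1" unfolding d_def using finite_UNIV_card_ge_0[where 'a='d] by simp
  \<comment> \<open>Taking the root of a \<open>d\<close>-fold product of moments multiplies the exponent by \<open>d / 2\<close>.\<close>
  define \<eta> where "\<eta> = min (1/2) (2 * \<delta> / d)"
  have eta: "0 < \<eta>" "\<eta> < 1" "\<eta> * d / 2 \<le> \<delta>"
    using assms d by (auto simp: \<eta>_def min_def field_simps)
  obtain A where A: "A > 0" "\<And>n. pint (phi n ^ 4) \<le> A * (2 * real n + 1) powr \<eta>"
    using phi_fourth_moment[OF eta(1,2)] by blast
  define C where "C = \<bar>r\<bar> * sqrt (A ^ CARD('d)) * 2 powr \<delta> + 1"
  have "(LINT x|cube_lborel. p x * (legendre_basis k x)\<^sup>2) \<le> C * real K powr \<delta>"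
    if p: "p \<in> sobolev_class \<alpha> r" and K: "K \<ge> 1" and k: "k \<in> index_box K" for p :: "real ^ 'd \<Rightarrow> real" and K k
  proof -
    obtain D where D: "\<forall>\<gamma>. multi_order \<gamma> \<le> \<alpha> \<longrightarrow> weak_deriv (interior unit_cube) \<gamma> p (D \<gamma>) \<and>
      sqint cube_lborel (D \<gamma>) \<and> (LINT x|cube_lborel. (D \<gamma> x)\<^sup>2) \<le> r\<^sup>2"
      and ae: "AE x in cube_lborel. p x = D (\<lambda>_. 0) x" and s: "sqint cube_lborel p"
      using sobolev_classE[OF p] by blast
    have "(LINT x|cube_lborel. (p x)\<^sup>2) = (LINT x|cube_lborel. (D (\<lambda>_. 0) x)\<^sup>2)"
    proof (rule integral_cong_AE)
      have "sqint cube_lborel (D (\<lambda>_. 0))" using D by (simp add: multi_order_def)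
      then have "D (\<lambda>_. 0) \<in> borel_measurable cube_lborel" by (simp add: sqint_def)
      then show "(\<lambda>x. (D (\<lambda>_. 0) x)\<^sup>2) \<in> borel_measurable cube_lborel" by (rule borel_measurable_power)
      have "p \<in> borel_measurable cube_lborel" using s by (simp add: sqint_def)
      then show "(\<lambda>x. (p x)\<^sup>2) \<in> borel_measurable cube_lborel" by (rule borel_measurable_power)
      show "AE x in cube_lborel. (p x)\<^sup>2 = (D (\<lambda>_. 0) x)\<^sup>2" using ae by eventually_elim simp
    qed
    then have pr: "(LINT x|cube_lborel. (p x)\<^sup>2) \<le> r\<^sup>2" using D by (simp add: multi_order_def)
    have sq: "(legendre_basis k x)\<^sup>2 = tensor (\<lambda>i. poly (phi (k i) * phi (k i))) x" for x
      by (simp add: legendre_basis_def power2_eq_square tensor_poly_mult)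
    have E2: "sqint cube_lborel (\<lambda>x. (legendre_basis k x)\<^sup>2)"
      unfolding sq[abs_def] by (rule sqint_tensor_poly)
    have "((legendre_basis k x)\<^sup>2)\<^sup>2 = tensor (\<lambda>i. poly (phi (k i) ^ 4)) x" for x
      unfolding sq by (simp add: power2_eq_square tensor_poly_mult power4_eq_xxxx mult.assoc)
    then have "(LINT x|cube_lborel. ((legendre_basis k x)\<^sup>2)\<^sup>2) = (\<Prod>i\<in>UNIV. pint (phi (k i) ^ 4))"
      using cube_tensor_poly(2)[of "\<lambda>i. phi (k i) ^ 4"] by simp
    also have "\<dots> \<le> (\<Prod>i\<in>(UNIV :: 'd set). A * (2 * real K) powr \<eta>)"
    proof (intro prod_mono conjI)
      fix i
      show "0 \<le> pint (phi (k i) ^ 4)" unfolding pint_def by (intro Bochner_Integration.integral_nonneg) simp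
      have "k i < K" using k max_index_ge[of k i] by (simp add: index_box_def)
      then have "(2 * real (k i) + 1) powr \<eta> \<le> (2 * real K) powr \<eta>" using eta by (intro powr_mono2) auto
      then show "pint (phi (k i) ^ 4) \<le> A * (2 * real K) powr \<eta>"
        using A by (meson less_imp_le mult_left_mono order_trans)
    qed
    also have "\<dots> = A ^ CARD('d) * ((2 * real K) powr (\<eta> * d / 2))\<^sup>2"
    proof -
      have "((2 * real K) powr \<eta>) ^ CARD('d) = (2 * real K) powr (\<eta> * d)"
        using K by (simp add: powr_power d_def mult.commute)
      moreover have "((2 * real K) powr (\<eta> * d / 2))\<^sup>2 = (2 * real K) powr (\<eta> * d)"
        using K by (simp add: powr_power)
      ultimately show ?thesis by (simp add: power_mult_distrib)
    qed
    finally have E4: "(LINT x|cube_lborel. ((legendre_basis k x)\<^sup>2)\<^sup>2) \<le> A ^ CARD('d) * ((2 * real K) powr (\<eta> * d / 2))\<^sup>2" .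
    have "(LINT x|cube_lborel. p x * (legendre_basis k x)\<^sup>2) \<le> sqrt (r\<^sup>2) * sqrt (A ^ CARD('d) * ((2 * real K) powr (\<eta> * d / 2))\<^sup>2)"
    proof -
      have "(LINT x|cube_lborel. p x * (legendre_basis k x)\<^sup>2) \<le>
         sqrt (LINT x|cube_lborel. (p x)\<^sup>2) * sqrt (LINT x|cube_lborel. ((legendre_basis k x)\<^sup>2)\<^sup>2)"
        using Cauchy_Schwarz_integral_sqrt[OF s E2] by linarith
      also have "\<dots> \<le> sqrt (r\<^sup>2) * sqrt (A ^ CARD('d) * ((2 * real K) powr (\<eta> * d / 2))\<^sup>2)"
        using pr E4 by (intro mult_mono real_sqrt_le_mono) auto
      finally show ?thesis .
    qed
    also have "\<dots> = \<bar>r\<bar> * sqrt (A ^ CARD('d)) * (2 * real K) powr (\<eta> * d / 2)"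
      by (simp add: real_sqrt_mult)
    also have "\<dots> \<le> \<bar>r\<bar> * sqrt (A ^ CARD('d)) * (2 * real K) powr \<delta>"
      using eta K A by (intro mult_left_mono powr_mono) auto
    also have "\<dots> = \<bar>r\<bar> * sqrt (A ^ CARD('d)) * 2 powr \<delta> * real K powr \<delta>"
      using K by (simp add: powr_mult)
    also have "\<dots> \<le> C * real K powr \<delta>" unfolding C_def by (intro mult_right_mono) auto
    finally show ?thesis .
  qed
  moreover have "C > 0" unfolding C_def using A by (intro add_nonneg_pos mult_nonneg_nonneg) auto
  ultimately show ?thesis by blast
qed

section \<open>The minimum distance estimator\<close>

text \<open>
  Rounding the coordinates to multiples of \<open>\<epsilon>\<close> leaves finitely many patterns; one point of \<open>G\<close> is kept
  for each pattern.
\<close>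

lemma finite_net:
  fixes c :: "'g \<Rightarrow> 'k \<Rightarrow> real"
  assumes "finite S" "\<epsilon> > 0" and bound: "\<And>g k. g \<in> G \<Longrightarrow> k \<in> S \<Longrightarrow> \<bar>c g k\<bar> \<le> B"
  shows "\<exists>G'. finite G' \<and> G' \<subseteq> G \<and> (\<forall>g\<in>G. \<exists>g'\<in>G'. \<forall>k\<in>S. \<bar>c g k - c g' k\<bar> \<le> \<epsilon>)"
proof -
  define q where "q = (\<lambda>g. restrict (\<lambda>k. \<lfloor>c g k / \<epsilon>\<rfloor>) S)"
  have "q ` G \<subseteq> (\<Pi>\<^sub>E k\<in>S. {\<lfloor>- B / \<epsilon>\<rfloor>..\<lfloor>B / \<epsilon>\<rfloor>})"
  proof
    fix z assume "z \<in> q ` G"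
    then obtain g where g: "g \<in> G" "z = q g" by blast
    have "\<lfloor>- B / \<epsilon>\<rfloor> \<le> \<lfloor>c g k / \<epsilon>\<rfloor> \<and> \<lfloor>c g k / \<epsilon>\<rfloor> \<le> \<lfloor>B / \<epsilon>\<rfloor>" if "k \<in> S" for k
    proof -
      have "- B \<le> c g k" "c g k \<le> B" using bound[OF g(1) that] by linarith+
      then show ?thesis using assms(2) by (intro conjI floor_mono divide_right_mono) auto
    qed
    then show "z \<in> (\<Pi>\<^sub>E k\<in>S. {\<lfloor>- B / \<epsilon>\<rfloor>..\<lfloor>B / \<epsilon>\<rfloor>})" using g by (auto simp: q_def)
  qed
  then have fin: "finite (q ` G)" by (rule finite_subset) (intro finite_PiE assms finite_atLeastAtMost_int)
  define G' where "G' = inv_into G q ` (q ` G)"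
  have "\<exists>g'\<in>G'. \<forall>k\<in>S. \<bar>c g k - c g' k\<bar> \<le> \<epsilon>" if g: "g \<in> G" for g
  proof
    define g' where "g' = inv_into G q (q g)"
    show "inv_into G q (q g) \<in> G'" using g by (auto simp: G'_def)
    have eq: "q g' = q g" unfolding g'_def using g by (intro f_inv_into_f) auto
    show "\<forall>k\<in>S. \<bar>c g k - c (inv_into G q (q g)) k\<bar> \<le> \<epsilon>"
    proof
      fix k assume k: "k \<in> S"
      have "\<lfloor>c g' k / \<epsilon>\<rfloor> = \<lfloor>c g k / \<epsilon>\<rfloor>" using fun_cong[OF eq, of k] k by (simp add: q_def)
      then have "\<bar>c g k / \<epsilon> - c g' k / \<epsilon>\<bar> \<le> 1" by linarith
      then have "\<bar>c g k - c g' k\<bar> / \<epsilon> \<le> 1" using assms(2) by (simp flip: diff_divide_distrib add: abs_divide)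
      then show "\<bar>c g k - c (inv_into G q (q g)) k\<bar> \<le> \<epsilon>" using assms(2) by (simp add: g'_def)
    qed
  qed
  moreover have "G' \<subseteq> G" by (auto simp: G'_def inv_into_into)
  moreover have "finite G'" using fin by (simp add: G'_def)
  ultimately show ?thesis by blast
qed

lemma weighted_dist_commute: "weighted_dist \<beta> K (\<lambda>k. u k - v k) = weighted_dist \<beta> K (\<lambda>k. v k - u k)"
  unfolding weighted_dist_def L2_set_def by (simp add: power_divide power2_commute)

lemma weighted_dist_le_sum: "weighted_dist \<beta> K v \<le> (\<Sum>k\<in>index_box K. \<bar>v k\<bar>)"
proof -
  have "weighted_dist \<beta> K v \<le> (\<Sum>k\<in>index_box K. \<bar>v k / (1 + real (max_index k)) ^ \<beta>\<bar>)"
    unfolding weighted_dist_def by (rule L2_set_le_sum_abs)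
  also have "\<dots> \<le> (\<Sum>k\<in>index_box K. \<bar>v k\<bar>)"
  proof (rule sum_mono)
    fix k :: "'a \<Rightarrow> nat"
    have "1 \<le> (1 + real (max_index k)) ^ \<beta>" by simp
    then show "\<bar>v k / (1 + real (max_index k)) ^ \<beta>\<bar> \<le> \<bar>v k\<bar>"
      by (simp add: abs_divide divide_le_eq mult_le_cancel_left1)
  qed
  finally show ?thesis .
qed

lemma legendre_basis_bounded: "\<exists>B. \<forall>x\<in>unit_cube. \<bar>legendre_basis k x\<bar> \<le> B"
proof -
  have "\<forall>p :: real poly. \<exists>B. \<forall>t\<in>{0..1}. \<bar>poly p t\<bar> \<le> B"
    using poly_bounded_unit_interval by blast
  then obtain bd :: "real poly \<Rightarrow> real" where bd: "\<forall>p. \<forall>t\<in>{0..1}. \<bar>poly p t\<bar> \<le> bd p"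
    by (rule choice[THEN exE])
  have "\<bar>legendre_basis k x\<bar> \<le> (\<Prod>i\<in>UNIV. bd (phi (k i)))" if "x \<in> unit_cube" for x
    unfolding legendre_basis_def by (rule tensor_bound) (use bd that in \<open>auto simp: unit_cube_def\<close>)
  then show ?thesis by blast
qed

definition emp_coeff :: "nat \<Rightarrow> (nat \<Rightarrow> real ^ 'd::finite) \<Rightarrow> ('d \<Rightarrow> nat) \<Rightarrow> real" where
  "emp_coeff n X k = (\<Sum>i<n. legendre_basis k (X i)) / real n"

lemma emp_coeff_measurable: "(\<lambda>X. emp_coeff n X k) \<in> borel_measurable (PiM {..<n} (\<lambda>_. cube_lborel))"
proof -
  have [measurable]: "(\<lambda>X. legendre_basis k (X i)) \<in> borel_measurable (PiM {..<n} (\<lambda>_. cube_lborel))" if "i < n" for i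
  proof (rule measurable_compose[where f="\<lambda>X. X i" and g="legendre_basis k"])
    show "(\<lambda>X. X i) \<in> measurable (PiM {..<n} (\<lambda>_. cube_lborel)) cube_lborel"
      using that by (intro measurable_component_singleton) simp
  qed (rule legendre_basis_measurable)
  show ?thesis unfolding emp_coeff_def
    by (intro borel_measurable_divide borel_measurable_sum) auto
qed

lemma weighted_dist_measurable:
  assumes "\<And>k. (\<lambda>X. v X k) \<in> borel_measurable N"
  shows "(\<lambda>X. weighted_dist \<beta> K (v X)) \<in> borel_measurable N"
proof -
  note [measurable] = assms
  show ?thesis unfolding weighted_dist_def L2_set_def by measurable
qed

lemma sobolev_distributionsE:
  assumes "\<nu> \<in> sobolev_distributions \<alpha> r"
  obtains p where "p \<in> sobolev_class \<alpha> r" "\<nu> = density cube_lborel (\<lambda>x. ennreal (p x))"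
    "prob_space \<nu>" "sets \<nu> = sets cube_lborel" "space \<nu> = unit_cube"
    "\<forall>f\<in>borel_measurable cube_lborel. (LINT x|\<nu>. f x) = (LINT x|cube_lborel. f x * p x)"
proof -
  obtain p where p: "p \<in> sobolev_class \<alpha> r" "\<forall>x\<in>unit_cube. 0 \<le> p x"
    "\<nu> = density cube_lborel (\<lambda>x. ennreal (p x))" and sp: "\<nu> \<in> space (prob_algebra cube_lborel)"
    using assms unfolding sobolev_distributions_def by blast
  have pm: "p \<in> borel_measurable cube_lborel" using p(1) by (simp add: sobolev_class_def)
  have 1: "(LINT x|\<nu>. f x) = (LINT x|cube_lborel. f x * p x)" if f: "f \<in> borel_measurable cube_lborel" for f
  proof -
    have "AE x in cube_lborel. 0 \<le> p x" using p(2) by (intro AE_I2) simp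
    then have "(LINT x|\<nu>. f x) = (LINT x|cube_lborel. p x * f x)"
      unfolding p(3) by (intro integral_real_density f pm)
    then show ?thesis by (simp add: mult.commute)
  qed
  have 2: "prob_space \<nu>" "sets \<nu> = sets cube_lborel" using sp by (auto simp: space_prob_algebra)
  have 3: "space \<nu> = unit_cube" using sets_eq_imp_space_eq[OF 2(2)] by simp
  show ?thesis by (rule that[OF p(1,3) 2 3]) (use 1 in blast)
qed

text \<open>
  The error of each empirical coefficient has variance at most \<open>A / n\<close>; the variances are summed with
  their weights, and the mean is bounded by the root of the second moment.
\<close>

lemma empirical_risk:
  fixes \<nu> :: "(real ^ 'd::finite) measure"
  assumes nu: "\<nu> \<in> sobolev_distributions \<alpha> r" and n: "n \<ge> 1"
    and A: "\<And>p k. p \<in> sobolev_class \<alpha> r \<Longrightarrow> k \<in> (index_box K :: ('d \<Rightarrow> nat) set) \<Longrightarrow>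
      (LINT x|cube_lborel. p x * (legendre_basis k x)\<^sup>2) \<le> A"
    and B: "(\<Sum>k\<in>(index_box K :: ('d \<Rightarrow> nat) set). 1 / (1 + real (max_index k)) ^ (2 * \<beta>)) \<le> B"
    and A0: "A \<ge> 0"
  shows "integrable (PiM {..<n} (\<lambda>_. \<nu>)) (\<lambda>X. weighted_dist \<beta> K (\<lambda>k. (LINT x|\<nu>. legendre_basis k x) - emp_coeff n X k))"
    and "(LINT X|PiM {..<n} (\<lambda>_. \<nu>). weighted_dist \<beta> K (\<lambda>k. (LINT x|\<nu>. legendre_basis k x) - emp_coeff n X k)) \<le> sqrt (A * B / real n)"
proof -
  obtain p where p: "p \<in> sobolev_class \<alpha> r" and "\<nu> = density cube_lborel (\<lambda>x. ennreal (p x))"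
    and pr: "prob_space \<nu>" and sets: "sets \<nu> = sets cube_lborel" and sp: "space \<nu> = unit_cube"
    and int0: "\<forall>f\<in>borel_measurable cube_lborel. (LINT x|\<nu>. f x) = (LINT x|cube_lborel. f x * p x)"
    by (rule sobolev_distributionsE[OF nu])
  note int = int0[rule_format]
  interpret nu: prob_space \<nu> by fact
  define P where "P = PiM {..<n} (\<lambda>_. \<nu>)"
  interpret P: prob_space P unfolding P_def by (intro prob_space_PiM pr)
  define c where "c = (\<lambda>k. LINT x|\<nu>. legendre_basis k x)"
  define Z where "Z = (\<lambda>X. weighted_dist \<beta> K (\<lambda>k. c k - emp_coeff n X k))"
  have Em: "legendre_basis k \<in> borel_measurable \<nu>" for k :: "'d \<Rightarrow> nat"
    using legendre_basis_measurable sets by (simp cong: measurable_cong_sets)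
  have setsP: "sets P = sets (PiM {..<n} (\<lambda>_. cube_lborel))"
    unfolding P_def by (intro sets_PiM_cong) (auto simp: sets)
  have Zm: "Z \<in> borel_measurable P"
    unfolding Z_def using emp_coeff_measurable[of n] setsP
    by (intro weighted_dist_measurable borel_measurable_diff) (auto cong: measurable_cong_sets)
  have var: "integrable P (\<lambda>X. (c k - emp_coeff n X k)\<^sup>2) \<and>
      (LINT X|P. (c k - emp_coeff n X k)\<^sup>2) \<le> A / real n" if k: "k \<in> index_box K" for k
  proof -
    obtain b where b: "\<And>x. x \<in> unit_cube \<Longrightarrow> \<bar>legendre_basis k x\<bar> \<le> b" using legendre_basis_bounded by blast
    have Ei: "integrable \<nu> (legendre_basis k)"
      using b Em sp by (intro nu.integrable_const_bound[where B=b]) auto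
    have E2i: "integrable \<nu> (\<lambda>x. (legendre_basis k x)\<^sup>2)"
    proof (rule nu.integrable_const_bound[where B="b\<^sup>2"])
      show "AE x in \<nu>. norm ((legendre_basis k x)\<^sup>2) \<le> b\<^sup>2"
        using b sp by (intro AE_I2) (auto simp: abs_le_square_iff[symmetric] intro: order_trans[OF _ abs_ge_self])
    qed (use Em in measurable)
    define Y where "Y = (\<lambda>x. legendre_basis k x - c k)"
    have Ym: "Y \<in> borel_measurable \<nu>" unfolding Y_def using Em by measurable
    have Yb: "\<bar>Y x\<bar> \<le> b + \<bar>c k\<bar>" if "x \<in> space \<nu>" for x
      using b[of x] that sp unfolding Y_def by (auto intro: order_trans[OF abs_triangle_ineq4])
    have Y0: "(LINT x|\<nu>. Y x) = 0" unfolding Y_def using Ei by (simp add: c_def nu.prob_space)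
    have Y2: "(LINT x|\<nu>. (Y x)\<^sup>2) \<le> A"
    proof -
      have "(LINT x|\<nu>. (Y x)\<^sup>2) = (LINT x|\<nu>. (legendre_basis k x)\<^sup>2 - 2 * c k * legendre_basis k x + (c k)\<^sup>2)"
        unfolding Y_def by (intro Bochner_Integration.integral_cong refl) (simp add: power2_eq_square algebra_simps)
      also have "\<dots> = (LINT x|\<nu>. (legendre_basis k x)\<^sup>2) - 2 * c k * (LINT x|\<nu>. legendre_basis k x) + (c k)\<^sup>2"
        using Ei E2i by (simp add: nu.prob_space)
      also have "\<dots> \<le> (LINT x|\<nu>. (legendre_basis k x)\<^sup>2)" by (simp add: c_def power2_eq_square)
      also have "\<dots> = (LINT x|cube_lborel. p x * (legendre_basis k x)\<^sup>2)"
        by (subst int) (auto simp: mult.commute)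
      also have "\<dots> \<le> A" by (rule A[OF p k])
      finally show ?thesis .
    qed
    note iv = iid_variance[OF pr Ym Yb Y0, of n, folded P_def]
    have eq: "(c k - emp_coeff n X k)\<^sup>2 = (1 / real n)\<^sup>2 * (\<Sum>i<n. Y (X i))\<^sup>2" for X
    proof -
      have "c k - emp_coeff n X k = - (1 / real n) * (\<Sum>i<n. Y (X i))"
        using n by (simp add: Y_def emp_coeff_def sum_subtractf field_simps)
      then show ?thesis by (simp only: power_mult_distrib power2_minus)
    qed
    have "(LINT X|P. (c k - emp_coeff n X k)\<^sup>2) = (1 / real n)\<^sup>2 * (real n * (LINT x|\<nu>. (Y x)\<^sup>2))"
      unfolding eq using iv by simp
    also have "\<dots> = (LINT x|\<nu>. (Y x)\<^sup>2) / real n" using n by (simp add: power2_eq_square field_simps)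
    also have "\<dots> \<le> A / real n" using Y2 by (intro divide_right_mono) auto
    finally show ?thesis unfolding eq using iv by simp
  qed
  have Z2: "(Z X)\<^sup>2 = (\<Sum>k\<in>index_box K. (1 / (1 + real (max_index k)) ^ (2 * \<beta>)) * (c k - emp_coeff n X k)\<^sup>2)" for X
    unfolding Z_def weighted_dist_square by simp
  have Z2i: "integrable P (\<lambda>X. (Z X)\<^sup>2)"
    unfolding Z2 using var by (intro Bochner_Integration.integrable_sum integrable_mult_right) auto
  have "(LINT X|P. (Z X)\<^sup>2) = (\<Sum>k\<in>index_box K. (1 / (1 + real (max_index k)) ^ (2 * \<beta>)) * (LINT X|P. (c k - emp_coeff n X k)\<^sup>2))"
    unfolding Z2 using var by (subst Bochner_Integration.integral_sum) auto
  also have "\<dots> \<le> (\<Sum>k\<in>(index_box K :: ('d \<Rightarrow> nat) set). (1 / (1 + real (max_index k)) ^ (2 * \<beta>)) * (A / real n))"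
    using var by (intro sum_mono mult_left_mono) auto
  also have "\<dots> = (\<Sum>k\<in>(index_box K :: ('d \<Rightarrow> nat) set). 1 / (1 + real (max_index k)) ^ (2 * \<beta>)) * (A / real n)"
    by (rule sum_distrib_right[symmetric])
  also have "\<dots> \<le> B * (A / real n)" using B A0 by (intro mult_right_mono) auto
  finally have Z2b: "(LINT X|P. (Z X)\<^sup>2) \<le> A * B / real n" by (simp add: mult_ac)
  have sZ: "sqint P Z" using Zm Z2i by (simp add: sqint_def)
  have s1: "sqint P (\<lambda>_. 1)" by (simp add: sqint_def)
  show "integrable (PiM {..<n} (\<lambda>_. \<nu>)) (\<lambda>X. weighted_dist \<beta> K (\<lambda>k. (LINT x|\<nu>. legendre_basis k x) - emp_coeff n X k))"
    using sqint_mult_integrable[OF sZ s1] by (simp add: Z_def c_def P_def)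
  have "(LINT X|P. Z X) \<le> sqrt (LINT X|P. (Z X)\<^sup>2)"
    using Cauchy_Schwarz_integral_sqrt[OF sZ s1] by (simp add: P.prob_space)
  also have "\<dots> \<le> sqrt (A * B / real n)" using Z2b by simp
  finally show "(LINT X|PiM {..<n} (\<lambda>_. \<nu>). weighted_dist \<beta> K (\<lambda>k. (LINT x|\<nu>. legendre_basis k x) - emp_coeff n X k)) \<le> sqrt (A * B / real n)"
    by (simp add: Z_def c_def P_def)
qed

lemma ipm_sobolev_le:
  fixes \<nu> \<nu>' :: "(real ^ 'd::finite) measure"
  assumes nu: "\<nu> \<in> sobolev_distributions \<alpha> r" "\<nu>' \<in> sobolev_distributions \<alpha> r" and K: "K \<ge> 1"
    and C: "\<forall>f\<in>sobolev_class \<beta> 1. \<forall>p\<in>(sobolev_class \<alpha> r :: (real ^ 'd \<Rightarrow> real) set). \<forall>p'\<in>sobolev_class \<alpha> r. \<forall>K\<ge>1.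
     \<bar>LINT x|cube_lborel. f x * (p x - p' x)\<bar> \<le>
       C * (1 / real K ^ (\<alpha> + \<beta>) + weighted_dist \<beta> K (\<lambda>k. coeff_fun p k - coeff_fun p' k))"
  shows "ipm (sobolev_class \<beta> 1) \<nu> \<nu>' \<le> ennreal (C * (1 / real K ^ (\<alpha> + \<beta>) +
     weighted_dist \<beta> K (\<lambda>k. (LINT x|\<nu>. legendre_basis k x) - (LINT x|\<nu>'. legendre_basis k x))))"
proof -
  obtain p where p: "p \<in> sobolev_class \<alpha> r" and "\<nu> = density cube_lborel (\<lambda>x. ennreal (p x))"
    and "prob_space \<nu>" and "sets \<nu> = sets cube_lborel" and "space \<nu> = unit_cube"
    and int0: "\<forall>f\<in>borel_measurable cube_lborel. (LINT x|\<nu>. f x) = (LINT x|cube_lborel. f x * p x)"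
    by (rule sobolev_distributionsE[OF nu(1)])
  note int = int0[rule_format]
  obtain p' where p': "p' \<in> sobolev_class \<alpha> r" and "\<nu>' = density cube_lborel (\<lambda>x. ennreal (p' x))"
    and "prob_space \<nu>'" and "sets \<nu>' = sets cube_lborel" and "space \<nu>' = unit_cube"
    and int0': "\<forall>f\<in>borel_measurable cube_lborel. (LINT x|\<nu>'. f x) = (LINT x|cube_lborel. f x * p' x)"
    by (rule sobolev_distributionsE[OF nu(2)])
  note int' = int0'[rule_format]
  have c: "(LINT x|\<nu>. legendre_basis k x) = coeff_fun p k" "(LINT x|\<nu>'. legendre_basis k x) = coeff_fun p' k" for k
    unfolding int[OF legendre_basis_measurable] int'[OF legendre_basis_measurable]
    by (simp_all only: mult.commute)
  show ?thesis unfolding ipm_def c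
  proof (rule SUP_least, rule ennreal_leI)
    fix f assume "f \<in> {f \<in> sobolev_class \<beta> 1. integrable \<nu> f \<and> integrable \<nu>' f}"
    then have f: "f \<in> sobolev_class \<beta> 1" by simp
    have sf: "sqint cube_lborel f" by (rule sobolev_classE[OF f])
    have sp: "sqint cube_lborel p" by (rule sobolev_classE[OF p])
    have sp': "sqint cube_lborel p'" by (rule sobolev_classE[OF p'])
    have fm: "f \<in> borel_measurable cube_lborel" using sf by (simp add: sqint_def)
    have "(LINT x|\<nu>. f x) - (LINT x|\<nu>'. f x) = (LINT x|cube_lborel. f x * (p x - p' x))"
      unfolding int[OF fm] int'[OF fm]
      using sqint_mult_integrable[OF sf sp] sqint_mult_integrable[OF sf sp'] by (simp add: right_diff_distrib)
    also have "\<dots> \<le> C * (1 / real K ^ (\<alpha> + \<beta>) + weighted_dist \<beta> K (\<lambda>k. coeff_fun p k - coeff_fun p' k))"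
      using C[rule_format, OF f p p' K] by linarith
    finally show "(LINT x|\<nu>. f x) - (LINT x|\<nu>'. f x) \<le> C * (1 / real K ^ (\<alpha> + \<beta>) + weighted_dist \<beta> K (\<lambda>k. coeff_fun p k - coeff_fun p' k))" .
  qed
qed

text \<open>
  A finite net of the class makes the estimator take finitely many values, all of them in the class,
  so that its measurability reduces to that of a finite minimisation.
\<close>

lemma coefficient_net:
  assumes "\<epsilon> > 0"
  shows "\<exists>G' \<subseteq> (sobolev_distributions \<alpha> r :: (real ^ 'd::finite) measure set). finite G' \<and>
    (\<forall>\<nu>\<in>sobolev_distributions \<alpha> r. \<exists>\<nu>'\<in>G'.
      weighted_dist \<beta> K (\<lambda>k. (LINT x|\<nu>'. legendre_basis k x) - (LINT x|\<nu>. legendre_basis k x)) \<le> \<epsilon>)"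
proof -
  define S where "S = (index_box K :: ('d \<Rightarrow> nat) set)"
  define c where "c = (\<lambda>(\<nu> :: (real ^ 'd) measure) (k :: 'd \<Rightarrow> nat). LINT x|\<nu>. legendre_basis k x)"
  have "\<forall>k :: 'd \<Rightarrow> nat. \<exists>B. \<forall>x\<in>unit_cube. \<bar>legendre_basis k x\<bar> \<le> B" using legendre_basis_bounded by blast
  then obtain bd where bd: "\<forall>k :: 'd \<Rightarrow> nat. \<forall>x\<in>unit_cube. \<bar>legendre_basis k x\<bar> \<le> bd k" by (rule choice[THEN exE])
  define B where "B = (\<Sum>k\<in>S. \<bar>bd k\<bar>)"
  have fS: "finite S" by (simp add: S_def)
  have cb: "\<bar>c \<nu> k\<bar> \<le> B" if nu: "\<nu> \<in> sobolev_distributions \<alpha> r" and k: "k \<in> S" for \<nu> k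
  proof -
    have pr: "prob_space \<nu>" and sp: "space \<nu> = unit_cube"
      by (rule sobolev_distributionsE[OF nu], assumption)+
    interpret prob_space \<nu> by fact
    have "\<bar>c \<nu> k\<bar> \<le> (LINT x|\<nu>. \<bar>bd k\<bar>)" unfolding c_def
    proof (rule integral_abs_bound[THEN order_trans], rule Bochner_Integration.integral_mono_AE')
      show "AE x in \<nu>. \<bar>legendre_basis k x\<bar> \<le> \<bar>bd k\<bar>"
        using bd sp by (intro AE_I2) (auto intro: order_trans[OF _ abs_ge_self])
    qed auto
    also have "\<dots> = \<bar>bd k\<bar>" by (simp add: prob_space)
    also have "\<dots> \<le> B" unfolding B_def using k fS by (intro member_le_sum) auto
    finally show ?thesis .
  qed
  define e where "e = \<epsilon> / (1 + real (card S))"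
  have e: "e > 0" unfolding e_def using assms by (intro divide_pos_pos add_pos_nonneg) auto
  obtain G' where G': "finite G'" "G' \<subseteq> sobolev_distributions \<alpha> r"
    "\<forall>\<nu>\<in>sobolev_distributions \<alpha> r. \<exists>\<nu>'\<in>G'. \<forall>k\<in>S. \<bar>c \<nu> k - c \<nu>' k\<bar> \<le> e"
    using finite_net[OF fS e, where G="sobolev_distributions \<alpha> r" and c=c, OF cb] by auto
  have wd: "weighted_dist \<beta> K (\<lambda>k. c \<nu>' k - c \<nu> k) \<le> \<epsilon>" if "\<forall>k\<in>S. \<bar>c \<nu> k - c \<nu>' k\<bar> \<le> e" for \<nu> \<nu>'
  proof -
    have "weighted_dist \<beta> K (\<lambda>k. c \<nu>' k - c \<nu> k) \<le> (\<Sum>k\<in>S. \<bar>c \<nu>' k - c \<nu> k\<bar>)"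
      unfolding S_def by (rule weighted_dist_le_sum)
    also have "\<dots> \<le> (\<Sum>k\<in>S. e)" using that by (intro sum_mono) (auto simp: abs_minus_commute)
    also have "\<dots> = (real (card S) / (1 + real (card S))) * \<epsilon>" by (simp add: e_def)
    also have "\<dots> \<le> 1 * \<epsilon>" using assms by (intro mult_right_mono) (auto simp: divide_le_eq_1)
    finally show ?thesis by simp
  qed
  show ?thesis
  proof (intro exI[of _ G'] conjI ballI)
    fix \<nu> :: "(real ^ 'd) measure" assume "\<nu> \<in> sobolev_distributions \<alpha> r"
    with G'(3) obtain \<nu>' where nu': "\<nu>' \<in> G'" "\<forall>k\<in>S. \<bar>c \<nu> k - c \<nu>' k\<bar> \<le> e" by meson
    show "\<exists>\<nu>'\<in>G'. weighted_dist \<beta> K (\<lambda>k. (LINT x|\<nu>'. legendre_basis k x) - (LINT x|\<nu>. legendre_basis k x)) \<le> \<epsilon>"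
      using wd[OF nu'(2)] nu'(1) unfolding c_def by (intro bexI[of _ \<nu>'])
  qed (use G' in auto)
qed

text \<open>
  The minimum distance estimator over a net of precision \<open>1 / n\<close>. By the triangle inequality its weighted
  distance from the truth is at most the precision of the net plus twice the empirical error.
\<close>

theorem minimax_upper_bound:
  assumes d: "\<delta> > 0" and ne: "(sobolev_distributions \<alpha> r :: (real ^ 'd::finite) measure set) \<noteq> {}"
  shows "\<exists>C>0. \<forall>n\<ge>1. \<forall>K\<ge>1.
    minimax_risk (sobolev_distributions \<alpha> r :: (real ^ 'd) measure set) (sobolev_class \<beta> 1) n \<le>
      ennreal (C * (1 / real K ^ (\<alpha> + \<beta>) + 1 / real n +
        sqrt (real K powr (max (real CARD('d) - 2 * real \<beta>) 0 + \<delta>) / real n)))"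
proof -
  define G where "G = (sobolev_distributions \<alpha> r :: (real ^ 'd) measure set)"
  obtain C1 where C1: "C1 > 0" and C1': "\<forall>f\<in>sobolev_class \<beta> 1. \<forall>p\<in>(sobolev_class \<alpha> r :: (real ^ 'd \<Rightarrow> real) set). \<forall>p'\<in>sobolev_class \<alpha> r. \<forall>K\<ge>1.
     \<bar>LINT x|cube_lborel. f x * (p x - p' x)\<bar> \<le>
       C1 * (1 / real K ^ (\<alpha> + \<beta>) + weighted_dist \<beta> K (\<lambda>k. coeff_fun p k - coeff_fun p' k))"
    using integral_difference_bound[of \<beta> \<alpha> r] by blast
  have d2: "\<delta> / 2 > 0" using d by simp
  obtain C2 where C2: "C2 > 0" "\<forall>p\<in>(sobolev_class \<alpha> r :: (real ^ 'd \<Rightarrow> real) set). \<forall>K\<ge>1. \<forall>k\<in>index_box K.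
     (LINT x|cube_lborel. p x * (legendre_basis k x)\<^sup>2) \<le> C2 * real K powr (\<delta> / 2)"
    using second_moment_bound[OF d2] by blast
  obtain C3 where C3: "C3 > 0" "\<forall>K\<ge>1. (\<Sum>k\<in>(index_box K :: ('d \<Rightarrow> nat) set). 1 / (1 + real (max_index k)) ^ (2 * \<beta>)) \<le>
     C3 * real K powr (max (real CARD('d) - 2 * real \<beta>) 0 + \<delta> / 2)"
    using weight_sum_bound[OF d2] by blast
  define C where "C = C1 * (1 + 2 * sqrt (C2 * C3))"
  have C: "C > 0" unfolding C_def using C1 C2 C3 by (intro mult_pos_pos add_pos_nonneg) auto
  have "minimax_risk G (sobolev_class \<beta> 1) n \<le>
      ennreal (C * (1 / real K ^ (\<alpha> + \<beta>) + 1 / real n +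
        sqrt (real K powr (max (real CARD('d) - 2 * real \<beta>) 0 + \<delta>) / real n)))"
    if n: "n \<ge> 1" and K: "K \<ge> 1" for n K
  proof -
    define PM where "PM = PiM {..<n} (\<lambda>_. cube_lborel :: (real ^ 'd) measure)"
    define c where "c = (\<lambda>(\<nu> :: (real ^ 'd) measure) (k :: 'd \<Rightarrow> nat). LINT x|\<nu>. legendre_basis k x)"
    have n1: "1 / real n > 0" using n by simp
    obtain G' where G': "G' \<subseteq> G" "finite G'"
      "\<forall>\<nu>\<in>G. \<exists>\<nu>'\<in>G'. weighted_dist \<beta> K (\<lambda>k. c \<nu>' k - c \<nu> k) \<le> 1 / real n"
      using coefficient_net[OF n1, of \<alpha> r \<beta> K] unfolding c_def G_def by blast
    obtain xs where xs: "set xs = G'" using finite_list[OF G'(2)] by blast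
    have G'ne: "G' \<noteq> {}" using G'(3) ne unfolding G_def by blast
    have len: "length xs > 0" using xs G'ne by auto
    have xsG: "xs ! j \<in> G" if "j < length xs" for j using xs G'(1) nth_mem[OF that] by auto
    define dst where "dst = (\<lambda>j X. weighted_dist \<beta> K (\<lambda>k. c (xs ! j) k - emp_coeff n X k))"
    have dstm[measurable]: "dst j \<in> borel_measurable PM" for j
      unfolding dst_def PM_def
      by (intro weighted_dist_measurable borel_measurable_diff emp_coeff_measurable) auto
    \<comment> \<open>The least index among the minimisers, which makes the selection measurable.\<close>
    define best where "best = (\<lambda>X. LEAST j. j < length xs \<and> (\<forall>l<length xs. dst j X \<le> dst l X))"
    have best_m: "best \<in> measurable PM (count_space UNIV)"
      unfolding best_def
    proof (rule measurable_Least)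
      fix j
      have "{X \<in> space PM. j < length xs \<and> (\<forall>l\<in>{..<length xs}. dst j X \<le> dst l X)} \<in> sets PM"
      proof (rule sets.sets_Collect_conj)
        show "{X \<in> space PM. j < length xs} \<in> sets PM" by (rule sets.sets_Collect_const)
        show "{X \<in> space PM. \<forall>l\<in>{..<length xs}. dst j X \<le> dst l X} \<in> sets PM"
        proof (rule sets.sets_Collect_finite_All')
          show "{X \<in> space PM. dst j X \<le> dst l X} \<in> sets PM" for l by (rule borel_measurable_le[OF dstm dstm])
          show "{..<length xs} \<noteq> {}" using len by blast
        qed simp
      qed
      then show "Measurable.pred PM (\<lambda>X. j < length xs \<and> (\<forall>l<length xs. dst j X \<le> dst l X))"
        unfolding pred_def Ball_def lessThan_iff .
    qed
    have best: "best X < length xs \<and> (\<forall>l<length xs. dst (best X) X \<le> dst l X)" for X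
    proof -
      have "\<exists>j. j < length xs \<and> (\<forall>l<length xs. dst j X \<le> dst l X)"
      proof -
        have "finite ((\<lambda>j. dst j X) ` {..<length xs})" "(\<lambda>j. dst j X) ` {..<length xs} \<noteq> {}" using len by auto
        from Min_in[OF this] obtain j where "j < length xs" "dst j X = Min ((\<lambda>j. dst j X) ` {..<length xs})" by auto
        moreover have "Min ((\<lambda>j. dst j X) ` {..<length xs}) \<le> dst l X" if "l < length xs" for l
          using that by (intro Min_le) auto
        ultimately show ?thesis by auto
      qed
      then show ?thesis unfolding best_def by (rule LeastI_ex)
    qed
    define T where "T = (\<lambda>X. xs ! best X)"
    have TG: "T X \<in> G" for X unfolding T_def using best xsG by blast
    have T_est: "T \<in> estimators n"
    proof -
      \<comment> \<open>The default value 0 makes the list access total; \<open>best X\<close> is always a valid index.\<close>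
      define \<mu> where "\<mu> = (\<lambda>j. xs ! (if j < length xs then j else 0))"
      have "\<mu> \<in> measurable (count_space UNIV) (prob_algebra cube_lborel)"
        unfolding measurable_count_space_eq1 \<mu>_def using xsG len
        by (auto simp: G_def sobolev_distributions_def)
      then have "(\<lambda>X. \<mu> (best X)) \<in> measurable PM (prob_algebra cube_lborel)"
        by (rule measurable_compose[OF best_m])
      moreover have "(\<lambda>X. \<mu> (best X)) = T" using best by (auto simp: \<mu>_def T_def fun_eq_iff)
      ultimately show ?thesis by (simp add: estimators_def PM_def)
    qed
    define e where "e = max (real CARD('d) - 2 * real \<beta>) 0"
    define W where "W = sqrt ((C2 * real K powr (\<delta> / 2)) * (C3 * real K powr (e + \<delta> / 2)) / real n)"
    have W: "W = sqrt (C2 * C3) * sqrt (real K powr (e + \<delta>) / real n)"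
    proof -
      have "real K powr (\<delta> / 2) * real K powr (e + \<delta> / 2) = real K powr (e + \<delta>)"
        by (simp add: add.commute flip: powr_add)
      then have "(C2 * real K powr (\<delta> / 2)) * (C3 * real K powr (e + \<delta> / 2)) / real n = (C2 * C3) * (real K powr (e + \<delta>) / real n)"
        by (simp add: mult_ac)
      then show ?thesis unfolding W_def by (simp only: real_sqrt_mult)
    qed
    define b where "b = 1 / real K ^ (\<alpha> + \<beta>)"
    have b: "b \<ge> 0" by (simp add: b_def)
    have risk: "(\<integral>\<^sup>+ X. ipm (sobolev_class \<beta> 1) \<nu> (T X) \<partial>(PiM {..<n} (\<lambda>_. \<nu>))) \<le> ennreal (C1 * (b + 1 / real n + 2 * W))"
      if nu: "\<nu> \<in> G" for \<nu>
    proof -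
      define P where "P = PiM {..<n} (\<lambda>_. \<nu>)"
      have "prob_space \<nu>" by (rule sobolev_distributionsE[OF nu[unfolded G_def]])
      then interpret P: prob_space P unfolding P_def by (intro prob_space_PiM)
      define Z where "Z = (\<lambda>X. weighted_dist \<beta> K (\<lambda>k. c \<nu> k - emp_coeff n X k))"
      have Z0: "Z X \<ge> 0" for X unfolding Z_def by (rule weighted_dist_nonneg)
      have Zi: "integrable P Z" and Zb: "(LINT X|P. Z X) \<le> W"
        using empirical_risk[OF nu[unfolded G_def] n, of K "C2 * real K powr (\<delta> / 2)" \<beta> "C3 * real K powr (e + \<delta> / 2)"] C2 C3 K
        unfolding Z_def P_def W_def c_def e_def by auto
      have pt: "ipm (sobolev_class \<beta> 1) \<nu> (T X) \<le> ennreal (C1 * (b + 1 / real n + 2 * Z X))" for X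
      proof -
        obtain \<nu>' where nu': "\<nu>' \<in> G'" "weighted_dist \<beta> K (\<lambda>k. c \<nu>' k - c \<nu> k) \<le> 1 / real n" using G'(3) nu by blast
        obtain l where l: "l < length xs" "xs ! l = \<nu>'" using nu'(1) xs by (metis in_set_conv_nth)
        have "weighted_dist \<beta> K (\<lambda>k. c \<nu> k - c (T X) k) \<le> Z X + dst (best X) X"
          unfolding Z_def dst_def T_def by (rule weighted_dist_triangle)
        also have "dst (best X) X \<le> dst l X" using best[of X] l(1) by blast
        also have "dst l X \<le> weighted_dist \<beta> K (\<lambda>k. c \<nu>' k - c \<nu> k) + weighted_dist \<beta> K (\<lambda>k. emp_coeff n X k - c \<nu> k)"
          unfolding dst_def l(2) by (rule weighted_dist_triangle)
        also have "weighted_dist \<beta> K (\<lambda>k. emp_coeff n X k - c \<nu> k) = Z X"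
          unfolding Z_def by (rule weighted_dist_commute)
        finally have wd: "weighted_dist \<beta> K (\<lambda>k. c \<nu> k - c (T X) k) \<le> 1 / real n + 2 * Z X" using nu'(2) by simp
        have "ipm (sobolev_class \<beta> 1) \<nu> (T X) \<le> ennreal (C1 * (b + weighted_dist \<beta> K (\<lambda>k. c \<nu> k - c (T X) k)))"
          unfolding b_def c_def by (rule ipm_sobolev_le[OF nu[unfolded G_def] TG[unfolded G_def] K C1'])
        also have "\<dots> \<le> ennreal (C1 * (b + 1 / real n + 2 * Z X))"
          using C1 wd by (intro ennreal_leI mult_left_mono) auto
        finally show ?thesis .
      qed
      have "(\<integral>\<^sup>+ X. ipm (sobolev_class \<beta> 1) \<nu> (T X) \<partial>P) \<le> (\<integral>\<^sup>+ X. ennreal (C1 * (b + 1 / real n + 2 * Z X)) \<partial>P)"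
        by (intro nn_integral_mono pt)
      also have "\<dots> = ennreal (LINT X|P. C1 * (b + 1 / real n + 2 * Z X))"
        using Zi Z0 b n1 C1 by (intro nn_integral_eq_integral) auto
      also have "(LINT X|P. C1 * (b + 1 / real n + 2 * Z X)) = C1 * (b + 1 / real n + 2 * (LINT X|P. Z X))"
        using Zi by (simp add: P.prob_space)
      also have "\<dots> \<le> C1 * (b + 1 / real n + 2 * W)" using Zb C1 by (intro mult_left_mono) auto
      finally show ?thesis by (simp add: P_def ennreal_leI)
    qed
    have "minimax_risk G (sobolev_class \<beta> 1) n \<le> (SUP \<nu>\<in>G. \<integral>\<^sup>+ X. ipm (sobolev_class \<beta> 1) \<nu> (T X) \<partial>(PiM {..<n} (\<lambda>_. \<nu>)))"
      unfolding minimax_risk_def by (rule INF_lower[OF T_est])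
    also have "\<dots> \<le> ennreal (C1 * (b + 1 / real n + 2 * W))" by (intro SUP_least risk)
    also have "\<dots> \<le> ennreal (C * (b + 1 / real n + sqrt (real K powr (e + \<delta>) / real n)))"
    proof (rule ennreal_leI)
      define V where "V = sqrt (real K powr (e + \<delta>) / real n)"
      have V: "V \<ge> 0" by (simp add: V_def)
      define q where "q = sqrt (C2 * C3)"
      have q: "q \<ge> 0" using C2 C3 by (simp add: q_def)
      have "b + 1 / real n + 2 * W \<le> (1 + 2 * q) * (b + 1 / real n + V)"
      proof -
        have "(1 + 2 * q) * (b + 1 / real n + V) - (b + 1 / real n + 2 * W) = 2 * q * (b + 1 / real n) + V"
          unfolding W V_def[symmetric] q_def[symmetric] by (simp add: algebra_simps)
        moreover have "0 \<le> 2 * q * (b + 1 / real n) + V" using q V b n1 by (intro add_nonneg_nonneg mult_nonneg_nonneg) auto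
        ultimately show ?thesis by linarith
      qed
      from mult_left_mono[OF this, of C1] C1
      show "C1 * (b + 1 / real n + 2 * W) \<le> C * (b + 1 / real n + sqrt (real K powr (e + \<delta>) / real n))"
        by (simp add: C_def q_def V_def mult.assoc)
    qed
    finally show ?thesis unfolding b_def e_def .
  qed
  then show ?thesis using C unfolding G_def by blast
qed

section \<open>Classical derivatives are weak derivatives\<close>

lemma partial_deriv_line:
  assumes "f differentiable (at (x + s *\<^sub>R axis i 1))"
  shows "((\<lambda>t. f (x + t *\<^sub>R axis i 1)) has_real_derivative partial_deriv i f (x + s *\<^sub>R axis i 1)) (at s)"
proof -
  obtain f' where f': "(f has_derivative f') (at (x + s *\<^sub>R axis i 1))" using assms by (auto simp: differentiable_def)
  interpret f': bounded_linear f' using f' by (rule has_derivative_bounded_linear)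
  have line: "((\<lambda>t. f (y + t *\<^sub>R axis i 1)) has_real_derivative f' (axis i 1)) (at u)"
    if "y + u *\<^sub>R axis i 1 = x + s *\<^sub>R axis i 1" for y u
  proof -
    have "((\<lambda>t. y + t *\<^sub>R axis i 1) has_derivative (\<lambda>t. t *\<^sub>R axis i 1)) (at u)"
      by (auto intro!: derivative_eq_intros)
    then have "((\<lambda>t. f (y + t *\<^sub>R axis i 1)) has_derivative (\<lambda>t. f' (t *\<^sub>R axis i 1))) (at u)"
      by (rule has_derivative_compose) (use f' that in simp)
    moreover have "(\<lambda>t. f' (t *\<^sub>R axis i 1)) = (*) (f' (axis i 1))"
      by (auto simp: f'.scaleR mult.commute)
    ultimately show ?thesis by (simp add: has_field_derivative_def)
  qed
  have "partial_deriv i f (x + s *\<^sub>R axis i 1) = f' (axis i 1)"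
    unfolding partial_deriv_def by (rule DERIV_imp_deriv[OF line]) simp
  then show ?thesis using line[of x s] by simp
qed

text \<open>
  Difference quotients have integral zero by translation invariance, and they converge dominatedly.
\<close>

lemma integral_partial_deriv_zero:
  fixes v w :: "real ^ 'd::finite \<Rightarrow> real"
  assumes d: "\<And>x s. ((\<lambda>t. v (x + t *\<^sub>R axis i 1)) has_real_derivative w (x + s *\<^sub>R axis i 1)) (at s)"
    and cv: "continuous_on UNIV v" and cw: "continuous_on UNIV w"
    and supp: "\<And>x. x \<notin> cball 0 R \<Longrightarrow> v x = 0" "\<And>x. x \<notin> cball 0 R \<Longrightarrow> w x = 0"
  shows "(LINT x|lborel. w x) = 0"
proof -
  have vi: "integrable lborel v"
  proof -
    have "integrable lborel (\<lambda>x. indicator (cball 0 R) x *\<^sub>R v x)"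
      by (rule borel_integrable_compact) (auto intro: continuous_on_subset[OF cv])
    moreover have "(\<lambda>x. indicator (cball 0 R) x *\<^sub>R v x) = v" using supp(1) by (auto simp: indicator_def fun_eq_iff)
    ultimately show ?thesis by simp
  qed
  have [measurable]: "v \<in> borel_measurable borel" "w \<in> borel_measurable borel"
    using cv cw by (auto intro: borel_measurable_continuous_onI)
  have "bounded (w ` cball 0 R)"
    by (intro compact_imp_bounded compact_continuous_image continuous_on_subset[OF cw]) auto
  then obtain B where B: "\<forall>x\<in>cball 0 R. \<bar>w x\<bar> \<le> B" by (auto simp: bounded_iff)
  have Bw: "\<bar>w x\<bar> \<le> \<bar>B\<bar>" for x
  proof (cases "x \<in> cball 0 R")
    case True
    with B have "\<bar>w x\<bar> \<le> B" by blast
    then show ?thesis by linarith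
  next
    case False
    then show ?thesis using supp(2)[of x] by simp
  qed
  define t where "t = (\<lambda>n. 1 / real (Suc n))"
  have t: "0 < t n" "t n \<le> 1" for n by (auto simp: t_def)
  have t0: "t \<longlonglongrightarrow> 0" unfolding t_def using LIMSEQ_inverse_real_of_nat by (simp add: inverse_eq_divide)
  define q where "q = (\<lambda>n x. (v (x + t n *\<^sub>R axis i 1) - v x) / t n)"
  have qint: "(LINT x|lborel. q n x) = 0" for n
  proof -
    have tr: "lborel = distr lborel borel ((+) (t n *\<^sub>R axis i (1::real)) :: real ^ 'd \<Rightarrow> _)"
      by (rule lborel_distr_plus[symmetric])
    have "(LINT x|lborel. v x) = (LINT x|distr lborel borel ((+) (t n *\<^sub>R axis i 1)). v x)"
      by (subst tr) simp
    also have "\<dots> = (LINT x|lborel. v (t n *\<^sub>R axis i 1 + x))"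
      by (subst integral_distr) auto
    finally have e: "(LINT x|lborel. v (x + t n *\<^sub>R axis i 1)) = (LINT x|lborel. v x)" by (simp add: add.commute)
    have "integrable (distr lborel borel ((+) (t n *\<^sub>R axis i 1))) v" using vi by (subst tr[symmetric])
    then have "integrable lborel (\<lambda>x. v (t n *\<^sub>R axis i 1 + x))"
      by (subst (asm) integrable_distr_eq) auto
    then have "(LINT x|lborel. v (x + t n *\<^sub>R axis i 1) - v x) = 0"
      using vi e by (subst Bochner_Integration.integral_diff) (auto simp: add.commute)
    then show ?thesis by (simp add: q_def)
  qed
  have qb: "\<bar>q n x\<bar> \<le> \<bar>B\<bar> * indicator (cball 0 (R + 1)) x" for n x
  proof (cases "x \<in> cball 0 (R + 1)")
    case True
    have "\<exists>z>0. z < t n \<and> v (x + t n *\<^sub>R axis i 1) - v (x + 0 *\<^sub>R axis i 1) = (t n - 0) * w (x + z *\<^sub>R axis i 1)"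
      using d by (intro MVT2[OF t(1)]) auto
    then obtain z where "v (x + t n *\<^sub>R axis i 1) - v x = t n * w (x + z *\<^sub>R axis i 1)" by auto
    then have "q n x = w (x + z *\<^sub>R axis i 1)" using t(1)[of n] by (simp add: q_def)
    then show ?thesis using True Bw by simp
  next
    case False
    then have nx: "norm x > R + 1" by simp
    have "norm x \<le> norm (x + t n *\<^sub>R axis i 1) + norm (t n *\<^sub>R axis i (1::real) :: real ^ 'd)"
      using norm_triangle_ineq4[of "x + t n *\<^sub>R axis i 1" "t n *\<^sub>R axis i 1"] by simp
    then have "norm (x + t n *\<^sub>R axis i 1) > R" using nx t[of n] by (simp add: norm_axis_1)
    then have "v (x + t n *\<^sub>R axis i 1) = 0" "v x = 0" using supp(1) nx by auto
    then show ?thesis by (simp add: q_def)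
  qed
  have ql: "(\<lambda>n. q n x) \<longlonglongrightarrow> w x" for x
  proof -
    have "((\<lambda>h. (v (x + (0 + h) *\<^sub>R axis i 1) - v (x + 0 *\<^sub>R axis i 1)) / h) \<longlongrightarrow> w (x + 0 *\<^sub>R axis i 1)) (at 0)"
      using d[of x 0] unfolding DERIV_def .
    moreover have "filterlim t (at 0) sequentially"
      using t0 t(1) by (intro filterlim_atI) (auto simp: less_imp_neq[symmetric])
    ultimately show ?thesis unfolding q_def by (auto dest: filterlim_compose)
  qed
  have qm[measurable]: "q n \<in> borel_measurable borel" for n unfolding q_def by measurable
  have "(\<lambda>n. LINT x|lborel. q n x) \<longlonglongrightarrow> (LINT x|lborel. w x)"
  proof (rule integral_dominated_convergence[where w="\<lambda>x. \<bar>B\<bar> * indicator (cball 0 (R + 1)) x"])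
    have "integrable lborel (indicator (cball 0 (R + 1)) :: real ^ 'd \<Rightarrow> real)"
      using emeasure_lborel_cball_finite by (auto simp: integrable_indicator_iff)
    then show "integrable lborel (\<lambda>x :: real ^ 'd. \<bar>B\<bar> * indicator (cball 0 (R + 1)) x)" by simp
  qed (use qb ql in auto)
  then show ?thesis unfolding qint using LIMSEQ_unique tendsto_const by blast
qed

lemma iter_partial_zero_open:
  assumes "open S" "\<And>x. x \<in> S \<Longrightarrow> f x = 0" "x \<in> S"
  shows "iter_partial is f x = 0"
  using assms(3)
proof (induction "is" arbitrary: x)
  case Nil
  then show ?case using assms(2) by simp
next
  case (Cons i "is")
  have c: "continuous_on UNIV (\<lambda>t. x + t *\<^sub>R axis i (1::real))" by (intro continuous_intros)
  have o: "open ((\<lambda>t. x + t *\<^sub>R axis i (1::real)) -` S)" by (rule open_vimage[OF assms(1) c])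
  have z: "((\<lambda>_. 0 :: real) has_real_derivative 0) (at 0)" by simp
  have "((\<lambda>t. iter_partial is f (x + t *\<^sub>R axis i 1)) has_real_derivative 0) (at 0)"
    by (rule has_field_derivative_transform_within_open[OF z o]) (use Cons in auto)
  then show ?case by (simp add: partial_deriv_def DERIV_imp_deriv)
qed

lemma tensor_continuous: "(\<And>i. smooth1 (G i)) \<Longrightarrow> continuous_on A (tensor G)"
  by (meson continuous_at_imp_continuous_on differentiable_imp_continuous_within tensor_differentiable)

text \<open>
  Integration by parts, one derivative of the test function at a time. It suffices to treat tensor
  products, because the perturbations of the lower bound are sums of tensor products.
\<close>

lemma tensor_parts_iter:
  fixes G :: "'d::finite \<Rightarrow> real \<Rightarrow> real"
  assumes \<phi>: "smooth \<phi>" and K: "\<And>x. x \<notin> cball 0 R \<Longrightarrow> \<phi> x = 0" and G: "\<And>i. smooth1 (G i)"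
  shows "(LINT x|lborel. tensor G x * iter_partial is \<phi> x) =
    (- 1) ^ length is * (LINT x|lborel. tensor (\<lambda>i. (deriv ^^ count_list is i) (G i)) x * \<phi> x)"
  using G
proof (induction "is" arbitrary: G)
  case Nil
  then show ?case by (simp add: tensor_def)
next
  case (Cons i "is")
  define u where "u = iter_partial is \<phi>"
  define G' where "G' = G(i := deriv (G i))"
  have sG': "smooth1 (G' j)" for j using Cons.prems by (auto simp: G'_def intro: smooth1_deriv)
  have ud: "u differentiable (at x)" for x using \<phi> by (simp add: smooth_def u_def)
  have ud': "partial_deriv i u differentiable (at x)" for x
    using \<phi>[unfolded smooth_def, rule_format, of "i # is" x] by (simp add: u_def)
  have cu: "continuous_on UNIV u" "continuous_on UNIV (partial_deriv i u)"
    using ud ud' by (auto intro!: continuous_at_imp_continuous_on differentiable_imp_continuous_within)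
  have out: "open (- cball 0 R :: (real ^ 'd) set)" by auto
  have u0: "u x = 0" "partial_deriv i u x = 0" if "x \<notin> cball 0 R" for x
    using iter_partial_zero_open[OF out, of \<phi> x "is"] iter_partial_zero_open[OF out, of \<phi> x "i # is"] K that
    by (auto simp: u_def)
  have pG: "partial_deriv i (tensor G) = tensor G'"
    unfolding G'_def by (rule iter_partial_tensor_aux[OF Cons.prems])
  define w where "w = (\<lambda>x. tensor G' x * u x + partial_deriv i u x * tensor G x)"
  have cG: "continuous_on UNIV (tensor G)" "continuous_on UNIV (tensor G')"
    using tensor_continuous Cons.prems sG' by auto
  have "(LINT x|lborel. w x) = 0"
  proof (rule integral_partial_deriv_zero[where v="\<lambda>x. tensor G x * u x" and R=R])
    fix x :: "real ^ 'd" and s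
    show "((\<lambda>t. tensor G (x + t *\<^sub>R axis i 1) * u (x + t *\<^sub>R axis i 1)) has_real_derivative w (x + s *\<^sub>R axis i 1)) (at s)"
    proof -
      have 1: "((\<lambda>t. tensor G (x + t *\<^sub>R axis i 1)) has_real_derivative tensor G' (x + s *\<^sub>R axis i 1)) (at s)"
        unfolding pG[symmetric] by (rule partial_deriv_line) (intro tensor_differentiable Cons.prems)
      have 2: "((\<lambda>t. u (x + t *\<^sub>R axis i 1)) has_real_derivative partial_deriv i u (x + s *\<^sub>R axis i 1)) (at s)"
        by (rule partial_deriv_line[OF ud])
      show ?thesis unfolding w_def by (rule DERIV_mult[OF 1 2])
    qed
  qed (auto simp: w_def u0 intro!: continuous_intros cG cu)
  moreover have int: "integrable lborel (\<lambda>x. f x * g x)"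
    if "continuous_on UNIV f" "continuous_on UNIV g" "\<And>x. x \<notin> cball 0 R \<Longrightarrow> g x = 0" for f g :: "real ^ 'd \<Rightarrow> real"
  proof -
    have "integrable lborel (\<lambda>x. indicator (cball 0 R) x *\<^sub>R (f x * g x))"
      by (rule borel_integrable_compact) (auto intro!: continuous_on_mult continuous_on_subset[OF that(1)] continuous_on_subset[OF that(2)])
    moreover have "(\<lambda>x. indicator (cball 0 R) x *\<^sub>R (f x * g x)) = (\<lambda>x. f x * g x)"
      using that(3) by (auto simp: indicator_def fun_eq_iff)
    ultimately show ?thesis by simp
  qed
  ultimately have "(LINT x|lborel. tensor G' x * u x) + (LINT x|lborel. tensor G x * partial_deriv i u x) = 0"
    using int[OF cG(2) cu(1) u0(1)] int[OF cG(1) cu(2) u0(2)]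
    by (simp add: w_def mult.commute)
  then have "(LINT x|lborel. tensor G x * iter_partial (i # is) \<phi> x) = - (LINT x|lborel. tensor G' x * u x)"
    by (simp add: u_def)
  also have "(LINT x|lborel. tensor G' x * u x) =
     (- 1) ^ length is * (LINT x|lborel. tensor (\<lambda>j. (deriv ^^ count_list is j) (G' j)) x * \<phi> x)"
    unfolding u_def by (rule Cons.IH[OF sG'])
  also have "(\<lambda>j. (deriv ^^ count_list is j) (G' j)) = (\<lambda>j. (deriv ^^ count_list (i # is) j) (G j))"
    by (auto simp: G'_def fun_eq_iff funpow_swap1)
  finally show ?case by simp
qed

lemma multi_order_count_list: "multi_order (count_list is) = length is"
proof -
  have "(\<Sum>i\<in>UNIV. count_list is i) = length is"
    using sum_count_set[of "is" UNIV] by simp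
  then show ?thesis by (simp add: multi_order_def)
qed

lemma continuous_locally_integrable: "continuous_on UNIV f \<Longrightarrow> locally_integrable U f"
  unfolding locally_integrable_def set_integrable_def
proof (intro allI impI)
  fix K assume "continuous_on UNIV f" "compact K \<and> K \<subseteq> U"
  then show "integrable lborel (\<lambda>x. indicator K x *\<^sub>R f x)"
    using continuous_on_subset by (intro borel_integrable_compact) auto
qed

theorem weak_deriv_of_tensor:
  fixes G :: "'d::finite \<Rightarrow> real \<Rightarrow> real"
  assumes G: "\<And>i. smooth1 (G i)"
  shows "weak_deriv U \<gamma> (tensor G) (tensor (\<lambda>i. (deriv ^^ \<gamma> i) (G i)))"
  unfolding weak_deriv_def
proof (intro conjI allI impI)
  show "locally_integrable U (tensor G)" "locally_integrable U (tensor (\<lambda>i. (deriv ^^ \<gamma> i) (G i)))"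
    by (intro continuous_locally_integrable tensor_continuous smooth1_iter_deriv G)+
  fix \<phi> :: "real ^ 'd \<Rightarrow> real" assume tf: "test_function U \<phi>"
  define C where "C = closure {x. \<phi> x \<noteq> 0}"
  have C: "compact C" "C \<subseteq> U" and sm: "smooth \<phi>" using tf by (auto simp: test_function_def C_def)
  have phi0: "\<phi> x = 0" if "x \<notin> C" for x using that closure_subset[of "{x. \<phi> x \<noteq> 0}"] by (auto simp: C_def)
  obtain R where "\<forall>x\<in>C. norm x \<le> R" using compact_imp_bounded[OF C(1)] by (auto simp: bounded_iff)
  then have R: "C \<subseteq> cball 0 R" by auto
  define xs where "xs = (SOME is. \<forall>i. count_list is i = \<gamma> i)"
  have xs: "count_list xs = \<gamma>" unfolding xs_def using someI_ex[OF ex_list_multi_index[of \<gamma>]] by (simp add: fun_eq_iff)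
  have o: "open (- C)" using compact_imp_closed[OF C(1)] by (simp add: open_Compl)
  have md0: "iter_partial xs \<phi> x = 0" if "x \<notin> C" for x
    by (rule iter_partial_zero_open[OF o]) (use phi0 that in auto)
  have LU: "(LINT x:U|lborel. h x * g x) = (LINT x|lborel. h x * g x)" if "\<And>x. x \<notin> C \<Longrightarrow> g x = 0" for h g :: "real ^ 'd \<Rightarrow> real"
    unfolding set_lebesgue_integral_def using that C(2)
    by (intro Bochner_Integration.integral_cong) (auto simp: indicator_def)
  have "(LINT x|lborel. tensor G x * iter_partial xs \<phi> x) =
    (- 1) ^ length xs * (LINT x|lborel. tensor (\<lambda>i. (deriv ^^ count_list xs i) (G i)) x * \<phi> x)"
    by (rule tensor_parts_iter[OF sm _ G, of R]) (use phi0 R in blast)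
  then show "(LINT x:U|lborel. tensor G x * multi_deriv \<gamma> \<phi> x) =
     (- 1) ^ multi_order \<gamma> * (LINT x:U|lborel. tensor (\<lambda>i. (deriv ^^ \<gamma> i) (G i)) x * \<phi> x)"
  proof -
    assume *: "(LINT x|lborel. tensor G x * iter_partial xs \<phi> x) =
      (- 1) ^ length xs * (LINT x|lborel. tensor (\<lambda>i. (deriv ^^ count_list xs i) (G i)) x * \<phi> x)"
    have "(LINT x:U|lborel. tensor G x * iter_partial xs \<phi> x) = (LINT x|lborel. tensor G x * iter_partial xs \<phi> x)"
      by (rule LU) (rule md0)
    moreover have "(LINT x:U|lborel. tensor (\<lambda>i. (deriv ^^ \<gamma> i) (G i)) x * \<phi> x) =
        (LINT x|lborel. tensor (\<lambda>i. (deriv ^^ \<gamma> i) (G i)) x * \<phi> x)"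
      by (rule LU) (rule phi0)
    ultimately show ?thesis
      using * multi_order_count_list[of xs] by (simp add: xs multi_deriv_def flip: xs_def)
  qed
qed

lemma continuous_iter_partial: "smooth \<phi> \<Longrightarrow> continuous_on A (iter_partial is \<phi>)"
  by (auto simp: smooth_def intro!: continuous_at_imp_continuous_on differentiable_imp_continuous_within)

text \<open>
  Continuity makes all products with test functions integrable, so that the integrals can be split.
\<close>

lemma weak_deriv_add:
  fixes f f' g g' :: "real ^ 'd::finite \<Rightarrow> real"
  assumes f: "weak_deriv U \<gamma> f f'" and g: "weak_deriv U \<gamma> g g'"
    and c: "continuous_on UNIV f" "continuous_on UNIV f'" "continuous_on UNIV g" "continuous_on UNIV g'"
  shows "weak_deriv U \<gamma> (\<lambda>x. f x + a * g x) (\<lambda>x. f' x + a * g' x)"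
  unfolding weak_deriv_def
proof (intro conjI allI impI)
  show "locally_integrable U (\<lambda>x. f x + a * g x)" "locally_integrable U (\<lambda>x. f' x + a * g' x)"
    by (intro continuous_locally_integrable continuous_intros c)+
  fix \<phi> :: "real ^ 'd \<Rightarrow> real" assume tf: "test_function U \<phi>"
  define C where "C = closure {x. \<phi> x \<noteq> 0}"
  have C: "compact C" "C \<subseteq> U" and sm: "smooth \<phi>" using tf by (auto simp: test_function_def C_def)
  have phi0: "\<phi> x = 0" if "x \<notin> C" for x using that closure_subset[of "{x. \<phi> x \<noteq> 0}"] by (auto simp: C_def)
  have o: "open (- C)" using compact_imp_closed[OF C(1)] by (simp add: open_Compl)
  have md0: "multi_deriv \<gamma> \<phi> x = 0" if "x \<notin> C" for x
    unfolding multi_deriv_def by (rule iter_partial_zero_open[OF o]) (use phi0 that in auto)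
  have cphi: "continuous_on UNIV \<phi>" "continuous_on UNIV (multi_deriv \<gamma> \<phi>)"
    using continuous_iter_partial[OF sm, of UNIV "[]"] continuous_iter_partial[OF sm] by (auto simp: multi_deriv_def)
  have int: "set_integrable lborel U (\<lambda>x. h x * \<psi> x)"
    if "continuous_on UNIV h" "continuous_on UNIV \<psi>" "\<And>x. x \<notin> C \<Longrightarrow> \<psi> x = 0" for h \<psi> :: "real ^ 'd \<Rightarrow> real"
  proof -
    have "integrable lborel (\<lambda>x. indicator C x *\<^sub>R (h x * \<psi> x))"
      by (rule borel_integrable_compact[OF C(1)]) (auto intro!: continuous_on_mult continuous_on_subset[OF that(1)] continuous_on_subset[OF that(2)])
    moreover have "(\<lambda>x. indicator C x *\<^sub>R (h x * \<psi> x)) = (\<lambda>x. indicator U x *\<^sub>R (h x * \<psi> x))"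
      using that(3) C(2) by (auto simp: indicator_def fun_eq_iff)
    ultimately show ?thesis by (simp add: set_integrable_def)
  qed
  have lin: "(LINT x:U|lborel. (h x + a * k x) * \<psi> x) = (LINT x:U|lborel. h x * \<psi> x) + a * (LINT x:U|lborel. k x * \<psi> x)"
    if h: "continuous_on UNIV h" and k: "continuous_on UNIV k" and p: "continuous_on UNIV \<psi>" "\<And>x. x \<notin> C \<Longrightarrow> \<psi> x = 0"
    for h k \<psi> :: "real ^ 'd \<Rightarrow> real"
  proof -
    have "(LINT x:U|lborel. (h x + a * k x) * \<psi> x) = (LINT x:U|lborel. h x * \<psi> x + a * (k x * \<psi> x))"
      by (simp add: algebra_simps)
    also have "\<dots> = (LINT x:U|lborel. h x * \<psi> x) + a * (LINT x:U|lborel. k x * \<psi> x)"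
      using int[OF h p] int[OF k p] by (subst set_integral_add(2)) auto
    finally show ?thesis .
  qed
  show "(LINT x:U|lborel. (f x + a * g x) * multi_deriv \<gamma> \<phi> x) =
     (- 1) ^ multi_order \<gamma> * (LINT x:U|lborel. (f' x + a * g' x) * \<phi> x)"
  proof -
    have 1: "(LINT x:U|lborel. f x * multi_deriv \<gamma> \<phi> x) = (- 1) ^ multi_order \<gamma> * (LINT x:U|lborel. f' x * \<phi> x)"
      "(LINT x:U|lborel. g x * multi_deriv \<gamma> \<phi> x) = (- 1) ^ multi_order \<gamma> * (LINT x:U|lborel. g' x * \<phi> x)"
      using f g tf unfolding weak_deriv_def by blast+
    have "(LINT x:U|lborel. (f x + a * g x) * multi_deriv \<gamma> \<phi> x) =
        (LINT x:U|lborel. f x * multi_deriv \<gamma> \<phi> x) + a * (LINT x:U|lborel. g x * multi_deriv \<gamma> \<phi> x)"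
      by (rule lin[OF c(1,3) cphi(2) md0])
    also have "\<dots> = (- 1) ^ multi_order \<gamma> * ((LINT x:U|lborel. f' x * \<phi> x) + a * (LINT x:U|lborel. g' x * \<phi> x))"
      unfolding 1 by (simp only: distrib_left mult.left_commute)
    also have "(LINT x:U|lborel. f' x * \<phi> x) + a * (LINT x:U|lborel. g' x * \<phi> x) = (LINT x:U|lborel. (f' x + a * g' x) * \<phi> x)"
      by (rule lin[OF c(2,4) cphi(1) phi0, symmetric])
    finally show ?thesis .
  qed
qed

section \<open>Perturbations of the uniform density\<close>

text \<open>
  The derivative of \<open>exp (- 1 / t) exp (- 1 / (1 - t))\<close>, by \<open>bump_antiderivative\<close>. It is smooth and supported
  in the unit interval, and its integral is zero, so that adding it to a density preserves the mass.
\<close>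

definition bump :: "real \<Rightarrow> real" where
  "bump t = flat_exp [:0,0,1:] t * flat_exp 1 (1 - t) - flat_exp 1 t * flat_exp [:0,0,1:] (1 - t)"

lemma bump_antiderivative:
  "((\<lambda>t. flat_exp 1 t * flat_exp 1 (1 - t)) has_real_derivative bump t) (at t)"
proof -
  have 1: "(flat_exp 1 has_real_derivative flat_exp [:0,0,1:] t) (at t)" for t
    using flat_exp_deriv[of 1 t] by simp
  have 2: "((\<lambda>t. flat_exp 1 (1 - t)) has_real_derivative flat_exp [:0,0,1:] (1 - t) * (- 1)) (at t)"
    by (rule DERIV_chain2[OF 1]) (auto intro!: derivative_eq_intros)
  show ?thesis
    by (rule DERIV_cong[OF DERIV_mult[OF 1 2]]) (simp add: bump_def)
qed

lemma smooth1_bump: "smooth1 bump"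
proof -
  have "smooth1 (\<lambda>t. flat_exp p ((-1) * t + 1))" for p by (rule smooth1_affine[OF smooth1_flat_exp])
  then have s: "smooth1 (\<lambda>t. flat_exp p (1 - t))" for p by (simp add: add.commute)
  have "smooth1 (\<lambda>t. flat_exp [:0,0,1:] t * flat_exp 1 (1 - t) + (-1) * (flat_exp 1 t * flat_exp [:0,0,1:] (1 - t)))"
    by (intro smooth1_add smooth1_mult smooth1_const smooth1_flat_exp s)
  then show ?thesis by (simp add: bump_def[abs_def])
qed

definition bump_deriv :: "nat \<Rightarrow> real \<Rightarrow> real" where
  "bump_deriv n = (deriv ^^ n) bump"

lemma smooth1_bump_deriv: "smooth1 (bump_deriv n)"
  unfolding bump_deriv_def by (intro smooth1_iter_deriv smooth1_bump)

lemma bump_deriv_zero: "t \<le> 0 \<or> 1 \<le> t \<Longrightarrow> bump_deriv n t = 0"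
proof -
  have b: "bump t = 0" if "t \<le> 0 \<or> 1 \<le> t" for t using that by (auto simp: bump_def flat_exp_def)
  have z: "bump_deriv n t = 0" if "t < 0 \<or> 1 < t" for t
    unfolding bump_deriv_def by (rule deriv_iter_zero_outside[OF b that])
  have c: "continuous_on A (bump_deriv n)" for A by (rule smooth1_continuous[OF smooth1_bump_deriv])
  assume "t \<le> 0 \<or> 1 \<le> t"
  then show ?thesis
  proof
    assume "t \<le> 0"
    have "bump_deriv n x = 0" if "x \<in> closure {..<0}" for x
      by (rule continuous_constant_on_closure[OF c _ that]) (use z in auto)
    with \<open>t \<le> 0\<close> show ?thesis by simp
  next
    assume "1 \<le> t"
    have "bump_deriv n x = 0" if "x \<in> closure {1<..}" for x
      by (rule continuous_constant_on_closure[OF c _ that]) (use z in auto)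
    with \<open>1 \<le> t\<close> show ?thesis by simp
  qed
qed

lemma integral_rescaled:
  fixes F :: "real \<Rightarrow> real"
  assumes F: "\<And>t. t \<le> 0 \<or> 1 \<le> t \<Longrightarrow> F t = 0" and M: "M \<ge> 1" and j: "j < M"
  shows "(LINT t|unit_interval. F (real M * t - real j)) = (1 / real M) * (LINT t|unit_interval. F t)"
proof -
  have ui: "(LINT t|unit_interval. h t) = (LINT t|lborel. h t)" if "\<And>t. t \<notin> {0..1} \<Longrightarrow> h t = 0" for h :: "real \<Rightarrow> real"
  proof -
    have "(LINT t|unit_interval. h t) = (LINT t|lborel. indicator {0..1} t * h t)"
      by (simp add: unit_interval_def integral_restrict_space)
    also have "(\<lambda>t. indicator {0..1} t * h t) = h" using that by (auto simp: indicator_def fun_eq_iff)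
    finally show ?thesis .
  qed
  have M0: "real M > 0" using M by simp
  have "F (real M * t - real j) = 0" if t: "t \<notin> {0..1}" for t
  proof (rule F)
    show "real M * t - real j \<le> 0 \<or> 1 \<le> real M * t - real j"
    proof (cases "t < 0")
      case True
      then have "real M * t \<le> 0" using M0 by (simp add: mult_nonneg_nonpos)
      then show ?thesis by simp
    next
      case False
      then have "real M * t \<ge> real M" using t M0 by (simp add: mult_le_cancel_left1)
      moreover have "real M \<ge> real j + 1" using j by simp
      ultimately show ?thesis by linarith
    qed
  qed
  then have "(LINT t|unit_interval. F (real M * t - real j)) = (LINT t|lborel. F (real M * t - real j))"
    by (rule ui)
  moreover have "(LINT t|lborel. F t) = real M * (LINT t|lborel. F (real M * t - real j))"
    using lborel_integral_real_affine[of "real M" F "- real j"] M0 by simp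
  moreover have "(LINT t|unit_interval. F t) = (LINT t|lborel. F t)" by (rule ui) (use F in auto)
  ultimately show ?thesis using M0 by simp
qed

text \<open>
  The derivative of order \<open>\<gamma>\<close> of the bump transplanted to the \<open>j\<close>-th cell of the grid of mesh \<open>1 / M\<close>; the
  index \<open>\<gamma> = 0\<close> is the bump itself.
\<close>

definition cell_bump :: "nat \<Rightarrow> ('d::finite \<Rightarrow> nat) \<Rightarrow> ('d \<Rightarrow> nat) \<Rightarrow> real ^ 'd \<Rightarrow> real" where
  "cell_bump M \<gamma> j = tensor (\<lambda>i t. real M ^ \<gamma> i * bump_deriv (\<gamma> i) (real M * t - real (j i)))"

lemma deriv_iter_rescaled:
  "(deriv ^^ n) (\<lambda>t. bump (real M * t - real j)) = (\<lambda>t. real M ^ n * bump_deriv n (real M * t - real j))"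
proof (induction n)
  case 0
  then show ?case by (simp add: bump_deriv_def)
next
  case (Suc n)
  have "((\<lambda>t. real M ^ n * bump_deriv n (real M * t - real j)) has_real_derivative
      real M ^ n * (deriv (bump_deriv n) (real M * t - real j) * real M)) (at t)" for t
    by (intro DERIV_cmult DERIV_chain2[OF smooth1_deriv(1)[OF smooth1_bump_deriv]]) (auto intro!: derivative_eq_intros)
  then have "deriv (\<lambda>t. real M ^ n * bump_deriv n (real M * t - real j)) t = real M ^ Suc n * bump_deriv (Suc n) (real M * t - real j)" for t
    by (subst DERIV_imp_deriv[of _ "real M ^ n * (deriv (bump_deriv n) (real M * t - real j) * real M)"])
       (auto simp: bump_deriv_def)
  then show ?case using Suc by auto
qed

lemma smooth1_rescaled: "smooth1 (\<lambda>t. c * bump_deriv n (real M * t - real j))"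
proof -
  have "smooth1 (\<lambda>t. c * bump_deriv n (real M * t + (- real j)))"
    by (intro smooth1_mult smooth1_const smooth1_affine smooth1_bump_deriv)
  then show ?thesis by simp
qed

lemma continuous_cell_bump: "continuous_on A (cell_bump M \<gamma> j)"
  unfolding cell_bump_def by (intro tensor_continuous smooth1_rescaled)

lemma cell_bump_weak_deriv: "weak_deriv U \<gamma> (cell_bump M (\<lambda>_. 0) j) (cell_bump M \<gamma> j)"
proof -
  have "weak_deriv U \<gamma> (tensor (\<lambda>i t. bump (real M * t - real (j i)))) (tensor (\<lambda>i. (deriv ^^ \<gamma> i) (\<lambda>t. bump (real M * t - real (j i)))))"
    by (rule weak_deriv_of_tensor) (use smooth1_rescaled[of 1 0] in \<open>simp add: bump_deriv_def\<close>)
  then show ?thesis unfolding deriv_iter_rescaled by (simp add: cell_bump_def bump_deriv_def)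
qed

lemma cell_bump_disjoint:
  assumes "j \<noteq> l" shows "cell_bump M \<gamma> j x * cell_bump M \<gamma>' l x = 0"
proof -
  obtain i where i: "j i \<noteq> l i" using assms by auto
  have "bump_deriv (\<gamma> i) (real M * (x $ i) - real (j i)) = 0 \<or> bump_deriv (\<gamma>' i) (real M * (x $ i) - real (l i)) = 0"
  proof (rule ccontr)
    assume *: "\<not> ?thesis"
    have "0 < real M * (x $ i) - real (j i)" "real M * (x $ i) - real (j i) < 1"
      "0 < real M * (x $ i) - real (l i)" "real M * (x $ i) - real (l i) < 1"
      using * bump_deriv_zero by (meson not_le)+
    then have "real (j i) < real (l i) + 1" "real (l i) < real (j i) + 1" by linarith+
    then show False using i by linarith
  qed
  then show ?thesis
    unfolding cell_bump_def tensor_mult unfolding tensor_def by (intro prod_zero) (auto intro!: bexI[of _ i])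
qed

text \<open>
  The squared \<open>L\<^sup>2\<close> norm of the derivative of order \<open>\<gamma>\<close> of the bump that fills the whole cube.
\<close>

definition bump_energy :: "('d::finite \<Rightarrow> nat) \<Rightarrow> real" where
  "bump_energy \<gamma> = (\<Prod>i\<in>UNIV. LINT t|unit_interval. (bump_deriv (\<gamma> i) t)\<^sup>2)"

lemma bump_energy_nonneg: "bump_energy \<gamma> \<ge> 0"
  unfolding bump_energy_def by (intro prod_nonneg) auto

text \<open>
  Scaling: each derivative contributes a factor \<open>M\<close> and each coordinate a factor \<open>1 / M\<close> of volume.
\<close>

lemma cell_bump_square_integral:
  fixes \<gamma> j :: "'d::finite \<Rightarrow> nat"
  assumes M: "M \<ge> 1" and j: "j \<in> index_box M"
  shows "(LINT x|cube_lborel. (cell_bump M \<gamma> j x)\<^sup>2) = real M ^ (2 * multi_order \<gamma>) / real M ^ CARD('d) * bump_energy \<gamma>"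
proof -
  have ji: "j i < M" for i using j max_index_ge[of j i] by (simp add: index_box_def)
  define g where "g = (\<lambda>i t. real M ^ (2 * \<gamma> i) * (bump_deriv (\<gamma> i) (real M * t - real (j i)))\<^sup>2)"
  have sq: "real M ^ (2 * n) = real M ^ n * real M ^ n" for n by (simp add: mult_2 power_add)
  have "(cell_bump M \<gamma> j x)\<^sup>2 = tensor g x" for x
    unfolding cell_bump_def power2_eq_square tensor_mult g_def sq by (simp add: mult_ac)
  then have "(LINT x|cube_lborel. (cell_bump M \<gamma> j x)\<^sup>2) = (LINT x|cube_lborel. tensor g x)" by simp
  also have "\<dots> = (\<Prod>i\<in>UNIV. LINT t|unit_interval. g i t)"
  proof (rule cube_tensor(2))
    show "integrable unit_interval (g i)" for i unfolding g_def
      using smooth1_rescaled[of 1 "\<gamma> i" M "j i"]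
      by (intro integrable_unit_interval_cont continuous_intros smooth1_continuous) simp
  qed
  also have "\<dots> = (\<Prod>i\<in>UNIV. real M ^ (2 * \<gamma> i) * ((1 / real M) * (LINT t|unit_interval. (bump_deriv (\<gamma> i) t)\<^sup>2)))"
    unfolding g_def using integral_rescaled[of "\<lambda>t. (bump_deriv (\<gamma> _) t)\<^sup>2", OF _ M ji] bump_deriv_zero
    by (intro prod.cong refl) simp
  also have "\<dots> = (\<Prod>i\<in>UNIV. real M ^ (2 * \<gamma> i)) * (1 / real M) ^ CARD('d) * bump_energy \<gamma>"
    by (simp add: prod.distrib prod_dividef bump_energy_def power_one_over)
  also have "(\<Prod>i\<in>UNIV. real M ^ (2 * \<gamma> i)) = real M ^ (2 * multi_order \<gamma>)"
    by (simp add: multi_order_def sum_distrib_left power_sum)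
  finally show ?thesis by (simp add: power_one_over)
qed

lemma cell_bump_integral:
  fixes j :: "'d::finite \<Rightarrow> nat"
  assumes M: "M \<ge> 1" and j: "j \<in> index_box M"
  shows "(LINT x|cube_lborel. cell_bump M (\<lambda>_. 0) j x) = 0"
proof -
  have ji: "j i < M" for i using j max_index_ge[of j i] by (simp add: index_box_def)
  have b0: "(LINT t|unit_interval. bump t) = 0"
  proof -
    have "(LINT t|unit_interval. bump t) = (LINT t|lborel. indicator {0..1} t *\<^sub>R bump t)"
      by (simp add: unit_interval_def integral_restrict_space)
    also have "\<dots> = flat_exp 1 1 * flat_exp 1 (1 - 1) - flat_exp 1 0 * flat_exp 1 (1 - 0)"
    proof (rule integral_FTC_Icc)
      show "((\<lambda>t. flat_exp 1 t * flat_exp 1 (1 - t)) has_vector_derivative bump x) (at x within {0..1})" for x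
        using bump_antiderivative[of x] by (simp add: has_real_derivative_iff_has_vector_derivative has_vector_derivative_at_within)
    qed (auto intro: smooth1_continuous[OF smooth1_bump])
    finally show ?thesis by (simp add: flat_exp_def)
  qed
  have "(LINT t|unit_interval. bump (real M * t - real (j i))) = 0" for i
    using integral_rescaled[of bump M "j i"] bump_deriv_zero[of _ 0] M ji[of i] b0 by (simp add: bump_deriv_def)
  moreover have "(LINT x|cube_lborel. cell_bump M (\<lambda>_. 0) j x) = (\<Prod>i\<in>UNIV. LINT t|unit_interval. bump (real M * t - real (j i)))"
    unfolding cell_bump_def
    using smooth1_rescaled[of 1 0 M]
    by (subst cube_tensor(2)) (auto simp: bump_deriv_def intro!: integrable_unit_interval_cont smooth1_continuous)
  ultimately show ?thesis by simp
qed

lemma card_index_box: "card (index_box M :: ('d::finite \<Rightarrow> nat) set) = M ^ CARD('d)"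
  unfolding index_box_PiE by (simp add: card_PiE)

lemma sqint_continuous_cube: "continuous_on UNIV f \<Longrightarrow> sqint cube_lborel f"
  using poly_approximable_continuous unfolding poly_approximable_def by blast

text \<open>
  The same coefficients \<open>w\<close> with \<open>\<gamma> = 0\<close> and with general \<open>\<gamma>\<close> give a function and its derivative.
\<close>

definition bump_sum :: "nat \<Rightarrow> (('d::finite \<Rightarrow> nat) \<Rightarrow> real) \<Rightarrow> ('d \<Rightarrow> nat) \<Rightarrow> real ^ 'd \<Rightarrow> real" where
  "bump_sum M w \<gamma> x = (\<Sum>j\<in>index_box M. w j * cell_bump M \<gamma> j x)"

lemma continuous_bump_sum: "continuous_on A (bump_sum M w \<gamma>)"
  unfolding bump_sum_def[abs_def] by (intro continuous_intros continuous_cell_bump)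

lemma bump_sum_mult:
  "bump_sum M w \<gamma> x * bump_sum M v \<gamma> x = (\<Sum>j\<in>index_box M. w j * v j * (cell_bump M \<gamma> j x)\<^sup>2)"
proof -
  have "bump_sum M w \<gamma> x * bump_sum M v \<gamma> x =
     (\<Sum>j\<in>index_box M. \<Sum>l\<in>index_box M. if j = l then w j * v j * (cell_bump M \<gamma> j x)\<^sup>2 else 0)"
    unfolding bump_sum_def sum_product
  proof (intro sum.cong refl)
    fix j l
    show "w j * cell_bump M \<gamma> j x * (v l * cell_bump M \<gamma> l x) = (if j = l then w j * v j * (cell_bump M \<gamma> j x)\<^sup>2 else 0)"
      using cell_bump_disjoint[of j l M \<gamma> x \<gamma>] by (auto simp: power2_eq_square)
  qed
  then show ?thesis by simp
qed

text \<open>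
  The bumps have disjoint supports, so the sum is orthogonal and the number of cells cancels against the
  volume of one cell.
\<close>

lemma bump_sum_square_integral_le:
  fixes w :: "('d::finite \<Rightarrow> nat) \<Rightarrow> real"
  assumes M: "M \<ge> 1" and w: "\<And>j. j \<in> index_box M \<Longrightarrow> \<bar>w j\<bar> \<le> a"
  shows "(LINT x|cube_lborel. (bump_sum M w \<gamma> x)\<^sup>2) \<le> a\<^sup>2 * real M ^ (2 * multi_order \<gamma>) * bump_energy \<gamma>"
proof -
  have int: "integrable cube_lborel (\<lambda>x. (cell_bump M \<gamma> j x)\<^sup>2)" for j
    using sqint_continuous_cube[OF continuous_cell_bump[of UNIV M \<gamma> j]] by (simp add: sqint_def)
  define e where "e = real M ^ (2 * multi_order \<gamma>) / real M ^ CARD('d) * bump_energy \<gamma>"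
  have e: "e \<ge> 0" unfolding e_def using bump_energy_nonneg[of \<gamma>] by simp
  have "(LINT x|cube_lborel. (bump_sum M w \<gamma> x)\<^sup>2) = (\<Sum>j\<in>index_box M. (w j)\<^sup>2 * (LINT x|cube_lborel. (cell_bump M \<gamma> j x)\<^sup>2))"
    unfolding power2_eq_square[of "bump_sum M w \<gamma> _"] bump_sum_mult
    using int by (subst Bochner_Integration.integral_sum) (auto simp: power2_eq_square)
  also have "\<dots> = (\<Sum>j\<in>index_box M. (w j)\<^sup>2 * e)"
    unfolding e_def using cell_bump_square_integral[OF M, of _ \<gamma>] by (intro sum.cong) auto
  also have "\<dots> \<le> (\<Sum>j\<in>(index_box M :: ('d \<Rightarrow> nat) set). a\<^sup>2 * e)"
  proof (intro sum_mono mult_right_mono e)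
    fix j :: "'d \<Rightarrow> nat" assume "j \<in> index_box M"
    from w[OF this] have "\<bar>w j\<bar> \<le> \<bar>a\<bar>" by linarith
    then show "(w j)\<^sup>2 \<le> a\<^sup>2" by (simp add: abs_le_square_iff)
  qed
  also have "\<dots> = a\<^sup>2 * real M ^ (2 * multi_order \<gamma>) * bump_energy \<gamma>"
    using M by (simp add: card_index_box e_def)
  finally show ?thesis .
qed

lemma bump_sum_integral:
  fixes w :: "('d::finite \<Rightarrow> nat) \<Rightarrow> real"
  assumes M: "M \<ge> 1"
  shows "(LINT x|cube_lborel. bump_sum M w (\<lambda>_. 0) x) = 0"
proof -
  have 1: "integrable cube_lborel (cell_bump M (\<lambda>_. 0) j)" for j :: "'d \<Rightarrow> nat"
    by (rule sqint_cube_integrable[OF sqint_continuous_cube[OF continuous_cell_bump]])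
  have 2: "(LINT x|cube_lborel. cell_bump M (\<lambda>_. 0) j x) = 0" if "j \<in> index_box M" for j :: "'d \<Rightarrow> nat"
    by (rule cell_bump_integral[OF M that])
  have "(LINT x|cube_lborel. bump_sum M w (\<lambda>_. 0) x) = (\<Sum>j\<in>index_box M. LINT x|cube_lborel. w j * cell_bump M (\<lambda>_. 0) j x)"
    unfolding bump_sum_def by (rule Bochner_Integration.integral_sum) (use 1 in auto)
  also have "\<dots> = (\<Sum>j\<in>(index_box M :: ('d \<Rightarrow> nat) set). 0)" using 2 by (intro sum.cong refl) simp
  finally show ?thesis by simp
qed

lemma weak_deriv_zero: "weak_deriv U \<gamma> (\<lambda>x. 0) (\<lambda>x. 0)"
  by (simp add: weak_deriv_def locally_integrable_def set_integrable_def set_lebesgue_integral_def)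

lemma weak_deriv_one:
  fixes \<gamma> :: "'d::finite \<Rightarrow> nat"
  shows "weak_deriv U \<gamma> (\<lambda>x. 1) (\<lambda>x. of_bool (\<gamma> = (\<lambda>_. 0)))"
proof -
  have d: "(deriv ^^ n) (\<lambda>_. 1) = (\<lambda>_ :: real. of_bool (n = 0) :: real)" for n by (induction n) auto
  have "tensor (\<lambda>i. (deriv ^^ \<gamma> i) (\<lambda>_. 1)) = (\<lambda>x. of_bool (\<gamma> = (\<lambda>_. 0)) :: real)"
    unfolding d by (auto simp: tensor_def fun_eq_iff)
  then show ?thesis
    using weak_deriv_of_tensor[where G="\<lambda>_ _. 1" and U=U and \<gamma>=\<gamma>] smooth1_const[of 1] by (simp add: tensor_def[of "\<lambda>_ _. 1", abs_def])
qed

lemma bump_sum_weak_deriv: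
  "weak_deriv U \<gamma> (\<lambda>x. c + bump_sum M w (\<lambda>_. 0) x) (\<lambda>x. c * of_bool (\<gamma> = (\<lambda>_. 0)) + bump_sum M w \<gamma> x)"
proof -
  have base: "weak_deriv U \<gamma> (\<lambda>x. c) (\<lambda>x. c * of_bool (\<gamma> = (\<lambda>_. 0)))"
  proof -
    have "weak_deriv U \<gamma> (\<lambda>x. 0 + c * 1) (\<lambda>x. 0 + c * of_bool (\<gamma> = (\<lambda>_. 0)))"
      by (intro weak_deriv_add weak_deriv_zero weak_deriv_one continuous_intros)
    then show ?thesis by simp
  qed
  have "weak_deriv U \<gamma> (\<lambda>x. c + (\<Sum>j\<in>J. w j * cell_bump M (\<lambda>_. 0) j x))
     (\<lambda>x. c * of_bool (\<gamma> = (\<lambda>_. 0)) + (\<Sum>j\<in>J. w j * cell_bump M \<gamma> j x))" if "finite J" for J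
    using that
  proof (induction J rule: finite_induct)
    case empty
    then show ?case using base by simp
  next
    case (insert l J)
    have "weak_deriv U \<gamma> (\<lambda>x. (c + (\<Sum>j\<in>J. w j * cell_bump M (\<lambda>_. 0) j x)) + w l * cell_bump M (\<lambda>_. 0) l x)
     (\<lambda>x. (c * of_bool (\<gamma> = (\<lambda>_. 0)) + (\<Sum>j\<in>J. w j * cell_bump M \<gamma> j x)) + w l * cell_bump M \<gamma> l x)"
      by (intro weak_deriv_add insert.IH cell_bump_weak_deriv continuous_intros continuous_cell_bump)
    then show ?case using insert.hyps by (simp add: add_ac)
  qed
  from this[OF finite_index_box] show ?thesis by (simp add: bump_sum_def)
qed

text \<open>
  The squared Sobolev norm of order \<open>m\<close> of the bump that fills the whole cube.
\<close>

definition sobolev_energy :: "'d::finite itself \<Rightarrow> nat \<Rightarrow> real" where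
  "sobolev_energy _ m = (\<Sum>\<gamma>\<in>(multi_indices m :: ('d \<Rightarrow> nat) set). bump_energy \<gamma>)"

lemma sobolev_energy_nonneg: "sobolev_energy TYPE('d::finite) m \<ge> 0"
  unfolding sobolev_energy_def by (intro sum_nonneg bump_energy_nonneg)

text \<open>
  The mean-zero bumps are orthogonal to the constant \<open>c\<close>, and a derivative of order at most \<open>m\<close> costs at
  most \<open>M ^ m\<close>.
\<close>

lemma bump_sum_in_sobolev:
  fixes w :: "('d::finite \<Rightarrow> nat) \<Rightarrow> real"
  assumes M: "M \<ge> 1" and w: "\<And>j. j \<in> index_box M \<Longrightarrow> \<bar>w j\<bar> \<le> a" and R: "R \<ge> 0"
    and le: "c\<^sup>2 + a\<^sup>2 * real M ^ (2 * m) * sobolev_energy TYPE('d) m \<le> R\<^sup>2"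
  shows "(\<lambda>x. c + bump_sum M w (\<lambda>_. 0) x) \<in> sobolev_class m R"
proof -
  interpret prob_space "cube_lborel :: (real ^ 'd) measure" by (rule prob_space_cube)
  have pu: "prob unit_cube = 1" using prob_space by simp
  define D where "D = (\<lambda>\<gamma> x. c * of_bool (\<gamma> = (\<lambda>_. 0)) + bump_sum M w \<gamma> x)"
  have cD: "continuous_on UNIV (D \<gamma>)" for \<gamma>
    unfolding D_def by (intro continuous_intros continuous_bump_sum)
  have L2: "(L2_norm (D \<gamma>))\<^sup>2 \<le> c\<^sup>2 * of_bool (\<gamma> = (\<lambda>_. 0)) + a\<^sup>2 * real M ^ (2 * m) * bump_energy \<gamma>"
    if g: "\<gamma> \<in> multi_indices m" for \<gamma>
  proof -
    have s1: "sqint cube_lborel (\<lambda>x :: real ^ 'd. c * of_bool (\<gamma> = (\<lambda>_. 0)))"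
      by (rule sqint_continuous_cube) (intro continuous_intros)
    have s2: "sqint cube_lborel (bump_sum M w \<gamma>)" by (rule sqint_continuous_cube[OF continuous_bump_sum])
    have "(L2_norm (D \<gamma>))\<^sup>2 = (LINT x|cube_lborel. (c * of_bool (\<gamma> = (\<lambda>_. 0)) + 1 * bump_sum M w \<gamma> x)\<^sup>2)"
      by (simp add: L2_norm_def D_def)
    also have "\<dots> = (c * of_bool (\<gamma> = (\<lambda>_. 0)))\<^sup>2 + 2 * (LINT x|cube_lborel. c * of_bool (\<gamma> = (\<lambda>_. 0)) * bump_sum M w \<gamma> x)
        + (LINT x|cube_lborel. (bump_sum M w \<gamma> x)\<^sup>2)"
      unfolding integral_square_add[OF s1 s2] using pu by simp
    also have "(LINT x|cube_lborel. c * of_bool (\<gamma> = (\<lambda>_. 0)) * bump_sum M w \<gamma> x) = 0"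
      using bump_sum_integral[OF M, of w] by auto
    also have "(LINT x|cube_lborel. (bump_sum M w \<gamma> x)\<^sup>2) \<le> a\<^sup>2 * real M ^ (2 * multi_order \<gamma>) * bump_energy \<gamma>"
      by (rule bump_sum_square_integral_le[OF M w])
    also have "\<dots> \<le> a\<^sup>2 * real M ^ (2 * m) * bump_energy \<gamma>"
      using g M bump_energy_nonneg[of \<gamma>] by (intro mult_right_mono mult_left_mono power_increasing) (auto simp: multi_indices_def)
    finally show ?thesis by (cases "\<gamma> = (\<lambda>_. 0)") (simp_all add: power_mult_distrib)
  qed
  have "(\<Sum>\<gamma>\<in>multi_indices m. (L2_norm (D \<gamma>))\<^sup>2) \<le>
     (\<Sum>\<gamma>\<in>(multi_indices m :: ('d \<Rightarrow> nat) set). c\<^sup>2 * of_bool (\<gamma> = (\<lambda>_. 0)) + a\<^sup>2 * real M ^ (2 * m) * bump_energy \<gamma>)"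
    by (intro sum_mono L2)
  also have "\<dots> = c\<^sup>2 * (\<Sum>\<gamma>\<in>(multi_indices m :: ('d \<Rightarrow> nat) set). of_bool (\<gamma> = (\<lambda>_. 0))) + a\<^sup>2 * real M ^ (2 * m) * sobolev_energy TYPE('d) m"
    by (simp add: sum.distrib sum_distrib_left sobolev_energy_def)
  also have "(\<Sum>\<gamma>\<in>(multi_indices m :: ('d \<Rightarrow> nat) set). of_bool (\<gamma> = (\<lambda>_. 0)) :: real) = 1"
  proof -
    have "(\<lambda>_. 0) \<in> (multi_indices m :: ('d \<Rightarrow> nat) set)" by (simp add: multi_indices_def multi_order_def)
    then show ?thesis by (simp add: of_bool_def sum.delta)
  qed
  finally have "sqrt (\<Sum>\<gamma>\<in>multi_indices m. (L2_norm (D \<gamma>))\<^sup>2) \<le> R"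
    using le R by (intro real_le_lsqrt) auto
  moreover have "weak_deriv (interior unit_cube) \<gamma> (\<lambda>x. c + bump_sum M w (\<lambda>_. 0) x) (D \<gamma>)" for \<gamma>
    unfolding D_def by (rule bump_sum_weak_deriv)
  moreover have "square_integrable (D \<gamma>)" for \<gamma>
    unfolding sqint_iff_square_integrable by (rule sqint_continuous_cube[OF cD])
  moreover have "(\<lambda>x. c + bump_sum M w (\<lambda>_. 0) x) \<in> borel_measurable cube_lborel"
    by (intro borel_measurable_cube borel_measurable_continuous_onI continuous_intros continuous_bump_sum)
  ultimately show ?thesis unfolding sobolev_class_def by blast
qed

lemma bump_bounded: "\<exists>H\<ge>1. \<forall>t. \<bar>bump t\<bar> \<le> H"
proof -
  have "bounded (bump ` {0..1})"
    by (intro compact_imp_bounded compact_continuous_image smooth1_continuous[OF smooth1_bump]) auto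
  then have "\<exists>B. \<forall>t\<in>{0..1}. \<bar>bump t\<bar> \<le> B" by (simp add: bounded_iff)
  then obtain B where B: "\<And>t. t \<in> {0..1} \<Longrightarrow> \<bar>bump t\<bar> \<le> B" by blast
  have "\<bar>bump t\<bar> \<le> max B 1" for t
  proof (cases "t \<in> {0..1}")
    case False
    then have "bump t = 0" using bump_deriv_zero[of t 0] by (auto simp: bump_deriv_def)
    then show ?thesis by simp
  qed (use B in \<open>auto simp: max_def intro: order_trans\<close>)
  then show ?thesis by (intro exI[of _ "max B 1"]) auto
qed

lemma cell_bump_bounded: "\<exists>H>0. \<forall>M j. \<forall>x :: real ^ 'd::finite. \<bar>cell_bump M (\<lambda>_. 0) j x\<bar> \<le> H"
proof -
  obtain H where H: "H \<ge> 1" "\<And>t. \<bar>bump t\<bar> \<le> H" using bump_bounded by blast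
  have "\<bar>cell_bump M (\<lambda>_. 0) j x\<bar> \<le> (\<Prod>i\<in>(UNIV :: 'd set). H)" for M j and x :: "real ^ 'd"
    unfolding cell_bump_def by (rule tensor_bound) (simp add: bump_deriv_def H)
  moreover have "(\<Prod>i\<in>(UNIV :: 'd set). H) > 0" using H(1) by simp
  ultimately show ?thesis by blast
qed

lemma bump_sum_abs_le:
  assumes H: "\<And>j. \<bar>cell_bump M (\<lambda>_. 0) j x\<bar> \<le> H" "H \<ge> 0" and w: "\<And>j. j \<in> index_box M \<Longrightarrow> \<bar>w j\<bar> \<le> a" and a: "a \<ge> 0"
  shows "\<bar>bump_sum M w (\<lambda>_. 0) x\<bar> \<le> a * H"
proof (cases "\<exists>j\<in>index_box M. cell_bump M (\<lambda>_. 0) j x \<noteq> 0")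
  case True
  then obtain j where j: "j \<in> index_box M" "cell_bump M (\<lambda>_. 0) j x \<noteq> 0" by blast
  have "bump_sum M w (\<lambda>_. 0) x = (\<Sum>l\<in>index_box M. if l = j then w j * cell_bump M (\<lambda>_. 0) j x else 0)"
    unfolding bump_sum_def using cell_bump_disjoint[of j _ M "\<lambda>_. 0" x "\<lambda>_. 0"] j(2)
    by (intro sum.cong refl) (metis mult_eq_0_iff)
  also have "\<dots> = w j * cell_bump M (\<lambda>_. 0) j x" using j(1) by simp
  finally show ?thesis using w[OF j(1)] H(1)[of j] a H(2) by (simp add: abs_mult mult_mono)
next
  case False
  then show ?thesis using a H(2) by (simp add: bump_sum_def)
qed

text \<open>
  If the bump vanished, its antiderivative would be constant; but it is zero at the ends and positive
  at the centre.
\<close>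

lemma bump_energy_zero_pos: "bump_energy (\<lambda>_ :: 'd::finite. 0) > 0"
proof -
  have "(LINT t|unit_interval. (bump t)\<^sup>2) \<noteq> 0"
  proof
    assume 0: "(LINT t|unit_interval. (bump t)\<^sup>2) = 0"
    have c: "continuous_on A bump" for A by (rule smooth1_continuous[OF smooth1_bump])
    have int: "integrable unit_interval (\<lambda>t. (bump t)\<^sup>2)"
      by (intro integrable_unit_interval_cont continuous_intros c)
    have "set_integrable lborel {0..1} (\<lambda>t. (bump t)\<^sup>2)"
      by (intro borel_integrable_atLeastAtMost' continuous_intros c)
    note * = set_borel_integral_eq_integral[OF this]
    have "((\<lambda>t. (bump t)\<^sup>2) has_integral 0) {0..1}"
      using * 0 by (simp add: has_integral_iff unit_interval_def integral_restrict_space set_lebesgue_integral_def)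
    then have z: "bump t = 0" if "t \<in> {0..1}" for t
      using has_integral_0_cbox_imp_0[of 0 1 "\<lambda>t. (bump t)\<^sup>2" t] that
        continuous_on_power[OF c[of "{0..1}"], of 2] by simp
    have "flat_exp 1 (1/2) * flat_exp 1 (1 - 1/2) = flat_exp 1 0 * flat_exp 1 (1 - 0)"
    proof (rule DERIV_isconst2[of 0 1 "\<lambda>t. flat_exp 1 t * flat_exp 1 (1 - t)"])
      show "continuous_on {0..1} (\<lambda>t. flat_exp 1 t * flat_exp 1 (1 - t))"
        by (rule DERIV_continuous_on[OF has_field_derivative_at_within[OF bump_antiderivative]])
      show "((\<lambda>t. flat_exp 1 t * flat_exp 1 (1 - t)) has_real_derivative 0) (at x)" if "0 < x" "x < 1" for x
        using bump_antiderivative[of x] z that by auto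
    qed auto
    then show False by (simp add: flat_exp_def)
  qed
  then have "(LINT t|unit_interval. (bump t)\<^sup>2) > 0" by (simp add: order_less_le)
  then show ?thesis unfolding bump_energy_def by (simp add: bump_deriv_def)
qed

text \<open>
  Mass one because the bumps have mean zero, nonnegative because the perturbation is at most \<open>1 / 2\<close>.
\<close>

lemma perturbed_uniform_in_class:
  fixes w :: "('d::finite \<Rightarrow> nat) \<Rightarrow> real"
  assumes M: "M \<ge> 1" and w: "\<And>j. j \<in> index_box M \<Longrightarrow> \<bar>w j\<bar> \<le> a" and r: "r \<ge> 0"
    and le: "1 + a\<^sup>2 * real M ^ (2 * \<alpha>) * sobolev_energy TYPE('d) \<alpha> \<le> r\<^sup>2"
    and half: "\<And>x. \<bar>bump_sum M w (\<lambda>_. 0) x\<bar> \<le> 1 / 2"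
  shows "density cube_lborel (\<lambda>x. ennreal (1 + bump_sum M w (\<lambda>_. 0) x)) \<in> sobolev_distributions \<alpha> r"
proof -
  interpret prob_space "cube_lborel :: (real ^ 'd) measure" by (rule prob_space_cube)
  have pu: "prob unit_cube = 1" using prob_space by simp
  define p where "p = (\<lambda>x. 1 + bump_sum M w (\<lambda>_. 0) x)"
  have pos: "0 \<le> p x" for x using half[of x] unfolding p_def by linarith
  have p: "p \<in> sobolev_class \<alpha> r" unfolding p_def
    by (rule bump_sum_in_sobolev[OF M w r]) (use le in auto)
  have bi: "integrable cube_lborel (bump_sum M w (\<lambda>_. 0))"
    by (rule sqint_cube_integrable[OF sqint_continuous_cube[OF continuous_bump_sum]])
  then have pi: "integrable cube_lborel p" unfolding p_def by simp
  have "(LINT x|cube_lborel. p x) = 1"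
    unfolding p_def using bi bump_sum_integral[OF M, of w] pu by simp
  then have "(\<integral>\<^sup>+x. ennreal (p x) \<partial>cube_lborel) = 1"
    using nn_integral_eq_integral[OF pi] pos by simp
  then have "prob_space (density cube_lborel (\<lambda>x. ennreal (p x)))"
  proof (intro prob_spaceI)
    assume 1: "(\<integral>\<^sup>+x. ennreal (p x) \<partial>cube_lborel) = 1"
    have "emeasure (density cube_lborel (\<lambda>x. ennreal (p x))) (space cube_lborel) = (\<integral>\<^sup>+x. ennreal (p x) * indicator (space cube_lborel) x \<partial>cube_lborel)"
      using pi by (intro emeasure_density sets.top) auto
    also have "\<dots> = (\<integral>\<^sup>+x. ennreal (p x) \<partial>cube_lborel)" by (intro nn_integral_cong) auto
    finally show "emeasure (density cube_lborel (\<lambda>x. ennreal (p x))) (space (density cube_lborel (\<lambda>x. ennreal (p x)))) = 1"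
      using 1 by simp
  qed
  then have "density cube_lborel (\<lambda>x. ennreal (p x)) \<in> space (prob_algebra cube_lborel)"
    by (simp add: space_prob_algebra)
  moreover have "\<exists>p'\<in>sobolev_class \<alpha> r. (\<forall>x\<in>unit_cube. 0 \<le> p' x) \<and>
      density cube_lborel (\<lambda>x. ennreal (p x)) = density cube_lborel (\<lambda>x. ennreal (p' x))"
    using p pos by (intro bexI[of _ p]) simp_all
  ultimately show ?thesis unfolding sobolev_distributions_def p_def by simp
qed

section \<open>The lower bound\<close>

lemma PiM_density_lessThan:
  fixes f :: "'a \<Rightarrow> ennreal"
  assumes M: "prob_space M" and f: "f \<in> borel_measurable M" and D: "prob_space (density M f)"
  shows "PiM {..<n::nat} (\<lambda>_. density M f) = density (PiM {..<n} (\<lambda>_. M)) (\<lambda>X. \<Prod>i<n. f (X i))"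
proof -
  interpret M: prob_space M by fact
  interpret D: prob_space "density M f" by fact
  interpret PM: product_sigma_finite "\<lambda>_::nat. M" by standard
  interpret PD: product_sigma_finite "\<lambda>_::nat. density M f" by standard
  note [measurable] = f
  have comp[measurable]: "(\<lambda>X. f (X i)) \<in> borel_measurable (PiM {..<n} (\<lambda>_. M))" if "i < n" for i
    by (rule measurable_compose[where f="\<lambda>X. X i" and g=f]) (use that f in \<open>auto intro: measurable_component_singleton\<close>)
  have pm: "(\<lambda>X. \<Prod>i<n. f (X i)) \<in> borel_measurable (PiM {..<n} (\<lambda>_. M))"
    by (intro borel_measurable_prod_ennreal comp) auto
  have "density (PiM {..<n} (\<lambda>_. M)) (\<lambda>X. \<Prod>i<n. f (X i)) = PiM {..<n} (\<lambda>_. density M f)"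
  proof (rule PD.PiM_eqI)
    show "sets (density (PiM {..<n} (\<lambda>_. M)) (\<lambda>X. \<Prod>i<n. f (X i))) = sets (PiM {..<n} (\<lambda>_. density M f))"
      unfolding sets_density by (intro sets_PiM_cong) auto
    fix A :: "nat \<Rightarrow> 'a set" assume A: "\<And>i. i \<in> {..<n} \<Longrightarrow> A i \<in> sets (density M f)"
    have Am: "A i \<in> sets M" if "i < n" for i using A that by auto
    have "emeasure (density (PiM {..<n} (\<lambda>_. M)) (\<lambda>X. \<Prod>i<n. f (X i))) (Pi\<^sub>E {..<n} A)
        = (\<integral>\<^sup>+X. (\<Prod>i<n. f (X i)) * indicator (Pi\<^sub>E {..<n} A) X \<partial>PiM {..<n} (\<lambda>_. M))"
      using pm Am by (intro emeasure_density sets_PiM_I_finite) auto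
    also have "\<dots> = (\<integral>\<^sup>+X. (\<Prod>i<n. f (X i) * indicator (A i) (X i)) \<partial>PiM {..<n} (\<lambda>_. M))"
    proof (rule nn_integral_cong)
      fix X assume X: "X \<in> space (PiM {..<n} (\<lambda>_. M))"
      have "indicator (Pi\<^sub>E {..<n} A) X = (\<Prod>i<n. indicator (A i) (X i) :: ennreal)"
      proof (cases "\<forall>i<n. X i \<in> A i")
        case True
        then show ?thesis using X by (auto simp: space_PiM PiE_iff)
      next
        case False
        then obtain i where i: "i < n" "X i \<notin> A i" by blast
        have p0: "(\<Prod>i<n. indicator (A i) (X i) :: ennreal) = 0"
          by (rule prod_zero) (use i in \<open>auto intro!: bexI[of _ i]\<close>)
        have "X \<notin> Pi\<^sub>E {..<n} A" using i by auto
        then have "indicator (Pi\<^sub>E {..<n} A) X = (0 :: ennreal)" by simp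
        then show ?thesis using p0 by (rule trans[OF _ sym])
      qed
      then show "(\<Prod>i<n. f (X i)) * indicator (Pi\<^sub>E {..<n} A) X = (\<Prod>i<n. f (X i) * indicator (A i) (X i))"
        by (simp add: prod.distrib)
    qed
    also have "\<dots> = (\<Prod>i<n. \<integral>\<^sup>+x. f x * indicator (A i) x \<partial>M)"
      using Am by (intro PM.product_nn_integral_prod) auto
    also have "\<dots> = (\<Prod>i<n. emeasure (density M f) (A i))"
      using Am f by (intro prod.cong refl) (auto simp: emeasure_density)
    finally show "emeasure (density (PiM {..<n} (\<lambda>_. M)) (\<lambda>X. \<Prod>i<n. f (X i))) (Pi\<^sub>E {..<n} A) =
        (\<Prod>i\<in>{..<n}. emeasure (density M f) (A i))" .
  qed simp
  then show ?thesis by simp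
qed

text \<open>
  Le Cam's two-point argument. For the likelihoods \<open>U\<close> and \<open>V\<close> of the sample, the hypothesis on \<open>\<kappa>\<close> says
  that their chi-square distance is at most \<open>1 / 4\<close>, which forces \<open>\<integral> min U V \<ge> 1 / 2\<close>. On the common
  mass no statistic \<open>Z\<close> is close to both parameters.
\<close>

lemma two_point_bound:
  fixes p q :: "'a \<Rightarrow> real" and Z :: "(nat \<Rightarrow> 'a) \<Rightarrow> real"
  assumes M: "prob_space M"
    and p: "p \<in> borel_measurable M" "\<And>x. 1 / 2 \<le> p x" "\<And>x. p x \<le> B" "(LINT x|M. p x) = 1"
    and q: "q \<in> borel_measurable M" "\<And>x. 0 \<le> q x" "\<And>x. q x \<le> B" "(LINT x|M. q x) = 1"
    and chi: "(LINT x|M. (q x)\<^sup>2 / p x) \<le> 1 + \<kappa>" "(1 + \<kappa>) ^ n \<le> 5 / 4"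
    and Z: "Z \<in> borel_measurable (PiM {..<n} (\<lambda>_. M))"
  shows "ennreal (\<bar>\<theta> - \<theta>'\<bar> / 2) \<le>
    (\<integral>\<^sup>+ X. ennreal \<bar>\<theta> - Z X\<bar> \<partial>PiM {..<n} (\<lambda>_. density M (\<lambda>x. ennreal (p x)))) +
    (\<integral>\<^sup>+ X. ennreal \<bar>\<theta>' - Z X\<bar> \<partial>PiM {..<n} (\<lambda>_. density M (\<lambda>x. ennreal (q x))))"
proof -
  interpret M: prob_space M by fact
  interpret PM: product_sigma_finite "\<lambda>_::nat. M" by standard
  define L where "L = PiM {..<n} (\<lambda>_. M)"
  interpret L: prob_space L unfolding L_def by (intro prob_space_PiM M)
  have B: "B \<ge> 0" using q(2,3) order_trans by blast
  have p0: "p x > 0" for x using p(2)[of x] by linarith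
  have pint: "integrable M p"
    by (rule M.integrable_const_bound[where B=B]) (use p p0 in \<open>auto simp: abs_of_pos\<close>)
  have qint: "integrable M q"
    by (rule M.integrable_const_bound[where B=B]) (use q in auto)
  have wint: "integrable M (\<lambda>x. (q x)\<^sup>2 / p x)"
  proof (rule M.integrable_const_bound[where B="B\<^sup>2 / (1/2)"])
    show "AE x in M. norm ((q x)\<^sup>2 / p x) \<le> B\<^sup>2 / (1/2)"
    proof (rule AE_I2)
      fix x
      have "(q x)\<^sup>2 / p x \<le> B\<^sup>2 / (1/2)"
        using p(2)[of x] q(2,3)[of x] by (intro frac_le power_mono) auto
      then show "norm ((q x)\<^sup>2 / p x) \<le> B\<^sup>2 / (1/2)" using p0[of x] by simp
    qed
  qed (use p q in measurable)
  have dens: "prob_space (density M (\<lambda>x. ennreal (h x)))" if h: "integrable M h" "\<And>x. 0 \<le> h x" "(LINT x|M. h x) = 1" for h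
  proof (rule prob_spaceI)
    have hm[measurable]: "h \<in> borel_measurable M" using h(1) by simp
    have "emeasure (density M (\<lambda>x. ennreal (h x))) (space M) = (\<integral>\<^sup>+x. ennreal (h x) * indicator (space M) x \<partial>M)"
      by (intro emeasure_density sets.top) measurable
    also have "\<dots> = (\<integral>\<^sup>+x. ennreal (h x) \<partial>M)" by (intro nn_integral_cong) auto
    also have "\<dots> = 1" using nn_integral_eq_integral[OF h(1)] h(2,3) by simp
    finally show "emeasure (density M (\<lambda>x. ennreal (h x))) (space (density M (\<lambda>x. ennreal (h x)))) = 1" by simp
  qed
  define U where "U = (\<lambda>X :: nat \<Rightarrow> 'a. \<Prod>i<n. p (X i))"
  define V where "V = (\<lambda>X :: nat \<Rightarrow> 'a. \<Prod>i<n. q (X i))"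
  define W where "W = (\<lambda>X :: nat \<Rightarrow> 'a. \<Prod>i<n. (q (X i))\<^sup>2 / p (X i))"
  have U: "integrable L U" "(LINT X|L. U X) = 1"
    using PM.product_integrable_prod[of "{..<n}" "\<lambda>_. p"] PM.product_integral_prod[of "{..<n}" "\<lambda>_. p"] pint p(4)
    by (auto simp: U_def L_def)
  have V: "integrable L V" "(LINT X|L. V X) = 1"
    using PM.product_integrable_prod[of "{..<n}" "\<lambda>_. q"] PM.product_integral_prod[of "{..<n}" "\<lambda>_. q"] qint q(4)
    by (auto simp: V_def L_def)
  have W: "integrable L W" "(LINT X|L. W X) \<le> 5 / 4"
  proof -
    show "integrable L W"
      using PM.product_integrable_prod[of "{..<n}" "\<lambda>_ x. (q x)\<^sup>2 / p x"] wint by (auto simp: W_def L_def)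
    have "(LINT X|L. W X) = (LINT x|M. (q x)\<^sup>2 / p x) ^ n"
      using PM.product_integral_prod[of "{..<n}" "\<lambda>_ x. (q x)\<^sup>2 / p x"] wint by (auto simp: W_def L_def)
    also have "\<dots> \<le> (1 + \<kappa>) ^ n"
      by (intro power_mono chi Bochner_Integration.integral_nonneg divide_nonneg_pos p0 zero_le_power2)
    finally show "(LINT X|L. W X) \<le> 5 / 4" using chi(2) by linarith
  qed
  have U0: "U X > 0" for X unfolding U_def by (intro prod_pos) (auto simp: p0)
  have V0: "V X \<ge> 0" for X unfolding V_def by (intro prod_nonneg) (auto simp: q)
  have UW: "(V X)\<^sup>2 = U X * W X" for X
    unfolding U_def V_def W_def prod.distrib[symmetric] prod_power_distrib
    using p0 by (intro prod.cong refl) (simp add: less_imp_neq[symmetric])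
  \<comment> \<open>From \<open>2 (U / 2) \<bar>U - V\<bar> \<le> (U / 2)\<^sup>2 + (U - V)\<^sup>2\<close>, divided by \<open>U\<close>; note that \<open>V\<^sup>2 / U = W\<close>.\<close>
  have mn: "min (U X) (V X) \<ge> U X - (U X / 4 + (U X - 2 * V X + W X))" for X
  proof -
    have "U X * \<bar>U X - V X\<bar> \<le> U X * (U X / 4 + (U X - 2 * V X + W X))"
    proof -
      have "U X * (U X / 4 + (U X - 2 * V X + W X)) = (U X / 2)\<^sup>2 + \<bar>U X - V X\<bar>\<^sup>2"
        using UW[of X] by (simp add: power2_eq_square algebra_simps)
      moreover have "2 * (U X / 2) * \<bar>U X - V X\<bar> \<le> (U X / 2)\<^sup>2 + \<bar>U X - V X\<bar>\<^sup>2"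
        by (rule sum_squares_bound)
      ultimately show ?thesis by simp
    qed
    then have "\<bar>U X - V X\<bar> \<le> U X / 4 + (U X - 2 * V X + W X)" using U0[of X] by simp
    then show ?thesis by linarith
  qed
  have min_int: "integrable L (\<lambda>X. min (U X) (V X))" using U V by (intro integrable_min)
  have "1 / 2 \<le> (LINT X|L. U X - (U X / 4 + (U X - 2 * V X + W X)))"
    using U V W by simp
  also have "\<dots> \<le> (LINT X|L. min (U X) (V X))"
    using U V W mn min_int by (intro integral_mono) auto
  finally have half: "1 / 2 \<le> (LINT X|L. min (U X) (V X))" .
  have [measurable]: "U \<in> borel_measurable L" "V \<in> borel_measurable L" using U V by auto
  have [measurable]: "Z \<in> borel_measurable L" using Z by (simp add: L_def)
  have PU: "PiM {..<n} (\<lambda>_. density M (\<lambda>x. ennreal (p x))) = density L (\<lambda>X. ennreal (U X))"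
    unfolding L_def U_def using p p0 dens[OF pint less_imp_le[OF p0] p(4)]
    by (subst PiM_density_lessThan[OF M]) (auto simp: prod_ennreal less_imp_le)
  have PV: "PiM {..<n} (\<lambda>_. density M (\<lambda>x. ennreal (q x))) = density L (\<lambda>X. ennreal (V X))"
    unfolding L_def V_def using q dens[OF qint q(2) q(4)]
    by (subst PiM_density_lessThan[OF M]) (auto simp: prod_ennreal)
  have "ennreal (\<bar>\<theta> - \<theta>'\<bar> / 2) \<le> ennreal (LINT X|L. \<bar>\<theta> - \<theta>'\<bar> * min (U X) (V X))"
    using mult_left_mono[OF half, of "\<bar>\<theta> - \<theta>'\<bar>"] by (intro ennreal_leI) simp
  also have "\<dots> = (\<integral>\<^sup>+ X. ennreal (\<bar>\<theta> - \<theta>'\<bar> * min (U X) (V X)) \<partial>L)"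
    using min_int U0 V0 by (intro nn_integral_eq_integral[symmetric]) (auto simp: less_imp_le)
  also have "\<dots> \<le> (\<integral>\<^sup>+ X. ennreal (U X) * ennreal \<bar>\<theta> - Z X\<bar> + ennreal (V X) * ennreal \<bar>\<theta>' - Z X\<bar> \<partial>L)"
  proof (rule nn_integral_mono)
    fix X
    have "\<bar>\<theta> - \<theta>'\<bar> * min (U X) (V X) \<le> (\<bar>\<theta> - Z X\<bar> + \<bar>\<theta>' - Z X\<bar>) * min (U X) (V X)"
      using U0[of X] V0[of X] by (intro mult_right_mono) auto
    also have "\<dots> = min (U X) (V X) * \<bar>\<theta> - Z X\<bar> + min (U X) (V X) * \<bar>\<theta>' - Z X\<bar>" by (simp add: algebra_simps)
    also have "\<dots> \<le> U X * \<bar>\<theta> - Z X\<bar> + V X * \<bar>\<theta>' - Z X\<bar>"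
      by (intro add_mono mult_right_mono) auto
    finally have "ennreal (\<bar>\<theta> - \<theta>'\<bar> * min (U X) (V X)) \<le> ennreal (U X * \<bar>\<theta> - Z X\<bar> + V X * \<bar>\<theta>' - Z X\<bar>)"
      by (rule ennreal_leI)
    also have "\<dots> = ennreal (U X) * ennreal \<bar>\<theta> - Z X\<bar> + ennreal (V X) * ennreal \<bar>\<theta>' - Z X\<bar>"
      using U0[of X] V0[of X] by (simp add: ennreal_plus ennreal_mult less_imp_le)
    finally show "ennreal (\<bar>\<theta> - \<theta>'\<bar> * min (U X) (V X)) \<le> ennreal (U X) * ennreal \<bar>\<theta> - Z X\<bar> + ennreal (V X) * ennreal \<bar>\<theta>' - Z X\<bar>" .
  qed
  also have "\<dots> = (\<integral>\<^sup>+ X. ennreal (U X) * ennreal \<bar>\<theta> - Z X\<bar> \<partial>L) + (\<integral>\<^sup>+ X. ennreal (V X) * ennreal \<bar>\<theta>' - Z X\<bar> \<partial>L)"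
    by (rule nn_integral_add) measurable
  also have "\<dots> = (\<integral>\<^sup>+ X. ennreal \<bar>\<theta> - Z X\<bar> \<partial>density L (\<lambda>X. ennreal (U X))) + (\<integral>\<^sup>+ X. ennreal \<bar>\<theta>' - Z X\<bar> \<partial>density L (\<lambda>X. ennreal (V X)))"
    by (subst (1 2) nn_integral_density) auto
  finally show ?thesis unfolding PU PV .
qed

definition flip :: "'k \<Rightarrow> 'k set \<Rightarrow> 'k set" where
  "flip j A = (if j \<in> A then A - {j} else insert j A)"

definition sign :: "'k set \<Rightarrow> 'k \<Rightarrow> real" where
  "sign A j = (if j \<in> A then 1 else - 1)"

lemma sign_flip: "sign (flip j A) l = (if l = j then - sign A l else sign A l)"
  by (cases "j \<in> A"; cases "l = j"; simp add: sign_def flip_def)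

lemma abs_sign [simp]: "\<bar>sign A j\<bar> = 1" "sign A j * sign A j = 1" "(sign A j)\<^sup>2 = 1"
  by (simp_all add: sign_def)

lemma bij_flip: "j \<in> J \<Longrightarrow> bij_betw (flip j) (Pow J) (Pow J)"
  by (rule bij_betwI[where g="flip j"]) (auto simp: flip_def split: if_splits)

text \<open>
  Flipping the sign of \<open>j\<close> permutes the sign patterns, so a bound for each pair of neighbouring patterns
  bounds the average.
\<close>

lemma sum_pairs_lower:
  fixes R :: "'k set \<Rightarrow> ennreal"
  assumes J: "finite J" "j \<in> J" and R: "\<And>A. A \<subseteq> J \<Longrightarrow> c \<le> R A + R (flip j A)"
  shows "of_nat (card (Pow J)) * c \<le> 2 * (\<Sum>A\<in>Pow J. R A)"
proof -
  have "of_nat (card (Pow J)) * c = (\<Sum>A\<in>Pow J. c)" by simp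
  also have "\<dots> \<le> (\<Sum>A\<in>Pow J. R A + R (flip j A))" using R by (intro sum_mono) auto
  also have "\<dots> = (\<Sum>A\<in>Pow J. R A) + (\<Sum>A\<in>Pow J. R (flip j A))" by (rule sum.distrib)
  also have "(\<Sum>A\<in>Pow J. R (flip j A)) = (\<Sum>A\<in>Pow J. R A)"
    by (rule sum.reindex_bij_betw[OF bij_flip[OF J(2)]])
  finally show ?thesis by (simp add: mult_2)
qed

text \<open>
  Sign patterns \<open>A\<close> index densities \<open>p A\<close>. For a given estimate, the test function with the sign of the
  error in every cell turns the metric into a sum of errors over the cells. In each cell the two densities
  that differ only there are nearly indistinguishable, by \<open>h4\<close>, so flipping that sign yields an error of order
  \<open>a b\<close> times the volume of the cell. Averaging over all patterns and summing over the cells gives \<open>a b\<close>.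
\<close>

theorem Assouad_lower_bound:
  fixes a b H r :: real
  assumes n: "n \<ge> 1" and M: "M \<ge> 1" and a: "a > 0" and b: "b > 0" and r: "r \<ge> 0"
    and H: "H > 0" "\<And>M j. \<And>x :: real ^ 'd::finite. \<bar>cell_bump M (\<lambda>_. 0) j x\<bar> \<le> H"
    and h1: "a * H \<le> 1 / 2"
    and h2: "1 + a\<^sup>2 * real M ^ (2 * \<alpha>) * sobolev_energy TYPE('d) \<alpha> \<le> r\<^sup>2"
    and h3: "b\<^sup>2 * real M ^ (2 * \<beta>) * sobolev_energy TYPE('d) \<beta> \<le> 1"
    and h4: "(1 + 8 * a\<^sup>2 * (bump_energy (\<lambda>_ :: 'd. 0) / real M ^ CARD('d))) ^ n \<le> 5 / 4"
  shows "ennreal (a * b * bump_energy (\<lambda>_ :: 'd. 0) / 2) \<le>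
    minimax_risk (sobolev_distributions \<alpha> r :: (real ^ 'd) measure set) (sobolev_class \<beta> 1) n"
  unfolding minimax_risk_def
proof (rule INF_greatest)
  interpret cube: prob_space "cube_lborel :: (real ^ 'd) measure" by (rule prob_space_cube)
  define J where "J = (index_box M :: ('d \<Rightarrow> nat) set)"
  have fJ: "finite J" by (simp add: J_def)
  have cJ: "card J = M ^ CARD('d)" by (simp add: J_def card_index_box)
  define E0 where "E0 = bump_energy (\<lambda>_ :: 'd. 0)"
  define \<kappa> where "\<kappa> = E0 / real M ^ CARD('d)"
  have E0: "E0 \<ge> 0" unfolding E0_def by (rule bump_energy_nonneg)
  have kap: "\<kappa> \<ge> 0" using E0 by (simp add: \<kappa>_def)
  define C where "C = (\<lambda>j. cell_bump M (\<lambda>_. 0) j :: real ^ 'd \<Rightarrow> real)"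
  define w where "w = (\<lambda>A j. a * sign A (j :: 'd \<Rightarrow> nat))"
  define S where "S = (\<lambda>v :: ('d \<Rightarrow> nat) \<Rightarrow> real. bump_sum M v (\<lambda>_. 0))"
  define p where "p = (\<lambda>A x. 1 + S (w A) x)"
  define \<nu> where "\<nu> = (\<lambda>A. density (cube_lborel :: (real ^ 'd) measure) (\<lambda>x. ennreal (p A x)))"
  have wa: "\<bar>w A j\<bar> \<le> a" for A j using a by (simp add: w_def abs_mult)
  have Sh: "\<bar>S (w A) x\<bar> \<le> 1 / 2" for A x
    using bump_sum_abs_le[of M x H "w A" a] H wa a h1 unfolding S_def by force
  have nuG: "\<nu> A \<in> sobolev_distributions \<alpha> r" for A
    unfolding \<nu>_def p_def S_def
    by (rule perturbed_uniform_in_class[OF M wa r h2]) (use Sh in \<open>simp add: S_def\<close>)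
  have cC: "continuous_on B (C j)" for B j unfolding C_def by (rule continuous_cell_bump)
  have cS: "continuous_on B (S v)" for B v unfolding S_def by (rule continuous_bump_sum)
  have sC: "sqint cube_lborel (C j)" and sS: "sqint cube_lborel (S v)" for j v
    by (intro sqint_continuous_cube cC cS)+
  have Cm[measurable]: "C j \<in> borel_measurable cube_lborel" for j using sC by (simp add: sqint_def)
  have pm[measurable]: "p A \<in> borel_measurable cube_lborel" for A
  proof -
    have "S (w A) \<in> borel_measurable cube_lborel" using sS[of "w A"] by (simp add: sqint_def)
    then show ?thesis unfolding p_def by (intro borel_measurable_add) auto
  qed
  have p12: "1 / 2 \<le> p A x" "p A x \<le> 2" for A x using Sh[of A x] unfolding p_def by linarith+
  have pint: "integrable cube_lborel (p A)" for A
    unfolding p_def using sqint_cube_integrable[OF sS] by simp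
  have pu: "cube.prob unit_cube = 1" using cube.prob_space by simp
  have p1: "(LINT x|cube_lborel. p A x) = 1" for A
    unfolding p_def using sqint_cube_integrable[OF sS] bump_sum_integral[OF M, of "w A"] pu by (simp add: S_def)
  have C2: "(LINT x|cube_lborel. (C j x)\<^sup>2) = \<kappa>" if "j \<in> J" for j
    using cell_bump_square_integral[OF M, of j "\<lambda>_. 0"] that
    by (simp add: C_def J_def \<kappa>_def E0_def multi_order_def)
  have C1: "(LINT x|cube_lborel. C j x) = 0" if "j \<in> J" for j
    using cell_bump_integral[OF M, of j] that by (simp add: C_def J_def)
  \<comment> \<open>Only the bump of the same cell survives in the product.\<close>
  have CS: "C j x * S v x = v j * (C j x)\<^sup>2" if j: "j \<in> J" for j v x
  proof -
    have "C j x * S v x = (\<Sum>l\<in>J. if l = j then v j * (C j x)\<^sup>2 else 0)"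
      unfolding S_def bump_sum_def sum_distrib_left J_def[symmetric]
      using cell_bump_disjoint[of j _ M "\<lambda>_. 0" x "\<lambda>_. 0"]
      by (intro sum.cong refl) (auto simp: C_def power2_eq_square)
    then show ?thesis using j fJ by simp
  qed
  have nuint: "(LINT x|\<nu> A. f x) = (LINT x|cube_lborel. p A x * f x)" if "f \<in> borel_measurable cube_lborel" for A f
  proof -
    have "0 \<le> p A x" for x using p12(1)[of A x] by linarith
    then show ?thesis unfolding \<nu>_def using that by (intro integral_real_density pm AE_I2) auto
  qed
  have muC: "(LINT x|\<nu> A. C j x) = w A j * \<kappa>" if j: "j \<in> J" for A j
  proof -
    have "(LINT x|\<nu> A. C j x) = (LINT x|cube_lborel. C j x + w A j * (C j x)\<^sup>2)"
      unfolding nuint[OF Cm] by (intro Bochner_Integration.integral_cong refl) (simp add: p_def algebra_simps CS[OF j])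
    also have "\<dots> = w A j * \<kappa>"
      using sqint_cube_integrable[OF sC[of j]] sC[of j] C1[OF j] C2[OF j] by (simp add: sqint_def)
    finally show ?thesis .
  qed
  \<comment> \<open>Flipping one sign changes the density by \<open>2 a C j\<close>, and the denominator is at least \<open>1 / 2\<close>.\<close>
  have chi: "(LINT x|cube_lborel. (p (flip j A) x)\<^sup>2 / p A x) \<le> 1 + 8 * a\<^sup>2 * \<kappa>" if j: "j \<in> J" for A j
  proof -
    have diff: "p (flip j A) x = p A x - 2 * w A j * C j x" for x
    proof -
      have "S (w (flip j A)) x - S (w A) x = (\<Sum>l\<in>J. if l = j then - 2 * w A j * C j x else 0)"
        unfolding S_def bump_sum_def sum_subtractf[symmetric] J_def[symmetric]
        by (intro sum.cong refl) (auto simp: w_def sign_flip C_def algebra_simps)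
      then show ?thesis using j fJ unfolding p_def by simp
    qed
    have pt: "(p (flip j A) x)\<^sup>2 / p A x \<le> p A x - 4 * w A j * C j x + 8 * a\<^sup>2 * (C j x)\<^sup>2" for x
    proof -
      define P where "P = p A x"
      define e where "e = 2 * w A j * C j x"
      have P: "P \<ge> 1 / 2" unfolding P_def by (rule p12)
      have "(P - e)\<^sup>2 / P = P - 2 * e + e\<^sup>2 / P" using P by (simp add: power2_eq_square field_simps)
      also have "e\<^sup>2 / P \<le> e\<^sup>2 / (1 / 2)" using P by (intro divide_left_mono) auto
      finally have "(P - e)\<^sup>2 / P \<le> P - 2 * e + 2 * e\<^sup>2" by simp
      moreover have "e\<^sup>2 = 4 * a\<^sup>2 * (C j x)\<^sup>2" by (simp add: e_def w_def power_mult_distrib)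
      ultimately show ?thesis unfolding diff P_def e_def by simp
    qed
    have i: "integrable cube_lborel (\<lambda>x. p A x - 4 * w A j * C j x + 8 * a\<^sup>2 * (C j x)\<^sup>2)"
      using pint sqint_cube_integrable[OF sC[of j]] sC[of j] by (simp add: sqint_def)
    have "(LINT x|cube_lborel. (p (flip j A) x)\<^sup>2 / p A x) \<le> (LINT x|cube_lborel. p A x - 4 * w A j * C j x + 8 * a\<^sup>2 * (C j x)\<^sup>2)"
    proof (rule integral_mono)
      show "integrable cube_lborel (\<lambda>x. (p (flip j A) x)\<^sup>2 / p A x)"
      proof (rule Bochner_Integration.integrable_bound[OF i])
        show "AE x in cube_lborel. norm ((p (flip j A) x)\<^sup>2 / p A x) \<le> norm (p A x - 4 * w A j * C j x + 8 * a\<^sup>2 * (C j x)\<^sup>2)"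
        proof (rule AE_I2)
          fix x
          have "p A x > 0" using p12(1)[of A x] by linarith
          then have "0 \<le> (p (flip j A) x)\<^sup>2 / p A x" by simp
          then show "norm ((p (flip j A) x)\<^sup>2 / p A x) \<le> norm (p A x - 4 * w A j * C j x + 8 * a\<^sup>2 * (C j x)\<^sup>2)"
            using pt[of x] by simp
        qed
      qed measurable
    qed (use i pt in auto)
    also have "\<dots> = 1 + 8 * a\<^sup>2 * \<kappa>"
      using pint sqint_cube_integrable[OF sC[of j]] sC[of j] p1 C1[OF j] C2[OF j] by (simp add: sqint_def)
    finally show ?thesis .
  qed
  fix T :: "(nat \<Rightarrow> real ^ 'd) \<Rightarrow> (real ^ 'd) measure" assume T: "T \<in> estimators n"
  define PM where "PM = PiM {..<n} (\<lambda>_. cube_lborel :: (real ^ 'd) measure)"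
  have Tm: "T \<in> measurable PM (prob_algebra cube_lborel)" using T by (simp add: estimators_def PM_def)
  define Z where "Z = (\<lambda>j X. LINT x|T X. C j x)"
  have Zm: "Z j \<in> borel_measurable PM" for j
    unfolding Z_def
    by (rule measurable_compose[OF measurable_prob_algebraD[OF Tm] integral_measurable_subprob_algebra[OF Cm]])
  have nusp: "prob_space (\<nu> A)" "sets (\<nu> A) = sets cube_lborel" "space (\<nu> A) = unit_cube" for A
    by (rule sobolev_distributionsE[OF nuG[of A]], assumption)+
  define P where "P = (\<lambda>A. PiM {..<n} (\<lambda>_. \<nu> A))"
  have setsP: "sets (P A) = sets PM" for A
    unfolding P_def PM_def by (intro sets_PiM_cong) (auto simp: nusp)
  have spP: "space (P A) = space PM" for A by (rule sets_eq_imp_space_eq[OF setsP])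
  define R where "R = (\<lambda>A j. \<integral>\<^sup>+ X. ennreal \<bar>b * (w A j * \<kappa>) - b * Z j X\<bar> \<partial>P A)"
  define F where "F = (sobolev_class \<beta> 1 :: (real ^ 'd \<Rightarrow> real) set)"
  define risk where "risk = (\<lambda>A. \<integral>\<^sup>+ X. ipm F (\<nu> A) (T X) \<partial>P A)"
  have ipm_lower: "(\<Sum>j\<in>J. ennreal \<bar>b * (w A j * \<kappa>) - b * Z j X\<bar>) \<le> ipm F (\<nu> A) (T X)" if X: "X \<in> space PM" for A X
  proof -
    have TX: "T X \<in> space (prob_algebra cube_lborel)" using measurable_space[OF Tm X] .
    then have pT: "prob_space (T X)" and sT: "sets (T X) = sets cube_lborel" by (auto simp: space_prob_algebra)
    \<comment> \<open>The height of the test function in each cell carries the sign of the error there.\<close>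
    define s where "s = (\<lambda>j. b * sgn (w A j * \<kappa> - Z j X))"
    have sb: "\<bar>s j\<bar> \<le> b" for j using b by (auto simp: s_def sgn_if abs_mult)
    have f: "S s \<in> F"
      using bump_sum_in_sobolev[OF M, of s b 1 0 \<beta>] sb h3 unfolding S_def F_def by simp
    have bd: "\<bar>S s x\<bar> \<le> b * H" for x
      unfolding S_def using H sb b by (intro bump_sum_abs_le) (auto intro: less_imp_le)
    have Sm: "S s \<in> borel_measurable cube_lborel" using sS[of s] by (simp add: sqint_def)
    have int: "integrable N (S s)" "integrable N (C j)" if N: "prob_space N" "sets N = sets cube_lborel" for N j
    proof -
      interpret N: prob_space N by fact
      have m: "S s \<in> borel_measurable N" "C j \<in> borel_measurable N"
        using Sm Cm[of j] N(2) by (auto cong: measurable_cong_sets)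
      show "integrable N (S s)" using bd m by (intro N.integrable_const_bound[where B="b * H"]) auto
      show "integrable N (C j)" using H(2)[of M j] m by (intro N.integrable_const_bound[where B=H]) (auto simp: C_def)
    qed
    have val: "(LINT x|N. S s x) = (\<Sum>j\<in>J. s j * (LINT x|N. C j x))" if N: "prob_space N" "sets N = sets cube_lborel" for N
    proof -
      have "(LINT x|N. S s x) = (\<Sum>j\<in>J. LINT x|N. s j * C j x)"
        unfolding S_def bump_sum_def J_def[symmetric] C_def[symmetric]
        by (rule Bochner_Integration.integral_sum) (use int(2)[OF N] in auto)
      then show ?thesis by simp
    qed
    have "(\<Sum>j\<in>J. ennreal \<bar>b * (w A j * \<kappa>) - b * Z j X\<bar>) = ennreal (\<Sum>j\<in>J. \<bar>b * (w A j * \<kappa>) - b * Z j X\<bar>)"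
      by (rule sum_ennreal) simp
    also have "(\<Sum>j\<in>J. \<bar>b * (w A j * \<kappa>) - b * Z j X\<bar>) = (\<Sum>j\<in>J. s j * (w A j * \<kappa>) - s j * Z j X)"
    proof (intro sum.cong refl)
      fix j
      have "\<bar>b * (w A j * \<kappa>) - b * Z j X\<bar> = b * \<bar>w A j * \<kappa> - Z j X\<bar>"
        using b by (simp add: abs_mult flip: right_diff_distrib)
      also have "\<dots> = s j * (w A j * \<kappa> - Z j X)"
        by (simp add: s_def abs_sgn mult_ac)
      finally show "\<bar>b * (w A j * \<kappa>) - b * Z j X\<bar> = s j * (w A j * \<kappa>) - s j * Z j X"
        by (simp add: right_diff_distrib)
    qed
    also have "\<dots> = (LINT x|\<nu> A. S s x) - (LINT x|T X. S s x)"
      unfolding val[OF nusp(1,2)] val[OF pT sT] sum_subtractf[symmetric]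
      by (intro sum.cong refl) (simp add: muC Z_def)
    also have "ennreal \<dots> \<le> ipm F (\<nu> A) (T X)"
      unfolding ipm_def by (intro SUP_upper) (use f int(1)[OF nusp(1,2)] int(1)[OF pT sT] in auto)
    finally show ?thesis .
  qed
  have risk_lower: "(\<Sum>j\<in>J. R A j) \<le> risk A" for A
  proof -
    have "(\<Sum>j\<in>J. R A j) = (\<integral>\<^sup>+ X. (\<Sum>j\<in>J. ennreal \<bar>b * (w A j * \<kappa>) - b * Z j X\<bar>) \<partial>P A)"
      unfolding R_def using Zm setsP[of A]
      by (intro nn_integral_sum[symmetric]) (auto cong: measurable_cong_sets)
    also have "\<dots> \<le> risk A"
      unfolding risk_def using ipm_lower by (intro nn_integral_mono) (simp add: spP)
    finally show ?thesis .
  qed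
  have pair: "ennreal (a * b * \<kappa>) \<le> R A j + R (flip j A) j" if j: "j \<in> J" for A j
  proof -
    have "ennreal (\<bar>b * (w A j * \<kappa>) - b * (w (flip j A) j * \<kappa>)\<bar> / 2) \<le> R A j + R (flip j A) j"
      unfolding R_def P_def \<nu>_def
    proof (rule two_point_bound[where B=2])
      show "(1 + 8 * a\<^sup>2 * \<kappa>) ^ n \<le> 5 / 4" using h4 by (simp add: \<kappa>_def E0_def)
      show "(LINT x|cube_lborel. (p (flip j A) x)\<^sup>2 / p A x) \<le> 1 + 8 * a\<^sup>2 * \<kappa>" by (rule chi[OF j])
      show "(\<lambda>X. b * Z j X) \<in> borel_measurable (PiM {..<n} (\<lambda>_. cube_lborel))"
        using Zm[of j] unfolding PM_def by simp
      show "prob_space (cube_lborel :: (real ^ 'd) measure)" by (rule prob_space_cube)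
      show "0 \<le> p (flip j A) x" for x using p12(1)[of "flip j A" x] by linarith
    qed (use p12 p1 in auto)
    moreover have "\<bar>b * (w A j * \<kappa>) - b * (w (flip j A) j * \<kappa>)\<bar> / 2 = a * b * \<kappa>"
    proof -
      have "b * (w A j * \<kappa>) - b * (w (flip j A) j * \<kappa>) = sign A j * (2 * (a * b * \<kappa>))"
        by (simp add: w_def sign_flip algebra_simps)
      then show ?thesis using a b kap by (simp add: abs_mult)
    qed
    ultimately show ?thesis by simp
  qed
  define Sup_risk where "Sup_risk = (SUP \<nu>\<in>sobolev_distributions \<alpha> r. \<integral>\<^sup>+ X. ipm F \<nu> (T X) \<partial>PiM {..<n} (\<lambda>_. \<nu>))"
  have rS: "risk A \<le> Sup_risk" for A
    unfolding Sup_risk_def risk_def P_def by (rule SUP_upper[OF nuG])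
  define N where "N = card (Pow J)"
  have N0: "N > 0" unfolding N_def using fJ by (simp add: card_Pow)
  have "of_nat (card J) * (of_nat N * ennreal (a * b * \<kappa>)) = (\<Sum>j\<in>J. of_nat N * ennreal (a * b * \<kappa>))" by simp
  also have "\<dots> \<le> (\<Sum>j\<in>J. 2 * (\<Sum>A\<in>Pow J. R A j))"
  proof (rule sum_mono)
    fix j assume j: "j \<in> J"
    show "of_nat N * ennreal (a * b * \<kappa>) \<le> 2 * (\<Sum>A\<in>Pow J. R A j)"
      unfolding N_def by (rule sum_pairs_lower[OF fJ j]) (rule pair[OF j])
  qed
  also have "\<dots> = 2 * (\<Sum>A\<in>Pow J. \<Sum>j\<in>J. R A j)"
    by (subst sum.swap) (simp add: sum_distrib_left)
  also have "\<dots> \<le> 2 * (\<Sum>A\<in>Pow J. Sup_risk)"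
    by (intro mult_left_mono sum_mono order_trans[OF risk_lower rS]) auto
  also have "\<dots> = 2 * (of_nat N * Sup_risk)" by (simp add: N_def)
  finally have main: "of_nat (card J) * (of_nat N * ennreal (a * b * \<kappa>)) \<le> 2 * (of_nat N * Sup_risk)" .
  have "of_nat (card J) * (of_nat N * ennreal (a * b * \<kappa>)) = (2 * of_nat N) * ennreal (a * b * E0 / 2)"
  proof -
    have e: "real (card J) * \<kappa> = E0" using M by (simp add: cJ \<kappa>_def)
    have "real (card J) * (real N * (a * b * \<kappa>)) = real N * (a * b) * (real (card J) * \<kappa>)"
      by (simp only: mult_ac)
    also have "\<dots> = (2 * real N) * (a * b * E0 / 2)" unfolding e by simp
    finally have "ennreal (real (card J) * (real N * (a * b * \<kappa>))) = ennreal ((2 * real N) * (a * b * E0 / 2))"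
      by (rule arg_cong)
    moreover have "of_nat k * (of_nat N * ennreal x) = ennreal (real k * (real N * x))" if "x \<ge> 0" for k x
      using that by (simp add: ennreal_mult ennreal_of_nat_eq_real_of_nat)
    moreover have "(2 * of_nat N) * ennreal x = ennreal ((2 * real N) * x)" if "x \<ge> 0" for x
      using that by (simp add: ennreal_mult ennreal_of_nat_eq_real_of_nat)
    moreover have "a * b * \<kappa> \<ge> 0" "a * b * E0 / 2 \<ge> 0" using a b kap E0 by simp_all
    ultimately show ?thesis by presburger
  qed
  with main have le: "(2 * of_nat N) * ennreal (a * b * E0 / 2) \<le> (2 * of_nat N) * Sup_risk" by (simp add: mult.assoc)
  have nz: "(2 * of_nat N :: ennreal) \<noteq> 0" and nt: "(2 * of_nat N :: ennreal) \<noteq> top"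
    using N0 by (auto simp: ennreal_mult_eq_top_iff)
  have "ennreal (a * b * E0 / 2) \<le> Sup_risk"
    by (rule ennreal_mult_le_mult_iff[OF nz nt, THEN iffD1, OF le])
  then show "ennreal (a * b * bump_energy (\<lambda>_ :: 'd. 0) / 2) \<le>
      (SUP \<nu>\<in>sobolev_distributions \<alpha> r. \<integral>\<^sup>+ X. ipm (sobolev_class \<beta> 1) \<nu> (T X) \<partial>PiM {..<n} (\<lambda>_. \<nu>))"
    unfolding Sup_risk_def F_def E0_def .
qed

section \<open>Rates\<close>

lemma eventually_ratio_small:
  fixes c \<epsilon> :: real assumes "\<epsilon> > 0"
  shows "eventually (\<lambda>n. \<bar>c / ln (real n)\<bar> \<le> \<epsilon>) sequentially"
proof -
  have "filterlim (\<lambda>n. ln (real n)) at_top sequentially"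
    by (rule filterlim_compose[OF ln_at_top filterlim_real_sequentially])
  then have "((\<lambda>n. c / ln (real n)) \<longlonglongrightarrow> 0)"
    by (rule real_tendsto_divide_at_top[OF tendsto_const])
  then have "eventually (\<lambda>n. dist (c / ln (real n)) 0 < \<epsilon>) sequentially"
    using assms by (rule tendstoD)
  then show ?thesis by eventually_elim (simp add: dist_real_def)
qed

text \<open>
  Constant factors vanish in the limit of \<open>ln A / ln n\<close>, and so does an arbitrarily small loss in the exponent.
\<close>

lemma rate_leI:
  assumes "\<And>\<epsilon>. \<epsilon> > 0 \<Longrightarrow> \<exists>C>0. \<forall>n\<ge>1. A n \<le> ennreal (C * real n powr (s + \<epsilon>))"
  shows "rate_le A s"
  unfolding rate_le_def
proof (rule ereal_le_epsilon2)
  fix e :: real assume e: "0 < e"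
  obtain C where C: "C > 0" "\<forall>n\<ge>1. A n \<le> ennreal (C * real n powr (s + e / 2))"
    using assms[of "e / 2"] e by auto
  have "eventually (\<lambda>n. log_ennreal (A n) / ereal (ln (real n)) \<le> ereal (s + e)) sequentially"
    using eventually_ratio_small[OF half_gt_zero[OF e], of "ln C"] eventually_gt_at_top[of "1 :: nat"]
  proof eventually_elim
    case (elim n)
    then have n: "real n > 1" by simp
    then have ln: "ln (real n) > 0" by simp
    define y where "y = C * real n powr (s + e / 2)"
    have y: "y > 0" using C n by (simp add: y_def)
    have Ay: "A n \<le> ennreal y" using C(2) elim by (simp add: y_def)
    show ?case
    proof (cases "A n = 0")
      case True
      then show ?thesis using ln by (simp add: log_ennreal_def)
    next
      case False
      have fin: "A n \<noteq> \<infinity>" using Ay by (metis ennreal_neq_top infinity_ennreal_def top.extremum_uniqueI)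
      define x where "x = enn2real (A n)"
      have Ax: "A n = ennreal x" "x > 0"
        using False fin by (auto simp: x_def enn2real_positive_iff less_top[symmetric] zero_less_iff_neq_zero)
      have "x \<le> y" using Ay Ax y by (simp add: ennreal_le_iff)
      then have "ln x \<le> ln y" using Ax by simp
      also have "ln y = ln C + (s + e / 2) * ln (real n)"
        using C n by (simp add: y_def ln_mult ln_powr)
      finally have "ln x / ln (real n) \<le> ln C / ln (real n) + (s + e / 2)"
        using ln by (simp add: field_simps)
      also have "\<dots> \<le> s + e" using elim(1) by linarith
      finally show ?thesis using False fin ln by (simp add: log_ennreal_def x_def)
    qed
  qed
  then show "limsup (\<lambda>n. log_ennreal (A n) / ereal (ln (real n))) \<le> ereal s + ereal e"
    by (simp add: Limsup_bounded)
qed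

lemma rate_geI:
  assumes "c > 0" "\<And>n. n \<ge> 1 \<Longrightarrow> ennreal (c * real n powr s) \<le> A n"
  shows "rate_ge A s"
  unfolding rate_ge_def
proof (rule ereal_le_epsilon2)
  fix e :: real assume e: "0 < e"
  have "eventually (\<lambda>n. ereal (s - e) \<le> log_ennreal (A n) / ereal (ln (real n))) sequentially"
    using eventually_ratio_small[OF e, of "ln c"] eventually_gt_at_top[of "1 :: nat"]
  proof eventually_elim
    case (elim n)
    then have n: "real n > 1" by simp
    then have ln: "ln (real n) > 0" by simp
    define y where "y = c * real n powr s"
    have y: "y > 0" using assms(1) n by (simp add: y_def)
    have Ay: "ennreal y \<le> A n" using assms(2) elim by (simp add: y_def)
    have nz: "A n \<noteq> 0" using Ay y by (metis ennreal_eq_0_iff le_zero_eq not_le)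
    show ?case
    proof (cases "A n = \<infinity>")
      case True
      then show ?thesis using ln by (simp add: log_ennreal_def)
    next
      case False
      define x where "x = enn2real (A n)"
      have Ax: "A n = ennreal x" using False by (simp add: x_def less_top)
      have x: "y \<le> x" using Ay Ax y by (simp add: ennreal_le_iff2)
      then have "ln y \<le> ln x" using y by simp
      moreover have "ln y = ln c + s * ln (real n)"
        using assms(1) n by (simp add: y_def ln_mult ln_powr)
      ultimately have "(ln c + s * ln (real n)) / ln (real n) \<le> ln x / ln (real n)"
        using ln by (intro divide_right_mono) auto
      then have "ln c / ln (real n) + s \<le> ln x / ln (real n)"
        using ln by (simp add: add_divide_distrib)
      then have "s - e \<le> ln x / ln (real n)" using elim(1) by linarith
      then show ?thesis using nz False ln by (simp add: log_ennreal_def x_def)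
    qed
  qed
  then have "ereal (s - e) \<le> liminf (\<lambda>n. log_ennreal (A n) / ereal (ln (real n)))"
    by (rule Liminf_bounded)
  then have "ereal (s - e) + ereal e \<le> liminf (\<lambda>n. log_ennreal (A n) / ereal (ln (real n))) + ereal e"
    by (rule add_right_mono)
  then show "ereal s \<le> liminf (\<lambda>n. log_ennreal (A n) / ereal (ln (real n))) + ereal e" by simp
qed

lemma resolution:
  assumes "n \<ge> (1::nat)" "\<theta> \<ge> 0"
  defines "K \<equiv> nat \<lceil>real n powr \<theta>\<rceil>"
  shows "K \<ge> 1" "real n powr \<theta> \<le> real K" "real K \<le> 2 * real n powr \<theta>"
proof -
  have g: "real n powr \<theta> \<ge> 1" using assms by (intro ge_one_powr_ge_zero) auto
  show 1: "real n powr \<theta> \<le> real K" unfolding K_def by linarith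
  show "K \<ge> 1" using g 1 by linarith
  show "real K \<le> 2 * real n powr \<theta>" unfolding K_def using g by linarith
qed

text \<open>
  The three constraints on the amplitude in \<open>Assouad_lower_bound\<close> reduce to two up to a constant:
  smoothness, \<open>a \<lesssim> M powr - \<alpha>\<close>, and indistinguishability, \<open>n a\<^sup>2 \<lesssim> M\<^sup>d\<close>. The uniform density already
  has Sobolev norm 1; \<open>r > 1\<close> is the room that is left for the perturbation.
\<close>

lemma minimax_lower_bound:
  fixes r :: real
  assumes r: "r > 1"
  shows "\<exists>c>0. \<exists>b0>0. \<forall>n\<ge>1. \<forall>M\<ge>1. \<forall>a. 0 < a \<and> a \<le> c / real M ^ \<alpha> \<and> real n * a\<^sup>2 \<le> c\<^sup>2 * real M ^ CARD('d::finite) \<longrightarrow>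
    ennreal (b0 * a / real M ^ \<beta>) \<le>
      minimax_risk (sobolev_distributions \<alpha> r :: (real ^ 'd) measure set) (sobolev_class \<beta> 1) n"
proof -
  obtain H where H: "H > 0" "\<And>M j. \<And>x :: real ^ 'd. \<bar>cell_bump M (\<lambda>_. 0) j x\<bar> \<le> H"
    using cell_bump_bounded by blast
  define Ea Eb E0 where "Ea = sobolev_energy TYPE('d) \<alpha>" and "Eb = sobolev_energy TYPE('d) \<beta>"
    and "E0 = bump_energy (\<lambda>_ :: 'd. 0)"
  have E: "Ea \<ge> 0" "Eb \<ge> 0" "E0 > 0"
    unfolding Ea_def Eb_def E0_def by (intro sobolev_energy_nonneg bump_energy_zero_pos)+
  have r2: "r\<^sup>2 - 1 > 0" using r by (simp add: one_less_power)
  \<comment> \<open>The three terms ensure positivity of the densities, membership in the class and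
    indistinguishability of neighbouring densities.\<close>
  define c where "c = Min {1 / (2 * H), sqrt ((r\<^sup>2 - 1) / (1 + Ea)), sqrt (1 / (40 * E0))}"
  have c: "c > 0" "c \<le> 1 / (2 * H)" "c \<le> sqrt ((r\<^sup>2 - 1) / (1 + Ea))" "c \<le> sqrt (1 / (40 * E0))"
    unfolding c_def using H r2 E by auto
  have cEa: "c\<^sup>2 * Ea \<le> r\<^sup>2 - 1"
  proof -
    have "c\<^sup>2 \<le> (r\<^sup>2 - 1) / (1 + Ea)"
      using power_mono[OF c(3), of 2] c(1) r2 E by simp
    then have "c\<^sup>2 * (1 + Ea) \<le> r\<^sup>2 - 1" using E by (simp add: pos_le_divide_eq)
    then show ?thesis by (simp add: distrib_left) (metis add_increasing zero_le_power2 order_trans le_add_same_cancel2)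
  qed
  have cE0: "8 * c\<^sup>2 * E0 \<le> 1 / 5"
  proof -
    have "c\<^sup>2 \<le> 1 / (40 * E0)" using power_mono[OF c(4), of 2] c(1) E by simp
    then show ?thesis using E by (simp add: field_simps)
  qed
  define b1 where "b1 = 1 / sqrt (1 + Eb)"
  have b1: "b1 > 0" "b1\<^sup>2 * Eb \<le> 1" using E by (auto simp: b1_def power_divide)
  define b0 where "b0 = b1 * E0 / 2"
  have "ennreal (b0 * a / real M ^ \<beta>) \<le>
      minimax_risk (sobolev_distributions \<alpha> r :: (real ^ 'd) measure set) (sobolev_class \<beta> 1) n"
    if n: "n \<ge> 1" and M: "M \<ge> 1" and a: "0 < a" "a \<le> c / real M ^ \<alpha>" "real n * a\<^sup>2 \<le> c\<^sup>2 * real M ^ CARD('d)" for n M a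
  proof -
    have Mp: "real M ^ k \<ge> 1" for k using M by simp
    have M0: "real M ^ k > 0" for k using M by simp
    have aM: "a * real M ^ \<alpha> \<le> c" using a(2) M0[of \<alpha>] by (simp add: pos_le_divide_eq)
    have ac: "a \<le> c" using aM Mp[of \<alpha>] a(1) by (smt (verit) mult_le_cancel_left1)
    have "ennreal (a * (b1 / real M ^ \<beta>) * bump_energy (\<lambda>_ :: 'd. 0) / 2) \<le>
      minimax_risk (sobolev_distributions \<alpha> r :: (real ^ 'd) measure set) (sobolev_class \<beta> 1) n"
    proof (rule Assouad_lower_bound[OF n M a(1) _ _ H])
      show "0 < b1 / real M ^ \<beta>" using b1 M0 by simp
      show "0 \<le> r" using r by simp
      show "a * H \<le> 1 / 2"
        using order_trans[OF ac c(2)] H(1) by (simp add: field_simps)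
      have "a\<^sup>2 * real M ^ (2 * \<alpha>) = (a * real M ^ \<alpha>)\<^sup>2" by (simp add: power_mult_distrib power_mult mult.commute)
      also have "\<dots> \<le> c\<^sup>2" using aM a(1) by (intro power_mono) auto
      finally have "a\<^sup>2 * real M ^ (2 * \<alpha>) * Ea \<le> c\<^sup>2 * Ea" using E by (intro mult_right_mono) auto
      then show "1 + a\<^sup>2 * real M ^ (2 * \<alpha>) * sobolev_energy TYPE('d) \<alpha> \<le> r\<^sup>2" using cEa by (simp add: Ea_def)
      have "(b1 / real M ^ \<beta>)\<^sup>2 * real M ^ (2 * \<beta>) = b1\<^sup>2"
        using M0[of \<beta>] by (simp add: power_divide power_mult mult.commute)
      then show "(b1 / real M ^ \<beta>)\<^sup>2 * real M ^ (2 * \<beta>) * sobolev_energy TYPE('d) \<beta> \<le> 1"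
        using b1 by (simp add: Eb_def)
      define z where "z = 8 * a\<^sup>2 * (E0 / real M ^ CARD('d))"
      have z: "z \<ge> 0" using E by (simp add: z_def)
      have "real n * z = 8 * (real n * a\<^sup>2) * E0 / real M ^ CARD('d)" by (simp add: z_def)
      also have "\<dots> \<le> 8 * (c\<^sup>2 * real M ^ CARD('d)) * E0 / real M ^ CARD('d)"
        using a(3) E M0[of "CARD('d)"] by (intro divide_right_mono mult_right_mono mult_left_mono) auto
      also have "\<dots> = 8 * c\<^sup>2 * E0" using M by simp
      finally have nz: "real n * z \<le> 1 / 5" using cE0 by linarith
      have "(1 + z) ^ n \<le> exp z ^ n" using z exp_ge_add_one_self[of z] by (intro power_mono) auto
      also have "\<dots> = exp (real n * z)" by (simp add: exp_of_nat_mult)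
      also have "\<dots> \<le> exp (1 / 5)" using nz by simp
      also have "\<dots> \<le> 5 / 4"
      proof -
        have "1 + (- (1 / 5)) \<le> exp (- (1 / 5) :: real)" by (rule exp_ge_add_one_self)
        then have "exp (1 / 5) * (4 / 5) \<le> exp (1 / 5) * exp (- (1 / 5) :: real)" by (intro mult_left_mono) auto
        also have "\<dots> = 1" by (simp flip: exp_add)
        finally show ?thesis by simp
      qed
      finally show "(1 + 8 * a\<^sup>2 * (bump_energy (\<lambda>_ :: 'd. 0) / real M ^ CARD('d))) ^ n \<le> 5 / 4"
        by (simp add: z_def E0_def)
    qed
    moreover have "a * (b1 / real M ^ \<beta>) * bump_energy (\<lambda>_ :: 'd. 0) / 2 = b0 * a / real M ^ \<beta>"
      by (simp add: b0_def E0_def mult_ac)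
    ultimately show ?thesis by simp
  qed
  moreover have "b0 > 0" using b1 E by (simp add: b0_def)
  ultimately show ?thesis using c(1) by blast
qed

text \<open>The uniform distribution.\<close>

lemma sobolev_distributions_nonempty:
  assumes "r > 1" shows "(sobolev_distributions \<alpha> r :: (real ^ 'd::finite) measure set) \<noteq> {}"
proof -
  have "density cube_lborel (\<lambda>x. ennreal (1 + bump_sum 1 (\<lambda>_. 0) (\<lambda>_. 0) x)) \<in> (sobolev_distributions \<alpha> r :: (real ^ 'd) measure set)"
    by (rule perturbed_uniform_in_class[where a=0]) (use assms in \<open>auto simp: bump_sum_def one_le_power\<close>)
  then show ?thesis by blast
qed

theorem theorem4:
  fixes \<alpha> \<beta> :: nat and r :: real
  assumes "r > 1"
  shows "rate_eq
    (minimax_risk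
       (sobolev_distributions \<alpha> r :: (real ^ 'd::finite) measure set)
       (sobolev_class \<beta> 1))
    (max (- ((real \<alpha> + real \<beta>) / (2 * real \<alpha> + real CARD('d)))) (- (1 / 2)))"
proof -
  define d where "d = real CARD('d)"
  have d: "d \<ge> 1" unfolding d_def using finite_UNIV_card_ge_0[where 'a='d] by simp
  \<comment> \<open>\<open>K = n powr \<theta>\<close> is the number of frequencies, or of cells, per coordinate.\<close>
  define \<theta> where "\<theta> = 1 / (2 * real \<alpha> + d)"
  have th: "\<theta> > 0" "\<theta> \<le> 1" "\<theta> * (2 * real \<alpha> + d) = 1" using d by (auto simp: \<theta>_def add_pos_pos add_nonneg_pos)
  define s1 where "s1 = - ((real \<alpha> + real \<beta>) / (2 * real \<alpha> + d))"
  define s where "s = max s1 (- (1 / 2))"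
  have s1: "s1 = - (\<theta> * (real \<alpha> + real \<beta>))" by (simp add: s1_def \<theta>_def)
  have s: "s \<ge> s1" "s \<ge> - (1 / 2)" by (auto simp: s_def)
  let ?A = "minimax_risk (sobolev_distributions \<alpha> r :: (real ^ 'd) measure set) (sobolev_class \<beta> 1)"
  have "rate_le ?A s"
  proof (rule rate_leI)
    fix \<epsilon> :: real assume e: "\<epsilon> > 0"
    define ex where "ex = max (d - 2 * real \<beta>) 0"
    \<comment> \<open>For \<open>d \<ge> 2 \<beta>\<close> the stochastic error equals the bias \<open>n powr s1\<close>; otherwise it is parametric.\<close>
    have ex: "ex \<ge> 0" "(\<theta> * ex - 1) / 2 \<le> s"
    proof -
      show "ex \<ge> 0" by (simp add: ex_def)
      show "(\<theta> * ex - 1) / 2 \<le> s"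
      proof (cases "d - 2 * real \<beta> \<ge> 0")
        case True
        have "\<theta> * ex - 1 = \<theta> * (d - 2 * real \<beta>) - \<theta> * (2 * real \<alpha> + d)" using True th(3) by (simp add: ex_def)
        also have "\<dots> = 2 * s1" unfolding s1 by (simp add: algebra_simps)
        finally have "(\<theta> * ex - 1) / 2 = s1" by simp
        then show ?thesis using s by simp
      next
        case False
        then show ?thesis using s by (simp add: ex_def)
      qed
    qed
    obtain C where C: "C > 0" "\<forall>n\<ge>1. \<forall>K\<ge>1. ?A n \<le> ennreal (C * (1 / real K ^ (\<alpha> + \<beta>) + 1 / real n +
        sqrt (real K powr (ex + \<epsilon>) / real n)))"
      using minimax_upper_bound[OF e sobolev_distributions_nonempty[OF assms], of \<alpha> \<beta>, where 'd='d] unfolding ex_def d_def by blast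
    define B where "B = sqrt (2 powr (ex + \<epsilon>))"
    have B: "B \<ge> 0" by (simp add: B_def)
    have "?A n \<le> ennreal (C * (2 + B) * real n powr (s + \<epsilon>))" if n: "n \<ge> 1" for n
    proof -
      define K where "K = nat \<lceil>real n powr \<theta>\<rceil>"
      note K = resolution[OF n less_imp_le[OF th(1)], folded K_def]
      have n1: "real n \<ge> 1" using n by simp
      \<comment> \<open>The steps \<open>t1\<close>, \<open>t2\<close> and \<open>t3\<close> bound the truncation error, the precision of the net and the
        stochastic error.\<close>
      have t1: "1 / real K ^ (\<alpha> + \<beta>) \<le> real n powr (s + \<epsilon>)"
      proof -
        have "real n powr (\<theta> * (real \<alpha> + real \<beta>)) = (real n powr \<theta>) ^ (\<alpha> + \<beta>)"
          using n1 by (simp add: powr_power mult.commute)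
        also have "\<dots> \<le> real K ^ (\<alpha> + \<beta>)" using K by (intro power_mono) auto
        finally have le: "real n powr (\<theta> * (real \<alpha> + real \<beta>)) \<le> real K ^ (\<alpha> + \<beta>)" .
        have "1 / real K ^ (\<alpha> + \<beta>) \<le> 1 / real n powr (\<theta> * (real \<alpha> + real \<beta>))"
          using le n1 K(1) by (intro divide_left_mono mult_pos_pos) auto
        also have "\<dots> = real n powr s1" unfolding s1 by (simp add: powr_minus_divide)
        also have "\<dots> \<le> real n powr (s + \<epsilon>)" using n1 s e by (intro powr_mono) auto
        finally show ?thesis .
      qed
      have t2: "1 / real n \<le> real n powr (s + \<epsilon>)"
      proof -
        have "1 / real n = real n powr (- 1)" using n1 by (simp add: powr_minus_divide)
        also have "\<dots> \<le> real n powr (s + \<epsilon>)" using n1 s e by (intro powr_mono) auto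
        finally show ?thesis .
      qed
      have t3: "sqrt (real K powr (ex + \<epsilon>) / real n) \<le> B * real n powr (s + \<epsilon>)"
      proof -
        have "real K powr (ex + \<epsilon>) \<le> (2 * real n powr \<theta>) powr (ex + \<epsilon>)"
          using K ex e by (intro powr_mono2) auto
        also have "\<dots> = 2 powr (ex + \<epsilon>) * real n powr (\<theta> * (ex + \<epsilon>))"
          by (simp add: powr_mult powr_powr)
        finally have "real K powr (ex + \<epsilon>) / real n \<le> 2 powr (ex + \<epsilon>) * real n powr (\<theta> * (ex + \<epsilon>)) / real n"
          by (intro divide_right_mono) auto
        also have "\<dots> = 2 powr (ex + \<epsilon>) * real n powr (\<theta> * (ex + \<epsilon>) - 1)"
          using n1 by (simp add: powr_diff)
        also have "\<dots> = 2 powr (ex + \<epsilon>) * (real n powr ((\<theta> * (ex + \<epsilon>) - 1) / 2))\<^sup>2"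
          by (simp only: power2_eq_square powr_add[symmetric] field_sum_of_halves)
        finally have "sqrt (real K powr (ex + \<epsilon>) / real n) \<le> sqrt (2 powr (ex + \<epsilon>) * (real n powr ((\<theta> * (ex + \<epsilon>) - 1) / 2))\<^sup>2)"
          by (rule real_sqrt_le_mono)
        also have "\<dots> = B * real n powr ((\<theta> * (ex + \<epsilon>) - 1) / 2)"
          by (simp add: real_sqrt_mult B_def)
        also have "\<dots> \<le> B * real n powr (s + \<epsilon>)"
        proof (intro mult_left_mono powr_mono B n1)
          have "\<theta> * \<epsilon> \<le> 1 * \<epsilon>" using th e by (intro mult_right_mono) auto
          moreover have "(\<theta> * (ex + \<epsilon>) - 1) / 2 = (\<theta> * ex - 1) / 2 + \<theta> * \<epsilon> / 2" by (simp add: field_simps)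
          ultimately show "(\<theta> * (ex + \<epsilon>) - 1) / 2 \<le> s + \<epsilon>" using ex e by linarith
        qed
        finally show ?thesis .
      qed
      have "?A n \<le> ennreal (C * (1 / real K ^ (\<alpha> + \<beta>) + 1 / real n + sqrt (real K powr (ex + \<epsilon>) / real n)))"
        using C(2) n K(1) by blast
      also have "\<dots> \<le> ennreal (C * ((2 + B) * real n powr (s + \<epsilon>)))"
        using t1 t2 t3 C(1) by (intro ennreal_leI mult_left_mono) (auto simp: distrib_right)
      finally show ?thesis by (simp add: mult.assoc)
    qed
    moreover have "C * (2 + B) > 0" using C B by simp
    ultimately show "\<exists>C>0. \<forall>n\<ge>1. ?A n \<le> ennreal (C * real n powr (s + \<epsilon>))" by blast
  qed
  moreover have "rate_ge ?A s"
  proof -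
    obtain c b0 where c: "c > 0" and b0: "b0 > 0" and low: "\<forall>n\<ge>1. \<forall>M\<ge>1. \<forall>a. 0 < a \<and> a \<le> c / real M ^ \<alpha> \<and> real n * a\<^sup>2 \<le> c\<^sup>2 * real M ^ CARD('d) \<longrightarrow>
      ennreal (b0 * a / real M ^ \<beta>) \<le> ?A n"
      using minimax_lower_bound[OF assms, of \<alpha> \<beta>, where 'd='d] by blast
    show ?thesis
    \<comment> \<open>A single cell for the parametric rate, \<open>n powr \<theta>\<close> cells per coordinate otherwise.\<close>
    proof (cases "s1 \<le> - (1 / 2)")
      case True
      then have s_eq: "s = - (1 / 2)" by (simp add: s_def)
      show ?thesis
      proof (rule rate_geI[of "b0 * c"])
        show "b0 * c > 0" using b0 c by simp
        fix n :: nat assume n: "n \<ge> 1"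
        define a where "a = c * real n powr (- (1 / 2))"
        have n0: "real n > 0" using n by simp
        have "a > 0" using c n0 by (simp add: a_def)
        moreover have "a \<le> c"
        proof -
          have "real n powr (- (1 / 2)) \<le> real n powr 0" using n by (intro powr_mono) auto
          then have "c * real n powr (- (1 / 2)) \<le> c * 1" using c n0 by (intro mult_left_mono) auto
          then show ?thesis by (simp add: a_def)
        qed
        moreover have "real n * a\<^sup>2 \<le> c\<^sup>2"
        proof -
          have "(real n powr (- (1 / 2)))\<^sup>2 = 1 / real n" using n0 by (simp add: powr_minus_divide powr_half_sqrt power_divide)
          then show ?thesis using n0 by (simp add: a_def power_mult_distrib)
        qed
        ultimately have "ennreal (b0 * a / real 1 ^ \<beta>) \<le> ?A n" using low n by (metis div_by_1 le_refl mult.right_neutral of_nat_1 power_one)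
        then show "ennreal (b0 * c * real n powr s) \<le> ?A n" by (simp add: a_def s_eq mult.assoc)
      qed
    next
      case False
      then have s_eq: "s = s1" by (simp add: s_def)
      define q where "q = b0 * c / 2 ^ (\<alpha> + \<beta>)"
      show ?thesis
      proof (rule rate_geI[of q])
        show "q > 0" using b0 c by (simp add: q_def)
        fix n :: nat assume n: "n \<ge> 1"
        define M where "M = nat \<lceil>real n powr \<theta>\<rceil>"
        note M = resolution[OF n less_imp_le[OF th(1)], folded M_def]
        have n0: "real n > 0" using n by simp
        have M0: "real M > 0" using M(1) by simp
        define a where "a = c / real M ^ \<alpha>"
        have "a > 0" using c M0 by (simp add: a_def)
        moreover have "real n * a\<^sup>2 \<le> c\<^sup>2 * real M ^ CARD('d)"
        proof -
          have "real n = real n powr (\<theta> * (2 * real \<alpha> + d))" using th(3) n0 by simp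
          also have "\<dots> = (real n powr \<theta>) ^ (2 * \<alpha> + CARD('d))"
            using n0 by (simp add: powr_power d_def mult.commute)
          also have "\<dots> \<le> real M ^ (2 * \<alpha> + CARD('d))" using M by (intro power_mono) auto
          finally have "real n \<le> real M ^ CARD('d) * (real M ^ \<alpha>)\<^sup>2"
            by (simp add: power_add power_mult mult.commute flip: power_mult)
          then have "real n / (real M ^ \<alpha>)\<^sup>2 \<le> real M ^ CARD('d)" using M0 by (simp add: pos_divide_le_eq)
          then have "c\<^sup>2 * (real n / (real M ^ \<alpha>)\<^sup>2) \<le> c\<^sup>2 * real M ^ CARD('d)" by (intro mult_left_mono) auto
          then show ?thesis by (simp add: a_def power_divide mult.commute)
        qed
        moreover have "a \<le> c / real M ^ \<alpha>" by (simp add: a_def)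
        ultimately have 1: "ennreal (b0 * a / real M ^ \<beta>) \<le> ?A n" using low n M(1) by blast
        have "real M ^ (\<alpha> + \<beta>) \<le> (2 * real n powr \<theta>) ^ (\<alpha> + \<beta>)" using M by (intro power_mono) auto
        also have "\<dots> = 2 ^ (\<alpha> + \<beta>) * real n powr (\<theta> * (real \<alpha> + real \<beta>))"
          using n0 by (simp add: power_mult_distrib powr_power mult.commute)
        finally have le: "real M ^ (\<alpha> + \<beta>) \<le> 2 ^ (\<alpha> + \<beta>) * real n powr (\<theta> * (real \<alpha> + real \<beta>))" .
        have "q * real n powr s = b0 * c / (2 ^ (\<alpha> + \<beta>) * real n powr (\<theta> * (real \<alpha> + real \<beta>)))"
          unfolding s_eq s1 q_def by (simp add: powr_minus_divide)
        also have "\<dots> \<le> b0 * c / real M ^ (\<alpha> + \<beta>)"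
          using le b0 c M0 n0 by (intro divide_left_mono) auto
        also have "\<dots> = b0 * a / real M ^ \<beta>" by (simp add: a_def power_add)
        finally have "ennreal (q * real n powr s) \<le> ennreal (b0 * a / real M ^ \<beta>)" by (rule ennreal_leI)
        with 1 show "ennreal (q * real n powr s) \<le> ?A n" by (rule order_trans[rotated])
      qed
    qed
  qed
  ultimately show ?thesis unfolding rate_eq_def s_def s1_def d_def by blast
qed

end
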